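(* Let $d\ge 1$ and $L\ge 2$ be integers. There exists a subalgebra $Y_{d,L}\subset A_{d,L}$ such that, as a vector space, $A_{d,L}$ splits into the tensor product $A_{0,L}\otimes Y_{d,L}$; that is, the multiplication map $A_{0,L}\otimes Y_{d,L}\to A_{d,L}$, $a\otimes y\mapsto ay$, is an isomorphism of vector spaces.
   Context: The ground field is $\mathbb C$; algebras are associative and unital. $\mathfrak{gl}(N,\mathbb C)$ has the basis of matrix units $E_{ij}$, $1\le i,j\le N$; $\mathfrak{gl}(N,\mathbb C)^{\oplus L}$ is the direct sum of $L$ copies, and $E_{ij\mid\alpha}$ is the matrix unit $E_{ij}$ in the $\alpha$-th copy, $\alpha\in[L]=\{1,\dots,L\}$. $U(\cdot)$ is the universal enveloping algebra with its standard filtration. For $0\le d\le N$, $\mathfrak{gl}_d(N,\mathbb C)\subset\mathfrak{gl}(N,\mathbb C)$ is the span of $E_{ij}$ with $d<i,j\le N$; $\operatorname{diag}$ is the diagonal embedding $X\mapsto (X,\dots,X)$ into $\mathfrak{gl}(N,\mathbb C)^{\oplus L}$. $A_{d,L}(N):=U(\mathfrak{gl}(N,\mathbb C)^{\oplus L})^{\operatorname{diag}\mathfrak{gl}_d(N,\mathbb C)}$ is the centralizer of $\operatorname{diag}\mathfrak{gl}_d(N,\mathbb C)$, with the induced filtration. Let $I^+(N)$ be the left ideal of $U(\mathfrak{gl}(N,\mathbb C)^{\oplus L})$ generated by all $E_{iN\mid\alpha}$, $1\le i\le N$, $\alpha\in[L]$. Then $J(N):=A_{N-1,L}(N)\cap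 I^+(N)$ is a two-sided ideal of $A_{N-1,L}(N)$ and $A_{N-1,L}(N)=U(\mathfrak{gl}(N-1,\mathbb C)^{\oplus L})\oplus J(N)$, where $\mathfrak{gl}(N-1,\mathbb C)$ is the span of $E_{ij}$ with $i,j\le N-1$. The projection $\pi_{N,N-1}$ onto the first summand is a filtration-preserving algebra morphism and maps $A_{d,L}(N)$ into $A_{d,L}(N-1)$ for $0\le d\le N-1$. $A_{d,L}:=\varprojlim(A_{d,L}(N),\pi_{N,N-1})$ as $N\to\infty$, in the category of filtered algebras: its elements are sequences $(x_N)_{N\ge\max(d,1)}$, $x_N\in A_{d,L}(N)$, with $\pi_{N,N-1}(x_N)=x_{N-1}$ and uniformly bounded degrees; the $n$-th filtration term $A^{(n)}_{d,L}$ consists of the sequences with $\deg x_N\le n$ for all $N$. $A_{0,L}$ is regarded as a subalgebra of $A_{d,L}$ by restricting sequences to $N\ge d$. *)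

theory Defs
  imports "HOL-Algebra.Algebra" "HOL-Library.Poly_Mapping"
begin

section \<open>Complex vector spaces and algebras\<close>

text \<open>
  Complex vector spaces and associative unital algebras are \<^typ>\<open>(complex, 'v) module\<close> records,
  that is, HOL-Algebra ring records with a scalar multiplication. For records that are used only as
  vector spaces the fields \<^const>\<open>monoid.mult\<close> and \<^const>\<open>one\<close> carry no information.
\<close>

definition complex_subalgebra :: "'a set \<Rightarrow> (complex, 'a, 'm) module_scheme \<Rightarrow> bool" where
  "complex_subalgebra Y A \<longleftrightarrow> subring Y A \<and> (\<forall>c. \<forall>y\<in>Y. c \<odot>\<^bsub>A\<^esub> y \<in> Y)"

definition complex_linear_iso ::
    "(complex, 'a, 'm) module_scheme \<Rightarrow> (complex, 'b, 'n) module_scheme \<Rightarrow> ('a \<Rightarrow> 'b) \<Rightarrow> bool" where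
  "complex_linear_iso V W f \<longleftrightarrow>
     bij_betw f (carrier V) (carrier W) \<and>
     (\<forall>x\<in>carrier V. \<forall>y\<in>carrier V. f (x \<oplus>\<^bsub>V\<^esub> y) = f x \<oplus>\<^bsub>W\<^esub> f y) \<and>
     (\<forall>c. \<forall>x\<in>carrier V. f (c \<odot>\<^bsub>V\<^esub> x) = c \<odot>\<^bsub>W\<^esub> f x)"

text \<open>
  The quotient by \<open>I\<close>, with elements the additive cosets of \<open>I\<close>: the quotient ring of HOL-Algebra
  with the induced scalar multiplication. It is a quotient algebra if \<open>I\<close> is a two-sided ideal, and
  a quotient vector space if \<open>I\<close> is only a subspace.
\<close>

definition quot_module ::
    "(complex, 'a, 'm) module_scheme \<Rightarrow> 'a set \<Rightarrow> (complex, 'a set) module" where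
  "quot_module A I =
     ring.extend (A Quot I)
       (module.fields (\<lambda>c C. \<Union>a\<in>C. I +>\<^bsub>A\<^esub> (c \<odot>\<^bsub>A\<^esub> a)))"

definition subspace_span :: "(complex, 'a, 'm) module_scheme \<Rightarrow> 'a set \<Rightarrow> 'a set" where
  "subspace_span V S =
     \<Inter>{T. additive_subgroup T V \<and> (\<forall>c. \<forall>t\<in>T. c \<odot>\<^bsub>V\<^esub> t \<in> T) \<and> S \<subseteq> T}"

definition left_genideal :: "('a, 'm) ring_scheme \<Rightarrow> 'a set \<Rightarrow> 'a set" where
  "left_genideal R S =
     \<Inter>{I. additive_subgroup I R \<and> (\<forall>a\<in>carrier R. \<forall>x\<in>I. a \<otimes>\<^bsub>R\<^esub> x \<in> I) \<and> S \<subseteq> I}"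


section \<open>Tensor products of vector spaces\<close>

definition free_space :: "'s set \<Rightarrow> (complex, 's \<Rightarrow>\<^sub>0 complex) module" where
  "free_space S =
     \<lparr>carrier = {p. Poly_Mapping.keys p \<subseteq> S}, monoid.mult = undefined, one = undefined,
      ring.zero = 0, add = (+), smult = (\<lambda>c. Poly_Mapping.map ((*) c))\<rparr>"

definition tensor_relators ::
    "(complex, 'a, 'm) module_scheme \<Rightarrow> (complex, 'b, 'n) module_scheme \<Rightarrow> ('a \<times> 'b \<Rightarrow>\<^sub>0 complex) set" where
  "tensor_relators V W =
     {Poly_Mapping.single (v \<oplus>\<^bsub>V\<^esub> v', w) 1 - Poly_Mapping.single (v, w) 1 - Poly_Mapping.single (v', w) 1
       | v v' w. v \<in> carrier V \<and> v' \<in> carrier V \<and> w \<in> carrier W} \<union>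
     {Poly_Mapping.single (v, w \<oplus>\<^bsub>W\<^esub> w') 1 - Poly_Mapping.single (v, w) 1 - Poly_Mapping.single (v, w') 1
       | v w w'. v \<in> carrier V \<and> w \<in> carrier W \<and> w' \<in> carrier W} \<union>
     {Poly_Mapping.single (c \<odot>\<^bsub>V\<^esub> v, w) 1 - Poly_Mapping.single (v, w) c
       | c v w. v \<in> carrier V \<and> w \<in> carrier W} \<union>
     {Poly_Mapping.single (v, c \<odot>\<^bsub>W\<^esub> w) 1 - Poly_Mapping.single (v, w) c
       | c v w. v \<in> carrier V \<and> w \<in> carrier W}"

definition tensor_product ::
    "(complex, 'a, 'm) module_scheme \<Rightarrow> (complex, 'b, 'n) module_scheme \<Rightarrow>
     (complex, ('a \<times> 'b \<Rightarrow>\<^sub>0 complex) set) module" where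
  "tensor_product V W =
     quot_module (free_space (carrier V \<times> carrier W))
       (subspace_span (free_space (carrier V \<times> carrier W)) (tensor_relators V W))"

text \<open>
  The linear map out of a tensor product with \<open>v \<otimes> w \<mapsto> f v w\<close>. For bilinear \<open>f\<close> the image
  of a coset \<open>C\<close> below is a singleton.
\<close>

definition tensor_lift ::
    "(complex, 'c, 'm) module_scheme \<Rightarrow> ('a \<Rightarrow> 'b \<Rightarrow> 'c) \<Rightarrow> ('a \<times> 'b \<Rightarrow>\<^sub>0 complex) set \<Rightarrow> 'c" where
  "tensor_lift Z f C =
     the_elem ((\<lambda>p. \<Oplus>\<^bsub>Z\<^esub>k\<in>Poly_Mapping.keys p. Poly_Mapping.lookup p k \<odot>\<^bsub>Z\<^esub> f (fst k) (snd k)) ` C)"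


section \<open>Universal enveloping algebras\<close>

text \<open>
  Words form the free monoid under concatenation, so the monoid algebra \<^typ>\<open>'v list \<Rightarrow>\<^sub>0 complex\<close>
  is the free associative algebra.
\<close>

instantiation list :: (type) monoid_add
begin

definition zero_list_def: "0 = []"
definition plus_list_def: "xs + ys = xs @ ys"

instance by standard (simp_all add: zero_list_def plus_list_def)

end

definition free_algebra :: "'v set \<Rightarrow> (complex, 'v list \<Rightarrow>\<^sub>0 complex) module" where
  "free_algebra S =
     \<lparr>carrier = {p. \<forall>w\<in>Poly_Mapping.keys p. set w \<subseteq> S}, monoid.mult = (*), one = 1,
      ring.zero = 0, add = (+), smult = (\<lambda>c. Poly_Mapping.map ((*) c))\<rparr>"

record 'v lie_algebra = "'v partial_object" +
  lie_add :: "'v \<Rightarrow> 'v \<Rightarrow> 'v"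
  lie_scale :: "complex \<Rightarrow> 'v \<Rightarrow> 'v"
  lie_bracket :: "'v \<Rightarrow> 'v \<Rightarrow> 'v"

abbreviation letter :: "'v \<Rightarrow> 'v list \<Rightarrow>\<^sub>0 complex" where
  "letter x \<equiv> Poly_Mapping.single [x] 1"

text \<open>
  The universal enveloping algebra is the free algebra on the set underlying the Lie algebra modulo
  linearity of the letters (which gives the tensor algebra) and \<open>x y - y x = [x, y]\<close>.
\<close>

definition uea_relators :: "'v lie_algebra \<Rightarrow> ('v list \<Rightarrow>\<^sub>0 complex) set" where
  "uea_relators g =
     {letter (lie_add g x y) - letter x - letter y | x y. x \<in> carrier g \<and> y \<in> carrier g} \<union>
     {letter (lie_scale g c x) - Poly_Mapping.single [x] c | c x. x \<in> carrier g} \<union>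
     {letter x * letter y - letter y * letter x - letter (lie_bracket g x y)
       | x y. x \<in> carrier g \<and> y \<in> carrier g}"

definition uea_ideal :: "'v lie_algebra \<Rightarrow> ('v list \<Rightarrow>\<^sub>0 complex) set" where
  "uea_ideal g = Idl\<^bsub>free_algebra (carrier g)\<^esub> (uea_relators g)"

definition uea :: "'v lie_algebra \<Rightarrow> (complex, ('v list \<Rightarrow>\<^sub>0 complex) set) module" where
  "uea g = quot_module (free_algebra (carrier g)) (uea_ideal g)"

definition uea_class :: "'v lie_algebra \<Rightarrow> ('v list \<Rightarrow>\<^sub>0 complex) \<Rightarrow> ('v list \<Rightarrow>\<^sub>0 complex) set" where
  "uea_class g p = uea_ideal g +>\<^bsub>free_algebra (carrier g)\<^esub> p"

definition uea_filtration :: "'v lie_algebra \<Rightarrow> nat \<Rightarrow> ('v list \<Rightarrow>\<^sub>0 complex) set set" where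
  "uea_filtration g n =
     uea_class g ` {p \<in> carrier (free_algebra (carrier g)). \<forall>w\<in>Poly_Mapping.keys p. length w \<le> n}"

text \<open>
  The homomorphism from the enveloping algebra of a Lie subalgebra of \<open>h\<close> to that of \<open>h\<close>: a coset of
  the smaller ideal is contained in a unique coset of the larger one.
\<close>

definition uea_incl :: "'v lie_algebra \<Rightarrow> ('v list \<Rightarrow>\<^sub>0 complex) set \<Rightarrow> ('v list \<Rightarrow>\<^sub>0 complex) set" where
  "uea_incl h C = the_elem (uea_class h ` C)"


section \<open>The algebras \<open>A\<^bsub>d,L\<^esub>\<close>\<close>

text \<open>
  An element of the direct sum of \<open>L\<close> copies of \<open>gl(N)\<close> is a function \<open>x\<close>, where \<open>x \<alpha> i j\<close> is the
  \<open>(i, j)\<close> entry of the \<open>\<alpha>\<close>-th component and \<open>x\<close> vanishes outside the range of the indices. So the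
  inclusion of the direct sum for \<open>N - 1\<close> into that for \<open>N\<close> is an inclusion of sets.
\<close>

type_synonym gl_elem = "nat \<Rightarrow> nat \<Rightarrow> nat \<Rightarrow> complex"
type_synonym uea_elem = "(gl_elem list \<Rightarrow>\<^sub>0 complex) set"

definition gl_sum :: "nat \<Rightarrow> nat \<Rightarrow> gl_elem lie_algebra" where
  "gl_sum L N =
     \<lparr>carrier = {x. \<forall>\<alpha> i j. x \<alpha> i j \<noteq> 0 \<longrightarrow> \<alpha> \<in> {1..L} \<and> i \<in> {1..N} \<and> j \<in> {1..N}},
      lie_add = (\<lambda>x y \<alpha> i j. x \<alpha> i j + y \<alpha> i j),
      lie_scale = (\<lambda>c x \<alpha> i j. c * x \<alpha> i j),
      lie_bracket = (\<lambda>x y \<alpha> i j. (\<Sum>k=1..N. x \<alpha> i k * y \<alpha> k j) - (\<Sum>k=1..N. y \<alpha> i k * x \<alpha> k j))\<rparr>"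

definition mat_unit :: "nat \<Rightarrow> nat \<Rightarrow> nat \<Rightarrow> gl_elem" where
  "mat_unit i j \<alpha> = (\<lambda>\<beta> k l. if \<beta> = \<alpha> \<and> k = i \<and> l = j then 1 else 0)"

definition gl_sub :: "nat \<Rightarrow> nat \<Rightarrow> (nat \<Rightarrow> nat \<Rightarrow> complex) set" where
  "gl_sub d N = {x. \<forall>i j. x i j \<noteq> 0 \<longrightarrow> i \<in> {d<..N} \<and> j \<in> {d<..N}}"

definition gl_diag :: "nat \<Rightarrow> (nat \<Rightarrow> nat \<Rightarrow> complex) \<Rightarrow> gl_elem" where
  "gl_diag L x = (\<lambda>\<alpha> i j. if \<alpha> \<in> {1..L} then x i j else 0)"

definition Ugl :: "nat \<Rightarrow> nat \<Rightarrow> (complex, uea_elem) module" where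
  "Ugl L N = uea (gl_sum L N)"

definition gl_gen :: "nat \<Rightarrow> nat \<Rightarrow> gl_elem \<Rightarrow> uea_elem" where
  "gl_gen L N x = uea_class (gl_sum L N) (letter x)"

definition A_fin :: "nat \<Rightarrow> nat \<Rightarrow> nat \<Rightarrow> uea_elem set" where
  "A_fin d L N =
     {u \<in> carrier (Ugl L N). \<forall>x\<in>gl_sub d N.
        gl_gen L N (gl_diag L x) \<otimes>\<^bsub>Ugl L N\<^esub> u = u \<otimes>\<^bsub>Ugl L N\<^esub> gl_gen L N (gl_diag L x)}"

definition I_plus :: "nat \<Rightarrow> nat \<Rightarrow> uea_elem set" where
  "I_plus L N =
     left_genideal (Ugl L N) {gl_gen L N (mat_unit i N \<alpha>) | i \<alpha>. i \<in> {1..N} \<and> \<alpha> \<in> {1..L}}"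

definition J_ideal :: "nat \<Rightarrow> nat \<Rightarrow> uea_elem set" where
  "J_ideal L N = A_fin (N - 1) L N \<inter> I_plus L N"

text \<open>
  The projection of \<open>A_fin (N - 1) L N\<close> onto the first summand of its decomposition
  \<open>Ugl L (N - 1) \<oplus> J_ideal L N\<close>.
\<close>

definition pi_proj :: "nat \<Rightarrow> nat \<Rightarrow> uea_elem \<Rightarrow> uea_elem" where
  "pi_proj L N x =
     (THE y. y \<in> carrier (Ugl L (N - 1)) \<and> x \<ominus>\<^bsub>Ugl L N\<^esub> uea_incl (gl_sum L N) y \<in> J_ideal L N)"

text \<open>
  Sequences start at \<open>N = max d 1\<close> and are \<^const>\<open>undefined\<close> below that index; they lie in a common term of
  the filtrations, since the inverse limit is taken in the category of filtered algebras.
\<close>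

definition A_lim :: "nat \<Rightarrow> nat \<Rightarrow> (complex, nat \<Rightarrow> uea_elem) module" where
  "A_lim d L =
     \<lparr>carrier = {x \<in> (\<Pi>\<^sub>E N\<in>{max d 1..}. A_fin d L N).
        (\<forall>N\<ge>max d 1. pi_proj L (Suc N) (x (Suc N)) = x N) \<and>
        (\<exists>n. \<forall>N\<ge>max d 1. x N \<in> uea_filtration (gl_sum L N) n)},
      monoid.mult = (\<lambda>x y. \<lambda>N\<in>{max d 1..}. x N \<otimes>\<^bsub>Ugl L N\<^esub> y N),
      one = (\<lambda>N\<in>{max d 1..}. \<one>\<^bsub>Ugl L N\<^esub>),
      ring.zero = (\<lambda>N\<in>{max d 1..}. \<zero>\<^bsub>Ugl L N\<^esub>),
      add = (\<lambda>x y. \<lambda>N\<in>{max d 1..}. x N \<oplus>\<^bsub>Ugl L N\<^esub> y N),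
      smult = (\<lambda>c x. \<lambda>N\<in>{max d 1..}. c \<odot>\<^bsub>Ugl L N\<^esub> x N)\<rparr>"

definition A0_embed :: "nat \<Rightarrow> (nat \<Rightarrow> uea_elem) \<Rightarrow> nat \<Rightarrow> uea_elem" where
  "A0_embed d a = (\<lambda>N\<in>{max d 1..}. a N)"

end

theory Submission
  imports Defs "HOL-Library.Function_Algebras" "HOL-Library.Complex_Order"
begin

text \<open>
  The idea is to replace every element of the inverse limit by one function. Write an edge of colour \<open>\<alpha>\<close> from
  \<open>i\<close> to \<open>j\<close> for the matrix unit \<open>E\<^sub>i\<^sub>j\<close> in copy \<open>\<alpha>\<close>. The enveloping algebra acts on functions of lists of edges
  by the operators \<open>lop\<close>, the left regular representation written in coefficients, and applying an element to the
  function \<open>vac\<close> supported at the empty list gives its coefficient function. The Poincare-Birkhoff-Witt theorem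
  (\<open>phi_eq_zero_iff\<close>, \<open>phi_surj\<close>) says that this identifies the enveloping algebra with the symmetric functions of
  bounded degree. In these terms the centralizer condition is the vanishing of the derivations \<open>Dop a b\<close> with \<open>a, b > d\<close>
  (\<open>A_fin_iff\<close>), and the projections are restriction to lists without the vertex \<open>N\<close> (\<open>pi_proj_eq\<close>). So the inverse
  limit is the space of invariant functions of bounded degree in edges on all positive vertices (\<open>A_lim_elim\<close>,
  \<open>psi_surj\<close>). In top degree the product is the shuffle product (\<open>A_lim_mult\<close>).

  Invariant functions come from trails. A closed trail with colour word \<open>w\<close> gives an element \<open>pel d L w\<close>,
  which already lies in the algebra for \<open>d = 0\<close> and depends, in top degree, on \<open>w\<close> up to rotation. A trail from
  \<open>i\<close> to \<open>j\<close> with \<open>i, j \<le> d\<close> gives \<open>tel d L w i j\<close>; as an operator it is the iterated matrix product \<open>Top\<close>. Ordered products of closed trails and of trails between low vertices form a basis. To see this, evaluate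
  at standard layouts, which are disjoint trails whose inner vertices are all distinct and above \<open>d\<close>. An invariant
  function is determined by its values there (\<open>layouts_determine\<close>), the value depends only on the words
  (\<open>value_by_type\<close>), and a product does not vanish at its own layout while it vanishes at those of equal
  weight with fewer open trails or with equally many of another type (\<open>bas_at_layout\<close>, from \<open>layout_determined\<close>).
  This triangularity gives \<open>bas_spanning\<close> and \<open>bas_independent\<close>.

  The basis for \<open>d = 0\<close> consists of the products of closed trails alone. Hence the decomposition holds with the span \<open>Ysub d L\<close>
  of the products of the elements \<open>tel\<close> (\<open>tensor_lift_iso\<close>). It remains to see that this span is closed under multiplication.
  The commutator of two path generators is a combination of products of two path generators of smaller total length
  (\<open>T_commutator\<close>), with coefficients that do not depend on \<open>N\<close>, so reordering a product changes it by products of smaller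
  length (\<open>tgen_products\<close>).
\<close>

section \<open>Operators acting on one entry of a list\<close>

type_synonym edge = "nat \<times> nat \<times> nat"
type_synonym coef = "edge list \<Rightarrow> complex"

definition functional :: "('a \<Rightarrow> (('a \<Rightarrow> complex) \<Rightarrow> complex)) \<Rightarrow> bool" where
  "functional m \<longleftrightarrow> (\<forall>e g h. m e (\<lambda>x. g x + h x) = m e g + m e h) \<and> (\<forall>e c g. m e (\<lambda>x. c * g x) = c * m e g)"

text \<open>A first order operator on functions of lists: each entry is either removed, with weight \<open>s\<close>, or replaced according to the
  functional \<open>m\<close>. Multiplication by a Lie algebra element and the adjoint action both have this form in coefficients.\<close>

fun gop :: "('a \<Rightarrow> complex) \<Rightarrow> ('a \<Rightarrow> ('a \<Rightarrow> complex) \<Rightarrow> complex) \<Rightarrow> ('a list \<Rightarrow> complex) \<Rightarrow> 'a list \<Rightarrow> complex" where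
  "gop s m f [] = 0"
| "gop s m f (e # es) = s e * f es + m e (\<lambda>e'. f (e' # es)) + gop s m (\<lambda>r. f (e # r)) es"

lemma functionalD:
  assumes "functional m"
  shows "m e (\<lambda>x. g x + h x) = m e g + m e h" "m e (\<lambda>x. c * g x) = c * m e g"
    "m e (\<lambda>x. g x * c) = m e g * c" "m e (\<lambda>x. 0) = 0" "m e (\<lambda>x. g x - h x) = m e g - m e h"
proof -
  show a: "m e (\<lambda>x. g x + h x) = m e g + m e h" and b: "m e (\<lambda>x. c * g x) = c * m e g" for g h c
    using assms unfolding functional_def by blast+
  show "m e (\<lambda>x. g x * c) = m e g * c" using b[of c g] by (simp add: mult.commute)
  show "m e (\<lambda>x. 0) = 0" using b[of 0 "\<lambda>_. 0"] by simp
  show "m e (\<lambda>x. g x - h x) = m e g - m e h"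
    using a[of g "\<lambda>x. (-1) * h x"] b[of "-1" h] by simp
qed

lemma gop_add:
  assumes m: "functional m"
  shows "gop s m (\<lambda>r. f r + g r) es = gop s m f es + gop s m g es"
  by (induction es arbitrary: f g) (simp_all add: functionalD[OF m] algebra_simps)

lemma gop_scale:
  assumes m: "functional m"
  shows "gop s m (\<lambda>r. c * f r) es = c * gop s m f es"
  by (induction es arbitrary: f) (simp_all add: functionalD[OF m] algebra_simps)

lemma gop_zero: "functional m ==> gop s m (\<lambda>r. 0) es = 0"
  using gop_scale[of m s 0 "\<lambda>_. 0"] by simp

lemma gop_linear_operator:
  "gop (\<lambda>e. a * s e + s' e) (\<lambda>e h. a * m e h + m' e h) f es = a * gop s m f es + gop s' m' f es"
  by (induction es arbitrary: f) (simp_all add: algebra_simps)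

definition commuting :: "('a \<Rightarrow> ('a \<Rightarrow> complex) \<Rightarrow> complex) \<Rightarrow> ('a \<Rightarrow> ('a \<Rightarrow> complex) \<Rightarrow> complex) \<Rightarrow> bool" where
  "commuting m m' \<longleftrightarrow> (\<forall>e e' F. m e (\<lambda>x. m' e' (\<lambda>y. F x y)) = m' e' (\<lambda>y. m e (\<lambda>x. F x y)))"

lemma commuting_sym: "commuting m m' ==> commuting m' m"
proof -
  assume "commuting m m'"
  then have "m e (\<lambda>x. m' e' (\<lambda>y. F y x)) = m' e' (\<lambda>y. m e (\<lambda>x. F y x))" for e e' F
    unfolding commuting_def by (elim allE[of _ e] allE[of _ e'] allE[of _ "\<lambda>x y. F y x"])
  then show "commuting m' m" unfolding commuting_def by metis
qed

lemma gop_functional_commute: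
  assumes "functional m'" and "commuting m m'"
  shows "gop s m (\<lambda>r. m' e' (\<lambda>x. F x r)) es = m' e' (\<lambda>x. gop s m (\<lambda>r. F x r) es)"
proof (induction es arbitrary: F)
  case (Cons a es)
  have "m a (\<lambda>x. m' e' (\<lambda>y. F y (x # es))) = m' e' (\<lambda>y. m a (\<lambda>x. F y (x # es)))"
    using assms(2) unfolding commuting_def 
    by (elim allE[of _ a] allE[of _ e'] allE[of _ "\<lambda>x y. F y (x # es)"])
  then show ?case
    using Cons[of "\<lambda>x r. F x (a # r)"]
    by (simp add: functionalD[OF assms(1)])
qed (simp add: functionalD[OF assms(1)])

text \<open>The operators of this form are closed under commutators because replacements at different positions commute, so
  only the terms that act twice on the same entry survive.\<close>

lemma gop_commutator:
  assumes m: "functional m" and m': "functional m'" and "commuting m m'"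
  shows "gop s m (gop s' m' f) es - gop s' m' (gop s m f) es
    = gop (\<lambda>e. m e s' - m' e s) (\<lambda>e h. m e (\<lambda>e'. m' e' h) - m' e (\<lambda>e'. m e' h)) f es"
proof (induction es arbitrary: f)
  case (Cons e es)
  note 1 = gop_functional_commute[OF m' assms(3), of s e "\<lambda>x r. f (x # r)" es]
  note 2 = gop_functional_commute[OF m commuting_sym[OF assms(3)], of s' e "\<lambda>x r. f (x # r)" es]
  have A: "gop s m (gop s' m' f) (e # es) = 
     s e * gop s' m' f es + (m e s' * f es + m e (\<lambda>x. m' x (\<lambda>y. f (y # es))) + m e (\<lambda>x. gop s' m' (\<lambda>r. f (x # r)) es))
     + (s' e * gop s m f es + m' e (\<lambda>x. gop s m (\<lambda>r. f (x # r)) es) + gop s m (gop s' m' (\<lambda>r. f (e # r))) es)"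
    by (simp add: functionalD[OF m] functionalD[OF m'] gop_add[OF m] gop_scale[OF m] 1)
  have B: "gop s' m' (gop s m f) (e # es) = 
     s' e * gop s m f es + (m' e s * f es + m' e (\<lambda>x. m x (\<lambda>y. f (y # es))) + m' e (\<lambda>x. gop s m (\<lambda>r. f (x # r)) es))
     + (s e * gop s' m' f es + m e (\<lambda>x. gop s' m' (\<lambda>r. f (x # r)) es) + gop s' m' (gop s m (\<lambda>r. f (e # r))) es)"
    by (simp add: functionalD[OF m] functionalD[OF m'] gop_add[OF m'] gop_scale[OF m'] 2)
  show ?case
    unfolding A B using Cons[of "\<lambda>r. f (e # r)"] by (simp add: algebra_simps)
qed simp

section \<open>Symmetric functions and sums over the entries of a list\<close>

definition symf :: "('a list \<Rightarrow> 'b) \<Rightarrow> bool" where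
  "symf f \<longleftrightarrow> (\<forall>es es'. mset es = mset es' --> f es = f es')"

lemma symfD: "symf f ==> mset es = mset es' ==> f es = f es'"
  unfolding symf_def by blast

lemma symf_Cons: "symf f ==> symf (\<lambda>r. f (e # r))"
  unfolding symf_def by auto

lemma symf_step:
  assumes swap: "\<And>e e' es. f (e # e' # es) = f (e' # e # es)"
    and tail: "\<And>e r r'. mset r = mset r' ==> Suc (length r) = length es ==> f (e # r) = f (e # r')"
    and eq: "mset es = mset es'"
  shows "f es = f es'"
proof (cases es)
  case (Cons e r)
  note es = Cons
  have len: "length es' = length es" using eq by (metis size_mset)
  then obtain e' r' where es': "es' = e' # r'" using es by (cases es') auto
  show ?thesis
  proof (cases "e = e'")
    case True
    then show ?thesis using eq es es' tail[of r r' e] by simp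
  next
    case False
    have "add_mset e (mset r) = add_mset e' (mset r')" using eq es es' by simp
    then obtain K where K: "mset r = add_mset e' K" "mset r' = add_mset e K"
      using False unfolding add_eq_conv_ex by blast
    obtain q where q: "mset q = K" by (metis ex_mset)
    have "size (mset r) = Suc (length q)" unfolding K(1) q[symmetric] by simp
    then have lenq: "Suc (length (e # q)) = length es" using es by simp
    have "f (e # r) = f (e # e' # q)" by (rule tail) (use K q es in simp_all)
    also have "\<dots> = f (e' # e # q)" by (rule swap)
    also have "\<dots> = f (e' # r')" by (rule tail) (use K q lenq in simp_all)
    finally show ?thesis using es es' by simp
  qed
next
  case Nil
  then show ?thesis using eq by simp
qed

text \<open>A function is symmetric if it is invariant under swapping its first two entries and the same holds after fixing
  any number of first entries. The predicate \<open>P\<close> collects the functions obtained that way.\<close>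

lemma symf_coinduct [consumes 1, case_names swap tail]:
  assumes "P f"
    and swap: "\<And>f e e' es. P f ==> f (e # e' # es) = f (e' # e # es)"
    and tail: "\<And>f e. P f ==> P (\<lambda>r. f (e # r))"
  shows "symf f"
proof -
  have "f es = f es'" if "length es = n" "mset es = mset es'" "P f" for n es es' f
    using that
  proof (induction n arbitrary: es es' f)
    case 0
    then show ?case by simp
  next
    case (Suc n)
    show ?case
    proof (rule symf_step)
      show "f (e # r) = f (e # r')" if "mset r = mset r'" "Suc (length r) = length es" for e r r'
        using Suc.IH[of r r' "\<lambda>r. f (e # r)"] tail[OF Suc.prems(3)] that Suc.prems by simp
    qed (use swap Suc.prems in auto)
  qed
  then show ?thesis using assms(1) unfolding symf_def by blast
qed

fun psum :: "('a \<Rightarrow> 'a list \<Rightarrow> 'b::comm_monoid_add) \<Rightarrow> 'a list \<Rightarrow> 'b" where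
  "psum h [] = 0"
| "psum h (e # es) = h e es + psum (\<lambda>e' r. h e' (e # r)) es"

lemma psum_add: "psum (\<lambda>e r. h e r + h' e r) es = psum h es + psum h' es"
  by (induction es arbitrary: h h') (simp_all add: algebra_simps)

lemma psum_cmult: "psum (\<lambda>e r. (c::complex) * h e r) es = c * psum h es"
  by (induction es arbitrary: h) (simp_all add: algebra_simps)

lemma psum_zero [simp]: "psum (\<lambda>e r. 0) es = 0"
  by (induction es) simp_all

lemma psum_sum: "finite A ==> psum (\<lambda>e r. \<Sum>a\<in>A. h a e r) es = (\<Sum>a\<in>A. psum (h a) es)"
  by (induction A rule: finite_induct) (simp_all add: psum_add)

lemma psum_cong:
  "(\<And>e r. mset es = add_mset e (mset r) ==> h e r = h' e r) ==> psum h es = psum h' es"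
proof (induction es arbitrary: h h')
  case (Cons a es)
  have "psum (\<lambda>e' r. h e' (a # r)) es = psum (\<lambda>e' r. h' e' (a # r)) es"
  proof (rule Cons.IH)
    fix e r assume "mset es = add_mset e (mset r)"
    then show "h e (a # r) = h' e (a # r)" by (intro Cons.prems) (simp add: add_mset_commute)
  qed
  then show ?case using Cons.prems[of a es] by simp
qed simp

lemma psum_eq_0:
  assumes "\<And>e r. mset es = add_mset e (mset r) ==> h e r = 0"
  shows "psum h es = 0"
proof -
  have "psum h es = psum (\<lambda>_ _. 0) es" by (rule psum_cong) (rule assms)
  then show ?thesis by simp
qed

lemma psum_nonzeroD:
  assumes "psum h es ~= 0"
  obtains e r where "mset es = add_mset e (mset r)" "h e r ~= 0"
proof (rule ccontr)
  assume no: "\<not> thesis"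
  have "h e r = 0" if eq: "mset es = add_mset e (mset r)" for e r
  proof (rule ccontr)
    assume "h e r ~= 0"
    with eq have thesis by (rule \<open>\<And>e r. mset es = add_mset e (mset r) ==> h e r ~= 0 ==> thesis\<close>)
    with no show False by contradiction
  qed
  then have "psum h es = 0" by (rule psum_eq_0)
  then show False using assms by simp
qed

lemma psum_nonneg:
  fixes h :: "'a \<Rightarrow> 'a list \<Rightarrow> complex"
  assumes "\<And>e r. h e r \<ge> 0"
  shows "psum h es \<ge> 0"
  using assms
proof (induction es arbitrary: h)
  case (Cons e es)
  have "0 \<le> psum (\<lambda>e' r. h e' (e # r)) es" by (rule Cons.IH) (rule Cons.prems)
  then show ?case using Cons.prems[of e es] by simp
qed simp

lemma symf_add: "symf f ==> symf g ==> symf (\<lambda>r. f r + g r)"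
  unfolding symf_def by (intro allI impI arg_cong2[where f = "(+)"]) blast+

lemma symf_psum:
  assumes "\<And>e. symf (h e)"
  shows "symf (psum h :: 'a list \<Rightarrow> 'b::comm_monoid_add)"
proof -
  define P where "P = (\<lambda>f :: 'a list \<Rightarrow> 'b. \<exists>h k. (\<forall>e. symf (h e)) \<and> symf k \<and> f = (\<lambda>r. psum h r + k r))"
  have "psum h = (\<lambda>r. psum h r + 0)" "symf (\<lambda>_ :: 'a list. 0 :: 'b)" by (simp_all add: symf_def)
  then have P: "P (psum h)" unfolding P_def using assms by blast
  show ?thesis
  proof (rule symf_coinduct[where P = P, OF P])
    fix f e e' and es :: "'a list"
    assume "P f"
    then obtain h k where hk: "\<And>e. symf (h e)" "symf k" "f = (\<lambda>r. psum h r + k r)" unfolding P_def by blast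
    have 1: "h x (e # e' # r) = h x (e' # e # r)" for x r
      by (rule symfD[OF hk(1)]) (simp add: add_mset_commute)
    have 2: "k (e # e' # es) = k (e' # e # es)"
      by (rule symfD[OF hk(2)]) (simp add: add_mset_commute)
    show "f (e # e' # es) = f (e' # e # es)"
      unfolding hk(3) by (simp add: 1 2 ac_simps)
  next
    fix f e
    assume "P f"
    then obtain h k where hk: "\<And>e. symf (h e)" "symf k" "f = (\<lambda>r. psum h r + k r)" unfolding P_def by blast
    have "(\<lambda>r. f (e # r)) = (\<lambda>r. psum (\<lambda>e' r. h e' (e # r)) r + (h e r + k (e # r)))"
      unfolding hk(3) by (rule ext) (simp add: ac_simps)
    moreover have "symf (\<lambda>r. h e r + k (e # r))" by (intro symf_add symf_Cons hk(2) hk(1))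
    moreover have "\<forall>e'. symf (\<lambda>r. h e' (e # r))" by (intro allI symf_Cons hk(1))
    ultimately show "P (\<lambda>r. f (e # r))" unfolding P_def
      by (intro exI[of _ "\<lambda>e' r. h e' (e # r)"] exI[of _ "\<lambda>r. h e r + k (e # r)"] conjI)
  qed
qed

text \<open>On symmetric functions the position of the changed entry does not matter, so it may be moved to the front.\<close>

lemma gop_eq_psum:
  assumes "functional m" "symf f"
  shows "gop s m f es = psum (\<lambda>e r. s e * f r + m e (\<lambda>e'. f (e' # r))) es"
  using assms(2)
proof (induction es arbitrary: f)
  case (Cons e es)
  have "f (e # e' # r) = f (e' # e # r)" for e' r
    using symfD[OF Cons.prems, of "e # e' # r" "e' # e # r"] by (simp add: add_mset_commute)
  then show ?case using Cons.IH[OF symf_Cons[OF Cons.prems]] by simp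
qed simp

lemma symf_gop:
  assumes "functional m" "symf f"
  shows "symf (gop s m f)"
proof -
  have "symf (psum (\<lambda>e r. s e * f r + m e (\<lambda>e'. f (e' # r))))"
  proof (rule symf_psum, unfold symf_def, intro allI impI)
    fix e and es es' :: "'a list"
    assume eq: "mset es = mset es'"
    have "f (x # es) = f (x # es')" for x by (rule symfD[OF assms(2)]) (simp add: eq)
    then show "s e * f es + m e (\<lambda>e'. f (e' # es)) = s e * f es' + m e (\<lambda>e'. f (e' # es'))"
      using symfD[OF assms(2) eq] by simp
  qed
  moreover have "gop s m f = psum (\<lambda>e r. s e * f r + m e (\<lambda>e'. f (e' # r)))"
    by (rule ext) (rule gop_eq_psum[OF assms])
  ultimately show ?thesis by simp
qed

lemma functional_psum:
  assumes m: "functional m"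
  shows "m e (\<lambda>x. psum (h x) r) = psum (\<lambda>a r. m e (\<lambda>x. h x a r)) r"
proof (induction r arbitrary: h)
  case (Cons a r)
  have "m e (\<lambda>x. psum (h x) (a # r)) = m e (\<lambda>x. h x a r) + m e (\<lambda>x. psum (\<lambda>b r. h x b (a # r)) r)"
    by (simp add: functionalD(1)[OF m])
  then show ?case using Cons.IH[of "\<lambda>x b r. h x b (a # r)"] by simp
qed (simp add: functionalD[OF m])

lemma gop_psum:
  assumes m: "functional m"
  shows "gop (\<lambda>_. 0) m (\<lambda>r. psum h r) es
    = psum (\<lambda>e r. m e (\<lambda>e'. h e' r) + gop (\<lambda>_. 0) m (\<lambda>r. h e r) r) es"
proof (induction es arbitrary: h)
  case (Cons e es)
  let ?G = "gop (\<lambda>_. 0) m"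
  have "?G (\<lambda>r. psum h r) (e # es) = m e (\<lambda>x. h x es + psum (\<lambda>a r. h a (x # r)) es)
      + ?G (\<lambda>r. h e r + psum (\<lambda>a r. h a (e # r)) r) es"
    by simp
  also have "\<dots> = m e (\<lambda>x. h x es) + psum (\<lambda>a r. m e (\<lambda>x. h a (x # r))) es
      + (?G (\<lambda>r. h e r) es + ?G (\<lambda>r. psum (\<lambda>a r. h a (e # r)) r) es)"
    by (simp only: functionalD(1)[OF m] gop_add[OF m] functional_psum[OF m])
  also have "?G (\<lambda>r. psum (\<lambda>a r. h a (e # r)) r) es
      = psum (\<lambda>a r. m a (\<lambda>x. h x (e # r)) + ?G (\<lambda>r. h a (e # r)) r) es"
    by (rule Cons.IH)
  finally show ?case by (simp add: psum_add)
qed simp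

definition deg_le :: "nat \<Rightarrow> ('a list \<Rightarrow> complex) \<Rightarrow> bool" where
  "deg_le n f \<longleftrightarrow> (\<forall>es. length es > n --> f es = 0)"

lemma deg_leD: "deg_le n f ==> n < length es ==> f es = 0"
  unfolding deg_le_def by blast

lemma deg_le_gop:
  assumes m: "functional m" and "deg_le n f"
  shows "deg_le (Suc n) (gop s m f)"
  unfolding deg_le_def
proof (intro allI impI)
  have gen: "gop s m f es = 0" if "length es > Suc n" "\<And>r. length r > n ==> f r = 0" for es :: "'a list" and n f
    using that
  proof (induction es arbitrary: f n)
    case (Cons e es)
    have len: "length es > n" using Cons.prems(1) by simp
    have "gop s m (\<lambda>r. f (e # r)) es = 0"
    proof (cases n)
      case 0
      have "(\<lambda>r. f (e # r)) = (\<lambda>r. 0)" by (rule ext, rule Cons.prems(2)) (simp add: 0)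
      then show ?thesis by (simp add: gop_zero[OF m])
    next
      case (Suc k)
      show ?thesis by (rule Cons.IH[of k]) (use Suc len Cons.prems(2) in auto)
    qed
    moreover have "f es = 0" by (rule Cons.prems(2)) (rule len)
    moreover have "(\<lambda>e'. f (e' # es)) = (\<lambda>e'. 0)" by (rule ext, rule Cons.prems(2)) (use len in simp)
    ultimately show ?case by (simp add: functionalD(4)[OF m])
  qed simp
  fix es :: "'a list"
  assume "Suc n < length es"
  then show "gop s m f es = 0" using gen deg_leD[OF assms(2)] by blast
qed

lemma gop_top:
  assumes m: "functional m" and "\<And>r. length r \<ge> length es ==> f r = 0"
  shows "gop s m f es = psum (\<lambda>e r. s e * f r) es"
  using assms(2)
proof (induction es arbitrary: f)
  case (Cons e es)
  have "(\<lambda>e'. f (e' # es)) = (\<lambda>e'. 0)" by (rule ext, rule Cons.prems) simp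
  moreover have "gop s m (\<lambda>r. f (e # r)) es = psum (\<lambda>e' r. s e' * f (e # r)) es"
    by (rule Cons.IH, rule Cons.prems) simp
  ultimately show ?case by (simp add: functionalD(4)[OF m])
qed simp

section \<open>Shuffle products\<close>

text \<open>The sum over all ways to distribute the entries to the two factors: the shuffle product, which is the product of the symmetric
  algebra expressed in coefficients.\<close>

fun conv :: "('a list \<Rightarrow> complex) \<Rightarrow> ('a list \<Rightarrow> complex) \<Rightarrow> 'a list \<Rightarrow> complex" where
  "conv f g [] = f [] * g []"
| "conv f g (e # es) = conv (\<lambda>r. f (e # r)) g es + conv f (\<lambda>r. g (e # r)) es"

definition vac :: "'a list \<Rightarrow> complex" where "vac es = (if es = [] then 1 else 0)"

lemma conv_add_left: "conv (\<lambda>r. f r + f' r) g es = conv f g es + conv f' g es"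
  by (induction es arbitrary: f f' g) (simp_all add: algebra_simps)

lemma conv_add_right: "conv f (\<lambda>r. g r + g' r) es = conv f g es + conv f g' es"
  by (induction es arbitrary: f g' g) (simp_all add: algebra_simps)

lemma conv_scale_left: "conv (\<lambda>r. c * f r) g es = c * conv f g es"
  by (induction es arbitrary: f g) (simp_all add: algebra_simps)

lemma conv_zero_left [simp]: "conv (\<lambda>r. 0) g es = 0"
  using conv_scale_left[of 0 "\<lambda>_. 0"] by simp

lemma conv_vac_left [simp]: "conv vac g es = g es"
proof (induction es arbitrary: g)
  case (Cons e es)
  have "(\<lambda>r. vac (e # r)) = (\<lambda>r. 0)" by (simp add: vac_def)
  then show ?case using Cons by simp
qed (simp add: vac_def)

lemma conv_assoc: "conv (conv f g) h es = conv f (conv g h) es"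
  by (induction es arbitrary: f g h) (simp_all add: conv_add_left conv_add_right)

lemma conv_cong:
  "(\<And>r1 r2. mset es = mset r1 + mset r2 ==> f r1 * g r2 = f' r1 * g' r2) ==> conv f g es = conv f' g' es"
proof (induction es arbitrary: f g f' g')
  case (Cons e es)
  have "conv (\<lambda>r. f (e # r)) g es = conv (\<lambda>r. f' (e # r)) g' es"
    by (rule Cons.IH) (simp add: Cons.prems)
  moreover have "conv f (\<lambda>r. g (e # r)) es = conv f' (\<lambda>r. g' (e # r)) es"
    by (rule Cons.IH) (simp add: Cons.prems)
  ultimately show ?case by simp
qed simp

lemma conv_nonzeroD:
  assumes "conv f g es ~= 0"
  obtains r1 r2 where "mset es = mset r1 + mset r2" "f r1 ~= 0" "g r2 ~= 0"
proof (rule ccontr)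
  assume "\<not> thesis"
  then have "f r1 * g r2 = (\<lambda>_. 0) r1 * g r2" if "mset es = mset r1 + mset r2" for r1 r2
    using that \<open>\<And>r1 r2. mset es = mset r1 + mset r2 ==> f r1 ~= 0 ==> g r2 ~= 0 ==> thesis\<close> by auto
  then have "conv f g es = conv (\<lambda>_. 0) g es" by (rule conv_cong)
  then show False using assms by simp
qed

lemma conv_nonneg:
  assumes "\<And>r. f r \<ge> 0" "\<And>r. g r \<ge> 0"
  shows "conv f g es \<ge> 0"
  using assms
proof (induction es arbitrary: f g)
  case (Cons e es)
  have "0 \<le> conv (\<lambda>r. f (e # r)) g es" "0 \<le> conv f (\<lambda>r. g (e # r)) es"
    by (rule Cons.IH; rule Cons.prems)+
  then show ?case by simp
qed simp

lemma conv_ge_mult: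
  assumes "\<And>r. f r \<ge> 0" "\<And>r. g r \<ge> 0"
  shows "conv f g (r1 @ r2) \<ge> f r1 * g r2"
  using assms
proof (induction r1 arbitrary: f)
  case Nil
  show ?case using Nil
  proof (induction r2 arbitrary: g)
    case (Cons e r)
    have "f [] * g (e # r) \<le> conv f (\<lambda>r. g (e # r)) ([] @ r)"
      by (rule Cons.IH) (rule Cons.prems)+
    moreover have "0 \<le> conv (\<lambda>r. f (e # r)) g r" by (rule conv_nonneg) (rule Cons.prems)+
    ultimately show ?case by (simp add: add_increasing)
  qed simp
next
  case (Cons e r1)
  have "f (e # r1) * g r2 \<le> conv (\<lambda>r. f (e # r)) g (r1 @ r2)"
    by (rule Cons.IH) (rule Cons.prems)+
  moreover have "0 \<le> conv f (\<lambda>r. g (e # r)) (r1 @ r2)" by (rule conv_nonneg) (rule Cons.prems)+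
  ultimately show ?case by (simp add: add_increasing2)
qed

lemma psum_eq_conv: "psum (\<lambda>e r. s e * f r) es = conv (\<lambda>r. case r of [e] \<Rightarrow> s e | _ \<Rightarrow> 0) f es"
proof (induction es arbitrary: f)
  case (Cons e es)
  have "(\<lambda>r. case e # r of [e] \<Rightarrow> s e | _ \<Rightarrow> 0) = (\<lambda>r. s e * vac r)"
    by (auto simp: vac_def fun_eq_iff split: list.split)
  then show ?case using Cons[of "\<lambda>r. f (e # r)"] by (simp add: conv_scale_left)
qed simp

section \<open>The action of the enveloping algebra on functions of edge lists\<close>

definition xe :: "gl_elem \<Rightarrow> edge \<Rightarrow> complex" where "xe x e = (case e of (c, i, j) \<Rightarrow> x c i j)"

definition lker :: "nat \<Rightarrow> gl_elem \<Rightarrow> edge \<Rightarrow> (edge \<Rightarrow> complex) \<Rightarrow> complex" where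
  "lker N x e h = (case e of (c, i, j) \<Rightarrow> \<Sum>b=1..N. x c i b * h (c, b, j))"

definition rker :: "nat \<Rightarrow> gl_elem \<Rightarrow> edge \<Rightarrow> (edge \<Rightarrow> complex) \<Rightarrow> complex" where
  "rker N x e h = (case e of (c, i, j) \<Rightarrow> \<Sum>b=1..N. x c b j * h (c, i, b))"

text \<open>Left and right multiplication by \<open>x\<close> on coefficient functions. Removing an entry corresponds to a new tensor factor, replacing it to
  the bracket.\<close>

definition lop :: "nat \<Rightarrow> gl_elem \<Rightarrow> coef \<Rightarrow> coef" where "lop N x = gop (xe x) (lker N x)"
definition rop :: "nat \<Rightarrow> gl_elem \<Rightarrow> coef \<Rightarrow> coef" where "rop N x = gop (xe x) (rker N x)"

lemma functional_lker: "functional (lker N x)"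
  unfolding functional_def lker_def
  by (auto split: prod.split simp: algebra_simps sum.distrib sum_distrib_left)

lemma functional_rker: "functional (rker N x)"
  unfolding functional_def rker_def
  by (auto split: prod.split simp: algebra_simps sum.distrib sum_distrib_left)

lemma commuting_lker_lker: "commuting (lker N x) (lker N y)"
  unfolding commuting_def lker_def
proof (intro allI)
  fix e e' :: edge and F :: "edge \<Rightarrow> edge \<Rightarrow> complex"
  obtain c i j c' i' j' where e: "e = (c, i, j)" "e' = (c', i', j')" by (cases e, cases e') auto
  show "(case e of (c, i, j) \<Rightarrow> \<Sum>b = 1..N. x c i b * (case e' of (c', i', j') \<Rightarrow> \<Sum>b' = 1..N. y c' i' b' * F (c, b, j) (c', b', j')))
      = (case e' of (c', i', j') \<Rightarrow> \<Sum>b' = 1..N. y c' i' b' * (case e of (c, i, j) \<Rightarrow> \<Sum>b = 1..N. x c i b * F (c, b, j) (c', b', j')))"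
    by (simp add: e sum_distrib_left mult.left_commute) (rule sum.swap)
qed

lemma commuting_lker_rker: "commuting (lker N x) (rker N y)"
  unfolding commuting_def lker_def rker_def
proof (intro allI)
  fix e e' :: edge and F :: "edge \<Rightarrow> edge \<Rightarrow> complex"
  obtain c i j c' i' j' where e: "e = (c, i, j)" "e' = (c', i', j')" by (cases e, cases e') auto
  show "(case e of (c, i, j) \<Rightarrow> \<Sum>b = 1..N. x c i b * (case e' of (c', i', j') \<Rightarrow> \<Sum>b' = 1..N. y c' b' j' * F (c, b, j) (c', i', b')))
      = (case e' of (c', i', j') \<Rightarrow> \<Sum>b' = 1..N. y c' b' j' * (case e of (c, i, j) \<Rightarrow> \<Sum>b = 1..N. x c i b * F (c, b, j) (c', i', b')))"
    by (simp add: e sum_distrib_left mult.left_commute) (rule sum.swap)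
qed

lemma lop_commutator:
  "lop N x (lop N y f) es - lop N y (lop N x f) es = lop N (lie_bracket (gl_sum L N) x y) f es"
proof -
  have 1: "(\<lambda>e. lker N x e (xe y) - lker N y e (xe x)) = xe (lie_bracket (gl_sum L N) x y)"
    by (auto simp: fun_eq_iff lker_def xe_def gl_sum_def)
  have 2: "(\<lambda>e h. lker N x e (\<lambda>e'. lker N y e' h) - lker N y e (\<lambda>e'. lker N x e' h))
      = lker N (lie_bracket (gl_sum L N) x y)"
  proof (intro ext)
    fix e :: edge and h :: "edge \<Rightarrow> complex"
    obtain c i j where e: "e = (c, i, j)" by (cases e) auto
    have "(\<Sum>b=1..N. u c i b * (\<Sum>b'=1..N. v c b b' * h (c, b', j)))
        = (\<Sum>b'=1..N. (\<Sum>k=1..N. u c i k * v c k b') * h (c, b', j))" for u v :: gl_elem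
      unfolding sum_distrib_left sum_distrib_right by (subst sum.swap) (simp add: mult.assoc)
    then show "lker N x e (\<lambda>e'. lker N y e' h) - lker N y e (\<lambda>e'. lker N x e' h)
        = lker N (lie_bracket (gl_sum L N) x y) e h"
      by (simp add: e lker_def gl_sum_def left_diff_distrib sum_subtractf)
  qed
  show ?thesis
    unfolding lop_def gop_commutator[OF functional_lker functional_lker commuting_lker_lker] 1 2 ..
qed

lemma lop_rop_commute: "lop N x (rop N y f) = rop N y (lop N x f)"
proof
  fix es
  have 1: "(\<lambda>e. lker N x e (xe y) - rker N y e (xe x)) = (\<lambda>e. 0)"
    by (auto simp: fun_eq_iff lker_def rker_def xe_def mult.commute)
  have 2: "(\<lambda>e h. lker N x e (\<lambda>e'. rker N y e' h) - rker N y e (\<lambda>e'. lker N x e' h)) = (\<lambda>e h. 0)"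
  proof (intro ext)
    fix e :: edge and h :: "edge \<Rightarrow> complex"
    obtain c i j where e: "e = (c, i, j)" by (cases e) auto
    have "(\<Sum>b=1..N. x c i b * (\<Sum>b'=1..N. y c b' j * h (c, b, b')))
        = (\<Sum>b'=1..N. y c b' j * (\<Sum>b=1..N. x c i b * h (c, b, b')))"
      unfolding sum_distrib_left by (subst sum.swap) (simp add: mult.left_commute)
    then show "lker N x e (\<lambda>e'. rker N y e' h) - rker N y e (\<lambda>e'. lker N x e' h) = 0"
      by (simp add: e lker_def rker_def)
  qed
  have "gop (\<lambda>_. 0) (\<lambda>_ _. 0) f es = 0" for f :: coef by (induction es arbitrary: f) simp_all
  then have "lop N x (rop N y f) es - rop N y (lop N x f) es = 0"
    unfolding lop_def rop_def gop_commutator[OF functional_lker functional_rker commuting_lker_rker] 1 2 .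
  then show "lop N x (rop N y f) es = rop N y (lop N x f) es" by simp
qed

lemma vac_Nil [simp]: "vac [] = 1" and vac_Cons [simp]: "vac (e # es) = 0"
  by (simp_all add: vac_def)

lemma symf_vac: "symf vac"
  unfolding symf_def vac_def by auto

lemma deg_le_vac: "deg_le 0 vac"
  unfolding deg_le_def vac_def by auto

lemma lop_vac_eq_rop_vac: "lop N x vac = rop N x vac"
proof
  fix es
  have "gop s m vac es = psum (\<lambda>e r. s e * vac r) es" if "functional m" for s and m :: "edge \<Rightarrow> (edge \<Rightarrow> complex) \<Rightarrow> complex"
  proof (cases es)
    case (Cons a r)
    show ?thesis by (rule gop_top[OF that]) (auto simp: vac_def Cons)
  qed simp
  from this[OF functional_lker] this[OF functional_rker]
  show "lop N x vac es = rop N x vac es" unfolding lop_def rop_def by simp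
qed

text \<open>Linear operators on coefficient functions form a ring.\<close>

text \<open>The operators are bundled into a type of class \<open>ring_1\<close>, so that the ring laws need no carrier conditions.\<close>

typedef lin = "{T :: coef \<Rightarrow> coef. (\<forall>f g. T (\<lambda>r. f r + g r) = (\<lambda>r. T f r + T g r)) \<and>
    (\<forall>c f. T (\<lambda>r. c * f r) = (\<lambda>r. c * T f r))}" morphisms ap Lin
  by (rule exI[of _ "\<lambda>f. f"]) simp

setup_lifting type_definition_lin

lemma ap_add: "ap T (\<lambda>r. f r + g r) = (\<lambda>r. ap T f r + ap T g r)"
  and ap_scale: "ap T (\<lambda>r. c * f r) = (\<lambda>r. c * ap T f r)"
  using ap[of T] by auto

lemma ap_minus: "ap T (\<lambda>r. f r - g r) = (\<lambda>r. ap T f r - ap T g r)"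
  using ap_add[of T f "\<lambda>r. (-1) * g r"] ap_scale[of T "-1" g] by simp

instantiation lin :: ring_1
begin
lift_definition zero_lin :: lin is "\<lambda>f r. 0" by simp
lift_definition one_lin :: lin is "\<lambda>f. f" by simp
lift_definition plus_lin :: "lin \<Rightarrow> lin \<Rightarrow> lin" is "\<lambda>S T f r. S f r + T f r"
  by (simp add: algebra_simps)
lift_definition minus_lin :: "lin \<Rightarrow> lin \<Rightarrow> lin" is "\<lambda>S T f r. S f r - T f r"
  by (simp add: algebra_simps)
lift_definition uminus_lin :: "lin \<Rightarrow> lin" is "\<lambda>S f r. - S f r"
  by (simp add: algebra_simps)
lift_definition times_lin :: "lin \<Rightarrow> lin \<Rightarrow> lin" is "\<lambda>S T f. S (T f)"
  by simp
instance
proof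
  fix a b c :: lin
  show "a * b * c = a * (b * c)" by transfer simp
  show "a + b + c = a + (b + c)" by transfer (simp add: algebra_simps)
  show "a + b = b + a" by transfer (simp add: algebra_simps)
  show "0 + a = a" by transfer simp
  show "- a + a = 0" by transfer simp
  show "a - b = a + - b" by transfer simp
  show "1 * a = a" "a * 1 = a" by (transfer, simp)+
  show "(a + b) * c = a * c + b * c" by transfer simp
  show "a * (b + c) = a * b + a * c" by transfer simp
  show "(0::lin) ~= 1" by transfer (auto simp: fun_eq_iff intro: exI[of _ "\<lambda>_. 1"])
qed
end

lift_definition scal :: "complex \<Rightarrow> lin" is "\<lambda>c f r. c * f r"
  by (simp add: algebra_simps)

lift_definition Lop :: "nat \<Rightarrow> gl_elem \<Rightarrow> lin" is lop
  by (auto simp: lop_def fun_eq_iff gop_add functional_lker gop_scale)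

lemma ap_simps [simp]:
  "ap 0 f = (\<lambda>r. 0)" "ap 1 f = f" "ap (S + T) f = (\<lambda>r. ap S f r + ap T f r)"
  "ap (S - T) f = (\<lambda>r. ap S f r - ap T f r)" "ap (- S) f = (\<lambda>r. - ap S f r)"
  "ap (S * T) f = ap S (ap T f)" "ap (scal c) f = (\<lambda>r. c * f r)" "ap (Lop N x) f = lop N x f"
  by (transfer; simp)+

lemma lin_eqI: "(\<And>f. ap S f = ap T f) ==> S = T"
  by (rule iffD1[OF ap_inject]) (rule ext)

lemma ap_sum: "ap (\<Sum>a\<in>A. S a) f es = (\<Sum>a\<in>A. ap (S a) f es)"
  by (induction A rule: infinite_finite_induct) simp_all

lemma scal_mult_left: "scal c * T = T * scal c"
  by (rule lin_eqI) (simp add: ap_scale)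

lemma scal_simps [simp]:
  "scal 0 = 0" "scal 1 = 1" "scal (a + b) = scal a + scal b" "scal (a * b) = scal a * scal b"
  "scal (- a) = - scal a" "scal (a - b) = scal a - scal b"
  by (rule lin_eqI; simp add: algebra_simps)+

lemma Lop_commutator: "Lop N x * Lop N y - Lop N y * Lop N x = Lop N (lie_bracket (gl_sum L N) x y)"
  by (rule lin_eqI) (simp add: fun_eq_iff lop_commutator[of N x y _ _ L])

lemma Lop_linear: "Lop N (lie_add (gl_sum L N) x y) = Lop N x + Lop N y"
  "Lop N (lie_scale (gl_sum L N) c x) = scal c * Lop N x"
proof -
  have 1: "xe (\<lambda>\<alpha> i j. a * x \<alpha> i j + y \<alpha> i j) = (\<lambda>e. a * xe x e + xe y e)" 
    "lker N (\<lambda>\<alpha> i j. a * x \<alpha> i j + y \<alpha> i j) = (\<lambda>e h. a * lker N x e h + lker N y e h)" for a and x y :: gl_elem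
    by (auto simp: xe_def lker_def fun_eq_iff sum_distrib_left sum.distrib algebra_simps)
  have 2: "lop N (\<lambda>\<alpha> i j. a * x \<alpha> i j + y \<alpha> i j) f es = a * lop N x f es + lop N y f es" for a x y f es
    unfolding lop_def 1 by (rule gop_linear_operator)
  have 3: "lop N (\<lambda>\<alpha> i j. 0) f es = 0" for f es
  proof -
    have e: "xe (\<lambda>\<alpha> i j. 0) = (\<lambda>e. 0)" "lker N (\<lambda>\<alpha> i j. 0) = (\<lambda>e h. 0)" by (auto simp: xe_def lker_def fun_eq_iff)
    show ?thesis unfolding lop_def e by (induction es arbitrary: f) simp_all
  qed
  show "Lop N (lie_add (gl_sum L N) x y) = Lop N x + Lop N y"
    using 2[of 1 x y] by (intro lin_eqI) (simp add: gl_sum_def fun_eq_iff)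
  show "Lop N (lie_scale (gl_sum L N) c x) = scal c * Lop N x"
    using 2[of c x "\<lambda>_ _ _. 0"] 3 by (intro lin_eqI) (simp add: gl_sum_def fun_eq_iff)
qed

section \<open>The free algebra and its action\<close>

definition lact :: "nat \<Rightarrow> (gl_elem list \<Rightarrow>\<^sub>0 complex) \<Rightarrow> lin" where
  "lact N p = (\<Sum>w\<in>Poly_Mapping.keys p. scal (Poly_Mapping.lookup p w) * prod_list (map (Lop N) w))"

lemma lact_superset:
  assumes "finite S" "Poly_Mapping.keys p \<subseteq> S"
  shows "lact N p = (\<Sum>w\<in>S. scal (Poly_Mapping.lookup p w) * prod_list (map (Lop N) w))"
  unfolding lact_def using assms by (intro sum.mono_neutral_left) (auto simp: in_keys_iff)

lemma lact_add: "lact N (p + q) = lact N p + lact N q"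
proof -
  let ?S = "Poly_Mapping.keys p \<union> Poly_Mapping.keys q"
  have "Poly_Mapping.keys (p + q) \<subseteq> ?S" by (rule keys_add)
  then show ?thesis
    by (simp add: lact_superset[of ?S] lookup_add sum.distrib distrib_right)
qed

lemma lact_zero [simp]: "lact N 0 = 0" by (simp add: lact_def)

lemma lact_single: "lact N (Poly_Mapping.single w c) = scal c * prod_list (map (Lop N) w)"
  by (simp add: lact_superset[of "{w}"])

lemma lact_uminus: "lact N (- p) = - lact N p"
  using lact_add[of N p "- p"] by (simp add: eq_neg_iff_add_eq_0 add.commute)

lemma lact_diff: "lact N (p - q) = lact N p - lact N q"
  using lact_add[of N p "- q"] by (simp add: lact_uminus)

lemma lact_sum: "lact N (\<Sum>a\<in>A. p a) = (\<Sum>a\<in>A. lact N (p a))"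
  by (induction A rule: infinite_finite_induct) (simp_all add: lact_add)

lemma poly_eq_sum_single: "p = (\<Sum>w\<in>Poly_Mapping.keys p. Poly_Mapping.single w (Poly_Mapping.lookup p w))"
  by (rule poly_mapping_eqI) (simp add: lookup_sum lookup_single when_def in_keys_iff)

lemma lact_mult: "lact N (p * q) = lact N p * lact N q"
proof -
  have 1: "lact N (Poly_Mapping.single u a * Poly_Mapping.single v b)
      = lact N (Poly_Mapping.single u a) * lact N (Poly_Mapping.single v b)" for u v a b
    by (simp add: mult_single lact_single plus_list_def mult.assoc scal_mult_left[of b])
  have "p * q = (\<Sum>u\<in>Poly_Mapping.keys p. Poly_Mapping.single u (Poly_Mapping.lookup p u)) *
      (\<Sum>v\<in>Poly_Mapping.keys q. Poly_Mapping.single v (Poly_Mapping.lookup q v))"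
    by (simp only: poly_eq_sum_single[symmetric])
  then have "lact N (p * q) = (\<Sum>u\<in>Poly_Mapping.keys p. \<Sum>v\<in>Poly_Mapping.keys q.
      lact N (Poly_Mapping.single u (Poly_Mapping.lookup p u) * Poly_Mapping.single v (Poly_Mapping.lookup q v)))"
    by (simp only: sum_product lact_sum)
  also have "\<dots> = lact N p * lact N q"
    unfolding 1 sum_product[symmetric] lact_sum[symmetric] poly_eq_sum_single[symmetric] ..
  finally show ?thesis .
qed

lemma single_Nil_one: "Poly_Mapping.single [] 1 = 1"
  by (simp flip: zero_list_def)

lemma lact_one [simp]: "lact N 1 = 1"
  using lact_single[of N "[]" 1] by (simp add: single_Nil_one)

lemma lact_const: "lact N (Poly_Mapping.single [] c) = scal c"
  by (simp add: lact_single)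

lemma lact_letter: "lact N (letter x) = Lop N x"
  by (simp add: lact_single)

section \<open>Enveloping algebras as quotients of free algebras\<close>

lemma ring_free_algebra: "ring (free_algebra S)"
proof -
  have add: "p + q \<in> carrier (free_algebra S)" if "p \<in> carrier (free_algebra S)" "q \<in> carrier (free_algebra S)" for p q
    using that subsetD[OF keys_add[of p q]] unfolding free_algebra_def by auto
  have mult: "p * q \<in> carrier (free_algebra S)" if p: "p \<in> carrier (free_algebra S)" and q: "q \<in> carrier (free_algebra S)" for p q
  proof -
    have "set w \<subseteq> S" if w: "w \<in> Poly_Mapping.keys (p * q)" for w
    proof -
      obtain u v where "w = u @ v" "u \<in> Poly_Mapping.keys p" "v \<in> Poly_Mapping.keys q"
        using subsetD[OF keys_mult w] by (auto simp: plus_list_def)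
      then show ?thesis using p q by (simp add: free_algebra_def)
    qed
    then show ?thesis by (simp add: free_algebra_def)
  qed
  have sel: "x \<otimes>\<^bsub>free_algebra S\<^esub> y = x * y" "\<one>\<^bsub>free_algebra S\<^esub> = 1" "\<zero>\<^bsub>free_algebra S\<^esub> = 0"
    "x \<oplus>\<^bsub>free_algebra S\<^esub> y = x + y" for x y by (simp_all add: free_algebra_def)
  have const: "0 \<in> carrier (free_algebra S)" "1 \<in> carrier (free_algebra S)"
    by (simp_all add: free_algebra_def zero_list_def)
  have neg: "- p \<in> carrier (free_algebra S)" if "p \<in> carrier (free_algebra S)" for p
    using that by (simp add: free_algebra_def)
  show ?thesis
  proof (rule ringI)
    show "abelian_group (free_algebra S)"
    proof (rule abelian_groupI)
      fix x assume "x \<in> carrier (free_algebra S)"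
      then show "\<exists>y\<in>carrier (free_algebra S). y \<oplus>\<^bsub>free_algebra S\<^esub> x = \<zero>\<^bsub>free_algebra S\<^esub>"
        by (intro bexI[of _ "- x"] neg) (simp add: sel)
    qed (simp_all add: sel add const add_ac)
    show "Group.monoid (free_algebra S)"
      by (rule monoidI) (simp_all add: sel mult const mult.assoc)
  qed (simp_all add: sel distrib_left distrib_right)
qed

lemma gl_sum_closed:
  assumes "x \<in> carrier (gl_sum L N)" "y \<in> carrier (gl_sum L N)"
  shows "lie_add (gl_sum L N) x y \<in> carrier (gl_sum L N)"
    "lie_scale (gl_sum L N) c x \<in> carrier (gl_sum L N)"
    "lie_bracket (gl_sum L N) x y \<in> carrier (gl_sum L N)"
proof -
  have nz: "\<alpha> \<in> {1..L} \<and> i \<in> {1..N} \<and> j \<in> {1..N}" if "u \<alpha> i j ~= 0" "u \<in> carrier (gl_sum L N)" for u \<alpha> i j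
    using that by (auto simp: gl_sum_def)
  have "\<alpha> \<in> {1..L} \<and> i \<in> {1..N} \<and> j \<in> {1..N}" if "x \<alpha> i j + y \<alpha> i j ~= 0" for \<alpha> i j
    using that nz[of x \<alpha> i j, OF _ assms(1)] nz[of y \<alpha> i j, OF _ assms(2)] by (cases "x \<alpha> i j = 0") auto
  then show "lie_add (gl_sum L N) x y \<in> carrier (gl_sum L N)"
    unfolding gl_sum_def by (simp only: partial_object.select_convs lie_algebra.select_convs) blast
  have "\<alpha> \<in> {1..L} \<and> i \<in> {1..N} \<and> j \<in> {1..N}" if "c * x \<alpha> i j ~= 0" for \<alpha> i j
    using that nz[of x \<alpha> i j, OF _ assms(1)] by auto
  then show "lie_scale (gl_sum L N) c x \<in> carrier (gl_sum L N)"
    unfolding gl_sum_def by (simp only: partial_object.select_convs lie_algebra.select_convs) blast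
  have s: "\<alpha> \<in> {1..L} \<and> i \<in> {1..N} \<and> j \<in> {1..N}" if s: "(\<Sum>k=1..N. u \<alpha> i k * v \<alpha> k j) ~= 0"
    and u: "u \<in> carrier (gl_sum L N)" and v: "v \<in> carrier (gl_sum L N)" for u v \<alpha> i j
  proof -
    obtain k where "u \<alpha> i k * v \<alpha> k j ~= 0" using s by (meson sum.not_neutral_contains_not_neutral)
    then show ?thesis using nz[OF _ u, of \<alpha> i k] nz[OF _ v, of \<alpha> k j] by auto
  qed
  show "lie_bracket (gl_sum L N) x y \<in> carrier (gl_sum L N)"
  proof -
    have "\<alpha> \<in> {1..L} \<and> i \<in> {1..N} \<and> j \<in> {1..N}"
      if "(\<Sum>k=1..N. x \<alpha> i k * y \<alpha> k j) - (\<Sum>k=1..N. y \<alpha> i k * x \<alpha> k j) ~= 0" for \<alpha> i j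
    proof (cases "(\<Sum>k=1..N. x \<alpha> i k * y \<alpha> k j) = 0")
      case True
      then show ?thesis using that s[of y \<alpha> i x j, OF _ assms(2) assms(1)] by simp
    next
      case False
      then show ?thesis using s[of x \<alpha> i y j, OF _ assms] by simp
    qed
    then show ?thesis unfolding gl_sum_def by (simp only: partial_object.select_convs lie_algebra.select_convs) blast
  qed
qed

abbreviation glc :: "nat \<Rightarrow> nat \<Rightarrow> gl_elem set" where "glc L N \<equiv> carrier (gl_sum L N)"
abbreviation FA :: "nat \<Rightarrow> nat \<Rightarrow> (complex, gl_elem list \<Rightarrow>\<^sub>0 complex) module" where "FA L N \<equiv> free_algebra (glc L N)"
abbreviation FC :: "nat \<Rightarrow> nat \<Rightarrow> (gl_elem list \<Rightarrow>\<^sub>0 complex) set" where "FC L N \<equiv> carrier (FA L N)"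
abbreviation UI :: "nat \<Rightarrow> nat \<Rightarrow> (gl_elem list \<Rightarrow>\<^sub>0 complex) set" where "UI L N \<equiv> uea_ideal (gl_sum L N)"
abbreviation cl :: "nat \<Rightarrow> nat \<Rightarrow> (gl_elem list \<Rightarrow>\<^sub>0 complex) \<Rightarrow> uea_elem" where "cl L N \<equiv> uea_class (gl_sum L N)"

lemma FC_iff: "p \<in> FC L N \<longleftrightarrow> (\<forall>w\<in>Poly_Mapping.keys p. set w \<subseteq> glc L N)"
  by (simp add: free_algebra_def)

lemma FA_sel [simp]: "x \<otimes>\<^bsub>FA L N\<^esub> y = x * y" "\<one>\<^bsub>FA L N\<^esub> = 1" "\<zero>\<^bsub>FA L N\<^esub> = 0" "x \<oplus>\<^bsub>FA L N\<^esub> y = x + y"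
  by (simp_all add: free_algebra_def)

lemma FA_smult: "c \<odot>\<^bsub>FA L N\<^esub> p = Poly_Mapping.single [] c * p"
  by (simp add: free_algebra_def mult_map_scale_conv_mult zero_list_def)

lemma FC_closed [simp]:
  "0 \<in> FC L N" "1 \<in> FC L N" "p \<in> FC L N ==> q \<in> FC L N ==> p + q \<in> FC L N"
  "p \<in> FC L N ==> q \<in> FC L N ==> p * q \<in> FC L N" "p \<in> FC L N ==> - p \<in> FC L N"
  "p \<in> FC L N ==> q \<in> FC L N ==> p - q \<in> FC L N"
  "Poly_Mapping.single [] c \<in> FC L N" "x \<in> glc L N ==> Poly_Mapping.single [x] c \<in> FC L N"
proof -
  interpret ring "FA L N" by (rule ring_free_algebra)
  show "0 \<in> FC L N" "1 \<in> FC L N" using zero_closed one_closed by simp_all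
  show "p + q \<in> FC L N" "p * q \<in> FC L N" if "p \<in> FC L N" "q \<in> FC L N" for p q
    using a_closed[OF that] m_closed[OF that] by simp_all
  show m: "- p \<in> FC L N" if "p \<in> FC L N" for p using that by (simp add: FC_iff)
  show "p - q \<in> FC L N" if "p \<in> FC L N" "q \<in> FC L N" for p q
    using a_closed[OF that(1) m[OF that(2)]] by simp
  show "Poly_Mapping.single [] c \<in> FC L N" "x \<in> glc L N ==> Poly_Mapping.single [x] c \<in> FC L N"
    by (auto simp: FC_iff)
qed

lemma FC_sum: "(\<And>a. a \<in> A ==> p a \<in> FC L N) ==> (\<Sum>a\<in>A. p a) \<in> FC L N"
  by (induction A rule: infinite_finite_induct) auto

lemma uea_relators_subset: "uea_relators (gl_sum L N) \<subseteq> FC L N"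
proof
  fix p assume "p \<in> uea_relators (gl_sum L N)"
  then consider x y where "x \<in> glc L N" "y \<in> glc L N" "p = letter (lie_add (gl_sum L N) x y) - letter x - letter y"
    | c x where "x \<in> glc L N" "p = letter (lie_scale (gl_sum L N) c x) - Poly_Mapping.single [x] c"
    | x y where "x \<in> glc L N" "y \<in> glc L N"
        "p = letter x * letter y - letter y * letter x - letter (lie_bracket (gl_sum L N) x y)"
    unfolding uea_relators_def by blast
  then show "p \<in> FC L N"
  proof cases
    case (2 c x)
    then show ?thesis using gl_sum_closed(2)[of x L N x c] by simp
  qed (use gl_sum_closed(1,3) in simp_all)
qed

lemma UI_ideal: "ideal (UI L N) (FA L N)"
  unfolding uea_ideal_def by (rule ring.genideal_ideal[OF ring_free_algebra uea_relators_subset])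

lemma a_inv_FA: "p \<in> FC L N ==> \<ominus>\<^bsub>FA L N\<^esub> p = - p"
proof -
  assume "p \<in> FC L N"
  interpret ring "FA L N" by (rule ring_free_algebra)
  show ?thesis using \<open>p \<in> FC L N\<close> minus_equality[of "- p" p] by simp
qed

lemma UI_subset: "p \<in> UI L N ==> p \<in> FC L N"
  using ideal.Icarr[OF UI_ideal] .

lemma UI_closed:
  shows UI_zero [simp]: "0 \<in> UI L N" 
    and UI_add: "p \<in> UI L N ==> q \<in> UI L N ==> p + q \<in> UI L N"
    and UI_uminus: "p \<in> UI L N ==> - p \<in> UI L N"
    and UI_mult_left: "r \<in> FC L N ==> p \<in> UI L N ==> r * p \<in> UI L N"
    and UI_mult_right: "r \<in> FC L N ==> p \<in> UI L N ==> p * r \<in> UI L N"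
proof -
  interpret ideal "UI L N" "FA L N" by (rule UI_ideal)
  note sub = ideal.axioms(1)[OF UI_ideal]
  show "0 \<in> UI L N" using additive_subgroup.zero_closed[OF sub] by simp
  show "p \<in> UI L N ==> q \<in> UI L N ==> p + q \<in> UI L N" using additive_subgroup.a_closed[OF sub, of p]  by simp
  show "p \<in> UI L N ==> - p \<in> UI L N" using I_l_closed[of p "- 1"] by simp
  show "r \<in> FC L N ==> p \<in> UI L N ==> r * p \<in> UI L N" using I_l_closed[of p r] by simp
  show "r \<in> FC L N ==> p \<in> UI L N ==> p * r \<in> UI L N" using I_r_closed[of p r] by simp
qed

lemma UI_diff: "p \<in> UI L N ==> q \<in> UI L N ==> p - q \<in> UI L N"
  using UI_add[OF _ UI_uminus, of p L N q] by simp

lemma UI_relator: "p \<in> uea_relators (gl_sum L N) ==> p \<in> UI L N"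
  using ring.genideal_self[OF ring_free_algebra uea_relators_subset] unfolding uea_ideal_def by blast

lemma cl_eq_iff:
  assumes "p \<in> FC L N" "q \<in> FC L N"
  shows "cl L N p = cl L N q \<longleftrightarrow> p - q \<in> UI L N"
  unfolding uea_class_def
  using ring.quotient_eq_iff_same_a_r_cos[OF ring_free_algebra UI_ideal assms] a_inv_FA[OF assms(2)]
  by (simp add: a_minus_def)

lemma cl_memD: "p \<in> cl L N q ==> q \<in> FC L N ==> p \<in> FC L N \<and> cl L N p = cl L N q"
proof -
  assume p: "p \<in> cl L N q" and q: "q \<in> FC L N"
  then obtain h where "h \<in> UI L N" "p = h + q"
    unfolding uea_class_def a_r_coset_def r_coset_def by auto
  then show ?thesis using q UI_subset cl_eq_iff[of p L N q] by auto
qed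

lemma cl_self: "p \<in> FC L N ==> p \<in> cl L N p"
  unfolding uea_class_def a_r_coset_def r_coset_def using UI_zero[of L N] by auto

lemma Ugl_carrier: "carrier (Ugl L N) = cl L N ` FC L N"
proof -
  have "carrier (Ugl L N) = carrier (FactRing (FA L N) (UI L N))"
    by (simp add: Ugl_def uea_def quot_module_def ring.defs)
  also have "\<dots> = A_RCOSETS (FA L N) (UI L N)" by (simp add: FactRing_def)
  also have "\<dots> = cl L N ` FC L N" unfolding A_RCOSETS_def' uea_class_def by blast
  finally show ?thesis .
qed

lemma Ugl_quot:
  "add (Ugl L N) = add (FactRing (FA L N) (UI L N))" "monoid.mult (Ugl L N) = monoid.mult (FactRing (FA L N) (UI L N))"
  "one (Ugl L N) = one (FactRing (FA L N) (UI L N))"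
  by (simp_all add: Ugl_def uea_def quot_module_def ring.defs)

lemma Ugl_add: "p \<in> FC L N ==> q \<in> FC L N ==> cl L N p \<oplus>\<^bsub>Ugl L N\<^esub> cl L N q = cl L N (p + q)"
  unfolding Ugl_quot FactRing_def ring.select_convs uea_class_def
  by (rule trans[OF ideal.a_rcos_sum[OF UI_ideal]]) simp_all

lemma Ugl_mult: "p \<in> FC L N ==> q \<in> FC L N ==> cl L N p \<otimes>\<^bsub>Ugl L N\<^esub> cl L N q = cl L N (p * q)"
  unfolding Ugl_quot FactRing_def monoid.select_convs uea_class_def
  by (rule trans[OF ideal.rcoset_mult_add[OF UI_ideal]]) simp_all

lemma Ugl_one: "\<one>\<^bsub>Ugl L N\<^esub> = cl L N 1"
  unfolding Ugl_quot FactRing_def monoid.select_convs uea_class_def by simp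

lemma Ugl_zero: "\<zero>\<^bsub>Ugl L N\<^esub> = cl L N 0"
proof -
  interpret ring "FA L N" by (rule ring_free_algebra)
  have "\<zero>\<^bsub>Ugl L N\<^esub> = UI L N" by (simp add: Ugl_def uea_def quot_module_def ring.defs FactRing_def)
  moreover have "UI L N \<subseteq> FC L N" using UI_subset by blast
  ultimately show ?thesis using a_coset_add_zero[of "UI L N"] by (simp add: uea_class_def)
qed

lemma Ugl_smult: 
  assumes p: "p \<in> FC L N" 
  shows "c \<odot>\<^bsub>Ugl L N\<^esub> cl L N p = cl L N (Poly_Mapping.single [] c * p)"
proof -
  have "c \<odot>\<^bsub>Ugl L N\<^esub> cl L N p = (\<Union>a\<in>cl L N p. cl L N (Poly_Mapping.single [] c * a))"
    unfolding Ugl_def uea_def quot_module_def by (simp add: ring.defs module.defs uea_class_def FA_smult)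
  also have "\<dots> = cl L N (Poly_Mapping.single [] c * p)"
  proof -
    have "cl L N (Poly_Mapping.single [] c * a) = cl L N (Poly_Mapping.single [] c * p)" if "a \<in> cl L N p" for a
    proof -
      have a: "a \<in> FC L N" "a - p \<in> UI L N" using cl_memD[OF that p] cl_eq_iff[of a L N p] p by auto
      have "Poly_Mapping.single [] c * (a - p) \<in> UI L N" by (rule UI_mult_left) (use a in auto)
      then have "Poly_Mapping.single [] c * a - Poly_Mapping.single [] c * p \<in> UI L N"
        by (simp only: right_diff_distrib)
      then show ?thesis using a(1) p cl_eq_iff[of "Poly_Mapping.single [] c * a" L N "Poly_Mapping.single [] c * p"] by simp
    qed
    then show ?thesis by (intro UN_constant_eq[OF cl_self[OF p]] ballI)
  qed
  finally show ?thesis .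
qed

lemma gl_gen_eq: "gl_gen L N x = cl L N (letter x)"
  by (simp add: gl_gen_def)

text \<open>A structure that embeds into a type class ring by a map respecting the operations is a ring.\<close>

text \<open>This avoids checking the ring axioms in the inverse limit by hand: they are inherited from sequences of operators.\<close>

lemma ring_by_embedding:
  fixes \<phi> :: "'a \<Rightarrow> 'r::ring_1" and R :: "('a, 'm) ring_scheme"
  assumes inj: "inj_on \<phi> (carrier R)"
    and cl: "\<And>x y. x \<in> carrier R ==> y \<in> carrier R ==> x \<otimes>\<^bsub>R\<^esub> y \<in> carrier R"
      "\<And>x y. x \<in> carrier R ==> y \<in> carrier R ==> x \<oplus>\<^bsub>R\<^esub> y \<in> carrier R"
      "\<one>\<^bsub>R\<^esub> \<in> carrier R" "\<zero>\<^bsub>R\<^esub> \<in> carrier R"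
    and hom: "\<And>x y. x \<in> carrier R ==> y \<in> carrier R ==> \<phi> (x \<otimes>\<^bsub>R\<^esub> y) = \<phi> x * \<phi> y"
      "\<And>x y. x \<in> carrier R ==> y \<in> carrier R ==> \<phi> (x \<oplus>\<^bsub>R\<^esub> y) = \<phi> x + \<phi> y"
      "\<phi> \<one>\<^bsub>R\<^esub> = 1" "\<phi> \<zero>\<^bsub>R\<^esub> = 0"
    and neg: "\<And>x. x \<in> carrier R ==> \<exists>y\<in>carrier R. \<phi> y = - \<phi> x"
  shows "ring R"
proof -
  note eqI = inj_onD[OF inj]
  show ?thesis
  proof (rule ringI)
    show "abelian_group R"
    proof (rule abelian_groupI)
      fix x assume x: "x \<in> carrier R"
      then obtain y where "y \<in> carrier R" "\<phi> y = - \<phi> x" using neg by blast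
      then show "\<exists>y\<in>carrier R. y \<oplus>\<^bsub>R\<^esub> x = \<zero>\<^bsub>R\<^esub>" using x by (intro bexI[of _ y] eqI) (auto simp: cl hom)
    qed (auto intro!: eqI simp: cl hom algebra_simps)
    show "Group.monoid R" by (rule monoidI) (auto intro!: eqI simp: cl hom algebra_simps)
  qed (auto intro!: eqI simp: cl hom algebra_simps)
qed

section \<open>The symbol map and the Poincare-Birkhoff-Witt theorem\<close>

lemma lact_UI:
  assumes "p \<in> UI L N"
  shows "lact N p = 0"
proof -
  let ?K = "{p \<in> FC L N. lact N p = 0}"
  interpret ring "FA L N" by (rule ring_free_algebra)
  have "ideal ?K (FA L N)"
  proof (rule idealI)
    show "ring (FA L N)" by (rule ring_free_algebra)
    show "subgroup ?K (add_monoid (FA L N))"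
    proof (rule subgroup.intro)
      show "inv\<^bsub>add_monoid (FA L N)\<^esub> x \<in> ?K" if "x \<in> ?K" for x
        using that a_inv_FA[of x L N] by (simp add: a_inv_def lact_uminus)
    qed (auto simp: lact_add)
  qed (auto simp: lact_mult)
  moreover have "uea_relators (gl_sum L N) \<subseteq> ?K"
  proof
    fix q assume q: "q \<in> uea_relators (gl_sum L N)"
    then consider x y where "q = letter (lie_add (gl_sum L N) x y) - letter x - letter y"
      | c x where "q = letter (lie_scale (gl_sum L N) c x) - Poly_Mapping.single [x] c"
      | x y where "q = letter x * letter y - letter y * letter x - letter (lie_bracket (gl_sum L N) x y)"
      unfolding uea_relators_def by blast
    then have "lact N q = 0"
      by cases (simp_all add: lact_diff lact_mult lact_single Lop_linear Lop_commutator[of N _ _ L, symmetric])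
    then show "q \<in> ?K" using q uea_relators_subset by blast
  qed
  ultimately show ?thesis
    using genideal_minimal[of ?K "uea_relators (gl_sum L N)"] assms unfolding uea_ideal_def by blast
qed

definition Ed :: "nat \<Rightarrow> nat \<Rightarrow> edge set" where "Ed L N = {1..L} \<times> {1..N} \<times> {1..N}"

definition Em :: "edge \<Rightarrow> gl_elem" where "Em e = (case e of (c, i, j) \<Rightarrow> mat_unit i j c)"

lemma finite_Ed [simp]: "finite (Ed L N)" by (simp add: Ed_def)

lemma Em_glc: "e \<in> Ed L N ==> Em e \<in> glc L N"
  by (auto simp: Ed_def Em_def mat_unit_def gl_sum_def split: prod.splits)

lemma xe_Em: "xe (Em e) e' = (if e' = e then 1 else 0)"
  by (auto simp: xe_def Em_def mat_unit_def split: prod.splits)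

lemma xe_nonzero: "x \<in> glc L N ==> xe x e ~= 0 ==> e \<in> Ed L N"
  by (auto simp: xe_def gl_sum_def Ed_def split: prod.splits)

definition cst :: "complex \<Rightarrow> (gl_elem list \<Rightarrow>\<^sub>0 complex)" where "cst c = Poly_Mapping.single [] c"

lemma cst_simps [simp]: "cst 0 = 0" "cst 1 = 1" "cst c \<in> FC L N" "cst (a + b) = cst a + cst b" "cst (a * b) = cst a * cst b"
  "lact N (cst c) = scal c"
  by (simp_all add: cst_def single_Nil_one single_add mult_single plus_list_def lact_const)

lemma cst_commute: "p * cst c = cst c * p"
proof -
  have "(\<Sum>w\<in>Poly_Mapping.keys p. Poly_Mapping.single w (Poly_Mapping.lookup p w)) * cst c
      = cst c * (\<Sum>w\<in>Poly_Mapping.keys p. Poly_Mapping.single w (Poly_Mapping.lookup p w))"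
    by (simp add: sum_distrib_left sum_distrib_right cst_def mult_single plus_list_def mult.commute)
  then show ?thesis by (simp only: poly_eq_sum_single[symmetric])
qed

lemma cst_left_commute: "p * (cst c * q) = cst c * (p * q)"
  by (simp add: mult.assoc[symmetric] cst_commute)

text \<open>Preimages of the filtration terms: classes of combinations of words shorter than \<open>n\<close>.\<close>

text \<open>The elements of filtration degree below \<open>n\<close>, as representatives in the free algebra.\<close>

definition Gf :: "nat \<Rightarrow> nat \<Rightarrow> nat \<Rightarrow> (gl_elem list \<Rightarrow>\<^sub>0 complex) set" where
  "Gf L N n = {p \<in> FC L N. \<exists>q\<in>FC L N. (\<forall>w\<in>Poly_Mapping.keys q. length w < n) \<and> p - q \<in> UI L N}"

lemma GfI: "p \<in> FC L N ==> q \<in> FC L N ==> (\<And>w. w \<in> Poly_Mapping.keys q ==> length w < n) ==> p - q \<in> UI L N ==> p \<in> Gf L N n"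
  unfolding Gf_def by blast

lemma GfE:
  assumes "p \<in> Gf L N n"
  obtains q where "p \<in> FC L N" "q \<in> FC L N" "\<forall>w\<in>Poly_Mapping.keys q. length w < n" "p - q \<in> UI L N"
  using assms unfolding Gf_def by blast

lemma Gf_FC: "p \<in> Gf L N n ==> p \<in> FC L N" unfolding Gf_def by blast

lemma Gf_UI: "p \<in> UI L N ==> p \<in> Gf L N n"
  by (rule GfI[of _ _ _ 0]) (auto simp: UI_subset)

lemma Gf_0: "p \<in> Gf L N 0 \<longleftrightarrow> p \<in> UI L N"
proof
  assume "p \<in> Gf L N 0"
  then obtain q where "\<forall>w\<in>Poly_Mapping.keys q. length w < 0" "p - q \<in> UI L N"
    by (rule GfE)
  then have "Poly_Mapping.keys q = {}" by blast
  then show "p \<in> UI L N" using \<open>p - q \<in> UI L N\<close> by simp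
qed (rule Gf_UI)

lemma Gf_mono: "p \<in> Gf L N m ==> m \<le> n ==> p \<in> Gf L N n"
  unfolding Gf_def by (blast intro: less_le_trans)

lemma Gf_add:
  assumes "p \<in> Gf L N n" "p' \<in> Gf L N n"
  shows "p + p' \<in> Gf L N n"
proof -
  obtain q where q: "p \<in> FC L N" "q \<in> FC L N" "\<forall>w\<in>Poly_Mapping.keys q. length w < n" "p - q \<in> UI L N"
    using assms(1) by (rule GfE)
  obtain q' where q': "p' \<in> FC L N" "q' \<in> FC L N" "\<forall>w\<in>Poly_Mapping.keys q'. length w < n" "p' - q' \<in> UI L N"
    using assms(2) by (rule GfE)
  show ?thesis
  proof (rule GfI[of _ _ _ "q + q'"])
    show "p + p' - (q + q') \<in> UI L N" using UI_add[OF q(4) q'(4)] by (simp add: algebra_simps)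
    show "length w < n" if "w \<in> Poly_Mapping.keys (q + q')" for w
      using subsetD[OF keys_add that] q(3) q'(3) by blast
  qed (use q q' in simp_all)
qed

lemma Gf_mult_left:
  assumes r: "r \<in> FC L N" "\<And>w. w \<in> Poly_Mapping.keys r ==> length w \<le> k" and p: "p \<in> Gf L N n"
  shows "r * p \<in> Gf L N (k + n)"
proof -
  obtain q where q: "p \<in> FC L N" "q \<in> FC L N" "\<forall>w\<in>Poly_Mapping.keys q. length w < n" "p - q \<in> UI L N"
    using p by (rule GfE)
  show ?thesis
  proof (rule GfI[of _ _ _ "r * q"])
    show "r * p - r * q \<in> UI L N" using UI_mult_left[OF r(1) q(4)] by (simp add: right_diff_distrib)
    show "length w < k + n" if w: "w \<in> Poly_Mapping.keys (r * q)" for w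
    proof -
      obtain u v where "w = u @ v" "u \<in> Poly_Mapping.keys r" "v \<in> Poly_Mapping.keys q"
        using subsetD[OF keys_mult w] by (auto simp: plus_list_def)
      then show ?thesis using r(2)[of u] q(3) by fastforce
    qed
  qed (use q r in simp_all)
qed

lemma Gf_mult_letter: "x \<in> glc L N ==> p \<in> Gf L N n ==> letter x * p \<in> Gf L N (Suc n)"
  using Gf_mult_left[of "letter x" L N 1 p n] by simp

lemma Gf_cst: "p \<in> Gf L N n ==> cst c * p \<in> Gf L N n"
  by (rule Gf_mult_left[of "cst c" L N 0 p n, simplified]) (auto simp: cst_def split: if_splits)

lemma Gf_uminus: "p \<in> Gf L N n ==> - p \<in> Gf L N n"
proof -
  have "cst (-1) = -1" by (simp add: cst_def single_uminus single_Nil_one)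
  then show "p \<in> Gf L N n ==> - p \<in> Gf L N n" using Gf_cst[of p L N n "-1"] by simp
qed

lemma Gf_diff: "p \<in> Gf L N n ==> q \<in> Gf L N n ==> p - q \<in> Gf L N n"
  using Gf_add[OF _ Gf_uminus] by fastforce

lemma Gf_zero [simp]: "0 \<in> Gf L N n" by (rule Gf_UI) simp

lemma Gf_sum: "(\<And>a. a \<in> A ==> p a \<in> Gf L N n) ==> (\<Sum>a\<in>A. p a) \<in> Gf L N n"
  by (induction A rule: infinite_finite_induct) (auto intro: Gf_add)

lemma Gf_word: "set w \<subseteq> glc L N ==> length w < n ==> Poly_Mapping.single w c \<in> Gf L N n"
  by (rule GfI[of _ _ _ "Poly_Mapping.single w c"]) (auto simp: FC_iff split: if_splits)

lemma UI_lie_add: "x \<in> glc L N ==> y \<in> glc L N ==> letter (lie_add (gl_sum L N) x y) - letter x - letter y \<in> UI L N"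
  by (rule UI_relator, unfold uea_relators_def) blast

lemma UI_lie_scale: "x \<in> glc L N ==> letter (lie_scale (gl_sum L N) c x) - Poly_Mapping.single [x] c \<in> UI L N"
  by (rule UI_relator, unfold uea_relators_def) blast

lemma UI_lie_bracket: "x \<in> glc L N ==> y \<in> glc L N ==>
    letter x * letter y - letter y * letter x - letter (lie_bracket (gl_sum L N) x y) \<in> UI L N"
  by (rule UI_relator, unfold uea_relators_def) blast

lemma Gf_swap:
  assumes "x \<in> glc L N" "y \<in> glc L N" "p \<in> Gf L N n"
  shows "letter x * (letter y * p) - letter y * (letter x * p) \<in> Gf L N (Suc n)"
proof -
  let ?b = "lie_bracket (gl_sum L N) x y"
  have "(letter x * letter y - letter y * letter x - letter ?b) * p \<in> UI L N"
    by (rule UI_mult_right[OF Gf_FC[OF assms(3)] UI_lie_bracket[OF assms(1,2)]])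
  then have "(letter x * letter y - letter y * letter x - letter ?b) * p + letter ?b * p \<in> Gf L N (Suc n)"
    by (intro Gf_add Gf_UI Gf_mult_letter assms(3) gl_sum_closed(3)[OF assms(1,2)])
  moreover have "(letter x * letter y - letter y * letter x - letter ?b) * p + letter ?b * p
      = letter x * (letter y * p) - letter y * (letter x * p)"
    by (simp only: left_diff_distrib mult.assoc diff_add_cancel)
  ultimately show ?thesis by (simp only:)
qed

subsection \<open>Symmetrised words\<close>

abbreviation EL :: "edge \<Rightarrow> (gl_elem list \<Rightarrow>\<^sub>0 complex)" where "EL e \<equiv> letter (Em e)"

text \<open>Symmetrisation up to a factor: a coefficient function of degree \<open>n\<close> is turned into the sum of the words with these coefficients. The
  top degree part of its coefficient function is \<open>n!\<close> times the given symmetric function.\<close>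

fun Sg :: "nat \<Rightarrow> nat \<Rightarrow> nat \<Rightarrow> coef \<Rightarrow> (gl_elem list \<Rightarrow>\<^sub>0 complex)" where
  "Sg L N 0 f = cst (f [])"
| "Sg L N (Suc n) f = (\<Sum>e\<in>Ed L N. EL e * Sg L N n (\<lambda>r. f (e # r)))"

lemma Sg_Gf: "Sg L N n f \<in> Gf L N (Suc n)"
proof (induction n arbitrary: f)
  case 0
  show ?case using Gf_word[of "[]" L N "Suc 0" "f []"] by (simp add: cst_def)
next
  case (Suc n)
  show ?case by (simp, intro Gf_sum Gf_mult_letter Em_glc Suc)
qed

lemma Sg_FC [simp]: "Sg L N n f \<in> FC L N"
  using Gf_FC[OF Sg_Gf] .

lemma Sg_keys: "w \<in> Poly_Mapping.keys (Sg L N n f) ==> length w = n"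
proof (induction n arbitrary: f w)
  case 0
  then show ?case by (simp add: cst_def split: if_splits)
next
  case (Suc n)
  have "Poly_Mapping.lookup (Sg L N (Suc n) f) w ~= 0" using Suc.prems by (simp add: in_keys_iff)
  then have "(\<Sum>e\<in>Ed L N. Poly_Mapping.lookup (EL e * Sg L N n (\<lambda>r. f (e # r))) w) ~= 0"
    by (simp add: lookup_sum)
  then obtain e where "Poly_Mapping.lookup (EL e * Sg L N n (\<lambda>r. f (e # r))) w ~= 0"
    by (meson sum.not_neutral_contains_not_neutral)
  then have "w \<in> Poly_Mapping.keys (EL e * Sg L N n (\<lambda>r. f (e # r)))" by (simp add: in_keys_iff)
  then obtain u v where "w = u @ v" "u \<in> Poly_Mapping.keys (EL e)" "v \<in> Poly_Mapping.keys (Sg L N n (\<lambda>r. f (e # r)))"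
    using keys_mult[of "EL e" "Sg L N n (\<lambda>r. f (e # r))"] by (auto simp: plus_list_def)
  then show ?case using Suc.IH[of v "\<lambda>r. f (e # r)"] by simp
qed

lemma Sg_cong: "(\<And>es. length es = n ==> f es = g es) ==> Sg L N n f = Sg L N n g"
proof (induction n arbitrary: f g)
  case (Suc n)
  have "Sg L N n (\<lambda>r. f (e # r)) = Sg L N n (\<lambda>r. g (e # r))" for e
    by (rule Suc.IH) (rule Suc.prems, simp)
  then show ?case by simp
qed simp

lemma Sg_add: "Sg L N n (\<lambda>r. f r + g r) = Sg L N n f + Sg L N n g"
  by (induction n arbitrary: f g) (simp_all add: distrib_left sum.distrib)

lemma Sg_scale: "Sg L N n (\<lambda>r. c * f r) = cst c * Sg L N n f"
  by (induction n arbitrary: f) (simp_all add: sum_distrib_left cst_left_commute)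

lemma Sg_zero: "Sg L N n (\<lambda>r. 0) = 0"
  using Sg_scale[of L N n 0 "\<lambda>_. 0"] by simp

lemma Sg_sum: "Sg L N n (\<lambda>r. \<Sum>a\<in>A. f a r) = (\<Sum>a\<in>A. Sg L N n (f a))"
  by (induction A rule: infinite_finite_induct) (simp_all add: Sg_zero Sg_add)

definition Xs :: "nat \<Rightarrow> nat \<Rightarrow> (edge \<Rightarrow> complex) \<Rightarrow> (gl_elem list \<Rightarrow>\<^sub>0 complex)" where
  "Xs L N s = (\<Sum>e\<in>Ed L N. cst (s e) * EL e)"

lemma Xs_FC [simp]: "Xs L N s \<in> FC L N"
  unfolding Xs_def by (intro FC_sum FC_closed Em_glc cst_simps)

lemma Xs_swap:
  assumes "e \<in> Ed L N" "p \<in> Gf L N n"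
  shows "EL e * (Xs L N s * p) - Xs L N s * (EL e * p) \<in> Gf L N (Suc n)"
proof -
  have "EL e * (Xs L N s * p) - Xs L N s * (EL e * p)
      = (\<Sum>e'\<in>Ed L N. cst (s e') * (EL e * (EL e' * p) - EL e' * (EL e * p)))"
    by (simp add: Xs_def sum_distrib_left sum_distrib_right sum_subtractf right_diff_distrib mult.assoc cst_left_commute)
  also have "\<dots> \<in> Gf L N (Suc n)" by (intro Gf_sum Gf_cst Gf_swap Em_glc assms)
  finally show ?thesis .
qed

lemma letter_Xs:
  assumes x: "x \<in> glc L N"
  shows "letter x - Xs L N (xe x) \<in> UI L N"
proof -
  have gen: "letter (\<lambda>\<alpha> i j. if (\<alpha>, i, j) \<in> A then x \<alpha> i j else 0) - (\<Sum>e\<in>A. cst (xe x e) * EL e) \<in> UI L N \<and>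
      (\<lambda>\<alpha> i j. if (\<alpha>, i, j) \<in> A then x \<alpha> i j else 0) \<in> glc L N"
    if "finite A" "A \<subseteq> Ed L N" for A
    using that
  proof (induction A rule: finite_induct)
    case empty
    have z: "(\<lambda>\<alpha> i j. 0) = lie_scale (gl_sum L N) 0 x" by (simp add: gl_sum_def)
    have "letter (lie_scale (gl_sum L N) 0 x) - Poly_Mapping.single [x] 0 \<in> UI L N"
      by (rule UI_lie_scale[OF x])
    then show ?case using z gl_sum_closed(2)[OF x x, of 0] by simp
  next
    case (insert e A)
    let ?xA = "\<lambda>\<alpha> i j. if (\<alpha>, i, j) \<in> A then x \<alpha> i j else 0"
    let ?xe = "\<lambda>\<alpha> i j. if (\<alpha>, i, j) \<in> insert e A then x \<alpha> i j else 0"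
    have IH: "letter ?xA - (\<Sum>e\<in>A. cst (xe x e) * EL e) \<in> UI L N" "?xA \<in> glc L N"
      using insert by auto
    have e: "Em e \<in> glc L N" using insert.prems by (intro Em_glc) simp
    let ?y = "lie_scale (gl_sum L N) (xe x e) (Em e)"
    have y: "?y \<in> glc L N" by (rule gl_sum_closed(2)[OF e e])
    have eq: "?xe = lie_add (gl_sum L N) ?xA ?y"
      using insert.hyps(2) by (auto simp: gl_sum_def fun_eq_iff Em_def mat_unit_def xe_def split: prod.splits)
    have 1: "letter ?xe - letter ?xA - letter ?y \<in> UI L N"
      unfolding eq by (rule UI_lie_add[OF IH(2) y])
    have "letter ?y - Poly_Mapping.single [Em e] (xe x e) \<in> UI L N"
      by (rule UI_lie_scale[OF e])
    then have 2: "letter ?y - cst (xe x e) * EL e \<in> UI L N"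
      by (simp add: cst_def mult_single plus_list_def)
    have "(letter ?xe - letter ?xA - letter ?y) + (letter ?y - cst (xe x e) * EL e)
        + (letter ?xA - (\<Sum>e\<in>A. cst (xe x e) * EL e)) \<in> UI L N"
      by (intro UI_add 1 2 IH)
    moreover have "(\<Sum>e\<in>insert e A. cst (xe x e) * EL e) = cst (xe x e) * EL e + (\<Sum>e\<in>A. cst (xe x e) * EL e)"
      using insert.hyps by simp
    ultimately have "letter ?xe - (\<Sum>e\<in>insert e A. cst (xe x e) * EL e) \<in> UI L N"
      by (simp add: algebra_simps)
    moreover have "?xe \<in> glc L N" unfolding eq by (rule gl_sum_closed(1)[OF IH(2) y])
    ultimately show ?case by blast
  qed
  have "(\<lambda>\<alpha> i j. if (\<alpha>, i, j) \<in> Ed L N then x \<alpha> i j else 0) = x"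
    using x by (auto simp: fun_eq_iff gl_sum_def Ed_def)
  then show ?thesis using gen[of "Ed L N"] by (simp add: Xs_def)
qed

text \<open>The coefficient function of an element: its action on \<open>vac\<close>.\<close>

definition phi :: "nat \<Rightarrow> (gl_elem list \<Rightarrow>\<^sub>0 complex) \<Rightarrow> coef" where
  "phi N p = ap (lact N p) vac"

definition supp_in :: "edge set \<Rightarrow> coef \<Rightarrow> bool" where
  "supp_in A f \<longleftrightarrow> (\<forall>es. f es ~= 0 --> set es \<subseteq> A)"

lemma supp_inD: "supp_in A f ==> \<not> set es \<subseteq> A ==> f es = 0"
  unfolding supp_in_def by blast

lemma symf_lop: "symf f ==> symf (lop N x f)" unfolding lop_def by (rule symf_gop[OF functional_lker])
lemma symf_rop: "symf f ==> symf (rop N x f)" unfolding rop_def by (rule symf_gop[OF functional_rker])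
lemma deg_lop: "deg_le n f ==> deg_le (Suc n) (lop N x f)" unfolding lop_def by (rule deg_le_gop[OF functional_lker])

lemma set_mset_split: "mset es = add_mset e (mset r) ==> set es = insert e (set r)"
  by (metis set_mset_add_mset_insert set_mset_mset)

lemma supp_in_gop:
  assumes m: "functional m" and f: "symf f" "supp_in A f"
    and s: "\<And>e. s e ~= 0 ==> e \<in> A"
    and mA: "\<And>e h. e \<notin> A ==> (\<And>e'. e' \<notin> A ==> h e' = 0) ==> m e h = 0"
  shows "supp_in A (gop s m f)"
  unfolding supp_in_def
proof (intro allI impI, rule ccontr)
  fix es assume nz: "gop s m f es ~= 0" and es: "\<not> set es \<subseteq> A"
  have "psum (\<lambda>e r. s e * f r + m e (\<lambda>e'. f (e' # r))) es = 0"
  proof (rule psum_eq_0)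
    fix e r assume "mset es = add_mset e (mset r)"
    then have se: "set es = insert e (set r)" by (rule set_mset_split)
    show "s e * f r + m e (\<lambda>e'. f (e' # r)) = 0"
    proof (cases "set r \<subseteq> A")
      case True
      then have "e \<notin> A" using es se by simp
      then have "s e = 0" using s by blast
      moreover have "m e (\<lambda>e'. f (e' # r)) = 0"
        by (rule mA[OF \<open>e \<notin> A\<close>]) (rule supp_inD[OF f(2)], simp)
      ultimately show ?thesis by simp
    next
      case False
      then have "f r = 0" "(\<lambda>e'. f (e' # r)) = (\<lambda>_. 0)" using supp_inD[OF f(2)] by (auto simp: fun_eq_iff)
      then show ?thesis by (simp add: functionalD(4)[OF m])
    qed
  qed
  then show False using nz gop_eq_psum[OF m f(1)] by simp
qed

lemma supp_in_lop:
  assumes "x \<in> glc L N" "symf f" "supp_in (Ed L N) f"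
  shows "supp_in (Ed L N) (lop N x f)"
  unfolding lop_def
proof (rule supp_in_gop[OF functional_lker assms(2,3)])
  fix e and h :: "edge \<Rightarrow> complex" assume e: "e \<notin> Ed L N" and h: "\<And>e'. e' \<notin> Ed L N ==> h e' = 0"
  obtain c i j where eq: "e = (c, i, j)" by (cases e) auto
  have "x c i b * h (c, b, j) = 0" for b
  proof (cases "x c i b = 0")
    case False
    then have "c \<in> {1..L}" "i \<in> {1..N}" using assms(1) by (auto simp: gl_sum_def)
    then have "(c, b, j) \<notin> Ed L N" using e eq by (auto simp: Ed_def)
    then show ?thesis using h by simp
  qed simp
  then show "lker N x e h = 0" unfolding lker_def eq prod.case by (intro sum.neutral ballI)
qed (rule xe_nonzero[OF assms(1)])

lemma phi_add: "phi N (p + q) = (\<lambda>r. phi N p r + phi N q r)"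
  and phi_diff: "phi N (p - q) = (\<lambda>r. phi N p r - phi N q r)"
  and phi_cst: "phi N (cst c * p) = (\<lambda>r. c * phi N p r)"
  and phi_zero: "phi N 0 = (\<lambda>r. 0)" and phi_one: "phi N 1 = vac"
  and phi_letter_mult: "phi N (letter x * p) = lop N x (phi N p)"
  and phi_mult: "phi N (p * q) = ap (lact N p) (phi N q)"
  by (simp_all add: phi_def lact_add lact_diff lact_mult lact_single)

lemma phi_UI: "p \<in> UI L N ==> phi N p = (\<lambda>r. 0)"
  by (simp add: phi_def lact_UI)

lemma phi_Cons: "phi N (Poly_Mapping.single (x # w) 1) = lop N x (phi N (Poly_Mapping.single w 1))"
  by (simp add: phi_def lact_single)

lemma phi_Nil: "phi N (Poly_Mapping.single [] 1) = vac"
  by (simp add: phi_def lact_single)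

lemma phi_sum_words:
  "phi N p es = (\<Sum>w\<in>Poly_Mapping.keys p. Poly_Mapping.lookup p w * phi N (Poly_Mapping.single w 1) es)"
  unfolding phi_def lact_def by (simp add: ap_sum lact_single[unfolded lact_def])

lemma symf_phi_word: "symf (phi N (Poly_Mapping.single w 1))"
  by (induction w) (simp_all only: phi_Nil phi_Cons symf_vac symf_lop)

lemma deg_phi_word: "deg_le (length w) (phi N (Poly_Mapping.single w 1))"
proof (induction w)
  case Nil
  show ?case unfolding phi_Nil by (simp add: deg_le_vac)
next
  case (Cons x w)
  show ?case unfolding phi_Cons using deg_lop[OF Cons] by simp
qed

lemma supp_phi_word: "set w \<subseteq> glc L N ==> supp_in (Ed L N) (phi N (Poly_Mapping.single w 1))"
proof (induction w)
  case Nil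
  show ?case unfolding phi_Nil by (auto simp: supp_in_def vac_def)
next
  case (Cons x w)
  show ?case unfolding phi_Cons using Cons by (intro supp_in_lop symf_phi_word) auto
qed

lemma symf_phi: "symf (phi N p)"
  unfolding symf_def
proof (intro allI impI)
  fix es es' :: "edge list" assume "mset es = mset es'"
  then show "phi N p es = phi N p es'"
    unfolding phi_sum_words[of N p] using symfD[OF symf_phi_word] by (metis (no_types, lifting) sum.cong)
qed

lemma deg_phi:
  assumes "\<And>w. w \<in> Poly_Mapping.keys p ==> length w \<le> n"
  shows "deg_le n (phi N p)"
  unfolding deg_le_def
proof (intro allI impI)
  fix es :: "edge list" assume len: "n < length es"
  show "phi N p es = 0"
    unfolding phi_sum_words[of N p]
  proof (rule sum.neutral, rule ballI)
    fix w assume "w \<in> Poly_Mapping.keys p"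
    then have "phi N (Poly_Mapping.single w 1) es = 0"
      using deg_leD[OF deg_phi_word] assms[of w] len by (meson le_less_trans)
    then show "Poly_Mapping.lookup p w * phi N (Poly_Mapping.single w 1) es = 0" by simp
  qed
qed

lemma supp_phi:
  assumes "p \<in> FC L N"
  shows "supp_in (Ed L N) (phi N p)"
  unfolding supp_in_def
proof (intro allI impI, rule ccontr)
  fix es assume nz: "phi N p es ~= 0" and es: "\<not> set es \<subseteq> Ed L N"
  have "phi N (Poly_Mapping.single w 1) es = 0" if "w \<in> Poly_Mapping.keys p" for w
    using that assms supp_inD[OF supp_phi_word es] unfolding FC_iff by blast
  then show False using nz unfolding phi_sum_words[of N p] by simp
qed

lemma FC_Gf: "p \<in> FC L N ==> \<exists>n. p \<in> Gf L N n"
proof -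
  assume p: "p \<in> FC L N"
  have "p \<in> Gf L N (Suc (Max (length ` Poly_Mapping.keys p)))"
    by (rule GfI[OF p p]) (auto simp: less_Suc_eq_le)
  then show ?thesis by blast
qed

lemma cst_out: "letter x * (cst c * q) = cst c * (letter x * q)" "Xs L N s * (cst c * q) = cst c * (Xs L N s * q)"
  by (rule cst_left_commute)+

lemma Sg_psum:
  "Sg L N (Suc n) (\<lambda>es. psum (\<lambda>e r. s e * g r) es) - cst (of_nat (Suc n)) * (Xs L N s * Sg L N n g) \<in> Gf L N (Suc n)"
proof (induction n arbitrary: g)
  case 0
  have "Sg L N (Suc 0) (\<lambda>es. psum (\<lambda>e r. s e * g r) es) = Xs L N s * Sg L N 0 g"
    by (simp add: Xs_def sum_distrib_right mult.assoc cst_out(1))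
  then show ?case by simp
next
  case (Suc n)
  define q where "q e = Sg L N n (\<lambda>r. g (e # r))" for e
  define B where "B = (\<Sum>e\<in>Ed L N. EL e * Sg L N (Suc n) (\<lambda>r. psum (\<lambda>e' r'. s e' * g (e # r')) r))"
  define B' where "B' = (\<Sum>e\<in>Ed L N. EL e * (cst (of_nat (Suc n)) * (Xs L N s * q e)))"
  have 1: "Sg L N (Suc (Suc n)) (\<lambda>es. psum (\<lambda>e r. s e * g r) es) = Xs L N s * Sg L N (Suc n) g + B"
  proof -
    have "Sg L N (Suc (Suc n)) (\<lambda>es. psum (\<lambda>e r. s e * g r) es)
        = (\<Sum>e\<in>Ed L N. EL e * Sg L N (Suc n) (\<lambda>r. s e * g r + psum (\<lambda>e' r'. s e' * g (e # r')) r))"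
      by (subst Sg.simps(2)) simp
    also have "\<dots> = (\<Sum>e\<in>Ed L N. EL e * (cst (s e) * Sg L N (Suc n) g)) + B"
      unfolding Sg_add Sg_scale B_def by (simp only: distrib_left sum.distrib)
    also have "(\<Sum>e\<in>Ed L N. EL e * (cst (s e) * Sg L N (Suc n) g)) = Xs L N s * Sg L N (Suc n) g"
      unfolding Xs_def sum_distrib_right by (simp only: mult.assoc cst_out)
    finally show ?thesis .
  qed
  have 2: "B - B' \<in> Gf L N (Suc (Suc n))"
    unfolding B_def B'_def sum_subtractf[symmetric] right_diff_distrib[symmetric] q_def
    by (intro Gf_sum Gf_mult_letter Em_glc Suc)
  have 3: "B' - cst (of_nat (Suc n)) * (Xs L N s * Sg L N (Suc n) g) \<in> Gf L N (Suc (Suc n))"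
  proof -
    have "B' - cst (of_nat (Suc n)) * (Xs L N s * Sg L N (Suc n) g)
        = (\<Sum>e\<in>Ed L N. cst (of_nat (Suc n)) * (EL e * (Xs L N s * q e) - Xs L N s * (EL e * q e)))"
      unfolding B'_def q_def
      by (simp only: Sg.simps(2) sum_distrib_left sum_subtractf right_diff_distrib cst_out)
    also have "\<dots> \<in> Gf L N (Suc (Suc n))"
      by (intro Gf_sum Gf_cst Xs_swap) (simp_all only: q_def Sg_Gf)
    finally show ?thesis .
  qed
  have "cst (of_nat (Suc (Suc n))) = cst (of_nat (Suc n)) + 1"
    by (simp only: of_nat_Suc[of "Suc n"] cst_simps add.commute)
  then have "Sg L N (Suc (Suc n)) (\<lambda>es. psum (\<lambda>e r. s e * g r) es) - cst (of_nat (Suc (Suc n))) * (Xs L N s * Sg L N (Suc n) g)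
      = (B - B') + (B' - cst (of_nat (Suc n)) * (Xs L N s * Sg L N (Suc n) g))"
    unfolding 1 by (simp only: distrib_right mult_1_left) simp
  then show ?case using Gf_add[OF 2 3] by (simp only:)
qed

lemma lop_top: "deg_le n f ==> n < length es ==> lop N x f es = psum (\<lambda>e r. xe x e * f r) es"
  unfolding lop_def by (rule gop_top[OF functional_lker]) (auto intro: deg_leD)

lemma word_Sg:
  assumes "set w \<subseteq> glc L N"
  shows "cst (fact (length w)) * Poly_Mapping.single w 1 - Sg L N (length w) (phi N (Poly_Mapping.single w 1)) \<in> Gf L N (length w)"
  using assms
proof (induction w)
  case Nil
  show ?case by (simp add: phi_one single_Nil_one)
next
  case (Cons x w)
  let ?n = "length w" and ?s = "Poly_Mapping.single w 1 :: gl_elem list \<Rightarrow>\<^sub>0 complex"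
  let ?c = "cst (of_nat (Suc ?n))"
  have x: "x \<in> glc L N" using Cons by simp
  have IH: "cst (fact ?n) * ?s - Sg L N ?n (phi N ?s) \<in> Gf L N ?n" using Cons by simp
  have xs: "Poly_Mapping.single (x # w) 1 = letter x * ?s" by (simp add: mult_single plus_list_def)
  have 1: "?c * (letter x * (cst (fact ?n) * ?s - Sg L N ?n (phi N ?s))) \<in> Gf L N (Suc ?n)"
    by (intro Gf_cst Gf_mult_letter x IH)
  have 2: "?c * ((letter x - Xs L N (xe x)) * Sg L N ?n (phi N ?s)) \<in> Gf L N (Suc ?n)"
    by (intro Gf_cst Gf_UI UI_mult_right letter_Xs x Sg_FC)
  have "Sg L N (Suc ?n) (lop N x (phi N ?s)) = Sg L N (Suc ?n) (\<lambda>es. psum (\<lambda>e r. xe x e * phi N ?s r) es)"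
    by (rule Sg_cong, rule lop_top[OF deg_phi_word]) simp
  then have 3: "Sg L N (Suc ?n) (lop N x (phi N ?s)) - ?c * (Xs L N (xe x) * Sg L N ?n (phi N ?s)) \<in> Gf L N (Suc ?n)"
    using Sg_psum[of L N ?n "xe x" "phi N ?s"] by (simp only:)
  have "cst (fact (Suc ?n)) = ?c * cst (fact ?n)" by (simp only: fact_Suc cst_simps of_nat_mult of_nat_fact)
  then have "cst (fact (length (x # w))) * Poly_Mapping.single (x # w) 1 - Sg L N (length (x # w)) (phi N (Poly_Mapping.single (x # w) 1))
      = ?c * (letter x * (cst (fact ?n) * ?s - Sg L N ?n (phi N ?s))) + ?c * ((letter x - Xs L N (xe x)) * Sg L N ?n (phi N ?s))
        - (Sg L N (Suc ?n) (lop N x (phi N ?s)) - ?c * (Xs L N (xe x) * Sg L N ?n (phi N ?s)))"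
    unfolding xs phi_letter_mult list.size add_0_right add_Suc_right
    by (simp only: right_diff_distrib left_diff_distrib mult.assoc cst_out) simp
  then show ?case using Gf_diff[OF Gf_add[OF 1 2] 3] by (simp only: list.size add_0_right add_Suc_right)
qed

lemma Gf_Sg:
  assumes "p \<in> Gf L N (Suc n)"
  shows "cst (fact n) * p - Sg L N n (phi N p) \<in> Gf L N n"
proof -
  obtain q where q: "p \<in> FC L N" "q \<in> FC L N" "\<forall>w\<in>Poly_Mapping.keys q. length w < Suc n" "p - q \<in> UI L N"
    using assms by (rule GfE)
  have pq: "phi N p = phi N q" using phi_UI[OF q(4)] by (simp add: phi_diff fun_eq_iff)
  let ?t = "\<lambda>w. cst (fact n) * Poly_Mapping.single w 1 - Sg L N n (phi N (Poly_Mapping.single w 1))"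
  have w: "?t w \<in> Gf L N n" if "w \<in> Poly_Mapping.keys q" for w
  proof -
    have ws: "set w \<subseteq> glc L N" "length w \<le> n" using that q(2,3) unfolding FC_iff by (auto simp: less_Suc_eq_le)
    show ?thesis
    proof (cases "length w = n")
      case True
      then show ?thesis using word_Sg[OF ws(1)] by simp
    next
      case False
      have "Sg L N n (phi N (Poly_Mapping.single w 1)) = Sg L N n (\<lambda>_. 0)"
        by (rule Sg_cong, rule deg_leD[OF deg_phi_word]) (use False ws in simp)
      then show ?thesis using Gf_cst[OF Gf_word[OF ws(1)], of n "fact n" 1] False ws by (simp add: Sg_zero)
    qed
  qed
  have 1: "q = (\<Sum>w\<in>Poly_Mapping.keys q. cst (Poly_Mapping.lookup q w) * Poly_Mapping.single w 1)"
    by (subst poly_eq_sum_single) (simp add: cst_def mult_single plus_list_def)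
  have "phi N q = (\<lambda>es. \<Sum>w\<in>Poly_Mapping.keys q. Poly_Mapping.lookup q w * phi N (Poly_Mapping.single w 1) es)"
    by (rule ext) (rule phi_sum_words)
  then have 2: "Sg L N n (phi N q) = (\<Sum>w\<in>Poly_Mapping.keys q. cst (Poly_Mapping.lookup q w) * Sg L N n (phi N (Poly_Mapping.single w 1)))"
    by (simp only: Sg_sum Sg_scale)
  have "cst (fact n) * q - Sg L N n (phi N q) = (\<Sum>w\<in>Poly_Mapping.keys q. cst (Poly_Mapping.lookup q w) * ?t w)"
    unfolding 2 by (subst 1) (simp only: sum_distrib_left sum_subtractf right_diff_distrib cst_left_commute[of "cst (fact n)"])
  also have "\<dots> \<in> Gf L N n" by (intro Gf_sum Gf_cst w)
  finally have "cst (fact n) * q - Sg L N n (phi N q) \<in> Gf L N n" .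
  moreover have "cst (fact n) * (p - q) \<in> Gf L N n" by (intro Gf_cst Gf_UI q)
  ultimately show ?thesis using Gf_add by (fastforce simp: pq right_diff_distrib)
qed

lemma Gf_descend:
  assumes "p \<in> Gf L N (Suc n)" "Sg L N n (phi N p) - v \<in> Gf L N n"
  shows "p - cst (1 / fact n) * v \<in> Gf L N n"
proof -
  have "(cst (fact n) * p - Sg L N n (phi N p)) + (Sg L N n (phi N p) - v) \<in> Gf L N n"
    by (intro Gf_add Gf_Sg assms)
  then have "cst (1 / fact n) * (cst (fact n) * p - v) \<in> Gf L N n" by (intro Gf_cst) simp
  moreover have "cst (1 / fact n) * cst (fact n) = 1" unfolding cst_simps(5)[symmetric] by simp
  ultimately show ?thesis by (simp add: right_diff_distrib mult.assoc[symmetric])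
qed

lemma deg_Gf:
  assumes "p \<in> FC L N" "deg_le n (phi N p)"
  shows "p \<in> Gf L N (Suc n)"
proof -
  obtain k where k: "p \<in> Gf L N k" using FC_Gf[OF assms(1)] by blast
  have "p \<in> Gf L N (Suc n)" if "p \<in> Gf L N m" for m
    using that
  proof (induction m)
    case 0
    then show ?case by (rule Gf_mono) simp
  next
    case (Suc m)
    show ?case
    proof (cases "m \<le> n")
      case True
      then show ?thesis using Suc.prems by (auto intro: Gf_mono)
    next
      case False
      have "Sg L N m (phi N p) = Sg L N m (\<lambda>_. 0)"
        by (rule Sg_cong, rule deg_leD[OF assms(2)]) (use False in simp)
      then have "p \<in> Gf L N m" using Gf_descend[OF Suc.prems, of 0] by (simp add: Sg_zero)
      then show ?thesis by (rule Suc.IH)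
    qed
  qed
  then show ?thesis using k .
qed

text \<open>The injectivity half of the Poincare-Birkhoff-Witt theorem. The relators act as zero, which gives one direction. Conversely the
  symmetrised words recover an element, modulo lower terms, from the top degree part of its coefficient function, so an element with zero
  coefficient function has arbitrarily small degree.\<close>

theorem phi_eq_zero_iff:
  assumes "p \<in> FC L N"
  shows "phi N p = (\<lambda>_. 0) \<longleftrightarrow> p \<in> UI L N"
proof
  assume z: "phi N p = (\<lambda>_. 0)"
  have "p \<in> Gf L N (Suc 0)" by (rule deg_Gf[OF assms]) (simp add: z deg_le_def)
  then have "p \<in> Gf L N 0" using Gf_descend[of p L N 0 0] by (simp add: z)
  then show "p \<in> UI L N" by (simp add: Gf_0)
qed (rule phi_UI)

lemma psum_const: "psum (\<lambda>e r. c) es = of_nat (length es) * (c :: complex)"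
  by (induction es) (simp_all add: algebra_simps)

lemma phi_sum: "phi N (\<Sum>a\<in>A. p a) es = (\<Sum>a\<in>A. phi N (p a) es)"
  by (simp add: phi_def lact_sum ap_sum)

lemma phi_Sg_top:
  assumes "symf f" "supp_in (Ed L N) f" "length es = n"
  shows "phi N (Sg L N n f) es = fact n * f es"
  using assms
proof (induction n arbitrary: f es)
  case 0
  then show ?case by (simp add: phi_def)
next
  case (Suc n)
  have supp: "supp_in (Ed L N) (\<lambda>r. f (e # r))" for e
    using Suc.prems(2) unfolding supp_in_def by (metis insert_subset list.simps(15))
  have "phi N (Sg L N (Suc n) f) es = (\<Sum>e\<in>Ed L N. lop N (Em e) (phi N (Sg L N n (\<lambda>r. f (e # r)))) es)"
    by (simp add: phi_sum phi_letter_mult)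
  also have "\<dots> = (\<Sum>e\<in>Ed L N. psum (\<lambda>e' r. xe (Em e) e' * phi N (Sg L N n (\<lambda>r. f (e # r))) r) es)"
  proof (rule sum.cong[OF refl])
    fix e
    have "deg_le n (phi N (Sg L N n (\<lambda>r. f (e # r))))" by (rule deg_phi) (simp add: Sg_keys)
    then show "lop N (Em e) (phi N (Sg L N n (\<lambda>r. f (e # r)))) es
        = psum (\<lambda>e' r. xe (Em e) e' * phi N (Sg L N n (\<lambda>r. f (e # r))) r) es"
      by (rule lop_top) (use Suc.prems in simp)
  qed
  also have "\<dots> = psum (\<lambda>e' r. \<Sum>e\<in>Ed L N. xe (Em e) e' * phi N (Sg L N n (\<lambda>r. f (e # r))) r) es"
    by (rule psum_sum[symmetric]) simp
  also have "\<dots> = psum (\<lambda>e' r. fact n * f es) es"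
  proof (rule psum_cong)
    fix e' r assume eq: "mset es = add_mset e' (mset r)"
    have len: "length r = n" using arg_cong[OF eq, of size] Suc.prems(3) by simp
    have fe: "f (e' # r) = f es" by (rule symfD[OF Suc.prems(1)]) (simp add: eq)
    have "(\<Sum>e\<in>Ed L N. xe (Em e) e' * phi N (Sg L N n (\<lambda>r. f (e # r))) r)
        = (\<Sum>e\<in>Ed L N. if e = e' then fact n * f (e # r) else 0)"
    proof (rule sum.cong[OF refl])
      fix e
      show "xe (Em e) e' * phi N (Sg L N n (\<lambda>r. f (e # r))) r = (if e = e' then fact n * f (e # r) else 0)"
        using Suc.IH[OF symf_Cons[OF Suc.prems(1)] supp len] by (simp add: xe_Em)
    qed
    also have "\<dots> = (if e' \<in> Ed L N then fact n * f (e' # r) else 0)" by (simp add: sum.delta')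
    also have "\<dots> = fact n * f (e' # r)" using supp_inD[OF Suc.prems(2), of "e' # r"] by auto
    finally show "(\<Sum>e\<in>Ed L N. xe (Em e) e' * phi N (Sg L N n (\<lambda>r. f (e # r))) r) = fact n * f es"
      by (simp add: fe)
  qed
  also have "\<dots> = fact (Suc n) * f es" using Suc.prems by (simp add: psum_const)
  finally show ?case .
qed

text \<open>The surjectivity half: subtract the symmetrised word of the top degree part and induct on the degree.\<close>

theorem phi_surj:
  assumes "symf f" "supp_in (Ed L N) f" "deg_le n f"
  shows "\<exists>p\<in>FC L N. (\<forall>w\<in>Poly_Mapping.keys p. length w \<le> n) \<and> phi N p = f"
proof -
  have gen: "\<exists>p\<in>FC L N. (\<forall>w\<in>Poly_Mapping.keys p. length w < m) \<and> phi N p = g"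
    if "symf g" "supp_in (Ed L N) g" "\<And>es. length es \<ge> m ==> g es = 0" for m g
    using that
  proof (induction m arbitrary: g)
    case 0
    then show ?case by (intro bexI[of _ 0]) (auto simp: phi_zero)
  next
    case (Suc m)
    define u where "u = cst (1 / fact m) * Sg L N m g"
    have u: "u \<in> FC L N" by (simp add: u_def)
    have uk: "length w = m" if w: "w \<in> Poly_Mapping.keys u" for w
    proof -
      obtain a b where "w = a @ b" "a \<in> Poly_Mapping.keys (cst (1 / fact m))" "b \<in> Poly_Mapping.keys (Sg L N m g)"
        using subsetD[OF keys_mult w[unfolded u_def]] by (auto simp: plus_list_def)
      then show ?thesis using Sg_keys[of b L N m g] by (auto simp: cst_def split: if_splits)
    qed
    let ?g = "\<lambda>r. g r - phi N u r"
    have "\<exists>p\<in>FC L N. (\<forall>w\<in>Poly_Mapping.keys p. length w < m) \<and> phi N p = ?g"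
    proof (rule Suc.IH)
      show "symf ?g" using Suc.prems(1) symf_phi[of N u] unfolding symf_def by metis
      show "supp_in (Ed L N) ?g"
        using Suc.prems(2) supp_phi[OF u] unfolding supp_in_def by (metis diff_zero)
      show "?g es = 0" if "m \<le> length es" for es
      proof (cases "length es = m")
        case True
        then show ?thesis using phi_Sg_top[OF Suc.prems(1,2) True] by (simp add: u_def phi_cst)
      next
        case False
        have "deg_le m (phi N u)" by (rule deg_phi) (simp add: uk)
        then show ?thesis using False that Suc.prems(3)[of es] deg_leD[of m "phi N u" es] by simp
      qed
    qed
    then obtain p where p: "p \<in> FC L N" "\<forall>w\<in>Poly_Mapping.keys p. length w < m" "phi N p = ?g" by blast
    show ?case
    proof (intro bexI[of _ "p + u"] conjI ballI)
      show "length w < Suc m" if "w \<in> Poly_Mapping.keys (p + u)" for w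
        using subsetD[OF keys_add that] p(2) uk by auto
      show "phi N (p + u) = g" unfolding phi_add p(3) by simp
      show "p + u \<in> FC L N" using p u by simp
    qed
  qed
  show ?thesis using gen[of f "Suc n"] assms deg_leD[OF assms(3)] by (auto simp: less_Suc_eq_le Suc_le_eq)
qed

section \<open>The left ideal generated by the last column\<close>

lemma rop_add: "rop N x (\<lambda>r. f r + g r) = (\<lambda>r. rop N x f r + rop N x g r)"
  and rop_scale: "rop N x (\<lambda>r. c * f r) = (\<lambda>r. c * rop N x f r)"
  and rop_zero: "rop N x (\<lambda>r. 0) = (\<lambda>r. 0)"
  by (simp_all add: fun_eq_iff rop_def gop_add gop_scale gop_zero functional_rker)

lemma lact_rop_commute: "ap (lact N p) (rop N x f) = rop N x (ap (lact N p) f)"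
proof -
  have word: "ap (prod_list (map (Lop N) w)) (rop N x f) = rop N x (ap (prod_list (map (Lop N) w)) f)" for w
    by (induction w) (simp_all add: lop_rop_commute)
  have "ap (\<Sum>w\<in>A. scal (c w) * prod_list (map (Lop N) w)) (rop N x f)
      = rop N x (ap (\<Sum>w\<in>A. scal (c w) * prod_list (map (Lop N) w)) f)" for A :: "gl_elem list set" and c
    by (induction A rule: infinite_finite_induct) (simp_all add: word rop_zero rop_add rop_scale)
  then show ?thesis unfolding lact_def .
qed

lemma phi_mult_letter: "phi N (p * letter x) = rop N x (phi N p)"
  by (simp add: phi_mult) (simp add: phi_def lact_single lop_vac_eq_rop_vac lact_rop_commute)

lemma Gf_commute_word:
  assumes "x \<in> glc L N" "set w \<subseteq> glc L N" "length w < n"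
  shows "letter x * Poly_Mapping.single w 1 - Poly_Mapping.single w 1 * letter x \<in> Gf L N n"
  using assms(2,3)
proof (induction w arbitrary: n)
  case Nil
  then show ?case by (simp add: single_Nil_one)
next
  case (Cons y w)
  then obtain m where n: "n = Suc m" by (cases n) auto
  let ?s = "Poly_Mapping.single w 1 :: gl_elem list \<Rightarrow>\<^sub>0 complex"
  have w: "set w \<subseteq> glc L N" "length w < m" and y: "y \<in> glc L N" using Cons.prems n by auto
  have ys: "Poly_Mapping.single (y # w) 1 = letter y * ?s" by (simp add: mult_single plus_list_def)
  have "(letter x * (letter y * ?s) - letter y * (letter x * ?s)) + letter y * (letter x * ?s - ?s * letter x) \<in> Gf L N n"
    unfolding n by (intro Gf_add Gf_swap assms(1) y Gf_mult_letter Cons.IH w Gf_word)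
  then show ?case unfolding ys by (simp add: right_diff_distrib mult.assoc)
qed

lemma Gf_commute:
  assumes x: "x \<in> glc L N" and p: "p \<in> Gf L N n"
  shows "letter x * p - p * letter x \<in> Gf L N n"
proof -
  obtain q where q: "p \<in> FC L N" "q \<in> FC L N" "\<forall>w\<in>Poly_Mapping.keys q. length w < n" "p - q \<in> UI L N"
    using p by (rule GfE)
  have lx: "letter x \<in> FC L N" using x by simp
  have qs: "q = (\<Sum>w\<in>Poly_Mapping.keys q. cst (Poly_Mapping.lookup q w) * Poly_Mapping.single w 1)"
    by (subst poly_eq_sum_single) (simp add: cst_def mult_single plus_list_def)
  have l: "letter x * q = (\<Sum>w\<in>Poly_Mapping.keys q. cst (Poly_Mapping.lookup q w) * (letter x * Poly_Mapping.single w 1))"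
    by (subst qs) (simp only: sum_distrib_left cst_out(1))
  have r: "q * letter x = (\<Sum>w\<in>Poly_Mapping.keys q. cst (Poly_Mapping.lookup q w) * (Poly_Mapping.single w 1 * letter x))"
    by (subst qs) (simp only: sum_distrib_right mult.assoc)
  have "letter x * q - q * letter x = (\<Sum>w\<in>Poly_Mapping.keys q. cst (Poly_Mapping.lookup q w) *
      (letter x * Poly_Mapping.single w 1 - Poly_Mapping.single w 1 * letter x))"
    unfolding l r by (simp only: sum_subtractf right_diff_distrib)
  also have "\<dots> \<in> Gf L N n"
    by (intro Gf_sum Gf_cst Gf_commute_word x) (use q in \<open>auto simp: FC_iff\<close>)
  finally have 1: "letter x * q - q * letter x \<in> Gf L N n" .
  have 2: "letter x * (p - q) - (p - q) * letter x \<in> Gf L N n"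
    by (intro Gf_UI UI_diff UI_mult_left UI_mult_right lx q(4))
  have "(letter x * q - q * letter x) + (letter x * (p - q) - (p - q) * letter x) = letter x * p - p * letter x"
    by (simp only: right_diff_distrib left_diff_distrib) simp
  then show ?thesis using Gf_add[OF 1 2] by (simp only:)
qed

text \<open>The left ideal generated by the last column, as representatives in the free algebra.\<close>

inductive_set TN :: "nat \<Rightarrow> nat \<Rightarrow> (gl_elem list \<Rightarrow>\<^sub>0 complex) set" for L N where
  zero: "0 \<in> TN L N"
| gen: "r \<in> FC L N ==> c \<in> {1..L} ==> i \<in> {1..N} ==> p \<in> TN L N ==> r * EL (c, i, N) + p \<in> TN L N"

definition target_free :: "nat \<Rightarrow> edge list \<Rightarrow> bool" where
  "target_free N es \<longleftrightarrow> (\<forall>(c, i, j)\<in>set es. j ~= N)"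

definition tf_zero :: "nat \<Rightarrow> coef \<Rightarrow> bool" where
  "tf_zero N f \<longleftrightarrow> (\<forall>es. target_free N es --> f es = 0)"

lemma Em_last: "c \<in> {1..L} ==> i \<in> {1..N} ==> Em (c, i, N) \<in> glc L N"
  by (rule Em_glc) (auto simp: Ed_def)

lemma TN_FC: "p \<in> TN L N ==> p \<in> FC L N"
  by (induction rule: TN.induct) (simp_all add: Em_last)

lemma TN_add: "p \<in> TN L N ==> q \<in> TN L N ==> p + q \<in> TN L N"
  by (induction rule: TN.induct) (simp_all add: add.assoc TN.gen)

lemma TN_mult: "p \<in> TN L N ==> s \<in> FC L N ==> s * p \<in> TN L N"
  by (induction rule: TN.induct) (simp_all add: TN.zero distrib_left mult.assoc[symmetric] TN.gen)

lemma tf_zero_rop: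
  assumes "symf f"
  shows "tf_zero N (rop N (Em (c, i, N)) f)"
  unfolding tf_zero_def
proof (intro allI impI)
  fix es assume tf: "target_free N es"
  have "psum (\<lambda>e r. xe (Em (c, i, N)) e * f r + rker N (Em (c, i, N)) e (\<lambda>e'. f (e' # r))) es = 0"
  proof (rule psum_eq_0)
    fix e r assume "mset es = add_mset e (mset r)"
    then have "e \<in> set es" by (simp add: set_mset_split)
    then obtain c' i' j' where e: "e = (c', i', j')" "j' ~= N" using tf unfolding target_free_def by (cases e) auto
    show "xe (Em (c, i, N)) e * f r + rker N (Em (c, i, N)) e (\<lambda>e'. f (e' # r)) = 0"
    proof -
      have "xe (Em (c, i, N)) e = 0" using e by (simp add: xe_Em)
      moreover have "rker N (Em (c, i, N)) e (\<lambda>e'. f (e' # r)) = 0"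
        using e by (simp add: rker_def Em_def mat_unit_def)
      ultimately show ?thesis by simp
    qed
  qed
  then show "rop N (Em (c, i, N)) f es = 0"
    unfolding rop_def gop_eq_psum[OF functional_rker assms] .
qed

lemma TN_tf_zero: "p \<in> TN L N ==> tf_zero N (phi N p)"
proof (induction rule: TN.induct)
  case zero
  show ?case by (simp add: phi_zero tf_zero_def)
next
  case (gen r c i p)
  have "tf_zero N (phi N (r * EL (c, i, N)))" unfolding phi_mult_letter by (rule tf_zero_rop[OF symf_phi])
  then show ?case using gen.IH by (simp add: phi_add tf_zero_def)
qed

lemma TN_sum_approx:
  assumes "finite A" "\<And>a. a \<in> A ==> \<exists>v\<in>TN L N. g a - v \<in> Gf L N m"
  shows "\<exists>v\<in>TN L N. (\<Sum>a\<in>A. g a) - v \<in> Gf L N m"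
  using assms
proof (induction A rule: finite_induct)
  case empty
  then show ?case by (intro bexI[of _ 0]) (auto simp: TN.zero)
next
  case (insert a A)
  obtain v where v: "v \<in> TN L N" "(\<Sum>a\<in>A. g a) - v \<in> Gf L N m" using insert by auto
  obtain u where u: "u \<in> TN L N" "g a - u \<in> Gf L N m" using insert.prems by auto
  have "(g a - u) + ((\<Sum>a\<in>A. g a) - v) \<in> Gf L N m" by (intro Gf_add u v)
  moreover have "(g a - u) + ((\<Sum>a\<in>A. g a) - v) = (\<Sum>a\<in>insert a A. g a) - (u + v)"
    using insert.hyps by simp
  ultimately show ?case using TN_add[OF u(1) v(1)] by (intro bexI[of _ "u + v"]) (simp_all only:)
qed

lemma Sg_TN:
  assumes "tf_zero N f"
  shows "\<exists>v\<in>TN L N. Sg L N n f - v \<in> Gf L N n"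
  using assms
proof (induction n arbitrary: f)
  case 0
  then have "f [] = 0" by (simp add: tf_zero_def target_free_def)
  then show ?case by (intro bexI[of _ 0]) (auto simp: TN.zero)
next
  case (Suc n)
  have "\<exists>v\<in>TN L N. EL e * Sg L N n (\<lambda>r. f (e # r)) - v \<in> Gf L N (Suc n)" if e: "e \<in> Ed L N" for e
  proof -
    obtain c i j where eq: "e = (c, i, j)" by (cases e) auto
    show ?thesis
    proof (cases "j = N")
      case True
      have ci: "c \<in> {1..L}" "i \<in> {1..N}" using e eq by (auto simp: Ed_def)
      have "Sg L N n (\<lambda>r. f (e # r)) * EL (c, i, N) + 0 \<in> TN L N" by (rule TN.gen[OF Sg_FC ci TN.zero])
      moreover have "EL e * Sg L N n (\<lambda>r. f (e # r)) - Sg L N n (\<lambda>r. f (e # r)) * EL e \<in> Gf L N (Suc n)"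
        by (rule Gf_commute[OF Em_glc[OF e] Sg_Gf])
      ultimately show ?thesis unfolding eq True by (intro bexI[of _ "Sg L N n (\<lambda>r. f ((c, i, N) # r)) * EL (c, i, N)"]) simp_all
    next
      case False
      have "tf_zero N (\<lambda>r. f (e # r))"
        using Suc.prems False unfolding tf_zero_def target_free_def eq by simp
      then obtain v where v: "v \<in> TN L N" "Sg L N n (\<lambda>r. f (e # r)) - v \<in> Gf L N n" using Suc.IH by blast
      have "EL e * (Sg L N n (\<lambda>r. f (e # r)) - v) \<in> Gf L N (Suc n)" by (intro Gf_mult_letter Em_glc e v)
      moreover have "EL e * v \<in> TN L N" by (rule TN_mult[OF v(1)]) (simp add: Em_glc e)
      ultimately show ?thesis by (intro bexI[of _ "EL e * v"]) (simp_all only: right_diff_distrib)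
    qed
  qed
  then show ?case unfolding Sg.simps by (intro TN_sum_approx) auto
qed

lemma tf_zero_imp_TN:
  assumes "p \<in> FC L N" "tf_zero N (phi N p)"
  shows "\<exists>v\<in>TN L N. p - v \<in> UI L N"
proof -
  obtain n where "p \<in> Gf L N n" using FC_Gf[OF assms(1)] by blast
  then show ?thesis using assms(2)
  proof (induction n arbitrary: p)
    case 0
    then show ?case by (intro bexI[of _ 0]) (auto simp: Gf_0 TN.zero)
  next
    case (Suc n)
    obtain v where v: "v \<in> TN L N" "Sg L N n (phi N p) - v \<in> Gf L N n"
      using Sg_TN[OF Suc.prems(2)] by blast
    let ?v = "cst (1 / fact n) * v"
    have v': "?v \<in> TN L N" by (rule TN_mult[OF v(1)]) simp
    have "p - ?v \<in> Gf L N n" by (rule Gf_descend[OF Suc.prems(1) v(2)])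
    moreover have "tf_zero N (phi N (p - ?v))"
      using TN_tf_zero[OF v'] Suc.prems(2) unfolding tf_zero_def phi_diff by simp
    ultimately obtain u where u: "u \<in> TN L N" "p - ?v - u \<in> UI L N" using Suc.IH by blast
    then show ?case using TN_add[OF v' u(1)] by (intro bexI[of _ "?v + u"]) (simp_all add: diff_diff_add)
  qed
qed

section \<open>Changing the size of the matrices\<close>

lemma glc_mono: "M \<le> N ==> glc L M \<subseteq> glc L N"
  by (fastforce simp: gl_sum_def)

lemma FC_mono:
  assumes MN: "M \<le> N"
  shows "FC L M \<subseteq> FC L N"
proof
  fix p assume p: "p \<in> FC L M"
  show "p \<in> FC L N" unfolding FC_iff
  proof
    fix w assume "w \<in> Poly_Mapping.keys p"
    then have "set w \<subseteq> glc L M" using p FC_iff by blast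
    then show "set w \<subseteq> glc L N" by (rule subset_trans[OF _ glc_mono[OF MN]])
  qed
qed

lemma ker_mono:
  assumes x: "x \<in> glc L M" and MN: "M \<le> N"
  shows "lker N x = lker M x" "rker N x = rker M x"
proof -
  have z: "x c i b = 0" "x c b j = 0" if "b \<notin> {1..M}" for b c i j
    using x that by (auto simp: gl_sum_def)
  show "lker N x = lker M x" "rker N x = rker M x"
    by (auto simp: fun_eq_iff lker_def rker_def z intro!: sum.mono_neutral_right) (use MN in auto)
qed

lemma lop_mono:
  assumes "x \<in> glc L M" "M \<le> N"
  shows "lop N x = lop M x" "rop N x = rop M x"
  unfolding lop_def rop_def ker_mono[OF assms] by (rule refl)+

lemma phi_mono:
  assumes p: "p \<in> FC L M" and MN: "M \<le> N"
  shows "phi N p = phi M p"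
proof
  fix es
  have "phi N (Poly_Mapping.single w 1) = phi M (Poly_Mapping.single w 1)" if "set w \<subseteq> glc L M" for w
    using that
  proof (induction w)
    case (Cons x w)
    have "lop N x = lop M x" by (rule lop_mono(1)[of x L M N, OF _ MN]) (use Cons.prems in simp)
    then show ?case unfolding phi_Cons using Cons by simp
  qed (simp only: phi_Nil)
  then show "phi N p es = phi M p es"
    unfolding phi_sum_words[of N p] phi_sum_words[of M p] using p unfolding FC_iff by (intro sum.cong) auto
qed

lemma UI_mono: "p \<in> UI L M ==> M \<le> N ==> p \<in> UI L N"
proof -
  assume p: "p \<in> UI L M" and MN: "M \<le> N"
  have pM: "p \<in> FC L M" by (rule UI_subset[OF p])
  have "phi N p = (\<lambda>_. 0)" using phi_UI[OF p] phi_mono[OF pM MN] by simp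
  then show "p \<in> UI L N" using phi_eq_zero_iff[OF subsetD[OF FC_mono[OF MN] pM]] by simp
qed

section \<open>Coefficient functions of elements of the enveloping algebra\<close>

text \<open>Independent of the representative, since relators act as zero.\<close>

definition Rl :: "nat \<Rightarrow> nat \<Rightarrow> uea_elem \<Rightarrow> lin" where
  "Rl L N u = lact N (SOME p. p \<in> FC L N \<and> u = cl L N p)"

text \<open>The coefficient function of an element of the enveloping algebra.\<close>

definition co :: "nat \<Rightarrow> nat \<Rightarrow> uea_elem \<Rightarrow> coef" where "co L N u = ap (Rl L N u) vac"

lemma Rl_cl: assumes "p \<in> FC L N" shows "Rl L N (cl L N p) = lact N p"
proof -
  let ?q = "SOME q. q \<in> FC L N \<and> cl L N p = cl L N q"
  have q: "?q \<in> FC L N \<and> cl L N p = cl L N ?q"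
    by (rule someI[of "\<lambda>q. q \<in> FC L N \<and> cl L N p = cl L N q" p]) (use assms in simp)
  then have "p - ?q \<in> UI L N" using cl_eq_iff[OF assms] by blast
  then have "lact N p = lact N ?q" using lact_UI[of "p - ?q" L N] by (simp add: lact_diff)
  then show ?thesis by (simp add: Rl_def)
qed

lemma co_cl: "p \<in> FC L N ==> co L N (cl L N p) = phi N p"
  by (simp add: co_def Rl_cl phi_def)

lemma UglE:
  assumes "u \<in> carrier (Ugl L N)"
  obtains p where "p \<in> FC L N" "u = cl L N p"
  using assms unfolding Ugl_carrier by blast

lemma cl_carrier: "p \<in> FC L N ==> cl L N p \<in> carrier (Ugl L N)"
  unfolding Ugl_carrier by blast

lemma Ugl_closed:
  "\<one>\<^bsub>Ugl L N\<^esub> \<in> carrier (Ugl L N)" "\<zero>\<^bsub>Ugl L N\<^esub> \<in> carrier (Ugl L N)"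
  "u \<in> carrier (Ugl L N) ==> v \<in> carrier (Ugl L N) ==> u \<otimes>\<^bsub>Ugl L N\<^esub> v \<in> carrier (Ugl L N)"
  "u \<in> carrier (Ugl L N) ==> v \<in> carrier (Ugl L N) ==> u \<oplus>\<^bsub>Ugl L N\<^esub> v \<in> carrier (Ugl L N)"
  "u \<in> carrier (Ugl L N) ==> c \<odot>\<^bsub>Ugl L N\<^esub> u \<in> carrier (Ugl L N)"
  by (simp_all add: Ugl_one Ugl_zero cl_carrier)
    (elim UglE, simp add: Ugl_mult Ugl_add Ugl_smult cl_carrier)+

lemma Rl_simps:
  "Rl L N \<one>\<^bsub>Ugl L N\<^esub> = 1" "Rl L N \<zero>\<^bsub>Ugl L N\<^esub> = 0"
  "u \<in> carrier (Ugl L N) ==> v \<in> carrier (Ugl L N) ==> Rl L N (u \<otimes>\<^bsub>Ugl L N\<^esub> v) = Rl L N u * Rl L N v"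
  "u \<in> carrier (Ugl L N) ==> v \<in> carrier (Ugl L N) ==> Rl L N (u \<oplus>\<^bsub>Ugl L N\<^esub> v) = Rl L N u + Rl L N v"
  "u \<in> carrier (Ugl L N) ==> Rl L N (c \<odot>\<^bsub>Ugl L N\<^esub> u) = scal c * Rl L N u"
  by (simp_all add: Ugl_one Ugl_zero Rl_cl)
    (elim UglE, simp add: Ugl_mult Ugl_add Ugl_smult Rl_cl lact_mult lact_add lact_const)+

lemma co_inj:
  assumes "u \<in> carrier (Ugl L N)" "v \<in> carrier (Ugl L N)" "co L N u = co L N v"
  shows "u = v"
proof -
  obtain p where p: "p \<in> FC L N" "u = cl L N p" using assms(1) by (rule UglE)
  obtain q where q: "q \<in> FC L N" "v = cl L N q" using assms(2) by (rule UglE)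
  have "phi N (p - q) = (\<lambda>_. 0)" using assms(3) p q by (simp add: co_cl phi_diff)
  then have "p - q \<in> UI L N" using phi_eq_zero_iff[of "p - q" L N] p q by simp
  then show ?thesis using cl_eq_iff[OF p(1) q(1)] p q by simp
qed

lemma Rl_inj: "inj_on (Rl L N) (carrier (Ugl L N))"
proof (rule inj_onI, rule co_inj)
  fix u v assume "Rl L N u = Rl L N v"
  then show "co L N u = co L N v" unfolding co_def by (rule arg_cong)
qed

lemma ring_Ugl: "ring (Ugl L N)"
proof (rule ring_by_embedding[OF Rl_inj])
  fix u assume "u \<in> carrier (Ugl L N)"
  then show "\<exists>y\<in>carrier (Ugl L N). Rl L N y = - Rl L N u"
    by (intro bexI[of _ "(-1) \<odot>\<^bsub>Ugl L N\<^esub> u"]) (simp_all only: Rl_simps Ugl_closed scal_simps mult_minus1)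
qed (simp_all add: Ugl_closed Rl_simps)

lemma Rl_minus:
  assumes "u \<in> carrier (Ugl L N)" "v \<in> carrier (Ugl L N)"
  shows "u \<ominus>\<^bsub>Ugl L N\<^esub> v \<in> carrier (Ugl L N)" "Rl L N (u \<ominus>\<^bsub>Ugl L N\<^esub> v) = Rl L N u - Rl L N v"
proof -
  interpret ring "Ugl L N" by (rule ring_Ugl)
  show c: "u \<ominus>\<^bsub>Ugl L N\<^esub> v \<in> carrier (Ugl L N)" using assms by simp
  have "(u \<ominus>\<^bsub>Ugl L N\<^esub> v) \<oplus>\<^bsub>Ugl L N\<^esub> v = u" using assms by (simp add: a_minus_def a_assoc l_neg)
  then have "Rl L N (u \<ominus>\<^bsub>Ugl L N\<^esub> v) + Rl L N v = Rl L N u" using Rl_simps(4)[OF c assms(2)] by simp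
  then show "Rl L N (u \<ominus>\<^bsub>Ugl L N\<^esub> v) = Rl L N u - Rl L N v" by (simp add: algebra_simps)
qed

lemma co_simps:
  "co L N \<one>\<^bsub>Ugl L N\<^esub> = vac" "co L N \<zero>\<^bsub>Ugl L N\<^esub> = (\<lambda>_. 0)"
  "u \<in> carrier (Ugl L N) ==> v \<in> carrier (Ugl L N) ==> co L N (u \<otimes>\<^bsub>Ugl L N\<^esub> v) = ap (Rl L N u) (co L N v)"
  "u \<in> carrier (Ugl L N) ==> v \<in> carrier (Ugl L N) ==> co L N (u \<oplus>\<^bsub>Ugl L N\<^esub> v) = (\<lambda>r. co L N u r + co L N v r)"
  "u \<in> carrier (Ugl L N) ==> v \<in> carrier (Ugl L N) ==> co L N (u \<ominus>\<^bsub>Ugl L N\<^esub> v) = (\<lambda>r. co L N u r - co L N v r)"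
  "u \<in> carrier (Ugl L N) ==> co L N (c \<odot>\<^bsub>Ugl L N\<^esub> u) = (\<lambda>r. c * co L N u r)"
  by (simp_all add: co_def Rl_simps Rl_minus)

definition Sp :: "nat \<Rightarrow> nat \<Rightarrow> coef \<Rightarrow> bool" where
  "Sp L N f \<longleftrightarrow> symf f \<and> supp_in (Ed L N) f \<and> (\<exists>n. deg_le n f)"

lemma co_Sp: assumes "u \<in> carrier (Ugl L N)" shows "Sp L N (co L N u)"
proof -
  obtain p where p: "p \<in> FC L N" "u = cl L N p" using assms by (rule UglE)
  have "\<exists>n. deg_le n (phi N p)"
    by (rule exI[of _ "Max (length ` Poly_Mapping.keys p)"], rule deg_phi) simp
  then show ?thesis unfolding Sp_def p(2) co_cl[OF p(1)] using symf_phi supp_phi[OF p(1)] by blast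
qed

lemma co_filtration: "u \<in> uea_filtration (gl_sum L N) n \<longleftrightarrow> u \<in> carrier (Ugl L N) \<and> deg_le n (co L N u)"
proof
  assume "u \<in> uea_filtration (gl_sum L N) n"
  then obtain p where p: "p \<in> FC L N" "\<forall>w\<in>Poly_Mapping.keys p. length w \<le> n" "u = cl L N p"
    unfolding uea_filtration_def by blast
  then show "u \<in> carrier (Ugl L N) \<and> deg_le n (co L N u)"
    using cl_carrier[OF p(1)] deg_phi[of p n N] by (simp add: co_cl)
next
  assume u: "u \<in> carrier (Ugl L N) \<and> deg_le n (co L N u)"
  then obtain p where p: "p \<in> FC L N" "u = cl L N p" using UglE by blast
  then have "p \<in> Gf L N (Suc n)" using u by (intro deg_Gf) (simp_all add: co_cl)
  then obtain q where q: "p \<in> FC L N" "q \<in> FC L N" "\<forall>w\<in>Poly_Mapping.keys q. length w < Suc n" "p - q \<in> UI L N"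
    by (rule GfE)
  have "u = cl L N q" using cl_eq_iff[OF q(1,2)] q(4) p(2) by simp
  then show "u \<in> uea_filtration (gl_sum L N) n"
    unfolding uea_filtration_def using q by (intro image_eqI[of _ _ q]) (simp_all add: less_Suc_eq_le)
qed

lemma co_surj: assumes "Sp L N f" obtains u where "u \<in> carrier (Ugl L N)" "co L N u = f"
proof -
  obtain n where "deg_le n f" using assms unfolding Sp_def by blast
  then obtain p where p: "p \<in> FC L N" "phi N p = f" using phi_surj[of f L N n] assms unfolding Sp_def by blast
  then show thesis using that[of "cl L N p"] cl_carrier co_cl by simp
qed

lemma co_gl_gen:
  assumes "x \<in> glc L N" "u \<in> carrier (Ugl L N)"
  shows "gl_gen L N x \<in> carrier (Ugl L N)" "co L N (gl_gen L N x \<otimes>\<^bsub>Ugl L N\<^esub> u) = lop N x (co L N u)"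
    "co L N (u \<otimes>\<^bsub>Ugl L N\<^esub> gl_gen L N x) = rop N x (co L N u)"
proof -
  obtain p where p: "p \<in> FC L N" "u = cl L N p" using assms(2) by (rule UglE)
  have x: "letter x \<in> FC L N" using assms(1) by simp
  show "gl_gen L N x \<in> carrier (Ugl L N)" by (simp only: gl_gen_eq cl_carrier[OF x])
  show "co L N (gl_gen L N x \<otimes>\<^bsub>Ugl L N\<^esub> u) = lop N x (co L N u)" "co L N (u \<otimes>\<^bsub>Ugl L N\<^esub> gl_gen L N x) = rop N x (co L N u)"
    unfolding p(2) gl_gen_eq Ugl_mult[OF x p(1)] Ugl_mult[OF p(1) x] using p x
    by (simp_all add: co_cl phi_letter_mult phi_mult_letter)
qed

section \<open>Invariance under the diagonal subalgebra\<close>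

text \<open>The derivation induced by the bracket with \<open>E\<^sub>a\<^sub>b\<close> of the diagonal subalgebra: a source \<open>a\<close> becomes \<open>b\<close>, a target \<open>b\<close> becomes \<open>a\<close>.\<close>

definition dm :: "nat \<Rightarrow> nat \<Rightarrow> edge \<Rightarrow> (edge \<Rightarrow> complex) \<Rightarrow> complex" where
  "dm a b e h = (case e of (c, i, j) \<Rightarrow> (if i = a then h (c, b, j) else 0) - (if j = b then h (c, i, a) else 0))"

definition Dop :: "nat \<Rightarrow> nat \<Rightarrow> coef \<Rightarrow> coef" where "Dop a b = gop (\<lambda>_. 0) (dm a b)"

lemma functional_dm: "functional (dm a b)"
  unfolding functional_def dm_def by (auto split: prod.split simp: algebra_simps)

definition Inv :: "nat \<Rightarrow> nat \<Rightarrow> nat \<Rightarrow> coef \<Rightarrow> bool" where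
  "Inv d L N f \<longleftrightarrow> (\<forall>a b es. a \<in> {d<..N} --> b \<in> {d<..N} --> set es \<subseteq> Ed L N --> Dop a b f es = 0)"

lemma gop_expand:
  assumes "finite K" "\<And>e h. e \<in> set es ==> m e h = (\<Sum>k\<in>K. c k * m' k e h)"
  shows "gop (\<lambda>_. 0) m f es = (\<Sum>k\<in>K. c k * gop (\<lambda>_. 0) (m' k) f es)"
  using assms(2) by (induction es arbitrary: f) (simp_all add: distrib_left sum.distrib)

lemma gl_diag_glc: "y \<in> gl_sub d N ==> gl_diag L y \<in> glc L N"
  by (fastforce simp: gl_sub_def gl_diag_def gl_sum_def)

lemma supp_in_rop:
  assumes "x \<in> glc L N" "symf f" "supp_in (Ed L N) f"
  shows "supp_in (Ed L N) (rop N x f)"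
  unfolding rop_def
proof (rule supp_in_gop[OF functional_rker assms(2,3)])
  fix e and h :: "edge \<Rightarrow> complex"
  assume e: "e \<notin> Ed L N" and h: "\<And>e'. e' \<notin> Ed L N ==> h e' = 0"
  obtain c i j where eq: "e = (c, i, j)" by (cases e) auto
  have "x c b j * h (c, i, b) = 0" for b
  proof (cases "x c b j = 0")
    case False
    then have "c \<in> {1..L}" "j \<in> {1..N}" using assms(1) by (auto simp: gl_sum_def)
    then have "(c, i, b) \<notin> Ed L N" using e eq by (auto simp: Ed_def)
    then show ?thesis using h by simp
  qed simp
  then show "rker N x e h = 0" unfolding rker_def eq prod.case by (intro sum.neutral ballI)
qed (rule xe_nonzero[OF assms(1)])

lemma diag_commutator:
  assumes y: "y \<in> gl_sub d N" and es: "set es \<subseteq> Ed L N"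
  shows "lop N (gl_diag L y) f es - rop N (gl_diag L y) f es
    = (\<Sum>(a, b)\<in>{d<..N} \<times> {d<..N}. y a b * Dop a b f es)"
proof -
  let ?x = "gl_diag L y"
  have y0: "y a b = 0" if "a \<notin> {d<..N} \<or> b \<notin> {d<..N}" for a b
    using y that unfolding gl_sub_def by blast
  have "lop N ?x f es = (-1) * (- lop N ?x f es)" by simp
  have "gop (\<lambda>e. (-1) * xe ?x e + xe ?x e) (\<lambda>e h. (-1) * rker N ?x e h + lker N ?x e h) f es = (-1) * rop N ?x f es + lop N ?x f es"
    unfolding rop_def lop_def by (rule gop_linear_operator)
  then have "lop N ?x f es - rop N ?x f es = gop (\<lambda>_. 0) (\<lambda>e h. (-1) * rker N ?x e h + lker N ?x e h) f es"
    by simp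
  also have "\<dots> = (\<Sum>k\<in>{d<..N} \<times> {d<..N}. y (fst k) (snd k) * gop (\<lambda>_. 0) (dm (fst k) (snd k)) f es)"
  proof (rule gop_expand)
    fix e and h :: "edge \<Rightarrow> complex"
    assume "e \<in> set es"
    then obtain c i j where e: "e = (c, i, j)" "c \<in> {1..L}" "i \<in> {1..N}" "j \<in> {1..N}"
      using es by (cases e) (auto simp: Ed_def)
    have 1: "lker N ?x e h = (\<Sum>b\<in>{d<..N}. y i b * h (c, b, j))"
      unfolding lker_def e(1) using e(2) by (simp add: gl_diag_def) (rule sum.mono_neutral_right; auto simp: y0)
    have 2: "rker N ?x e h = (\<Sum>a\<in>{d<..N}. y a j * h (c, i, a))"
      unfolding rker_def e(1) using e(2) by (simp add: gl_diag_def) (rule sum.mono_neutral_right; auto simp: y0)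
    have 3: "(\<Sum>a\<in>{d<..N}. \<Sum>b\<in>{d<..N}. y a b * (if i = a then h (c, b, j) else 0)) = (\<Sum>b\<in>{d<..N}. y i b * h (c, b, j))"
    proof -
      have "(\<Sum>a\<in>{d<..N}. \<Sum>b\<in>{d<..N}. y a b * (if i = a then h (c, b, j) else 0))
          = (\<Sum>a\<in>{d<..N}. if i = a then (\<Sum>b\<in>{d<..N}. y a b * h (c, b, j)) else 0)"
        by (intro sum.cong refl) simp
      also have "\<dots> = (\<Sum>b\<in>{d<..N}. y i b * h (c, b, j))"
        by (simp add: sum.delta, intro impI) (simp add: y0)
      finally show ?thesis .
    qed
    have 4: "(\<Sum>a\<in>{d<..N}. \<Sum>b\<in>{d<..N}. y a b * (if j = b then h (c, i, a) else 0)) = (\<Sum>a\<in>{d<..N}. y a j * h (c, i, a))"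
    proof (rule sum.cong[OF refl])
      fix a
      have "(\<Sum>b\<in>{d<..N}. y a b * (if j = b then h (c, i, a) else 0)) = (\<Sum>b\<in>{d<..N}. if j = b then y a b * h (c, i, a) else 0)"
        by (intro sum.cong refl) simp
      also have "\<dots> = y a j * h (c, i, a)" by (simp add: sum.delta, intro impI) (simp add: y0)
      finally show "(\<Sum>b\<in>{d<..N}. y a b * (if j = b then h (c, i, a) else 0)) = y a j * h (c, i, a)" .
    qed
    have "(\<Sum>k\<in>{d<..N} \<times> {d<..N}. y (fst k) (snd k) * dm (fst k) (snd k) e h)
        = (\<Sum>a\<in>{d<..N}. \<Sum>b\<in>{d<..N}. y a b * (if i = a then h (c, b, j) else 0) - y a b * (if j = b then h (c, i, a) else 0))"
      unfolding sum.cartesian_product by (rule sum.cong[OF refl]) (auto simp: dm_def e(1) right_diff_distrib)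
    also have "\<dots> = (-1) * rker N ?x e h + lker N ?x e h"
      unfolding sum_subtractf 1 2 3 4 by simp
    finally show "(-1) * rker N ?x e h + lker N ?x e h
        = (\<Sum>k\<in>{d<..N} \<times> {d<..N}. y (fst k) (snd k) * dm (fst k) (snd k) e h)" ..
  qed simp
  finally show ?thesis by (simp add: Dop_def split_beta)
qed

text \<open>The difference of left and right multiplication has no terms that remove entries, so commuting with the diagonal subalgebra is a
  condition on the derivations alone.\<close>

lemma A_fin_iff: "u \<in> A_fin d L N \<longleftrightarrow> u \<in> carrier (Ugl L N) \<and> Inv d L N (co L N u)"
proof (cases "u \<in> carrier (Ugl L N)")
  case u: True
  let ?f = "co L N u"
  have f: "symf ?f" "supp_in (Ed L N) ?f" using co_Sp[OF u] unfolding Sp_def by auto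
  have 1: "gl_gen L N (gl_diag L y) \<otimes>\<^bsub>Ugl L N\<^esub> u = u \<otimes>\<^bsub>Ugl L N\<^esub> gl_gen L N (gl_diag L y)
      \<longleftrightarrow> lop N (gl_diag L y) ?f = rop N (gl_diag L y) ?f" if y: "y \<in> gl_sub d N" for y
  proof -
    note g = co_gl_gen[OF gl_diag_glc[OF y] u]
    show ?thesis using co_inj[OF Ugl_closed(3)[OF g(1) u] Ugl_closed(3)[OF u g(1)]] g by metis
  qed
  show ?thesis
  proof
    assume A: "u \<in> A_fin d L N"
    have "Dop a b ?f es = 0" if ab: "a \<in> {d<..N}" "b \<in> {d<..N}" and es: "set es \<subseteq> Ed L N" for a b es
    proof -
      let ?y = "\<lambda>i j. if i = a \<and> j = b then 1 else 0 :: complex"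
      have y: "?y \<in> gl_sub d N" using ab unfolding gl_sub_def by auto
      then have "lop N (gl_diag L ?y) ?f = rop N (gl_diag L ?y) ?f" using A 1 unfolding A_fin_def by blast
      then have "(\<Sum>(a', b')\<in>{d<..N} \<times> {d<..N}. ?y a' b' * Dop a' b' ?f es) = 0"
        using diag_commutator[OF y es, of ?f] by simp
      also have "(\<Sum>(a', b')\<in>{d<..N} \<times> {d<..N}. ?y a' b' * Dop a' b' ?f es)
          = (\<Sum>k\<in>{d<..N} \<times> {d<..N}. if k = (a, b) then Dop a b ?f es else 0)"
        by (rule sum.cong[OF refl]) (auto split: if_splits)
      also have "\<dots> = Dop a b ?f es" using ab by (simp add: sum.delta)
      finally show ?thesis .
    qed
    then show "u \<in> carrier (Ugl L N) \<and> Inv d L N ?f" using u unfolding Inv_def by blast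
  next
    assume I: "u \<in> carrier (Ugl L N) \<and> Inv d L N ?f"
    have "lop N (gl_diag L y) ?f = rop N (gl_diag L y) ?f" if y: "y \<in> gl_sub d N" for y
    proof
      fix es
      show "lop N (gl_diag L y) ?f es = rop N (gl_diag L y) ?f es"
      proof (cases "set es \<subseteq> Ed L N")
        case True
        have "(\<Sum>(a, b)\<in>{d<..N} \<times> {d<..N}. y a b * Dop a b ?f es) = 0"
          using I True unfolding Inv_def by (intro sum.neutral) auto
        then show ?thesis using diag_commutator[OF y True, of ?f] by simp
      next
        case False
        then show ?thesis
          using supp_inD[OF supp_in_lop[OF gl_diag_glc[OF y] f]] supp_inD[OF supp_in_rop[OF gl_diag_glc[OF y] f]] by metis
      qed
    qed
    then show "u \<in> A_fin d L N" unfolding A_fin_def using u 1 by blast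
  qed
next
  case False
  then show ?thesis unfolding A_fin_def by blast
qed

section \<open>The projections and the inverse limit\<close>

lemma uea_incl_cl:
  assumes p: "p \<in> FC L M" and MN: "M \<le> N"
  shows "uea_incl (gl_sum L N) (cl L M p) = cl L N p"
proof -
  have "cl L N q = cl L N p" if "q \<in> cl L M p" for q
  proof -
    have q: "q \<in> FC L M" "cl L M q = cl L M p" using cl_memD[OF that p] by auto
    then have "q - p \<in> UI L M" using cl_eq_iff[OF q(1) p] by simp
    then have "q - p \<in> UI L N" by (rule UI_mono[OF _ MN])
    then show ?thesis using cl_eq_iff[of q L N p] subsetD[OF FC_mono[OF MN]] q(1) p by blast
  qed
  then have "cl L N ` cl L M p = {cl L N p}" using cl_self[OF p] by blast
  then show ?thesis unfolding uea_incl_def by simp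
qed

lemma uea_incl_co:
  assumes "y \<in> carrier (Ugl L M)" "M \<le> N"
  shows "uea_incl (gl_sum L N) y \<in> carrier (Ugl L N)" "co L N (uea_incl (gl_sum L N) y) = co L M y"
proof -
  obtain p where p: "p \<in> FC L M" "y = cl L M p" using assms(1) by (rule UglE)
  have pN: "p \<in> FC L N" using FC_mono[OF assms(2)] p(1) by blast
  show "uea_incl (gl_sum L N) y \<in> carrier (Ugl L N)" "co L N (uea_incl (gl_sum L N) y) = co L M y"
    unfolding p(2) uea_incl_cl[OF p(1) assms(2)] co_cl[OF pN] co_cl[OF p(1)]
    by (rule cl_carrier[OF pN], rule phi_mono[OF p(1) assms(2)])
qed

lemma Em_mat_unit: "Em (c, i, j) = mat_unit i j c"
  by (simp add: Em_def)

text \<open>The last column acts first on \<open>vac\<close> and creates an edge with target \<open>N\<close>; further left multiplications change sources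
  only. So elements of the left ideal have coefficients only at lists with an edge into \<open>N\<close>, and a symmetrised word can be reordered so that such
  an edge comes last.\<close>

lemma I_plus_iff: "u \<in> I_plus L N \<longleftrightarrow> u \<in> carrier (Ugl L N) \<and> tf_zero N (co L N u)"
proof
  let ?U = "Ugl L N"
  let ?S = "{gl_gen L N (mat_unit i N \<alpha>) | i \<alpha>. i \<in> {1..N} \<and> \<alpha> \<in> {1..L}}"
  let ?K = "{u \<in> carrier ?U. tf_zero N (co L N u)}"
  interpret ring ?U by (rule ring_Ugl)
  {
    assume u: "u \<in> I_plus L N"
    have "additive_subgroup ?K ?U"
    proof (rule additive_subgroup.intro, rule subgroup.intro)
      show "x \<otimes>\<^bsub>add_monoid ?U\<^esub> y \<in> ?K" if "x \<in> ?K" "y \<in> ?K" for x y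
        using that by (simp add: co_simps tf_zero_def)
      show "inv\<^bsub>add_monoid ?U\<^esub> x \<in> ?K" if "x \<in> ?K" for x
      proof -
        have "\<ominus>\<^bsub>?U\<^esub> x = \<zero>\<^bsub>?U\<^esub> \<ominus>\<^bsub>?U\<^esub> x" using that by (simp add: a_minus_def)
        moreover have "tf_zero N (co L N (\<zero>\<^bsub>?U\<^esub> \<ominus>\<^bsub>?U\<^esub> x))"
          using that by (simp add: co_simps tf_zero_def)
        ultimately have "tf_zero N (co L N (\<ominus>\<^bsub>?U\<^esub> x))" "\<ominus>\<^bsub>?U\<^esub> x \<in> carrier ?U" using that by simp_all
        then show ?thesis unfolding a_inv_def by simp
      qed
    qed (auto simp: co_simps tf_zero_def)
    moreover have "a \<otimes>\<^bsub>?U\<^esub> x \<in> ?K" if a: "a \<in> carrier ?U" and x: "x \<in> ?K" for a x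
    proof -
      obtain q where q: "q \<in> FC L N" "a = cl L N q" using a by (rule UglE)
      obtain p where p: "p \<in> FC L N" "x = cl L N p" using x UglE[of x L N] by blast
      have "tf_zero N (phi N p)" using x p by (simp add: co_cl)
      then obtain v where v: "v \<in> TN L N" "p - v \<in> UI L N" using tf_zero_imp_TN[OF p(1)] by blast
      have "phi N (q * p) = phi N (q * v)"
        using phi_UI[OF UI_mult_left[OF q(1) v(2)]] by (simp add: right_diff_distrib phi_diff fun_eq_iff)
      moreover have "tf_zero N (phi N (q * v))" by (rule TN_tf_zero[OF TN_mult[OF v(1) q(1)]])
      ultimately show ?thesis unfolding p(2) q(2) Ugl_mult[OF q(1) p(1)] using p q by (simp add: co_cl cl_carrier)
    qed
    moreover have "?S \<subseteq> ?K"
    proof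
      fix x assume "x \<in> ?S"
      then obtain i \<alpha> where ia: "i \<in> {1..N}" "\<alpha> \<in> {1..L}" "x = gl_gen L N (mat_unit i N \<alpha>)" by blast
      have e: "Em (\<alpha>, i, N) \<in> glc L N" by (rule Em_last[OF ia(2,1)])
      have x: "x = cl L N (EL (\<alpha>, i, N))" by (simp add: ia(3) gl_gen_eq Em_mat_unit)
      have "phi N (EL (\<alpha>, i, N)) = rop N (Em (\<alpha>, i, N)) vac"
        using phi_mult_letter[of N 1] by (simp add: phi_one)
      then have "tf_zero N (phi N (EL (\<alpha>, i, N)))" using tf_zero_rop[OF symf_vac] by simp
      moreover have "EL (\<alpha>, i, N) \<in> FC L N" using e by simp
      ultimately show "x \<in> ?K" unfolding x by (simp add: co_cl cl_carrier)
    qed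
    ultimately have "?K \<in> {I. additive_subgroup I ?U \<and> (\<forall>a\<in>carrier ?U. \<forall>x\<in>I. a \<otimes>\<^bsub>?U\<^esub> x \<in> I) \<and> ?S \<subseteq> I}"
      by blast
    then have "I_plus L N \<subseteq> ?K" unfolding I_plus_def left_genideal_def by (rule Inter_lower)
    then show "u \<in> carrier ?U \<and> tf_zero N (co L N u)" using u by blast
  }
  {
    assume u: "u \<in> carrier ?U \<and> tf_zero N (co L N u)"
    then obtain p where p: "p \<in> FC L N" "u = cl L N p" using UglE[of u L N] by blast
    then obtain v where v: "v \<in> TN L N" "p - v \<in> UI L N" using tf_zero_imp_TN[OF p(1)] u by (auto simp: co_cl)
    have uv: "u = cl L N v" using cl_eq_iff[OF p(1) TN_FC[OF v(1)]] v(2) p(2) by simp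
    have "cl L N v \<in> I" if I: "additive_subgroup I ?U" "\<forall>a\<in>carrier ?U. \<forall>x\<in>I. a \<otimes>\<^bsub>?U\<^esub> x \<in> I" "?S \<subseteq> I" for I
      using v(1)
    proof (induction rule: TN.induct)
      case zero
      then show ?case using additive_subgroup.zero_closed[OF I(1)] by (simp add: Ugl_zero)
    next
      case (gen r c i p)
      have e: "EL (c, i, N) \<in> FC L N" using Em_last[OF gen(2,3)] by simp
      have "cl L N (EL (c, i, N)) \<in> I" using I(3) gen(2,3) gl_gen_eq[of L N "mat_unit i N c"] unfolding Em_mat_unit by auto
      then have "cl L N r \<otimes>\<^bsub>?U\<^esub> cl L N (EL (c, i, N)) \<in> I" using I(2) cl_carrier[OF gen(1)] by blast
      then have "cl L N (r * EL (c, i, N)) \<in> I" by (simp only: Ugl_mult[OF gen(1) e])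
      then have "cl L N (r * EL (c, i, N)) \<oplus>\<^bsub>?U\<^esub> cl L N p \<in> I"
        using additive_subgroup.a_closed[OF I(1)] gen.IH by blast
      then show ?case using Ugl_add[of "r * EL (c, i, N)" L N p] gen(1) e TN_FC[OF gen(4)] by simp
    qed
    then show "u \<in> I_plus L N" unfolding I_plus_def left_genideal_def uv by blast
  }
qed

definition trunc :: "nat \<Rightarrow> nat \<Rightarrow> coef \<Rightarrow> coef" where
  "trunc L N f = (\<lambda>es. if set es \<subseteq> Ed L N then f es else 0)"

lemma Ed_mono: "M \<le> N ==> Ed L M \<subseteq> Ed L N" by (auto simp: Ed_def)

lemma trunc_trunc: "M \<le> N ==> trunc L M (trunc L N f) = trunc L M f"
  using Ed_mono[of M N L] by (auto simp: trunc_def fun_eq_iff)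

lemma trunc_supp: "supp_in (Ed L N) f ==> trunc L N f = f"
  by (auto simp: trunc_def fun_eq_iff supp_in_def)

lemma Sp_trunc: "symf f ==> deg_le n f ==> Sp L N (trunc L N f)"
proof -
  assume f: "symf f" "deg_le n f"
  have "symf (trunc L N f)" unfolding symf_def trunc_def
  proof (intro allI impI)
    fix es es' :: "edge list" assume eq: "mset es = mset es'"
    show "(if set es \<subseteq> Ed L N then f es else 0) = (if set es' \<subseteq> Ed L N then f es' else 0)"
      using mset_eq_setD[OF eq] symfD[OF f(1) eq] by simp
  qed
  moreover have "supp_in (Ed L N) (trunc L N f)" by (auto simp: supp_in_def trunc_def)
  moreover have "deg_le n (trunc L N f)" using f(2) by (auto simp: deg_le_def trunc_def)
  ultimately show ?thesis unfolding Sp_def by blast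
qed

text \<open>At a diagonal index the invariance says that every vertex is as often a source as a target.\<close>

lemma Dop_diag:
  "Dop a a f es = (of_nat (count_list (map (\<lambda>(c, i, j). i) es) a) - of_nat (count_list (map (\<lambda>(c, i, j). j) es) a)) * f es"
proof -
  have 1: "dm a a e h = ((if (case e of (c, i, j) \<Rightarrow> i) = a then 1 else 0) - (if (case e of (c, i, j) \<Rightarrow> j) = a then 1 else 0)) * h e" for e h
    by (auto simp: dm_def split: prod.split)
  have "gop (\<lambda>_. 0) (\<lambda>e h. g e * h e) f es = (\<Sum>e\<leftarrow>es. g e) * f es" for g :: "edge \<Rightarrow> complex" and es and f
    by (induction es arbitrary: f) (simp_all add: algebra_simps)
  moreover have "dm a a = (\<lambda>e h. ((if (case e of (c, i, j) \<Rightarrow> i) = a then 1 else 0) - (if (case e of (c, i, j) \<Rightarrow> j) = a then 1 else 0)) * h e)"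
    by (intro ext) (rule 1)
  moreover have "(\<Sum>e\<leftarrow>es. (if (case e of (c, i, j) \<Rightarrow> i) = a then 1 else 0) - (if (case e of (c, i, j) \<Rightarrow> j) = a then 1 else 0) :: complex)
     = of_nat (count_list (map (\<lambda>(c, i, j). i) es) a) - of_nat (count_list (map (\<lambda>(c, i, j). j) es) a)"
    by (induction es) (auto simp: algebra_simps)
  ultimately show ?thesis unfolding Dop_def by simp
qed

text \<open>By invariance the vertex \<open>Suc N\<close> is left as often as it is entered, so a list without edges into it does not meet it at all.\<close>

lemma balanced_target_free:
  assumes d: "d \<le> N" and f: "supp_in (Ed L (Suc N)) f" "Inv d L (Suc N) f"
    and z: "\<And>es. set es \<subseteq> Ed L N ==> f es = 0"
  shows "tf_zero (Suc N) f"
  unfolding tf_zero_def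
proof (intro allI impI, rule ccontr)
  fix es assume tf: "target_free (Suc N) es" and nz: "f es ~= 0"
  have es: "set es \<subseteq> Ed L (Suc N)" using f(1) nz unfolding supp_in_def by blast
  have "Dop (Suc N) (Suc N) f es = 0" using f(2) d es unfolding Inv_def by simp
  then have "count_list (map (\<lambda>(c, i, j). i) es) (Suc N) = count_list (map (\<lambda>(c, i, j). j) es) (Suc N)"
    unfolding Dop_diag using nz by simp
  moreover have "count_list (map (\<lambda>(c, i, j). j) es) (Suc N) = 0"
    using tf unfolding target_free_def by (subst count_list_0_iff) auto
  ultimately have src: "Suc N \<notin> (\<lambda>(c, i, j). i) ` set es" by (simp add: count_list_0_iff)
  have "set es \<subseteq> Ed L N"
  proof
    fix e assume e: "e \<in> set es"
    obtain c i j where eq: "e = (c, i, j)" by (cases e) auto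
    have "i ~= Suc N" using src e eq by force
    moreover have "j ~= Suc N" using tf e eq unfolding target_free_def by auto
    ultimately show "e \<in> Ed L N" using subsetD[OF es e] eq by (auto simp: Ed_def)
  qed
  then show False using z nz by blast
qed

lemma Inv_diff: "Inv d L N f ==> Inv d L N g ==> Inv d L N (\<lambda>r. f r - g r)"
proof -
  assume "Inv d L N f" "Inv d L N g"
  moreover have "Dop a b (\<lambda>r. f r - g r) es = Dop a b f es - Dop a b g es" for a b es
    unfolding Dop_def using gop_add[OF functional_dm, of "\<lambda>_. 0" a b f "\<lambda>r. (-1) * g r"]
      gop_scale[OF functional_dm, of "\<lambda>_. 0" a b "-1" g] by simp
  ultimately show ?thesis unfolding Inv_def by simp
qed

lemma Inv_top_column: "supp_in (Ed L N) f ==> Inv N L (Suc N) f"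
  unfolding Inv_def
proof (intro allI impI)
  fix a b es assume f: "supp_in (Ed L N) f" and ab: "a \<in> {N<..Suc N}" "b \<in> {N<..Suc N}"
  have eq: "a = Suc N" "b = Suc N" using ab by auto
  show "Dop a b f es = 0"
  proof (cases "set es \<subseteq> Ed L N")
    case True
    then have "\<And>e. e \<in> set es ==> (case e of (c, i, j) \<Rightarrow> i ~= Suc N \<and> j ~= Suc N)"
      by (force simp: Ed_def)
    then have "count_list (map (\<lambda>(c, i, j). i) es) (Suc N) = 0" "count_list (map (\<lambda>(c, i, j). j) es) (Suc N) = 0"
      by (subst count_list_0_iff; force)+
    then show ?thesis unfolding eq Dop_diag by simp
  next
    case False
    then show ?thesis unfolding eq Dop_diag using supp_inD[OF f] by simp
  qed
qed

lemma Inv_mono: "Inv d L N f ==> d \<le> d' ==> Inv d' L N f"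
  unfolding Inv_def by auto

text \<open>The difference of an element and the truncation of its coefficient function vanishes on lists that avoid the largest vertex, hence lies in the left ideal
  by the balance of sources and targets.\<close>

theorem pi_proj_eq:
  assumes x: "x \<in> A_fin d L (Suc N)" and d: "d \<le> N" and y: "y \<in> carrier (Ugl L N)"
  shows "pi_proj L (Suc N) x = y \<longleftrightarrow> co L N y = trunc L N (co L (Suc N) x)"
proof -
  let ?U = "Ugl L (Suc N)" and ?i = "uea_incl (gl_sum L (Suc N))"
  have xU: "x \<in> carrier ?U" and xI: "Inv d L (Suc N) (co L (Suc N) x)" using x by (simp_all add: A_fin_iff)
  have key: "x \<ominus>\<^bsub>?U\<^esub> ?i z \<in> J_ideal L (Suc N) \<longleftrightarrow> co L N z = trunc L N (co L (Suc N) x)" if z: "z \<in> carrier (Ugl L N)" for z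
  proof -
    note i = uea_incl_co[OF z, of "Suc N", simplified]
    have h: "x \<ominus>\<^bsub>?U\<^esub> ?i z \<in> carrier ?U" "co L (Suc N) (x \<ominus>\<^bsub>?U\<^esub> ?i z) = (\<lambda>r. co L (Suc N) x r - co L N z r)"
      using Rl_minus(1)[OF xU i(1)] co_simps(5)[OF xU i(1)] i(2) by simp_all
    have zS: "supp_in (Ed L N) (co L N z)" using co_Sp[OF z] unfolding Sp_def by blast
    have I: "Inv N L (Suc N) (\<lambda>r. co L (Suc N) x r - co L N z r)"
      by (intro Inv_diff Inv_mono[OF xI d] Inv_top_column zS)
    have "x \<ominus>\<^bsub>?U\<^esub> ?i z \<in> J_ideal L (Suc N) \<longleftrightarrow> tf_zero (Suc N) (\<lambda>r. co L (Suc N) x r - co L N z r)"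
      unfolding J_ideal_def using I h by (simp add: A_fin_iff I_plus_iff)
    also have "\<dots> \<longleftrightarrow> co L N z = trunc L N (co L (Suc N) x)"
    proof
      assume tf: "tf_zero (Suc N) (\<lambda>r. co L (Suc N) x r - co L N z r)"
      have "co L (Suc N) x es = co L N z es" if "set es \<subseteq> Ed L N" for es
      proof -
        have "target_free (Suc N) es" using that unfolding target_free_def Ed_def by fastforce
        then show ?thesis using tf unfolding tf_zero_def by simp
      qed
      then show "co L N z = trunc L N (co L (Suc N) x)"
        using supp_inD[OF zS] by (auto simp: trunc_def fun_eq_iff)
    next
      assume eq: "co L N z = trunc L N (co L (Suc N) x)"
      have "supp_in (Ed L (Suc N)) (\<lambda>r. co L (Suc N) x r - co L N z r)"
        using co_Sp[OF h(1)] unfolding Sp_def h(2) by blast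
      then show "tf_zero (Suc N) (\<lambda>r. co L (Suc N) x r - co L N z r)"
        by (rule balanced_target_free[OF order_refl _ I]) (simp add: eq trunc_def)
    qed
    finally show ?thesis .
  qed
  have "Sp L N (trunc L N (co L (Suc N) x))"
    using co_Sp[OF xU] Sp_trunc unfolding Sp_def by blast
  then obtain z where z: "z \<in> carrier (Ugl L N)" "co L N z = trunc L N (co L (Suc N) x)" by (rule co_surj)
  have "pi_proj L (Suc N) x = z"
    unfolding pi_proj_def diff_Suc_1
  proof (rule the_equality)
    show "z \<in> carrier (Ugl L N) \<and> x \<ominus>\<^bsub>?U\<^esub> ?i z \<in> J_ideal L (Suc N)" using key[OF z(1)] z by blast
  next
    fix z' assume z': "z' \<in> carrier (Ugl L N) \<and> x \<ominus>\<^bsub>?U\<^esub> ?i z' \<in> J_ideal L (Suc N)"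
    then have "co L N z' = co L N z" using key[of z'] z(2) by simp
    then show "z' = z" using co_inj[of z' L N z] z' z(1) by blast
  qed
  moreover have "z = y \<longleftrightarrow> co L N y = co L N z" using co_inj[OF y z(1)] by blast
  ultimately show ?thesis using z(2) by simp
qed

section \<open>Leading terms of products\<close>

lemma word_top:
  assumes f: "deg_le m f" and len: "length w + m \<le> length es"
  shows "ap (prod_list (map (Lop N) w)) f es = conv (phi N (Poly_Mapping.single w 1)) f es
    \<and> deg_le (length w + m) (ap (prod_list (map (Lop N) w)) f)"
  using len
proof (induction w arbitrary: es)
  case Nil
  then show ?case using f by (simp add: phi_Nil)
next
  case (Cons x w)
  let ?g = "ap (prod_list (map (Lop N) w)) f" and ?s = "phi N (Poly_Mapping.single w 1)"
  have deg: "deg_le (length w + m) ?g" using Cons.IH[of "replicate (length w + m) undefined"] by simp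
  have len: "length w + m < length es" using Cons.prems by simp
  have "lop N x ?g es = psum (\<lambda>e r. xe x e * ?g r) es" by (rule lop_top[OF deg len])
  also have "\<dots> = psum (\<lambda>e r. xe x e * conv ?s f r) es"
  proof (rule psum_cong)
    fix e r assume "mset es = add_mset e (mset r)"
    from arg_cong[OF this, of size] have "length w + m \<le> length r" using len by simp
    then show "xe x e * ?g r = xe x e * conv ?s f r" using Cons.IH by simp
  qed
  also have "\<dots> = conv (\<lambda>r. case r of [e] \<Rightarrow> xe x e | _ \<Rightarrow> 0) (conv ?s f) es" by (rule psum_eq_conv)
  also have "\<dots> = conv (conv (\<lambda>r. case r of [e] \<Rightarrow> xe x e | _ \<Rightarrow> 0) ?s) f es" by (rule conv_assoc[symmetric])
  also have "\<dots> = conv (lop N x ?s) f es"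
  proof (rule conv_cong)
    fix r1 r2 assume eq: "mset es = mset r1 + mset r2"
    from arg_cong[OF this, of size] have l: "length es = length r1 + length r2" by simp
    show "conv (\<lambda>r. case r of [e] \<Rightarrow> xe x e | _ \<Rightarrow> 0) ?s r1 * f r2 = lop N x ?s r1 * f r2"
    proof (cases "length r2 > m")
      case True
      then show ?thesis using deg_leD[OF f] by simp
    next
      case False
      then have "length w < length r1" using l len by simp
      then show ?thesis using lop_top[OF deg_phi_word] by (simp add: psum_eq_conv)
    qed
  qed
  finally show ?case using deg_lop[OF deg, of N x] by (simp add: phi_Cons)
qed

lemma conv_sum_left: "conv (\<lambda>r. \<Sum>a\<in>A. f a r) g es = (\<Sum>a\<in>A. conv (f a) g es)"
  by (induction A rule: infinite_finite_induct) (simp_all add: conv_add_left)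

lemma conv_deg:
  assumes "deg_le n f" "deg_le m g" "n + m < length es"
  shows "conv f g es = 0"
proof (rule ccontr)
  assume "conv f g es ~= 0"
  then obtain r1 r2 where r: "mset es = mset r1 + mset r2" "f r1 ~= 0" "g r2 ~= 0" by (rule conv_nonzeroD)
  have "length es = length r1 + length r2" using arg_cong[OF r(1), of size] by simp
  moreover have "length r1 \<le> n" "length r2 \<le> m" using r assms deg_leD by (metis not_less)+
  ultimately show False using assms(3) by simp
qed

text \<open>Terms of the product in which one factor acts by a bracket on entries of the other lose a tensor factor, so they do not contribute in top degree.\<close>

theorem co_mult_top:
  assumes u: "u \<in> carrier (Ugl L N)" "deg_le n (co L N u)"
    and v: "v \<in> carrier (Ugl L N)" "deg_le m (co L N v)" and len: "n + m \<le> length es"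
  shows "co L N (u \<otimes>\<^bsub>Ugl L N\<^esub> v) es = conv (co L N u) (co L N v) es"
proof -
  have "u \<in> uea_filtration (gl_sum L N) n" using u by (simp add: co_filtration)
  then obtain p where p: "p \<in> FC L N" "\<forall>w\<in>Poly_Mapping.keys p. length w \<le> n" "u = cl L N p"
    unfolding uea_filtration_def by blast
  let ?f = "co L N v"
  have "co L N (u \<otimes>\<^bsub>Ugl L N\<^esub> v) es = ap (lact N p) ?f es"
  proof -
    have "Rl L N u = lact N p" unfolding p(3) by (rule Rl_cl[OF p(1)])
    then show ?thesis using co_simps(3)[OF u(1) v(1)] by simp
  qed
  also have "\<dots> = (\<Sum>w\<in>Poly_Mapping.keys p. Poly_Mapping.lookup p w * ap (prod_list (map (Lop N) w)) ?f es)"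
    by (simp add: lact_def ap_sum)
  also have "\<dots> = (\<Sum>w\<in>Poly_Mapping.keys p. Poly_Mapping.lookup p w * conv (phi N (Poly_Mapping.single w 1)) ?f es)"
  proof (rule sum.cong[OF refl])
    fix w assume "w \<in> Poly_Mapping.keys p"
    then have "length w + m \<le> length es" using p(2) len by (meson add_le_mono1 le_trans)
    then show "Poly_Mapping.lookup p w * ap (prod_list (map (Lop N) w)) ?f es
        = Poly_Mapping.lookup p w * conv (phi N (Poly_Mapping.single w 1)) ?f es"
      using word_top[OF v(2)] by simp
  qed
  also have "\<dots> = conv (\<lambda>r. \<Sum>w\<in>Poly_Mapping.keys p. Poly_Mapping.lookup p w * phi N (Poly_Mapping.single w 1) r) ?f es"
    by (simp only: conv_sum_left conv_scale_left)
  also have "(\<lambda>r. \<Sum>w\<in>Poly_Mapping.keys p. Poly_Mapping.lookup p w * phi N (Poly_Mapping.single w 1) r) = co L N u"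
    unfolding p(3) co_cl[OF p(1)] by (rule ext) (rule phi_sum_words[symmetric])
  finally show ?thesis .
qed

section \<open>The inverse limit as a space of functions\<close>

lemma tf_zero_rop_small:
  assumes x: "x \<in> glc L N" and f: "symf f" "tf_zero (Suc N) f"
  shows "tf_zero (Suc N) (rop (Suc N) x f)"
  unfolding tf_zero_def
proof (intro allI impI)
  fix es assume tf: "target_free (Suc N) es"
  have "psum (\<lambda>e r. xe x e * f r + rker (Suc N) x e (\<lambda>e'. f (e' # r))) es = 0"
  proof (rule psum_eq_0)
    fix e r assume "mset es = add_mset e (mset r)"
    then have "set es = insert e (set r)" by (rule set_mset_split)
    then have r: "target_free (Suc N) r" using tf unfolding target_free_def by auto
    obtain c i j where e: "e = (c, i, j)" by (cases e) auto
    have "x c b j * f ((c, i, b) # r) = 0" for b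
    proof (cases "b = Suc N")
      case True
      have "x c (Suc N) j = 0"
      proof (rule ccontr)
        assume "x c (Suc N) j ~= 0"
        then have "Suc N \<in> {1..N}" using x unfolding gl_sum_def by simp
        then show False by simp
      qed
      then show ?thesis using True by simp
    next
      case False
      then have "target_free (Suc N) ((c, i, b) # r)" using r unfolding target_free_def by simp
      then show ?thesis using f(2) unfolding tf_zero_def by simp
    qed
    then have "rker (Suc N) x e (\<lambda>e'. f (e' # r)) = 0" unfolding rker_def e prod.case by (intro sum.neutral ballI)
    moreover have "f r = 0" using f(2) r unfolding tf_zero_def by simp
    ultimately show "xe x e * f r + rker (Suc N) x e (\<lambda>e'. f (e' # r)) = 0" by simp
  qed
  then show "rop (Suc N) x f es = 0" unfolding rop_def gop_eq_psum[OF functional_rker f(1)] .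
qed

lemma tf_zero_mult_small:
  assumes q: "q \<in> FC L N" and v: "tf_zero (Suc N) (phi (Suc N) v)"
  shows "tf_zero (Suc N) (phi (Suc N) (v * q))"
proof -
  have word: "tf_zero (Suc N) (phi (Suc N) (u * Poly_Mapping.single w 1))" 
    if "set w \<subseteq> glc L N" "tf_zero (Suc N) (phi (Suc N) u)" for w u
    using that
  proof (induction w arbitrary: u)
    case Nil
    then show ?case by (simp add: single_Nil_one)
  next
    case (Cons x w)
    have "u * Poly_Mapping.single (x # w) 1 = (u * letter x) * Poly_Mapping.single w 1"
      by (simp add: mult.assoc mult_single plus_list_def)
    moreover have "tf_zero (Suc N) (phi (Suc N) (u * letter x))"
      unfolding phi_mult_letter by (rule tf_zero_rop_small[of x L N]) (use Cons.prems symf_phi in simp_all)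
    ultimately show ?case using Cons by simp
  qed
  have qs: "q = (\<Sum>w\<in>Poly_Mapping.keys q. cst (Poly_Mapping.lookup q w) * Poly_Mapping.single w 1)"
    by (subst poly_eq_sum_single) (simp add: cst_def mult_single plus_list_def)
  have vq: "v * q = (\<Sum>w\<in>Poly_Mapping.keys q. cst (Poly_Mapping.lookup q w) * (v * Poly_Mapping.single w 1))"
    by (subst qs) (simp only: sum_distrib_left cst_left_commute[of v])
  show ?thesis unfolding tf_zero_def
  proof (intro allI impI)
    fix es assume es: "target_free (Suc N) es"
    have "phi (Suc N) (v * Poly_Mapping.single w 1) es = 0" if "w \<in> Poly_Mapping.keys q" for w
      using word[of w v] v q es that unfolding FC_iff tf_zero_def by blast
    then show "phi (Suc N) (v * q) es = 0" unfolding vq by (simp add: phi_sum phi_cst)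
  qed
qed

lemma target_free_Ed: "set es \<subseteq> Ed L N ==> target_free (Suc N) es"
  unfolding target_free_def Ed_def by fastforce

lemma trunc_mult:
  assumes x: "x \<in> carrier (Ugl L N)" and x': "x' \<in> A_fin d L (Suc N)" "co L N x = trunc L N (co L (Suc N) x')"
    and y: "y \<in> carrier (Ugl L N)" and y': "y' \<in> A_fin d L (Suc N)" "co L N y = trunc L N (co L (Suc N) y')"
    and d: "d \<le> N"
  shows "trunc L N (co L (Suc N) (x' \<otimes>\<^bsub>Ugl L (Suc N)\<^esub> y')) = co L N (x \<otimes>\<^bsub>Ugl L N\<^esub> y)"
proof -
  have rep: "\<exists>p p' v. p \<in> FC L N \<and> z = cl L N p \<and> p' \<in> FC L (Suc N) \<and> z' = cl L (Suc N) p' \<and>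
      v \<in> TN L (Suc N) \<and> p' - p - v \<in> UI L (Suc N)"
    if z: "z \<in> carrier (Ugl L N)" and z': "z' \<in> A_fin d L (Suc N)" "co L N z = trunc L N (co L (Suc N) z')" for z z'
  proof -
    obtain p where p: "p \<in> FC L N" "z = cl L N p" using z by (rule UglE)
    have z'U: "z' \<in> carrier (Ugl L (Suc N))" "Inv d L (Suc N) (co L (Suc N) z')" using z'(1) by (simp_all add: A_fin_iff)
    obtain p' where p': "p' \<in> FC L (Suc N)" "z' = cl L (Suc N) p'" using z'U(1) by (rule UglE)
    have pN: "p \<in> FC L (Suc N)" using FC_mono[of N "Suc N" L] p(1) by auto
    have ph: "phi (Suc N) (p' - p) = (\<lambda>r. co L (Suc N) z' r - co L N z r)"
      unfolding phi_diff p(2) p'(2) co_cl[OF p(1)] co_cl[OF p'(1)] phi_mono[OF p(1), of "Suc N", simplified] ..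
    have I: "Inv N L (Suc N) (phi (Suc N) (p' - p))"
      unfolding ph using co_Sp[OF z] unfolding Sp_def
      by (intro Inv_diff Inv_mono[OF z'U(2) d] Inv_top_column) blast
    have "tf_zero (Suc N) (phi (Suc N) (p' - p))"
    proof (rule balanced_target_free[OF order_refl _ I])
      show "supp_in (Ed L (Suc N)) (phi (Suc N) (p' - p))" by (rule supp_phi) (use p' pN in simp)
      show "phi (Suc N) (p' - p) es = 0" if "set es \<subseteq> Ed L N" for es
        unfolding ph using z'(2) that by (simp add: trunc_def)
    qed
    then obtain v where "v \<in> TN L (Suc N)" "p' - p - v \<in> UI L (Suc N)"
      using tf_zero_imp_TN[of "p' - p" L "Suc N"] p' pN by auto
    then show ?thesis using p p' by blast
  qed
  obtain p p' v where p: "p \<in> FC L N" "x = cl L N p" "p' \<in> FC L (Suc N)" "x' = cl L (Suc N) p'"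
      "v \<in> TN L (Suc N)" "p' - p - v \<in> UI L (Suc N)" using rep[OF x x'] by blast
  obtain q q' w where q: "q \<in> FC L N" "y = cl L N q" "q' \<in> FC L (Suc N)" "y' = cl L (Suc N) q'"
      "w \<in> TN L (Suc N)" "q' - q - w \<in> UI L (Suc N)" using rep[OF y y'] by blast
  have pN: "p \<in> FC L (Suc N)" and qN: "q \<in> FC L (Suc N)" using FC_mono[of N "Suc N" L] p(1) q(1) by auto
  note vF = TN_FC[OF p(5)] and wF = TN_FC[OF q(5)]
  have "p' * q' - (p * q + v * q + (p + v) * w) = (p' - p - v) * q' + (p + v) * (q' - q - w)"
    by (simp add: algebra_simps)
  also have "\<dots> \<in> UI L (Suc N)"
    by (intro UI_add UI_mult_left UI_mult_right p(6) q(6)) (use q pN vF in simp_all)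
  finally have "phi (Suc N) (p' * q') = phi (Suc N) (p * q + v * q + (p + v) * w)"
    using phi_UI[of "p' * q' - (p * q + v * q + (p + v) * w)" L "Suc N"] by (simp add: phi_diff fun_eq_iff)
  also have "\<dots> = (\<lambda>r. phi N (p * q) r + phi (Suc N) (v * q) r + phi (Suc N) ((p + v) * w) r)"
    using phi_mono[of "p * q" L N "Suc N"] p(1) q(1) by (simp add: phi_add)
  finally have eq: "phi (Suc N) (p' * q') = (\<lambda>r. phi N (p * q) r + phi (Suc N) (v * q) r + phi (Suc N) ((p + v) * w) r)" .
  have 1: "tf_zero (Suc N) (phi (Suc N) (v * q))" by (rule tf_zero_mult_small[OF q(1) TN_tf_zero[OF p(5)]])
  have 2: "tf_zero (Suc N) (phi (Suc N) ((p + v) * w))" by (rule TN_tf_zero[OF TN_mult[OF q(5)]]) (use pN vF in simp)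
  have "trunc L N (phi (Suc N) (p' * q')) = phi N (p * q)"
  proof
    fix es
    show "trunc L N (phi (Suc N) (p' * q')) es = phi N (p * q) es"
    proof (cases "set es \<subseteq> Ed L N")
      case True
      then show ?thesis using 1 2 target_free_Ed[OF True] unfolding eq tf_zero_def trunc_def by simp
    next
      case False
      then show ?thesis using supp_inD[OF supp_phi, of "p * q" L N es] p q by (simp add: trunc_def)
    qed
  qed
  then show ?thesis
    unfolding p(2,4) q(2,4) Ugl_mult[OF p(1) q(1)] Ugl_mult[OF p(3) q(3)] using p q by (simp add: co_cl)
qed

text \<open>The functions that represent elements of the inverse limit.\<close>

definition good :: "nat \<Rightarrow> nat \<Rightarrow> coef \<Rightarrow> bool" where
  "good d L f \<longleftrightarrow> symf f \<and> (\<exists>n. deg_le n f) \<and> (\<forall>es. f es ~= 0 --> (\<exists>N. set es \<subseteq> Ed L N)) \<and> (\<forall>N. Inv d L N f)"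

definition vbound :: "edge list \<Rightarrow> nat" where "vbound es = sum_list (map (\<lambda>(c, i, j). i + j) es)"

lemma Ed_vbound: "set es \<subseteq> Ed L N ==> set es \<subseteq> Ed L (k + vbound es)"
proof
  fix e assume es: "set es \<subseteq> Ed L N" and e: "e \<in> set es"
  obtain c i j where eq: "e = (c, i, j)" by (cases e) auto
  have "i + j \<in> set (map (\<lambda>(c, i, j). i + j) es)" using e eq by force
  then have "i + j \<le> vbound es" unfolding vbound_def by (rule member_le_sum_list) simp
  then show "e \<in> Ed L (k + vbound es)" using subsetD[OF es e] eq by (auto simp: Ed_def)
qed

text \<open>The coefficients at a list stabilise as soon as all its vertices are available; \<open>vbound\<close> makes the index large enough for the given list.\<close>

definition psi :: "nat \<Rightarrow> nat \<Rightarrow> (nat \<Rightarrow> uea_elem) \<Rightarrow> coef" where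
  "psi d L x = (\<lambda>es. co L (max d 1 + vbound es) (x (max d 1 + vbound es)) es)"

lemma Dop_cong_on:
  assumes "set es \<subseteq> Ed L N" "a \<in> {1..N}" "b \<in> {1..N}" "\<And>r. set r \<subseteq> Ed L N ==> f r = g r"
  shows "Dop a b f es = Dop a b g es"
  using assms(1,4) unfolding Dop_def
proof (induction es arbitrary: f g)
  case (Cons e es)
  obtain c i j where e: "e = (c, i, j)" by (cases e) auto
  have E: "(c, b, j) \<in> Ed L N" "(c, i, a) \<in> Ed L N" using Cons.prems(1) assms(2,3) e by (auto simp: Ed_def)
  have "dm a b e (\<lambda>e'. f (e' # es)) = dm a b e (\<lambda>e'. g (e' # es))"
    using E Cons.prems unfolding dm_def e by simp
  moreover have "gop (\<lambda>_. 0) (dm a b) (\<lambda>r. f (e # r)) es = gop (\<lambda>_. 0) (dm a b) (\<lambda>r. g (e # r)) es"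
    by (rule Cons.IH) (use Cons.prems in simp_all)
  ultimately show ?case by simp
qed simp

lemma Inv_trunc: "Inv d L N (trunc L N f) \<longleftrightarrow> Inv d L N f"
proof -
  have "Dop a b (trunc L N f) es = Dop a b f es"
    if "set es \<subseteq> Ed L N" "a \<in> {d<..N}" "b \<in> {d<..N}" for a b es
    by (rule Dop_cong_on[of es L N]) (use that in \<open>auto simp: trunc_def\<close>)
  then show ?thesis unfolding Inv_def by simp
qed

lemma A_lim_sel:
  "x \<otimes>\<^bsub>A_lim d L\<^esub> y = (\<lambda>N\<in>{max d 1..}. x N \<otimes>\<^bsub>Ugl L N\<^esub> y N)"
  "x \<oplus>\<^bsub>A_lim d L\<^esub> y = (\<lambda>N\<in>{max d 1..}. x N \<oplus>\<^bsub>Ugl L N\<^esub> y N)"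
  "\<one>\<^bsub>A_lim d L\<^esub> = (\<lambda>N\<in>{max d 1..}. \<one>\<^bsub>Ugl L N\<^esub>)" "\<zero>\<^bsub>A_lim d L\<^esub> = (\<lambda>N\<in>{max d 1..}. \<zero>\<^bsub>Ugl L N\<^esub>)"
  "c \<odot>\<^bsub>A_lim d L\<^esub> x = (\<lambda>N\<in>{max d 1..}. c \<odot>\<^bsub>Ugl L N\<^esub> x N)"
  by (simp_all add: A_lim_def)

lemma A_lim_carrier:
  "x \<in> carrier (A_lim d L) \<longleftrightarrow> x \<in> extensional {max d 1..} \<and> (\<forall>N\<ge>max d 1. x N \<in> A_fin d L N) \<and>
    (\<forall>N\<ge>max d 1. pi_proj L (Suc N) (x (Suc N)) = x N) \<and> (\<exists>n. \<forall>N\<ge>max d 1. x N \<in> uea_filtration (gl_sum L N) n)"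
  unfolding A_lim_def PiE_def Pi_def by auto

lemma A_lim_intro:
  assumes ext: "x \<in> extensional {max d 1..}" and f: "good d L f"
    and x: "\<And>N. N \<ge> max d 1 ==> x N \<in> carrier (Ugl L N)" "\<And>N. N \<ge> max d 1 ==> co L N (x N) = trunc L N f"
  shows "x \<in> carrier (A_lim d L)" "psi d L x = f"
proof -
  have A: "x N \<in> A_fin d L N" if "N \<ge> max d 1" for N
    using x[OF that] f unfolding A_fin_iff good_def by (simp add: Inv_trunc)
  have pi: "pi_proj L (Suc N) (x (Suc N)) = x N" if N: "N \<ge> max d 1" for N
  proof -
    have "co L N (x N) = trunc L N (co L (Suc N) (x (Suc N)))"
      unfolding x(2)[OF N] x(2)[OF le_SucI[OF N]] by (rule trunc_trunc[symmetric]) simp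
    moreover have "d \<le> N" using N by simp
    ultimately show ?thesis using pi_proj_eq[OF A[OF le_SucI[OF N]] _ x(1)[OF N]] by blast
  qed
  obtain n where "deg_le n f" using f unfolding good_def by blast
  then have "x N \<in> uea_filtration (gl_sum L N) n" if "N \<ge> max d 1" for N
    unfolding co_filtration using x[OF that] by (auto simp: deg_le_def trunc_def)
  then show "x \<in> carrier (A_lim d L)" unfolding A_lim_carrier using ext A pi by blast
  show "psi d L x = f"
  proof
    fix es
    have "psi d L x es = trunc L (max d 1 + vbound es) f es" unfolding psi_def by (subst x(2)) simp_all
    also have "\<dots> = f es"
    proof (cases "f es = 0")
      case False
      then obtain N where "set es \<subseteq> Ed L N" using f unfolding good_def by blast
      then show ?thesis using Ed_vbound unfolding trunc_def by simp
    qed (simp add: trunc_def)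
    finally show "psi d L x es = f es" .
  qed
qed

text \<open>The projections restrict coefficient functions, so the compatible functions of a sequence glue to one function.\<close>

theorem A_lim_elim:
  assumes x: "x \<in> carrier (A_lim d L)"
  shows "good d L (psi d L x)" "\<And>N. N \<ge> max d 1 ==> x N \<in> carrier (Ugl L N)"
    "\<And>N. N \<ge> max d 1 ==> co L N (x N) = trunc L N (psi d L x)"
proof -
  let ?m = "max d 1" and ?f = "psi d L x"
  have A: "x N \<in> A_fin d L N" if "N \<ge> ?m" for N using x that unfolding A_lim_carrier by blast
  show U: "x N \<in> carrier (Ugl L N)" if "N \<ge> ?m" for N using A[OF that] by (simp add: A_fin_iff)
  have S: "Sp L N (co L N (x N))" if "N \<ge> ?m" for N by (rule co_Sp[OF U[OF that]])
  have step: "co L N (x N) = trunc L N (co L (Suc N) (x (Suc N)))" if N: "N \<ge> ?m" for N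
  proof -
    have "pi_proj L (Suc N) (x (Suc N)) = x N" using x N unfolding A_lim_carrier by blast
    moreover have "d \<le> N" using N by simp
    ultimately show ?thesis using pi_proj_eq[OF A[OF le_SucI[OF N]] _ U[OF N]] by blast
  qed
  have steps: "co L N (x N) = trunc L N (co L (N + k) (x (N + k)))" if N: "N \<ge> ?m" for N k
  proof (induction k)
    case 0
    show ?case using S[OF N] trunc_supp unfolding Sp_def by simp
  next
    case (Suc k)
    have "co L (N + k) (x (N + k)) = trunc L (N + k) (co L (Suc (N + k)) (x (Suc (N + k))))"
      by (rule step) (use N in simp)
    then show ?case using Suc by (simp add: trunc_trunc)
  qed
  have val: "?f es = co L N (x N) es" if N: "N \<ge> ?m" and es: "set es \<subseteq> Ed L N" for N es
  proof -
    let ?M = "?m + vbound es"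
    have M: "set es \<subseteq> Ed L ?M" by (rule Ed_vbound[OF es])
    have "co L N (x N) es = co L (N + ?M) (x (N + ?M)) es" using steps[OF N, of ?M] es by (simp add: trunc_def)
    moreover have "co L ?M (x ?M) es = co L (?M + N) (x (?M + N)) es" using steps[of ?M N] M by (simp add: trunc_def)
    ultimately show ?thesis unfolding psi_def by (simp add: add.commute)
  qed
  show tr: "co L N (x N) = trunc L N ?f" if N: "N \<ge> ?m" for N
  proof
    fix es
    show "co L N (x N) es = trunc L N ?f es"
      using val[OF N, of es] S[OF N] supp_inD[of "Ed L N" "co L N (x N)" es] unfolding Sp_def trunc_def by auto
  qed
  have supp: "\<exists>N. set es \<subseteq> Ed L N" if "?f es ~= 0" for es
    using that S[of "?m + vbound es"] unfolding psi_def Sp_def supp_in_def by auto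
  have common: "?m \<le> ?m + N + M" "set es \<subseteq> Ed L (?m + N + M)" if "set es \<subseteq> Ed L N" for es N M
    using that Ed_mono[of N "?m + N + M" L] by auto
  have "symf ?f" unfolding symf_def
  proof (intro allI impI)
    fix es es' :: "edge list" assume eq: "mset es = mset es'"
    show "?f es = ?f es'"
    proof (cases "\<exists>N. set es \<subseteq> Ed L N")
      case True
      then obtain N where N: "set es \<subseteq> Ed L N" by blast
      have N': "set es' \<subseteq> Ed L N" using N mset_eq_setD[OF eq] by simp
      let ?K = "?m + N + 0"
      have "symf (co L ?K (x ?K))" using S[of ?K] unfolding Sp_def by simp
      then show ?thesis using val[OF common[OF N, of 0]] val[OF common[OF N', of 0]] symfD[OF _ eq] by metis
    next
      case False
      then have "\<not> (\<exists>N. set es' \<subseteq> Ed L N)" using mset_eq_setD[OF eq] by simp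
      then show ?thesis using supp[of es] supp[of es'] False by metis
    qed
  qed
  moreover have "\<exists>n. deg_le n ?f"
  proof -
    obtain n where n: "\<And>N. N \<ge> ?m ==> x N \<in> uea_filtration (gl_sum L N) n" using x unfolding A_lim_carrier by blast
    have "deg_le n ?f" unfolding deg_le_def psi_def
    proof (intro allI impI)
      fix es :: "edge list" assume len: "n < length es"
      have "deg_le n (co L (?m + vbound es) (x (?m + vbound es)))"
        using n[of "?m + vbound es"] unfolding co_filtration by simp
      then show "co L (?m + vbound es) (x (?m + vbound es)) es = 0" using len by (rule deg_leD)
    qed
    then show ?thesis by blast
  qed
  moreover have "Inv d L N ?f" for N
  proof (cases "N \<ge> ?m")
    case True
    have "Inv d L N (co L N (x N))" using A[OF True] by (simp add: A_fin_iff)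
    then show ?thesis unfolding tr[OF True] Inv_trunc .
  next
    case False
    then show ?thesis unfolding Inv_def by auto
  qed
  ultimately show "good d L ?f" unfolding good_def using supp by blast
qed

lemma psi_inj:
  assumes "x \<in> carrier (A_lim d L)" "y \<in> carrier (A_lim d L)" "psi d L x = psi d L y"
  shows "x = y"
proof (rule extensionalityI[of _ "{max d 1..}"])
  show "x \<in> extensional {max d 1..}" "y \<in> extensional {max d 1..}" using assms unfolding A_lim_carrier by blast+
  fix N assume "N \<in> {max d 1..}"
  then have N: "N \<ge> max d 1" by simp
  show "x N = y N"
    by (rule co_inj[OF A_lim_elim(2)[OF assms(1) N] A_lim_elim(2)[OF assms(2) N]])
      (simp add: A_lim_elim(3)[OF assms(1) N] A_lim_elim(3)[OF assms(2) N] assms(3))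
qed

theorem psi_surj:
  assumes f: "good d L f"
  obtains x where "x \<in> carrier (A_lim d L)" "psi d L x = f"
proof -
  have "\<exists>u. u \<in> carrier (Ugl L N) \<and> co L N u = trunc L N f" for N
    using co_surj[of L N "trunc L N f"] Sp_trunc f unfolding good_def by metis
  then obtain u where u: "\<And>N. u N \<in> carrier (Ugl L N)" "\<And>N. co L N (u N) = trunc L N f" by metis
  show thesis
    using A_lim_intro[of "\<lambda>N\<in>{max d 1..}. u N", OF _ f] u that by simp
qed

lemma good_linear:
  assumes "good d L f" "good d L g"
  shows "good d L (\<lambda>r. f r + g r)" "good d L (\<lambda>r. c * f r)"
proof -
  obtain n m where nm: "deg_le n f" "deg_le m g" using assms unfolding good_def by blast
  have "deg_le (max n m) (\<lambda>r. f r + g r)" "deg_le n (\<lambda>r. c * f r)" using nm unfolding deg_le_def by auto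
  moreover have "symf (\<lambda>r. f r + g r)" using assms by (intro symf_add) (simp_all add: good_def)
  moreover have "symf (\<lambda>r. c * f r)" using assms(1) unfolding good_def symf_def by metis
  moreover have "\<exists>N. set es \<subseteq> Ed L N" if "f es + g es ~= 0" for es
    using that assms unfolding good_def by (cases "f es = 0") auto
  moreover have "\<exists>N. set es \<subseteq> Ed L N" if "c * f es ~= 0" for es
    using that assms unfolding good_def by auto
  moreover have "Inv d L N (\<lambda>r. f r + g r)" "Inv d L N (\<lambda>r. c * f r)" for N
  proof -
    have "Inv d L N f" "Inv d L N g" using assms unfolding good_def by blast+
    then show "Inv d L N (\<lambda>r. f r + g r)" "Inv d L N (\<lambda>r. c * f r)"
      unfolding Inv_def Dop_def by (simp_all add: gop_add[OF functional_dm] gop_scale[OF functional_dm])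
  qed
  ultimately show "good d L (\<lambda>r. f r + g r)" "good d L (\<lambda>r. c * f r)" unfolding good_def by blast+
qed

lemma Dop_vac: "Dop a b vac es = 0"
proof (cases es)
  case (Cons e r)
  have "Dop a b vac es = psum (\<lambda>e r. 0 * vac r) es"
    unfolding Dop_def by (rule gop_top[OF functional_dm]) (auto simp: Cons vac_def)
  then show ?thesis by simp
qed (simp add: Dop_def)

lemma good_vac: "good d L vac"
  unfolding good_def
proof (intro conjI)
  show "\<exists>n. deg_le n vac" using deg_le_vac by blast
  show "\<forall>es. vac es ~= 0 --> (\<exists>N. set es \<subseteq> Ed L N)" by (auto simp: vac_def)
qed (simp_all add: symf_vac Inv_def Dop_vac)

lemma trunc_add: "trunc L N (\<lambda>r. f r + g r) = (\<lambda>r. trunc L N f r + trunc L N g r)"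
  and trunc_scale: "trunc L N (\<lambda>r. c * f r) = (\<lambda>r. c * trunc L N f r)"
  and trunc_vac: "trunc L N vac = vac"
  by (auto simp: trunc_def fun_eq_iff vac_def)

lemma A_lim_add:
  assumes "x \<in> carrier (A_lim d L)" "y \<in> carrier (A_lim d L)"
  shows "x \<oplus>\<^bsub>A_lim d L\<^esub> y \<in> carrier (A_lim d L)" "psi d L (x \<oplus>\<^bsub>A_lim d L\<^esub> y) = (\<lambda>r. psi d L x r + psi d L y r)"
proof -
  note x = A_lim_elim[OF assms(1)] and y = A_lim_elim[OF assms(2)]
  have *: "x \<oplus>\<^bsub>A_lim d L\<^esub> y \<in> extensional {max d 1..}" "good d L (\<lambda>r. psi d L x r + psi d L y r)"
    by (simp_all add: A_lim_sel good_linear x(1) y(1))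
  have "(x \<oplus>\<^bsub>A_lim d L\<^esub> y) N \<in> carrier (Ugl L N)" "co L N ((x \<oplus>\<^bsub>A_lim d L\<^esub> y) N) = trunc L N (\<lambda>r. psi d L x r + psi d L y r)"
    if "N \<ge> max d 1" for N
    using that x(2,3)[OF that] y(2,3)[OF that] by (simp_all add: A_lim_sel Ugl_closed co_simps trunc_add)
  then show "x \<oplus>\<^bsub>A_lim d L\<^esub> y \<in> carrier (A_lim d L)" "psi d L (x \<oplus>\<^bsub>A_lim d L\<^esub> y) = (\<lambda>r. psi d L x r + psi d L y r)"
    using A_lim_intro[OF *] by blast+
qed

lemma A_lim_smult:
  assumes "x \<in> carrier (A_lim d L)"
  shows "c \<odot>\<^bsub>A_lim d L\<^esub> x \<in> carrier (A_lim d L)" "psi d L (c \<odot>\<^bsub>A_lim d L\<^esub> x) = (\<lambda>r. c * psi d L x r)"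
proof -
  note x = A_lim_elim[OF assms(1)]
  have *: "c \<odot>\<^bsub>A_lim d L\<^esub> x \<in> extensional {max d 1..}" "good d L (\<lambda>r. c * psi d L x r)"
    using good_linear(2)[OF x(1) x(1)] by (simp_all add: A_lim_sel)
  have "(c \<odot>\<^bsub>A_lim d L\<^esub> x) N \<in> carrier (Ugl L N)" "co L N ((c \<odot>\<^bsub>A_lim d L\<^esub> x) N) = trunc L N (\<lambda>r. c * psi d L x r)"
    if "N \<ge> max d 1" for N
    using that x(2,3)[OF that] by (simp_all add: A_lim_sel Ugl_closed co_simps trunc_scale)
  then show "c \<odot>\<^bsub>A_lim d L\<^esub> x \<in> carrier (A_lim d L)" "psi d L (c \<odot>\<^bsub>A_lim d L\<^esub> x) = (\<lambda>r. c * psi d L x r)"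
    using A_lim_intro[OF *] by blast+
qed

lemma A_lim_one: "\<one>\<^bsub>A_lim d L\<^esub> \<in> carrier (A_lim d L)" "psi d L \<one>\<^bsub>A_lim d L\<^esub> = vac"
proof -
  have *: "\<one>\<^bsub>A_lim d L\<^esub> \<in> extensional {max d 1..}" by (simp add: A_lim_sel)
  show "\<one>\<^bsub>A_lim d L\<^esub> \<in> carrier (A_lim d L)" "psi d L \<one>\<^bsub>A_lim d L\<^esub> = vac"
    using A_lim_intro[OF * good_vac] by (simp_all add: A_lim_sel Ugl_closed co_simps trunc_vac)
qed

lemma A_lim_zero: "\<zero>\<^bsub>A_lim d L\<^esub> \<in> carrier (A_lim d L)" "psi d L \<zero>\<^bsub>A_lim d L\<^esub> = (\<lambda>_. 0)"
proof -
  have *: "\<zero>\<^bsub>A_lim d L\<^esub> \<in> extensional {max d 1..}" by (simp add: A_lim_sel)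
  have g: "good d L (\<lambda>_. 0)" using good_linear(2)[OF good_vac good_vac, of d L 0] by simp
  show "\<zero>\<^bsub>A_lim d L\<^esub> \<in> carrier (A_lim d L)" "psi d L \<zero>\<^bsub>A_lim d L\<^esub> = (\<lambda>_. 0)"
    using A_lim_intro[OF * g] by (simp_all add: A_lim_sel Ugl_closed co_simps trunc_def)
qed

lemma A_lim_mult:
  assumes x: "x \<in> carrier (A_lim d L)" and y: "y \<in> carrier (A_lim d L)"
  shows "x \<otimes>\<^bsub>A_lim d L\<^esub> y \<in> carrier (A_lim d L)"
    "\<And>n m es. deg_le n (psi d L x) ==> deg_le m (psi d L y) ==> n + m \<le> length es ==>
      psi d L (x \<otimes>\<^bsub>A_lim d L\<^esub> y) es = conv (psi d L x) (psi d L y) es"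
proof -
  let ?m = "max d 1" and ?xy = "x \<otimes>\<^bsub>A_lim d L\<^esub> y"
  note x' = A_lim_elim[OF x] and y' = A_lim_elim[OF y]
  have xy: "?xy N = x N \<otimes>\<^bsub>Ugl L N\<^esub> y N" if "N \<ge> ?m" for N using that by (simp add: A_lim_sel)
  have Ax: "x N \<in> A_fin d L N" and Ay: "y N \<in> A_fin d L N" if "N \<ge> ?m" for N
    using x y that unfolding A_lim_carrier by blast+
  have A: "?xy N \<in> A_fin d L N" if N: "N \<ge> ?m" for N
  proof -
    interpret ring "Ugl L N" by (rule ring_Ugl)
    have g: "gl_gen L N (gl_diag L z) \<in> carrier (Ugl L N)" if "z \<in> gl_sub d N" for z
      using co_gl_gen(1)[OF gl_diag_glc[OF that] zero_closed] .
    show ?thesis unfolding xy[OF N] A_fin_def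
    proof (intro CollectI conjI ballI)
      show "x N \<otimes>\<^bsub>Ugl L N\<^esub> y N \<in> carrier (Ugl L N)" using x'(2)[OF N] y'(2)[OF N] by simp
      fix z assume z: "z \<in> gl_sub d N"
      let ?g = "gl_gen L N (gl_diag L z)"
      have c: "?g \<otimes>\<^bsub>Ugl L N\<^esub> x N = x N \<otimes>\<^bsub>Ugl L N\<^esub> ?g" "?g \<otimes>\<^bsub>Ugl L N\<^esub> y N = y N \<otimes>\<^bsub>Ugl L N\<^esub> ?g"
        using Ax[OF N] Ay[OF N] z unfolding A_fin_def by blast+
      have "?g \<otimes>\<^bsub>Ugl L N\<^esub> (x N \<otimes>\<^bsub>Ugl L N\<^esub> y N) = (x N \<otimes>\<^bsub>Ugl L N\<^esub> ?g) \<otimes>\<^bsub>Ugl L N\<^esub> y N"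
        using m_assoc[OF g[OF z] x'(2)[OF N] y'(2)[OF N]] c(1) by simp
      also have "\<dots> = x N \<otimes>\<^bsub>Ugl L N\<^esub> (y N \<otimes>\<^bsub>Ugl L N\<^esub> ?g)"
        using m_assoc[OF x'(2)[OF N] g[OF z] y'(2)[OF N]] c(2) by simp
      also have "\<dots> = (x N \<otimes>\<^bsub>Ugl L N\<^esub> y N) \<otimes>\<^bsub>Ugl L N\<^esub> ?g"
        using m_assoc[OF x'(2)[OF N] y'(2)[OF N] g[OF z]] by simp
      finally show "?g \<otimes>\<^bsub>Ugl L N\<^esub> (x N \<otimes>\<^bsub>Ugl L N\<^esub> y N) = (x N \<otimes>\<^bsub>Ugl L N\<^esub> y N) \<otimes>\<^bsub>Ugl L N\<^esub> ?g" .
    qed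
  qed
  have pi: "pi_proj L (Suc N) (?xy (Suc N)) = ?xy N" if N: "N \<ge> ?m" for N
  proof -
    have N': "Suc N \<ge> ?m" and d: "d \<le> N" using N by simp_all
    have tr: "co L N (z N) = trunc L N (co L (Suc N) (z (Suc N)))" if z: "z \<in> carrier (A_lim d L)" for z
      unfolding A_lim_elim(3)[OF z N] A_lim_elim(3)[OF z N'] by (rule trunc_trunc[symmetric]) simp
    have "co L N (?xy N) = trunc L N (co L (Suc N) (?xy (Suc N)))"
      unfolding xy[OF N] xy[OF N']
      by (rule trunc_mult[OF x'(2)[OF N] Ax[OF N'] tr[OF x] y'(2)[OF N] Ay[OF N'] tr[OF y] d, symmetric])
    moreover have "?xy N \<in> carrier (Ugl L N)" using A[OF N] by (simp add: A_fin_iff)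
    ultimately show ?thesis using pi_proj_eq[OF A[OF N'] d] by blast
  qed
  have top: "co L N (?xy N) es = conv (trunc L N (psi d L x)) (trunc L N (psi d L y)) es"
    if N: "N \<ge> ?m" and "deg_le n (psi d L x)" "deg_le m (psi d L y)" "n + m \<le> length es" for N n m es
  proof -
    have "deg_le n (trunc L N (psi d L x))" "deg_le m (trunc L N (psi d L y))"
      using that by (auto simp: deg_le_def trunc_def)
    then show ?thesis
      unfolding xy[OF N] using co_mult_top[OF x'(2)[OF N] _ y'(2)[OF N] _ that(4)] x'(3)[OF N] y'(3)[OF N] by simp
  qed
  obtain n m where nm: "deg_le n (psi d L x)" "deg_le m (psi d L y)" using x'(1) y'(1) unfolding good_def by blast
  have "?xy N \<in> uea_filtration (gl_sum L N) (n + m)" if N: "N \<ge> ?m" for N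
    unfolding co_filtration
  proof
    show "?xy N \<in> carrier (Ugl L N)" using A[OF N] by (simp add: A_fin_iff)
    show "deg_le (n + m) (co L N (?xy N))" unfolding deg_le_def
    proof (intro allI impI)
      fix es :: "edge list" assume len: "n + m < length es"
      have "deg_le n (trunc L N (psi d L x))" "deg_le m (trunc L N (psi d L y))"
        using nm by (auto simp: deg_le_def trunc_def)
      then show "co L N (?xy N) es = 0" using top[OF N nm, of es] conv_deg len by simp
    qed
  qed
  moreover have "?xy \<in> extensional {?m..}" by (simp add: A_lim_sel)
  ultimately show xyA: "?xy \<in> carrier (A_lim d L)" unfolding A_lim_carrier using A pi by blast
  fix n m and es :: "edge list" assume deg: "deg_le n (psi d L x)" "deg_le m (psi d L y)" "n + m \<le> length es"
  let ?N = "?m + vbound es"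
  have N: "?N \<ge> ?m" by simp
  have "psi d L ?xy es = conv (trunc L ?N (psi d L x)) (trunc L ?N (psi d L y)) es"
    unfolding psi_def[of d L ?xy] by (rule top[OF N deg])
  also have "\<dots> = conv (psi d L x) (psi d L y) es"
  proof (rule conv_cong)
    fix r1 r2 assume "mset es = mset r1 + mset r2"
    then have s: "set es = set r1 \<union> set r2" by (metis set_mset_mset set_mset_union)
    show "trunc L ?N (psi d L x) r1 * trunc L ?N (psi d L y) r2 = psi d L x r1 * psi d L y r2"
    proof (cases "psi d L x r1 = 0 \<or> psi d L y r2 = 0")
      case True
      then show ?thesis by (auto simp: trunc_def)
    next
      case False
      then obtain N1 N2 where "set r1 \<subseteq> Ed L N1" "set r2 \<subseteq> Ed L N2" using x'(1) y'(1) unfolding good_def by blast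
      then have "set es \<subseteq> Ed L (N1 + N2)" using s Ed_mono[of N1 "N1 + N2" L] Ed_mono[of N2 "N1 + N2" L] by auto
      then have "set es \<subseteq> Ed L ?N" by (rule Ed_vbound)
      then show ?thesis using s by (simp add: trunc_def)
    qed
  qed
  finally show "psi d L ?xy es = conv (psi d L x) (psi d L y) es" .
qed

section \<open>Embedding into a ring of sequences of operators\<close>

text \<open>Multiplication in the inverse limit is not determined by leading terms; as operators the elements multiply exactly.\<close>

definition emb :: "nat \<Rightarrow> nat \<Rightarrow> (nat \<Rightarrow> uea_elem) \<Rightarrow> nat \<Rightarrow> lin" where
  "emb d L x = (\<lambda>N. Rl L (N + max d 1) (x (N + max d 1)))"

lemma emb_simps:
  assumes x: "x \<in> carrier (A_lim d L)"
  shows "y \<in> carrier (A_lim d L) ==> emb d L (x \<otimes>\<^bsub>A_lim d L\<^esub> y) = emb d L x * emb d L y"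
    "y \<in> carrier (A_lim d L) ==> emb d L (x \<oplus>\<^bsub>A_lim d L\<^esub> y) = emb d L x + emb d L y"
    "emb d L (c \<odot>\<^bsub>A_lim d L\<^esub> x) = (\<lambda>_. scal c) * emb d L x"
    "emb d L \<one>\<^bsub>A_lim d L\<^esub> = 1" "emb d L \<zero>\<^bsub>A_lim d L\<^esub> = 0"
proof -
  have c: "z (k + max d 1) \<in> carrier (Ugl L (k + max d 1))" if "z \<in> carrier (A_lim d L)" for z k
    by (rule A_lim_elim(2)[OF that]) simp
  have xk: "x (k + max d 1) \<in> carrier (Ugl L (k + max d 1))" for k by (rule c[OF x])
  {
    assume y: "y \<in> carrier (A_lim d L)"
    have yk: "y (k + max d 1) \<in> carrier (Ugl L (k + max d 1))" for k by (rule c[OF y])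
    show "emb d L (x \<otimes>\<^bsub>A_lim d L\<^esub> y) = emb d L x * emb d L y" "emb d L (x \<oplus>\<^bsub>A_lim d L\<^esub> y) = emb d L x + emb d L y"
      using Rl_simps(3)[OF xk yk] Rl_simps(4)[OF xk yk] by (simp_all add: fun_eq_iff emb_def A_lim_sel)
  }
  show "emb d L (c \<odot>\<^bsub>A_lim d L\<^esub> x) = (\<lambda>_. scal c) * emb d L x"
    using Rl_simps(5)[OF xk] by (simp add: fun_eq_iff emb_def A_lim_sel)
  show "emb d L \<one>\<^bsub>A_lim d L\<^esub> = 1" "emb d L \<zero>\<^bsub>A_lim d L\<^esub> = 0"
    by (simp_all add: fun_eq_iff emb_def A_lim_sel Rl_simps)
qed

lemma emb_inj:
  assumes x: "x \<in> carrier (A_lim d L)" and y: "y \<in> carrier (A_lim d L)" and eq: "emb d L x = emb d L y"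
  shows "x = y"
proof (rule psi_inj[OF x y])
  have "Rl L (max d 1 + k) (x (max d 1 + k)) = Rl L (max d 1 + k) (y (max d 1 + k))" for k
    using fun_cong[OF eq, of k] by (simp add: emb_def add.commute)
  then show "psi d L x = psi d L y" unfolding psi_def co_def by simp
qed

theorem ring_A_lim: "ring (A_lim d L)"
proof (rule ring_by_embedding[of "emb d L"])
  show "inj_on (emb d L) (carrier (A_lim d L))" by (rule inj_onI) (rule emb_inj)
  show "\<exists>y\<in>carrier (A_lim d L). emb d L y = - emb d L x" if "x \<in> carrier (A_lim d L)" for x
  proof (rule bexI[of _ "(-1) \<odot>\<^bsub>A_lim d L\<^esub> x"])
    show "emb d L ((-1) \<odot>\<^bsub>A_lim d L\<^esub> x) = - emb d L x"
      unfolding emb_simps(3)[OF that] by (simp add: fun_eq_iff)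
  qed (rule A_lim_smult(1)[OF that])
qed (simp_all add: A_lim_mult A_lim_add A_lim_one A_lim_zero emb_simps emb_simps(4,5)[OF A_lim_one(1)])

lemma A0_embed_psi:
  assumes "x \<in> carrier (A_lim 0 L)"
  shows "A0_embed d x \<in> carrier (A_lim d L)" "psi d L (A0_embed d x) = psi 0 L x"
proof -
  note x = A_lim_elim[OF assms]
  have g: "good d L (psi 0 L x)" using x(1) Inv_mono[of 0 L _ _ d] unfolding good_def by blast
  have *: "A0_embed d x \<in> extensional {max d 1..}" by (simp add: A0_embed_def)
  have "A0_embed d x N \<in> carrier (Ugl L N)" "co L N (A0_embed d x N) = trunc L N (psi 0 L x)" if "N \<ge> max d 1" for N
    using x(2,3)[of N] that by (simp_all add: A0_embed_def)
  then show "A0_embed d x \<in> carrier (A_lim d L)" "psi d L (A0_embed d x) = psi 0 L x"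
    using A_lim_intro[OF * g] by blast+
qed

section \<open>Functions counting trails\<close>

text \<open>The number of ways to order the edges of a list into a trail from \<open>i\<close> to \<open>j\<close> with colours \<open>w\<close>.\<close>

primrec psym :: "nat list \<Rightarrow> nat \<Rightarrow> nat \<Rightarrow> coef" where
  "psym [] = (\<lambda>i j es. if es = [] \<and> i = j then 1 else 0)"
| "psym (\<alpha> # w) = (\<lambda>i j es. psum (\<lambda>e r. case e of (c, s, t) \<Rightarrow> if c = \<alpha> \<and> s = i then psym w t j r else 0) es)"

definition csym :: "nat list \<Rightarrow> coef" where
  "csym w = (\<lambda>es. case w of [] \<Rightarrow> 0 | \<alpha> # w' \<Rightarrow>
     psum (\<lambda>e r. case e of (c, s, t) \<Rightarrow> if c = \<alpha> then psym w' t s r else 0) es)"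

text \<open>The full coefficient function of a path generator. The second summand is a bracket term, which has smaller degree, so the leading part is
  \<open>psym\<close>.\<close>

primrec tfun :: "nat list \<Rightarrow> nat \<Rightarrow> nat \<Rightarrow> coef" where
  "tfun [] = (\<lambda>i j es. if es = [] \<and> i = j then 1 else 0)"
| "tfun (\<alpha> # w) = (\<lambda>i j es. psum (\<lambda>e r. case e of (c, s, t) \<Rightarrow>
     if c = \<alpha> then (if s = i then tfun w t j r else 0) + tfun w t j ((c, s, i) # r) else 0) es)"

lemma symf_zero: "symf (\<lambda>_. 0)" by (simp add: symf_def)

lemma symf_psym: "symf (psym w i j)"
proof (induction w arbitrary: i)
  case Nil
  show ?case unfolding symf_def by auto
next
  case (Cons \<alpha> w)
  have "symf (\<lambda>r. case e of (c, s, t) \<Rightarrow> if c = \<alpha> \<and> s = i then psym w t j r else 0)" for e :: edge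
  proof -
    obtain c s t where e: "e = (c, s, t)" by (cases e) auto
    show ?thesis by (cases "c = \<alpha>"; cases "s = i") (simp_all add: e Cons symf_zero)
  qed
  then show ?case by (simp add: symf_psum)
qed

lemma symf_csym: "symf (csym w)"
proof (cases w)
  case Nil
  then show ?thesis by (simp add: csym_def symf_zero)
next
  case (Cons \<alpha> w')
  have "symf (\<lambda>r. case e of (c, s, t) \<Rightarrow> if c = \<alpha> then psym w' t s r else 0)" for e :: edge
  proof -
    obtain c s t where e: "e = (c, s, t)" by (cases e) auto
    show ?thesis by (cases "c = \<alpha>") (simp_all add: e symf_psym symf_zero)
  qed
  then show ?thesis by (simp add: csym_def Cons symf_psum)
qed

lemma symf_tfun: "symf (tfun w i j)"
proof (induction w arbitrary: i)
  case Nil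
  show ?case unfolding symf_def by auto
next
  case (Cons \<alpha> w)
  have "symf (\<lambda>r. case e of (c, s, t) \<Rightarrow> if c = \<alpha> then (if s = i then tfun w t j r else 0) + tfun w t j ((c, s, i) # r) else 0)" for e :: edge
  proof -
    obtain c s t where e: "e = (c, s, t)" by (cases e) auto
    have "symf (\<lambda>r. (if s = i then tfun w t j r else 0) + tfun w t j ((c, s, i) # r))"
      by (cases "s = i") (simp_all add: symf_add symf_Cons Cons symf_zero)
    then show ?thesis by (cases "c = \<alpha>") (simp_all add: e symf_zero)
  qed
  then show ?case by (simp add: symf_psum)
qed

lemma psym_length: "length es ~= length w ==> psym w i j es = 0"
proof (induction w arbitrary: i es)
  case (Cons \<alpha> w)
  have "psum (\<lambda>e r. case e of (c, s, t) \<Rightarrow> if c = \<alpha> \<and> s = i then psym w t j r else 0) es = 0"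
  proof (rule psum_eq_0)
    fix e r assume "mset es = add_mset e (mset r)"
    from arg_cong[OF this, of size] have "length r ~= length w" using Cons.prems by simp
    then show "(case e of (c, s, t) \<Rightarrow> if c = \<alpha> \<and> s = i then psym w t j r else 0) = 0"
      using Cons.IH by (cases e) simp
  qed
  then show ?case by simp
qed simp

lemma csym_length: "length es ~= length w ==> csym w es = 0"
proof (cases w)
  case (Cons \<alpha> w')
  assume len: "length es ~= length w"
  have "psum (\<lambda>e r. case e of (c, s, t) \<Rightarrow> if c = \<alpha> then psym w' t s r else 0) es = 0"
  proof (rule psum_eq_0)
    fix e r assume "mset es = add_mset e (mset r)"
    from arg_cong[OF this, of size] have "length r ~= length w'" using len Cons by simp
    then show "(case e of (c, s, t) \<Rightarrow> if c = \<alpha> then psym w' t s r else 0) = 0"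
      using psym_length by (cases e) simp
  qed
  then show ?thesis by (simp add: csym_def Cons)
qed (simp add: csym_def)

lemma tfun_deg: "deg_le (length w) (tfun w i j)"
proof (induction w arbitrary: i)
  case Nil
  show ?case by (auto simp: deg_le_def)
next
  case (Cons \<alpha> w)
  show ?case unfolding deg_le_def
  proof (intro allI impI)
    fix es :: "edge list" assume len: "length (\<alpha> # w) < length es"
    have "psum (\<lambda>e r. case e of (c, s, t) \<Rightarrow> if c = \<alpha> then (if s = i then tfun w t j r else 0) + tfun w t j ((c, s, i) # r) else 0) es = 0"
    proof (rule psum_eq_0)
      fix e r assume "mset es = add_mset e (mset r)"
      from arg_cong[OF this, of size] have "length w < length r" using len by simp
      then show "(case e of (c, s, t) \<Rightarrow> if c = \<alpha> then (if s = i then tfun w t j r else 0) + tfun w t j ((c, s, i) # r) else 0) = 0"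
        using deg_leD[OF Cons] by (cases e) simp
    qed
    then show "tfun (\<alpha> # w) i j es = 0" by simp
  qed
qed

lemma tfun_top: "length es = length w ==> tfun w i j es = psym w i j es"
proof (induction w arbitrary: i es)
  case (Cons \<alpha> w)
  have "psum (\<lambda>e r. case e of (c, s, t) \<Rightarrow> if c = \<alpha> then (if s = i then tfun w t j r else 0) + tfun w t j ((c, s, i) # r) else 0) es
      = psum (\<lambda>e r. case e of (c, s, t) \<Rightarrow> if c = \<alpha> \<and> s = i then psym w t j r else 0) es"
  proof (rule psum_cong)
    fix e r assume "mset es = add_mset e (mset r)"
    from arg_cong[OF this, of size] have len: "length r = length w" using Cons.prems by simp
    obtain c s t where e: "e = (c, s, t)" by (cases e) auto
    have "tfun w t j (e' # r) = 0" for e' by (rule deg_leD[OF tfun_deg]) (simp add: len)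
    then show "(case e of (c, s, t) \<Rightarrow> if c = \<alpha> then (if s = i then tfun w t j r else 0) + tfun w t j ((c, s, i) # r) else 0)
        = (case e of (c, s, t) \<Rightarrow> if c = \<alpha> \<and> s = i then psym w t j r else 0)"
      using Cons.IH[OF len] by (simp add: e)
  qed
  then show ?case by simp
qed simp

lemma psym_nonneg: "psym w i j es \<ge> 0"
proof (induction w arbitrary: i es)
  case (Cons \<alpha> w)
  show ?case unfolding psym.simps by (rule psum_nonneg) (auto simp: Cons split: prod.split)
qed (simp add: less_eq_complex_def)

lemma csym_nonneg: "csym w es \<ge> 0"
proof (cases w)
  case (Cons \<alpha> w')
  show ?thesis unfolding csym_def Cons list.case by (rule psum_nonneg) (auto simp: psym_nonneg split: prod.split)
qed (simp add: csym_def)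

lemma Dop_psum:
  "Dop a b (\<lambda>r. psum h r) es = psum (\<lambda>e r. dm a b e (\<lambda>e'. h e' r) + Dop a b (\<lambda>r. h e r) r) es"
  unfolding Dop_def by (rule gop_psum[OF functional_dm])

lemma Dop_zero: "Dop a b (\<lambda>r. 0) es = 0"
  unfolding Dop_def by (rule gop_zero[OF functional_dm])

lemma Dop_psym: "Dop a b (psym w i j) es = (if i = b then psym w a j es else 0) - (if j = a then psym w i b es else 0)"
proof (induction w arbitrary: i es)
  case Nil
  have "psym [] i j = (\<lambda>r. (if i = j then 1 else 0) * vac r)" by (auto simp: vac_def fun_eq_iff)
  then have "Dop a b (psym [] i j) es = (if i = j then 1 else 0) * Dop a b vac es"
    unfolding Dop_def using gop_scale[OF functional_dm] by metis
  then show ?case by (auto simp: Dop_vac)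
next
  case (Cons \<alpha> w)
  let ?h = "\<lambda>i (e :: edge) r. case e of (c, s, t) \<Rightarrow> if c = \<alpha> \<and> s = i then psym w t j r else 0"
  let ?k = "\<lambda>i b (e :: edge) r. case e of (c, s, t) \<Rightarrow> if c = \<alpha> \<and> s = i then psym w t b r else 0"
  have "Dop a b (psym (\<alpha> # w) i j) es = psum (\<lambda>e r. dm a b e (\<lambda>e'. ?h i e' r) + Dop a b (\<lambda>r. ?h i e r) r) es"
    unfolding psym.simps by (rule Dop_psum)
  also have "\<dots> = psum (\<lambda>e r. (if i = b then 1 else 0) * ?h a e r + (if j = a then - 1 else 0) * ?k i b e r) es"
  proof (rule psum_cong)
    fix e :: edge and r
    obtain c s t where e: "e = (c, s, t)" by (cases e) auto
    have "Dop a b (\<lambda>r. ?h i e r) r = (if c = \<alpha> \<and> s = i then Dop a b (psym w t j) r else 0)"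
      by (cases "c = \<alpha>"; cases "s = i") (simp_all add: e Dop_zero)
    then show "dm a b e (\<lambda>e'. ?h i e' r) + Dop a b (\<lambda>r. ?h i e r) r
        = (if i = b then 1 else 0) * ?h a e r + (if j = a then - 1 else 0) * ?k i b e r"
      unfolding Cons.IH by (auto simp: e dm_def)
  qed
  also have "\<dots> = (if i = b then 1 else 0) * psum (?h a) es + (if j = a then - 1 else 0) * psum (?k i b) es"
    unfolding psum_add psum_cmult ..
  finally show ?case by auto
qed

lemma Dop_csym: "Dop a b (csym w) es = 0"
proof (cases w)
  case Nil
  then show ?thesis by (simp add: csym_def Dop_zero)
next
  case (Cons \<alpha> w')
  let ?h = "\<lambda>(e :: edge) r. case e of (c, s, t) \<Rightarrow> if c = \<alpha> then psym w' t s r else 0"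
  have "Dop a b (csym w) es = psum (\<lambda>e r. dm a b e (\<lambda>e'. ?h e' r) + Dop a b (\<lambda>r. ?h e r) r) es"
    unfolding csym_def Cons list.case by (rule Dop_psum)
  also have "\<dots> = 0"
  proof (rule psum_eq_0)
    fix e :: edge and r
    obtain c s t where e: "e = (c, s, t)" by (cases e) auto
    have "Dop a b (\<lambda>r. ?h e r) r = (if c = \<alpha> then Dop a b (psym w' t s) r else 0)"
      by (simp add: e Dop_zero)
    then show "dm a b e (\<lambda>e'. ?h e' r) + Dop a b (\<lambda>r. ?h e r) r = 0"
      unfolding Dop_psym by (auto simp: e dm_def)
  qed
  finally show ?thesis .
qed

text \<open>Inner vertices are summed over, so their contributions cancel and only the two end points change.\<close>

lemma Dop_tfun: "Dop a b (tfun w i j) es = (if i = b then tfun w a j es else 0) - (if j = a then tfun w i b es else 0)"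
proof (induction w arbitrary: i es)
  case Nil
  have "tfun [] i j = (\<lambda>r. (if i = j then 1 else 0) * vac r)" by (auto simp: vac_def fun_eq_iff)
  then have "Dop a b (tfun [] i j) es = (if i = j then 1 else 0) * Dop a b vac es"
    unfolding Dop_def using gop_scale[OF functional_dm] by metis
  then show ?case by (auto simp: Dop_vac)
next
  case (Cons \<alpha> w)
  let ?h = "\<lambda>i (e :: edge) r. case e of (c, s, t) \<Rightarrow> if c = \<alpha> then (if s = i then tfun w t j r else 0) + tfun w t j ((c, s, i) # r) else 0"
  let ?k = "\<lambda>i b (e :: edge) r. case e of (c, s, t) \<Rightarrow> if c = \<alpha> then (if s = i then tfun w t b r else 0) + tfun w t b ((c, s, i) # r) else 0"
  have "Dop a b (tfun (\<alpha> # w) i j) es = psum (\<lambda>e r. dm a b e (\<lambda>e'. ?h i e' r) + Dop a b (\<lambda>r. ?h i e r) r) es"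
    unfolding tfun.simps by (rule Dop_psum)
  also have "\<dots> = psum (\<lambda>e r. (if i = b then 1 else 0) * ?h a e r + (if j = a then - 1 else 0) * ?k i b e r) es"
  proof (rule psum_cong)
    fix e :: edge and r
    obtain c s t where e: "e = (c, s, t)" by (cases e) auto
    have 1: "Dop a b (\<lambda>r. tfun w t j ((c, s, i) # r)) r
        = Dop a b (tfun w t j) ((c, s, i) # r) - dm a b (c, s, i) (\<lambda>e'. tfun w t j (e' # r))"
      unfolding Dop_def by simp
    have "Dop a b (\<lambda>r. (if s = i then tfun w t j r else 0) + tfun w t j ((c, s, i) # r)) r
        = (if s = i then Dop a b (tfun w t j) r else 0) + Dop a b (\<lambda>r. tfun w t j ((c, s, i) # r)) r"
      unfolding Dop_def by (cases "s = i") (simp_all add: gop_add[OF functional_dm])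
    then have "Dop a b (\<lambda>r. ?h i e r) r = (if c = \<alpha> then (if s = i then Dop a b (tfun w t j) r else 0)
        + Dop a b (tfun w t j) ((c, s, i) # r) - dm a b (c, s, i) (\<lambda>e'. tfun w t j (e' # r)) else 0)"
      unfolding 1 by (cases "c = \<alpha>"; cases "s = i") (simp_all add: e Dop_zero)
    then show "dm a b e (\<lambda>e'. ?h i e' r) + Dop a b (\<lambda>r. ?h i e r) r
        = (if i = b then 1 else 0) * ?h a e r + (if j = a then - 1 else 0) * ?k i b e r"
      unfolding Cons.IH by (auto simp: e dm_def)
  qed
  also have "\<dots> = (if i = b then 1 else 0) * psum (?h a) es + (if j = a then - 1 else 0) * psum (?k i b) es"
    unfolding psum_add psum_cmult ..
  finally show ?case by auto
qed

text \<open>Restriction to lists of edges with admissible colours and vertices.\<close>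

definition adm :: "nat \<Rightarrow> edge list \<Rightarrow> bool" where "adm L es \<longleftrightarrow> (\<exists>N. set es \<subseteq> Ed L N)"

definition vr :: "nat \<Rightarrow> coef \<Rightarrow> coef" where "vr L f = (\<lambda>es. if adm L es then f es else 0)"

lemma trunc_vr: "trunc L N (vr L f) = trunc L N f"
  by (auto simp: trunc_def vr_def adm_def fun_eq_iff)

lemma good_vr:
  assumes "symf f" "deg_le n f" "\<And>a b es. d < a ==> d < b ==> Dop a b f es = 0"
  shows "good d L (vr L f)"
  unfolding good_def
proof (intro conjI)
  show "symf (vr L f)" unfolding symf_def
  proof (intro allI impI)
    fix es es' :: "edge list" assume eq: "mset es = mset es'"
    show "vr L f es = vr L f es'"
      using mset_eq_setD[OF eq] symfD[OF assms(1) eq] by (simp add: vr_def adm_def)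
  qed
  show "\<exists>n. deg_le n (vr L f)" using assms(2) by (intro exI[of _ n]) (auto simp: deg_le_def vr_def)
  show "\<forall>es. vr L f es ~= 0 --> (\<exists>N. set es \<subseteq> Ed L N)" by (auto simp: vr_def adm_def)
  have "Inv d L N f" for N using assms(3) unfolding Inv_def by auto
  then have "Inv d L N (trunc L N (vr L f))" for N by (simp only: trunc_vr Inv_trunc)
  then show "\<forall>N. Inv d L N (vr L f)" by (simp only: Inv_trunc) simp
qed

lemma good_csym: "good d L (vr L (csym w))"
  by (rule good_vr[OF symf_csym, of "length w"]) (auto simp: deg_le_def csym_length Dop_csym)

lemma good_tfun: "i \<le> d ==> j \<le> d ==> good d L (vr L (tfun w i j))"
  by (rule good_vr[OF symf_tfun tfun_deg]) (simp add: Dop_tfun)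

section \<open>The path generators as operators\<close>

definition En :: "nat \<Rightarrow> nat \<Rightarrow> nat \<Rightarrow> nat \<Rightarrow> lin" where
  "En N \<alpha> i j = (if i \<in> {1..N} \<and> j \<in> {1..N} then Lop N (mat_unit i j \<alpha>) else 0)"

text \<open>The iterated matrix product of the generators along the word; the inner vertices run over all of \<open>{1..N}\<close>.\<close>

primrec Top :: "nat \<Rightarrow> nat list \<Rightarrow> nat \<Rightarrow> nat \<Rightarrow> lin" where
  "Top N [] = (\<lambda>i j. if i = j \<and> i \<in> {1..N} then 1 else 0)"
| "Top N (\<alpha> # w) = (\<lambda>i j. \<Sum>a=1..N. Top N w a j * En N \<alpha> i a)"

lemma Top_poly:
  assumes "set w \<subseteq> {1..L}"
  shows "\<exists>p\<in>FC L N. Top N w i j = lact N p"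
  using assms
proof (induction w arbitrary: i)
  case Nil
  show ?case
  proof (cases "i = j \<and> i \<in> {1..N}")
    case True
    then show ?thesis by (intro bexI[of _ 1]) auto
  next
    case False
    then show ?thesis by (intro bexI[of _ 0]) auto
  qed
next
  case (Cons \<alpha> w)
  obtain p where p: "\<And>a. p a \<in> FC L N" "\<And>a. Top N w a j = lact N (p a)" using Cons by (metis insert_subset list.set(2))
  have "\<exists>q\<in>FC L N. En N \<alpha> i a = lact N q" for a
  proof (cases "i \<in> {1..N} \<and> a \<in> {1..N}")
    case True
    have "EL (\<alpha>, i, a) \<in> FC L N" using Em_glc[of "(\<alpha>, i, a)" L N] Cons.prems True by (simp add: Ed_def)
    then show ?thesis using True by (intro bexI[of _ "EL (\<alpha>, i, a)"]) (simp_all add: En_def lact_letter Em_mat_unit)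
  next
    case False
    then show ?thesis by (intro bexI[of _ 0]) (auto simp: En_def)
  qed
  then obtain q where q: "\<And>a. q a \<in> FC L N" "\<And>a. En N \<alpha> i a = lact N (q a)" by metis
  show ?case
    by (rule bexI[of _ "\<Sum>a=1..N. p a * q a"]) (simp_all add: lact_sum lact_mult p q FC_sum)
qed

lemma Top_vac:
  assumes w: "set w \<subseteq> {1..L}" and j: "j \<in> {1..N}" and i: "i \<in> {1..N}"
  shows "ap (Top N w i j) vac = trunc L N (tfun w i j)"
  using w i
proof (induction w arbitrary: i)
  case Nil
  then show ?case by (auto simp: fun_eq_iff trunc_def vac_def)
next
  case (Cons \<alpha> w)
  have w: "set w \<subseteq> {1..L}" "\<alpha> \<in> {1..L}" using Cons.prems by auto
  have IH: "ap (Top N w a j) vac = trunc L N (tfun w a j)" if "a \<in> {1..N}" for a using Cons.IH[OF w(1) that] .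
  have step: "ap (Top N w a j) (ap (En N \<alpha> i a) vac) = rop N (mat_unit i a \<alpha>) (trunc L N (tfun w a j))" if a: "a \<in> {1..N}" for a
  proof -
    obtain p where p: "Top N w a j = lact N p" using Top_poly[OF w(1)] by blast
    show ?thesis using a Cons.prems(2) IH[OF a] by (simp add: En_def p lop_vac_eq_rop_vac lact_rop_commute)
  qed
  show ?case
  proof
    fix es
    obtain p where p: "p \<in> FC L N" "Top N (\<alpha> # w) i j = lact N p" using Top_poly[OF Cons.prems(1)] by blast
    show "ap (Top N (\<alpha> # w) i j) vac es = trunc L N (tfun (\<alpha> # w) i j) es"
    proof (cases "set es \<subseteq> Ed L N")
      case False
      then show ?thesis using supp_inD[OF supp_phi[OF p(1)] False] unfolding p(2) by (simp add: phi_def trunc_def)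
    next
      case True
      have sy: "symf (trunc L N (tfun w a j))" for a
        using Sp_trunc[OF symf_tfun tfun_deg] unfolding Sp_def by blast
      have "ap (Top N (\<alpha> # w) i j) vac es = (\<Sum>a=1..N. rop N (mat_unit i a \<alpha>) (trunc L N (tfun w a j)) es)"
        by (simp add: ap_sum step del: ap_simps(8))
      also have "\<dots> = (\<Sum>a=1..N. psum (\<lambda>e r. xe (mat_unit i a \<alpha>) e * trunc L N (tfun w a j) r
          + rker N (mat_unit i a \<alpha>) e (\<lambda>e'. trunc L N (tfun w a j) (e' # r))) es)"
        unfolding rop_def gop_eq_psum[OF functional_rker sy] ..
      also have "\<dots> = psum (\<lambda>e r. \<Sum>a=1..N. xe (mat_unit i a \<alpha>) e * trunc L N (tfun w a j) r
          + rker N (mat_unit i a \<alpha>) e (\<lambda>e'. trunc L N (tfun w a j) (e' # r))) es"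
        by (rule psum_sum[symmetric]) simp
      also have "\<dots> = psum (\<lambda>e r. case e of (c, s, t) \<Rightarrow>
          if c = \<alpha> then (if s = i then tfun w t j r else 0) + tfun w t j ((c, s, i) # r) else 0) es"
      proof (rule psum_cong)
        fix e r assume "mset es = add_mset e (mset r)"
        then have "set es = insert e (set r)" by (rule set_mset_split)
        then have er: "e \<in> Ed L N" "set r \<subseteq> Ed L N" using True by auto
        obtain c s t where e: "e = (c, s, t)" by (cases e) auto
        have cst: "c \<in> {1..L}" "s \<in> {1..N}" "t \<in> {1..N}" using er(1) by (auto simp: e Ed_def)
        have "xe (mat_unit i a \<alpha>) e * trunc L N (tfun w a j) r + rker N (mat_unit i a \<alpha>) e (\<lambda>e'. trunc L N (tfun w a j) (e' # r))
            = (if a = t then (if c = \<alpha> then (if s = i then tfun w t j r else 0) + tfun w t j ((c, s, i) # r) else 0) else 0)" for a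
        proof -
          have "rker N (mat_unit i a \<alpha>) e (\<lambda>e'. trunc L N (tfun w a j) (e' # r))
              = (\<Sum>b=1..N. if b = i then (if c = \<alpha> \<and> t = a then trunc L N (tfun w a j) ((c, s, b) # r) else 0) else 0)"
            unfolding rker_def e prod.case by (rule sum.cong[OF refl]) (auto simp: mat_unit_def)
          also have "\<dots> = (if c = \<alpha> \<and> t = a then tfun w a j ((c, s, i) # r) else 0)"
            using Cons.prems(2) cst er(2) by (simp add: trunc_def Ed_def)
          finally show ?thesis using er(2) by (auto simp: xe_def e mat_unit_def trunc_def)
        qed
        then have "(\<Sum>a=1..N. xe (mat_unit i a \<alpha>) e * trunc L N (tfun w a j) r + rker N (mat_unit i a \<alpha>) e (\<lambda>e'. trunc L N (tfun w a j) (e' # r)))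
            = (\<Sum>a=1..N. if a = t then (if c = \<alpha> then (if s = i then tfun w t j r else 0) + tfun w t j ((c, s, i) # r) else 0) else 0)"
          by (simp only:)
        also have "\<dots> = (if c = \<alpha> then (if s = i then tfun w t j r else 0) + tfun w t j ((c, s, i) # r) else 0)"
          using cst(3) by (subst sum.delta) simp_all
        finally show "(\<Sum>a=1..N. xe (mat_unit i a \<alpha>) e * trunc L N (tfun w a j) r + rker N (mat_unit i a \<alpha>) e (\<lambda>e'. trunc L N (tfun w a j) (e' # r)))
            = (case e of (c, s, t) \<Rightarrow> if c = \<alpha> then (if s = i then tfun w t j r else 0) + tfun w t j ((c, s, i) # r) else 0)"
          by (simp add: e)
      qed
      finally show ?thesis using True by (simp add: trunc_def)
    qed
  qed
qed

definition tel :: "nat \<Rightarrow> nat \<Rightarrow> nat list \<Rightarrow> nat \<Rightarrow> nat \<Rightarrow> nat \<Rightarrow> uea_elem" where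
  "tel d L w i j = (SOME x. x \<in> carrier (A_lim d L) \<and> psi d L x = vr L (tfun w i j))"

definition pel :: "nat \<Rightarrow> nat \<Rightarrow> nat list \<Rightarrow> nat \<Rightarrow> uea_elem" where
  "pel d L w = (SOME x. x \<in> carrier (A_lim d L) \<and> psi d L x = vr L (csym w))"

lemma tel: assumes "i \<le> d" "j \<le> d" shows "tel d L w i j \<in> carrier (A_lim d L)" "psi d L (tel d L w i j) = vr L (tfun w i j)"
proof -
  have "\<exists>x. x \<in> carrier (A_lim d L) \<and> psi d L x = vr L (tfun w i j)"
    using psi_surj[OF good_tfun[OF assms, of L w]] by blast
  from someI_ex[OF this] show "tel d L w i j \<in> carrier (A_lim d L)" "psi d L (tel d L w i j) = vr L (tfun w i j)"
    unfolding tel_def by blast+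
qed

lemma pel: shows "pel d L w \<in> carrier (A_lim d L)" "psi d L (pel d L w) = vr L (csym w)"
proof -
  have "\<exists>x. x \<in> carrier (A_lim d L) \<and> psi d L x = vr L (csym w)"
    using psi_surj[OF good_csym[of d L w]] by blast
  from someI_ex[OF this] show "pel d L w \<in> carrier (A_lim d L)" "psi d L (pel d L w) = vr L (csym w)"
    unfolding pel_def by blast+
qed

lemma A0_embed_pel: "A0_embed d (pel 0 L w) = pel d L w"
  by (rule psi_inj[of _ d L]) (simp_all add: A0_embed_psi pel)

text \<open>Both sides have the same coefficient function: the operator is the action of an element of the enveloping algebra, which is determined by its value at \<open>vac\<close>.\<close>

theorem emb_tel:
  assumes w: "set w \<subseteq> {1..L}" and ij: "i \<in> {1..d}" "j \<in> {1..d}"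
  shows "emb d L (tel d L w i j) = (\<lambda>N. Top (N + max d 1) w i j)"
proof
  fix k
  let ?N = "k + max d 1" and ?x = "tel d L w i j"
  have x: "?x \<in> carrier (A_lim d L)" "psi d L ?x = vr L (tfun w i j)" using tel[of i d j] ij by simp_all
  have N: "?N \<ge> max d 1" by simp
  obtain p where p: "p \<in> FC L ?N" "Top ?N w i j = lact ?N p" using Top_poly[OF w] by blast
  have "co L ?N (?x ?N) = trunc L ?N (tfun w i j)" using A_lim_elim(3)[OF x(1) N] by (simp add: x(2) trunc_vr)
  also have "\<dots> = ap (Top ?N w i j) vac" using Top_vac[OF w, of j ?N i] ij by simp
  also have "\<dots> = co L ?N (cl L ?N p)" using p by (simp add: co_cl phi_def)
  finally have "?x ?N = cl L ?N p" by (rule co_inj[OF A_lim_elim(2)[OF x(1) N] cl_carrier[OF p(1)]])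
  then show "emb d L ?x k = Top ?N w i j" unfolding emb_def using Rl_cl[OF p(1)] p(2) by simp
qed

section \<open>Commutation relations between the path generators\<close>

locale gl_relations =
  fixes E :: "nat \<Rightarrow> nat \<Rightarrow> nat \<Rightarrow> nat \<Rightarrow> 'r::ring_1"
  assumes E_out: "i \<notin> {1..N} \<or> j \<notin> {1..N} ==> E N \<alpha> i j = 0"
    and E_comm: "E N \<alpha> i j * E N \<beta> k l - E N \<beta> k l * E N \<alpha> i j =
      (if \<alpha> = \<beta> then (if j = k \<and> j \<in> {1..N} then E N \<alpha> i l else 0) - (if l = i \<and> l \<in> {1..N} then E N \<alpha> k j else 0) else 0)"
begin

primrec T :: "nat \<Rightarrow> nat list \<Rightarrow> nat \<Rightarrow> nat \<Rightarrow> 'r" where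
  "T N [] = (\<lambda>i j. if i = j \<and> i \<in> {1..N} then 1 else 0)"
| "T N (\<alpha> # w) = (\<lambda>i j. \<Sum>a=1..N. T N w a j * E N \<alpha> i a)"

lemma T_out: "i \<notin> {1..N} \<or> j \<notin> {1..N} ==> T N w i j = 0"
proof (induction w arbitrary: i)
  case (Cons \<alpha> w)
  then show ?case by (cases "i \<in> {1..N}") (simp_all add: E_out)
qed auto

lemma T_delta: "(\<Sum>a=1..N. T N w a l * (if k = a \<and> k \<in> {1..N} then 1 else 0)) = T N w k l"
proof (cases "k \<in> {1..N}")
  case True
  have "(\<Sum>a=1..N. T N w a l * (if k = a \<and> k \<in> {1..N} then 1 else 0)) = (\<Sum>a=1..N. if a = k then T N w a l else 0)"
    by (rule sum.cong[OF refl]) (use True in auto)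
  then show ?thesis using True by (simp add: sum.delta)
next
  case False
  then have "(\<Sum>a=1..N. T N w a l * (if k = a \<and> k \<in> {1..N} then 1 else 0)) = (\<Sum>a=1..N. 0)"
    by (intro sum.cong[OF refl]) auto
  then show ?thesis using T_out[of k N l w] False by simp
qed

lemma T_append: "T N (v @ y) k l = (\<Sum>a=1..N. T N y a l * T N v k a)"
proof (induction v arbitrary: k)
  case Nil
  show ?case using T_delta[of N y l k] by simp
next
  case (Cons \<alpha> v)
  have "T N ((\<alpha> # v) @ y) k l = (\<Sum>b=1..N. (\<Sum>a=1..N. T N y a l * T N v b a) * E N \<alpha> k b)"
    by (simp add: Cons)
  also have "\<dots> = (\<Sum>b=1..N. \<Sum>a=1..N. T N y a l * (T N v b a * E N \<alpha> k b))"
    by (simp add: sum_distrib_right mult.assoc)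
  also have "\<dots> = (\<Sum>a=1..N. \<Sum>b=1..N. T N y a l * (T N v b a * E N \<alpha> k b))" by (rule sum.swap)
  finally show ?case by (simp add: sum_distrib_left)
qed

lemma T_single: "T N [\<beta>] k j = E N \<beta> k j"
proof (cases "j \<in> {1..N}")
  case True
  have "T N [\<beta>] k j = (\<Sum>a=1..N. if a = j then E N \<beta> k a else 0)"
    unfolding T.simps by (rule sum.cong[OF refl]) auto
  then show ?thesis using True by (simp add: sum.delta)
next
  case False
  then show ?thesis using E_out[of k N j \<beta>] T_out[of k N j "[\<beta>]"] by simp
qed

text \<open>The terms of the commutator of a matrix unit with a path generator.\<close>

fun cterms :: "nat \<Rightarrow> nat list \<Rightarrow> (int \<times> nat list \<times> nat list) list" where
  "cterms \<alpha> [] = []"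
| "cterms \<alpha> (\<beta> # w) = (if \<beta> = \<alpha> then [(1, \<beta> # w, []), (-1, w, [\<beta>])] else []) @
    map (\<lambda>(s, u, v). (s, u, \<beta> # v)) (cterms \<alpha> w)"

lemma cterms_length: "(s, u, v) \<in> set (cterms \<alpha> w) ==> length u + length v = length w"
  by (induction w arbitrary: s u v) (auto split: if_splits)

lemma sum_list_sum: "(\<Sum>x\<leftarrow>xs. \<Sum>a\<in>A. f x a) = (\<Sum>a\<in>A. \<Sum>x\<leftarrow>xs. f x a)"
  by (induction xs) (simp_all add: sum.distrib)

text \<open>The derivation by \<open>E \<alpha> i j\<close> cuts the trail at an edge of colour \<open>\<alpha>\<close> and interchanges end points. Each such edge gives two terms,
  with the cut before or after it and opposite signs; \<open>cterms\<close> lists them.\<close>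

lemma E_T_comm:
  "E N \<alpha> i j * T N w k l - T N w k l * E N \<alpha> i j = (\<Sum>(s, u, v)\<leftarrow>cterms \<alpha> w. of_int s * (T N u i l * T N v k j))"
proof (induction w arbitrary: k)
  case Nil
  show ?case by simp
next
  case (Cons \<beta> w)
  have "E N \<alpha> i j * T N (\<beta> # w) k l - T N (\<beta> # w) k l * E N \<alpha> i j
      = (\<Sum>a=1..N. (E N \<alpha> i j * T N w a l - T N w a l * E N \<alpha> i j) * E N \<beta> k a
          + T N w a l * (E N \<alpha> i j * E N \<beta> k a - E N \<beta> k a * E N \<alpha> i j))"
    by (simp add: sum_distrib_left sum_distrib_right sum_subtractf[symmetric] left_diff_distrib right_diff_distrib mult.assoc)
  also have "\<dots> = (\<Sum>a=1..N. (\<Sum>(s, u, v)\<leftarrow>cterms \<alpha> w. of_int s * (T N u i l * T N v a j)) * E N \<beta> k a)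
      + (\<Sum>a=1..N. T N w a l * (E N \<alpha> i j * E N \<beta> k a - E N \<beta> k a * E N \<alpha> i j))"
    by (simp only: Cons sum.distrib)
  also have "(\<Sum>a=1..N. (\<Sum>(s, u, v)\<leftarrow>cterms \<alpha> w. of_int s * (T N u i l * T N v a j)) * E N \<beta> k a)
      = (\<Sum>(s, u, v)\<leftarrow>cterms \<alpha> w. of_int s * (T N u i l * T N (\<beta> # v) k j))"
    by (simp add: sum_list_mult_const[symmetric] sum_list_sum[symmetric] case_prod_unfold mult.assoc sum_distrib_left)
  also have "(\<Sum>a=1..N. T N w a l * (E N \<alpha> i j * E N \<beta> k a - E N \<beta> k a * E N \<alpha> i j))
      = (if \<alpha> = \<beta> then T N (\<beta> # w) i l * T N [] k j - T N w i l * T N [\<beta>] k j else 0)"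
  proof (cases "\<alpha> = \<beta>")
    case True
    have "(\<Sum>a=1..N. T N w a l * (E N \<alpha> i j * E N \<beta> k a - E N \<beta> k a * E N \<alpha> i j))
        = (\<Sum>a=1..N. T N w a l * (if j = k \<and> j \<in> {1..N} then E N \<beta> i a else 0))
          - (\<Sum>a=1..N. T N w a l * (if i = a \<and> i \<in> {1..N} then 1 else 0) * E N \<beta> k j)"
      unfolding E_comm True sum_subtractf[symmetric] by (rule sum.cong[OF refl]) (auto simp: right_diff_distrib)
    also have "(\<Sum>a=1..N. T N w a l * (if j = k \<and> j \<in> {1..N} then E N \<beta> i a else 0)) = T N (\<beta> # w) i l * T N [] k j"
    proof (cases "j = k \<and> j \<in> {1..N}")
      case False
      then have "(\<Sum>a=1..N. T N w a l * (if j = k \<and> j \<in> {1..N} then E N \<beta> i a else 0)) = (\<Sum>a=1..N. 0)"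
        by (intro sum.cong[OF refl]) auto
      moreover have "T N [] k j = 0" using False by auto
      ultimately show ?thesis by simp
    qed auto
    also have "(\<Sum>a=1..N. T N w a l * (if i = a \<and> i \<in> {1..N} then 1 else 0) * E N \<beta> k j) = T N w i l * T N [\<beta>] k j"
      unfolding sum_distrib_right[symmetric] T_delta T_single ..
    finally show ?thesis using True by simp
  next
    case False
    then show ?thesis by (simp add: E_comm)
  qed
  finally show ?case by (simp add: case_prod_unfold o_def)
qed

text \<open>Combinations of products of two path generators, uniform in the size and in the indices.\<close>

inductive_set QS :: "nat \<Rightarrow> (nat \<Rightarrow> nat \<Rightarrow> nat \<Rightarrow> nat \<Rightarrow> nat \<Rightarrow> 'r) set" for n where
  zero: "(\<lambda>N i j k l. 0) \<in> QS n"
| add: "P \<in> QS n ==> Q \<in> QS n ==> (\<lambda>N i j k l. P N i j k l + Q N i j k l) \<in> QS n"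
| neg: "Q \<in> QS n ==> (\<lambda>N i j k l. - Q N i j k l) \<in> QS n"
| cross: "length x + length y < n ==> (\<lambda>N i j k l. T N x i l * T N y k j) \<in> QS n"
| straight: "length x + length y < n ==> (\<lambda>N i j k l. T N x i j * T N y k l) \<in> QS n"

lemma QS_diff: "P \<in> QS n ==> Q \<in> QS n ==> (\<lambda>N i j k l. P N i j k l - Q N i j k l) \<in> QS n"
  using QS.add[OF _ QS.neg, of P n Q] by simp

lemma QS_mono: "Q \<in> QS m ==> m \<le> n ==> Q \<in> QS n"
  by (induction rule: QS.induct) (auto intro: QS.intros)

lemma QS_swap: "Q \<in> QS n ==> (\<lambda>N i j k l. Q N i l k j) \<in> QS n"
  by (induction rule: QS.induct) (auto intro: QS.intros)

lemma QS_int_neg: "Q \<in> QS n ==> s = 1 \<or> s = -1 ==> (\<lambda>N i j k l. of_int s * Q N i j k l) \<in> QS n"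
  using QS.neg[of Q n] by auto

lemma cterms_sign: "(s, u, v) \<in> set (cterms \<alpha> w) ==> s = 1 \<or> s = -1"
  by (induction w arbitrary: s u v) (auto split: if_splits)

lemma QS_cterms:
  assumes "\<And>s u v. (s, u, v) \<in> set xs ==> (s = 1 \<or> s = -1) \<and> (\<lambda>N i j k l. F u v N i j k l) \<in> QS n"
  shows "(\<lambda>N i j k l. \<Sum>(s, u, v)\<leftarrow>xs. of_int s * F u v N i j k l) \<in> QS n"
  using assms
proof (induction xs)
  case Nil
  then show ?case by (simp add: QS.zero)
next
  case (Cons x xs)
  obtain s u v where x: "x = (s, u, v)" by (cases x) auto
  have suv: "s = 1 \<or> s = -1" "(\<lambda>N i j k l. F u v N i j k l) \<in> QS n"
    using Cons.prems[of s u v] x by simp_all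
  have "(\<lambda>N i j k l. of_int s * F u v N i j k l) \<in> QS n" by (rule QS_int_neg[OF suv(2,1)])
  moreover have "(\<lambda>N i j k l. \<Sum>(s, u, v)\<leftarrow>xs. of_int s * F u v N i j k l) \<in> QS n"
  proof (rule Cons.IH)
    fix s u v assume "(s, u, v) \<in> set xs"
    then show "(s = 1 \<or> s = -1) \<and> (\<lambda>N i j k l. F u v N i j k l) \<in> QS n"
      by (intro Cons.prems) simp
  qed
  ultimately show ?case unfolding x by (simp add: QS.add)
qed

lemma QS_join:
  assumes "Q \<in> QS m"
  shows "(\<lambda>N i j k l. \<Sum>a=1..N. Q N i l a j * T N v k a) \<in> QS (m + length v)"
  using assms
proof (induction rule: QS.induct)
  case zero
  show ?case by (simp add: QS.zero)
next
  case (add P Q)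
  show ?case using QS.add[OF add.IH] by (simp add: distrib_right sum.distrib)
next
  case (neg Q)
  show ?case using QS.neg[OF neg.IH] by (simp add: sum_negf)
next
  case (cross x y)
  have "(\<lambda>N i j k l. T N x i j * T N (v @ y) k l) \<in> QS (m + length v)"
    by (rule QS.straight) (use cross in simp)
  then show ?case by (simp add: T_append sum_distrib_left mult.assoc)
next
  case (straight x y)
  have "(\<lambda>N i j k l. T N x i l * T N (v @ y) k j) \<in> QS (m + length v)"
    by (rule QS.cross) (use straight in simp)
  then show ?case by (simp add: T_append sum_distrib_left mult.assoc)
qed

lemma QS_join': "Q \<in> QS m ==> (\<lambda>N i j k l. \<Sum>a=1..N. Q N i j a l * T N v k a) \<in> QS (m + length v)"
  using QS_swap[OF QS_join[of Q m v]] by simp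

abbreviation Cm :: "nat list \<Rightarrow> nat list \<Rightarrow> nat \<Rightarrow> nat \<Rightarrow> nat \<Rightarrow> nat \<Rightarrow> nat \<Rightarrow> 'r" where
  "Cm w w' N i j k l \<equiv> T N w i j * T N w' k l - T N w' k l * T N w i j"

text \<open>Moving the factor with the summation index to the right of a third generator.\<close>

lemma QS_reorder:
  assumes IH: "\<And>u y. length u + length y < n ==> Cm u y \<in> QS (length u + length y)"
    and len: "length u + length v + length x < n"
  shows "(\<lambda>N i j k l. \<Sum>a=1..N. T N x a l * (T N u i j * T N v k a)) \<in> QS n"
    "(\<lambda>N i j k l. \<Sum>a=1..N. T N x a j * (T N u i l * T N v k a)) \<in> QS n"
proof -
  have C: "Cm u x \<in> QS (length u + length x)" by (rule IH) (use len in simp)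
  have 1: "(\<lambda>N i j k l. T N u i j * T N (v @ x) k l) \<in> QS n" by (rule QS.straight) (use len in simp)
  have 2: "(\<lambda>N i j k l. \<Sum>a=1..N. Cm u x N i j a l * T N v k a) \<in> QS n"
    by (rule QS_mono[OF QS_join'[OF C]]) (use len in simp)
  have "(\<lambda>N i j k l. \<Sum>a=1..N. T N x a l * (T N u i j * T N v k a))
      = (\<lambda>N i j k l. T N u i j * T N (v @ x) k l - (\<Sum>a=1..N. Cm u x N i j a l * T N v k a))"
    by (intro ext) (simp add: T_append sum_distrib_left left_diff_distrib sum_subtractf mult.assoc)
  then show A: "(\<lambda>N i j k l. \<Sum>a=1..N. T N x a l * (T N u i j * T N v k a)) \<in> QS n"
    using QS_diff[OF 1 2] by simp
  show "(\<lambda>N i j k l. \<Sum>a=1..N. T N x a j * (T N u i l * T N v k a)) \<in> QS n"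
    using QS_swap[OF A] by simp
qed

lemma int_out: "x * (of_int s * y) = of_int s * (x * (y :: 'r))"
  by (subst mult.assoc[symmetric], subst mult_of_int_commute[symmetric], rule mult.assoc)

lemma QS_E_cross:
  assumes IH: "\<And>u y. length u + length y < n ==> Cm u y \<in> QS (length u + length y)"
    and len: "Suc (length x + length y) < n"
  shows "(\<lambda>N i j k l. \<Sum>a=1..N. T N x a l * T N y k j * E N \<alpha> i a) \<in> QS n"
proof -
  let ?S = "\<lambda>N i j k l. \<Sum>(s, u, v)\<leftarrow>cterms \<alpha> y. of_int s * (\<Sum>a=1..N. T N x a l * (T N u i j * T N v k a))"
  have 1: "(\<lambda>N i j k l. T N (\<alpha> # x) i l * T N y k j) \<in> QS n" by (rule QS.cross) (use len in simp)
  have 2: "?S \<in> QS n"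
  proof (rule QS_cterms, rule conjI)
    fix s u v assume c: "(s, u, v) \<in> set (cterms \<alpha> y)"
    show "s = 1 \<or> s = -1" by (rule cterms_sign[OF c])
    show "(\<lambda>N i j k l. \<Sum>a=1..N. T N x a l * (T N u i j * T N v k a)) \<in> QS n"
      by (rule QS_reorder(1)[OF IH]) (use cterms_length[OF c] len in simp_all)
  qed
  have "(\<Sum>a=1..N. T N x a l * T N y k j * E N \<alpha> i a) = T N (\<alpha> # x) i l * T N y k j - ?S N i j k l" for N i j k l
  proof -
    have "T N x a l * T N y k j * E N \<alpha> i a = T N x a l * E N \<alpha> i a * T N y k j
        - (\<Sum>(s, u, v)\<leftarrow>cterms \<alpha> y. of_int s * (T N x a l * (T N u i j * T N v k a)))" for a
    proof -
      have c: "T N y k j * E N \<alpha> i a = E N \<alpha> i a * T N y k j - (\<Sum>(s, u, v)\<leftarrow>cterms \<alpha> y. of_int s * (T N u i j * T N v k a))"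
        unfolding E_T_comm[of N \<alpha> i a y k j, symmetric] by simp
      have "T N x a l * T N y k j * E N \<alpha> i a = T N x a l * (T N y k j * E N \<alpha> i a)" by (rule mult.assoc)
      also have "\<dots> = T N x a l * E N \<alpha> i a * T N y k j
          - T N x a l * (\<Sum>(s, u, v)\<leftarrow>cterms \<alpha> y. of_int s * (T N u i j * T N v k a))"
        unfolding c by (simp only: right_diff_distrib mult.assoc)
      also have "T N x a l * (\<Sum>(s, u, v)\<leftarrow>cterms \<alpha> y. of_int s * (T N u i j * T N v k a))
          = (\<Sum>(s, u, v)\<leftarrow>cterms \<alpha> y. of_int s * (T N x a l * (T N u i j * T N v k a)))"
        by (simp only: sum_list_const_mult[symmetric] case_prod_unfold int_out)
      finally show ?thesis .
    qed
    then have "(\<Sum>a=1..N. T N x a l * T N y k j * E N \<alpha> i a) = (\<Sum>a=1..N. T N x a l * E N \<alpha> i a) * T N y k j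
        - (\<Sum>a=1..N. \<Sum>(s, u, v)\<leftarrow>cterms \<alpha> y. of_int s * (T N x a l * (T N u i j * T N v k a)))"
      by (simp only: sum_subtractf sum_distrib_right)
    then show ?thesis
      by (simp only: T.simps sum_distrib_left sum_list_sum[symmetric] case_prod_unfold)
  qed
  then show ?thesis using QS_diff[OF 1 2] by simp
qed

lemma QS_E:
  assumes IH: "\<And>u y. length u + length y < n ==> Cm u y \<in> QS (length u + length y)"
    and Q: "Q \<in> QS m" and mn: "Suc m \<le> n"
  shows "(\<lambda>N i j k l. \<Sum>a=1..N. Q N a j k l * E N \<alpha> i a) \<in> QS n"
  using Q
proof (induction rule: QS.induct)
  case zero
  show ?case by (simp add: QS.zero)
next
  case (add P Q)
  show ?case using QS.add[OF add.IH] by (simp add: distrib_right sum.distrib)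
next
  case (neg Q)
  show ?case using QS.neg[OF neg.IH] by (simp add: sum_negf)
next
  case (cross x y)
  show ?case by (rule QS_E_cross[OF IH]) (use cross mn in simp_all)
next
  case (straight x y)
  have "(\<lambda>N i j k l. \<Sum>a=1..N. T N x a l * T N y k j * E N \<alpha> i a) \<in> QS n"
    by (rule QS_E_cross[OF IH]) (use straight mn in simp_all)
  from QS_swap[OF this] show ?case .
qed

text \<open>Induction on the total length: split off the first edge of one word, commute it by \<open>E_T_comm\<close> and bring the result back to the form of products of
  two generators with the induction hypothesis. The class \<open>QS\<close> keeps track of the fact that the coefficients are the same for all sizes and indices.\<close>

theorem T_commutator: "Cm w w' \<in> QS (length w + length w')"
proof (induction "length w + length w'" arbitrary: w w' rule: less_induct)
  case less
  let ?n = "length w + length w'"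
  have IH: "Cm u y \<in> QS (length u + length y)" if "length u + length y < ?n" for u y using less that by blast
  show ?case
  proof (cases w)
    case Nil
    have "Cm [] w' = (\<lambda>N i j k l. 0)" by (intro ext) simp
    then show ?thesis unfolding Nil by (simp only: QS.zero)
  next
    case (Cons \<alpha> w1)
    let ?S = "\<lambda>N i j k l. \<Sum>(s, u, v)\<leftarrow>cterms \<alpha> w'. of_int s * (\<Sum>a=1..N. T N w1 a j * (T N u i l * T N v k a))"
    have 1: "?S \<in> QS ?n"
    proof (rule QS_cterms, rule conjI)
      fix s u v assume c: "(s, u, v) \<in> set (cterms \<alpha> w')"
      show "s = 1 \<or> s = -1" by (rule cterms_sign[OF c])
      show "(\<lambda>N i j k l. \<Sum>a=1..N. T N w1 a j * (T N u i l * T N v k a)) \<in> QS ?n"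
        by (rule QS_reorder(2)[OF IH]) (use cterms_length[OF c] Cons in simp_all)
    qed
    have 2: "(\<lambda>N i j k l. \<Sum>a=1..N. Cm w1 w' N a j k l * E N \<alpha> i a) \<in> QS ?n"
      by (rule QS_E[OF IH IH]) (use Cons in simp_all)
    have "Cm w w' N i j k l = ?S N i j k l + (\<Sum>a=1..N. Cm w1 w' N a j k l * E N \<alpha> i a)" for N i j k l
    proof -
      have "Cm w w' N i j k l = (\<Sum>a=1..N. T N w1 a j * (E N \<alpha> i a * T N w' k l - T N w' k l * E N \<alpha> i a))
          + (\<Sum>a=1..N. Cm w1 w' N a j k l * E N \<alpha> i a)"
        unfolding Cons by (simp add: sum_distrib_left sum_distrib_right sum_subtractf left_diff_distrib right_diff_distrib mult.assoc)
      also have "(\<Sum>a=1..N. T N w1 a j * (E N \<alpha> i a * T N w' k l - T N w' k l * E N \<alpha> i a)) = ?S N i j k l"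
        unfolding E_T_comm
        by (simp only: sum_list_const_mult[symmetric] case_prod_unfold int_out sum_distrib_left sum_list_sum[symmetric])
      finally show ?thesis .
    qed
    then show ?thesis using QS.add[OF 1 2] by simp
  qed
qed

end

section \<open>Trails and layouts\<close>

fun tr :: "nat \<Rightarrow> nat list \<Rightarrow> nat list \<Rightarrow> edge list" where
  "tr i (\<alpha> # w) (t # ts) = (\<alpha>, i, t) # tr t w ts"
| "tr i _ _ = []"

abbreviation esrc :: "edge \<Rightarrow> nat" where "esrc e \<equiv> fst (snd e)"
abbreviation etgt :: "edge \<Rightarrow> nat" where "etgt e \<equiv> snd (snd e)"

lemma tr_targets: "length w = length ts ==> map etgt (tr i w ts) = ts"
  by (induction i w ts rule: tr.induct) auto

lemma tr_sources: "length w = length ts ==> w ~= [] ==> map esrc (tr i w ts) = i # butlast ts"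
proof (induction i w ts rule: tr.induct)
  case (1 i \<alpha> w t ts)
  then show ?case by (cases w; cases ts) auto
qed auto

lemma tr_colours: "length w = length ts ==> map fst (tr i w ts) = w"
  by (induction i w ts rule: tr.induct) auto

lemma length_tr: "length w = length ts ==> length (tr i w ts) = length w"
  by (induction i w ts rule: tr.induct) auto

lemma tr_snoc: "length w = length ts ==> tr i (w @ [\<beta>]) (ts @ [b]) = tr i w ts @ [(\<beta>, last (i # ts), b)]"
  by (induction i w ts rule: tr.induct) auto

type_synonym pathgen = "nat \<times> nat list \<times> nat"

text \<open>A cycle through the vertices \<open>bs\<close> starts and ends at the last of them.\<close>

definition layc :: "nat list \<times> nat list \<Rightarrow> edge list" where "layc c = tr (last (snd c)) (fst c) (snd c)"

definition layp :: "pathgen \<times> nat list \<Rightarrow> edge list" where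
  "layp p = (case p of ((i, w, j), bs) \<Rightarrow> tr i w (bs @ [j]))"

definition lay :: "(nat list \<times> nat list) list \<Rightarrow> (pathgen \<times> nat list) list \<Rightarrow> edge list" where
  "lay cs ps = concat (map layc cs) @ concat (map layp ps)"

definition okc :: "nat list \<times> nat list \<Rightarrow> bool" where "okc c \<longleftrightarrow> fst c ~= [] \<and> length (snd c) = length (fst c)"

definition okp :: "nat \<Rightarrow> pathgen \<times> nat list \<Rightarrow> bool" where
  "okp d p \<longleftrightarrow> (case p of ((i, w, j), bs) \<Rightarrow> length w = Suc (length bs) \<and> i \<le> d \<and> j \<le> d)"

definition priv :: "(nat list \<times> nat list) list \<Rightarrow> (pathgen \<times> nat list) list \<Rightarrow> nat list" where
  "priv cs ps = concat (map snd cs) @ concat (map snd ps)"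

definition okl :: "nat \<Rightarrow> (nat list \<times> nat list) list \<Rightarrow> (pathgen \<times> nat list) list \<Rightarrow> bool" where
  "okl d cs ps \<longleftrightarrow> (\<forall>c\<in>set cs. okc c) \<and> (\<forall>p\<in>set ps. okp d p)"

definition std :: "nat \<Rightarrow> (nat list \<times> nat list) list \<Rightarrow> (pathgen \<times> nat list) list \<Rightarrow> bool" where
  "std d cs ps \<longleftrightarrow> okl d cs ps \<and> distinct (priv cs ps) \<and> (\<forall>v\<in>set (priv cs ps). d < v)"

lemma layc_sources: "okc c ==> mset (map esrc (layc c)) = mset (snd c)"
proof -
  assume "okc c"
  then have l: "length (fst c) = length (snd c)" "fst c ~= []" "snd c ~= []" by (auto simp: okc_def)
  have "mset (snd c) = mset (butlast (snd c) @ [last (snd c)])" using l(3) by simp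
  then show ?thesis unfolding layc_def tr_sources[OF l(1,2)] by simp
qed

lemma layp_sources: "okp d ((i, w, j), bs) ==> map esrc (layp ((i, w, j), bs)) = i # bs"
proof -
  assume "okp d ((i, w, j), bs)"
  then have "length w = length (bs @ [j])" "w ~= []" by (auto simp: okp_def)
  then show ?thesis unfolding layp_def prod.case by (subst tr_sources) auto
qed

lemma lay_sources:
  assumes "okl d cs ps"
  shows "mset (map esrc (lay cs ps)) = mset (map (fst \<circ> fst) ps) + mset (priv cs ps)"
proof -
  have c: "(\<Sum>c\<leftarrow>cs. mset (map esrc (layc c))) = (\<Sum>c\<leftarrow>cs. mset (snd c))"
    using assms unfolding okl_def by (intro arg_cong[of _ _ sum_list] map_cong refl layc_sources) auto
  have p: "(\<Sum>p\<leftarrow>ps. mset (map esrc (layp p))) = (\<Sum>p\<leftarrow>ps. add_mset (fst (fst p)) (mset (snd p)))"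
  proof (intro arg_cong[of _ _ sum_list] map_cong refl)
    fix p assume "p \<in> set ps"
    then have "okp d p" using assms unfolding okl_def by blast
    then show "mset (map esrc (layp p)) = add_mset (fst (fst p)) (mset (snd p))"
      using layp_sources by (cases p) fastforce
  qed
  have mc: "mset (map f (concat xss)) = (\<Sum>xs\<leftarrow>xss. mset (map f xs))" for f :: "edge \<Rightarrow> nat" and xss
    by (induction xss) simp_all
  have mc': "mset (concat xss) = (\<Sum>xs\<leftarrow>xss. mset xs)" for xss :: "nat list list"
    by (induction xss) simp_all
  have s: "(\<Sum>p\<leftarrow>ps. add_mset (fst (fst p)) (mset (snd p))) = mset (map (fst \<circ> fst) ps) + (\<Sum>p\<leftarrow>ps. mset (snd p))"
    by (induction ps) simp_all
  show ?thesis
    unfolding lay_def priv_def map_append mset_append mc mc' map_map o_def c p s[unfolded o_def] by simp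
qed

lemma filter_mset_empty_conv: "filter_mset P M = {#} \<longleftrightarrow> (\<forall>x\<in>#M. \<not> P x)"
  by (induction M) auto

lemma distinct_filter_map:
  assumes "distinct (filter P (map f xs))" "x \<in> set xs" "y \<in> set xs" "f x = f y" "P (f x)"
  shows "x = y"
  using assms
proof (induction xs)
  case (Cons a xs)
  have a: "f a \<notin> f ` set xs" if "P (f a)" using Cons.prems(1) that by auto
  have xs: "distinct (filter P (map f xs))" using Cons.prems(1) by (simp split: if_splits)
  consider "x = a" "y = a" | "x = a" "y \<in> set xs" | "y = a" "x \<in> set xs" | "x \<in> set xs" "y \<in> set xs"
    using Cons.prems(2,3) by auto
  then show ?case
  proof cases
    case 2
    then have "f a \<in> f ` set xs" using Cons.prems(4) by (intro image_eqI[of _ _ y]) simp_all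
    then show ?thesis using a 2 Cons.prems(5) by simp
  next
    case 3
    then have "f a \<in> f ` set xs" using Cons.prems(4) by (intro image_eqI[of _ _ x]) simp_all
    then show ?thesis using a 3 Cons.prems(4,5) by simp
  next
    case 4
    then show ?thesis using Cons.IH[OF xs] Cons.prems(4,5) by simp
  qed simp
qed simp

lemma std_unique_source:
  assumes "std d cs ps" "e \<in> set (lay cs ps)" "e' \<in> set (lay cs ps)" "esrc e = esrc e'" "d < esrc e"
  shows "e = e'"
proof -
  let ?E = "lay cs ps"
  have ok: "okl d cs ps" using assms(1) by (simp add: std_def)
  have "mset (filter (\<lambda>v. d < v) (map esrc ?E)) = filter_mset (\<lambda>v. d < v) (mset (map (fst \<circ> fst) ps)) + filter_mset (\<lambda>v. d < v) (mset (priv cs ps))"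
    using arg_cong[OF lay_sources[OF ok], of "filter_mset (\<lambda>v. d < v)"] by simp
  also have "filter_mset (\<lambda>v. d < v) (mset (map (fst \<circ> fst) ps)) = {#}"
    using ok unfolding okl_def okp_def by (auto simp: filter_mset_empty_conv)
  also have "filter_mset (\<lambda>v. d < v) (mset (priv cs ps)) = mset (priv cs ps)"
    using assms(1) unfolding std_def by (simp add: filter_mset_eq_conv)
  finally have "mset (filter (\<lambda>v. d < v) (map esrc ?E)) = mset (priv cs ps)" by simp
  then have "distinct (filter (\<lambda>v. d < v) (map esrc ?E))" using assms(1) unfolding std_def
    by (metis mset_eq_imp_distinct_iff)
  then show ?thesis using distinct_filter_map assms(2-5) by metis
qed

text \<open>Each open trail uses two ends at most \<open>d\<close>, and in a standard layout nothing else does. So counting low sources compares the numbers of open trails.\<close>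

lemma length_bound:
  assumes std: "std d cs ps" and ok: "okl d cs' ps'" and eq: "mset (lay cs' ps') = mset (lay cs ps)"
  shows "length ps' \<le> length ps" "length ps' = length ps ==> std d cs' ps'"
proof -
  have okl: "okl d cs ps" using std by (simp add: std_def)
  have s: "mset (map (fst \<circ> fst) ps') + mset (priv cs' ps') = mset (map (fst \<circ> fst) ps) + mset (priv cs ps)"
    unfolding lay_sources[OF okl, symmetric] lay_sources[OF ok, symmetric] using eq by (metis mset_map)
  have low: "filter_mset (\<lambda>v. v \<le> d) (mset (map (fst \<circ> fst) qs)) = mset (map (fst \<circ> fst) qs)"
    if "\<forall>p\<in>set qs. okp d p" for qs :: "(pathgen \<times> nat list) list"
    using that unfolding okp_def by (auto simp: filter_mset_eq_conv)
  have priv0: "filter_mset (\<lambda>v. v \<le> d) (mset (priv cs ps)) = {#}"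
    using std unfolding std_def by (auto simp: filter_mset_empty_conv)
  have "mset (map (fst \<circ> fst) ps') + filter_mset (\<lambda>v. v \<le> d) (mset (priv cs' ps')) = mset (map (fst \<circ> fst) ps)"
    using arg_cong[OF s, of "filter_mset (\<lambda>v. v \<le> d)"] low[of ps] low[of ps'] okl ok priv0 unfolding okl_def by simp
  from arg_cong[OF this, of size]
  have size: "length ps' + size (filter_mset (\<lambda>v. v \<le> d) (mset (priv cs' ps'))) = length ps" by simp
  then show "length ps' \<le> length ps" by simp
  assume "length ps' = length ps"
  then have "filter_mset (\<lambda>v. v \<le> d) (mset (priv cs' ps')) = {#}" using size by simp
  then have gt: "\<forall>v\<in>set (priv cs' ps'). d < v" by (auto simp: filter_mset_empty_conv)
  have high: "filter_mset (\<lambda>v. d < v) (mset (map (fst \<circ> fst) qs)) = {#}"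
    if "\<forall>p\<in>set qs. okp d p" for qs :: "(pathgen \<times> nat list) list"
    using that unfolding okp_def by (auto simp: filter_mset_empty_conv)
  have "filter_mset (\<lambda>v. d < v) (mset (priv cs' ps')) = filter_mset (\<lambda>v. d < v) (mset (priv cs ps))"
  proof -
    have h: "filter_mset (\<lambda>v. d < v) (mset (map (fst \<circ> fst) ps)) = {#}" "filter_mset (\<lambda>v. d < v) (mset (map (fst \<circ> fst) ps')) = {#}"
      using high okl ok unfolding okl_def by blast+
    show ?thesis using arg_cong[OF s, of "filter_mset (\<lambda>v. d < v)"] unfolding filter_union_mset h by simp
  qed
  moreover have "filter_mset (\<lambda>v. d < v) (mset (priv cs' ps')) = mset (priv cs' ps')"
    using gt by (simp add: filter_mset_eq_conv)
  moreover have "filter_mset (\<lambda>v. d < v) (mset (priv cs ps)) = mset (priv cs ps)"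
    using std unfolding std_def by (simp add: filter_mset_eq_conv)
  ultimately have "mset (priv cs' ps') = mset (priv cs ps)" by simp
  then have "distinct (priv cs' ps')" using std unfolding std_def by (metis mset_eq_imp_distinct_iff)
  then show "std d cs' ps'" using ok gt unfolding std_def by blast
qed

text \<open>A trail is determined by its first edge if edges are determined by their source.\<close>

lemma tr_determined:
  assumes uniq: "\<And>e e'. e \<in> E ==> e' \<in> E ==> esrc e = esrc e' ==> \<not> Tm (esrc e) ==> e = e'"
    and "length w = Suc (length bs)" "length w' = Suc (length bs')"
    and "set (tr i w (bs @ [j])) \<subseteq> E" "set (tr i w' (bs' @ [j'])) \<subseteq> E"
    and "hd (tr i w (bs @ [j])) = hd (tr i w' (bs' @ [j']))"
    and "\<forall>b\<in>set bs. \<not> Tm b" "\<forall>b\<in>set bs'. \<not> Tm b" "Tm j" "Tm j'"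
  shows "w = w' \<and> bs = bs' \<and> j = j'"
  using assms(2-)
proof (induction bs arbitrary: i w w' bs')
  case Nil
  obtain \<alpha> where w: "w = [\<alpha>]" using Nil.prems(1) by (cases w) auto
  obtain \<alpha>' w1' where w': "w' = \<alpha>' # w1'" using Nil.prems(2) by (cases w') auto
  show ?case
  proof (cases bs')
    case Nil
    then show ?thesis using w w' Nil.prems by simp
  next
    case (Cons b bs1)
    then show ?thesis using w w' Nil.prems by auto
  qed
next
  case (Cons b bs)
  obtain \<alpha> w1 where w: "w = \<alpha> # w1" using Cons.prems(1) by (cases w) auto
  obtain \<alpha>' w1' where w': "w' = \<alpha>' # w1'" using Cons.prems(2) by (cases w') auto
  show ?case
  proof (cases bs')
    case Nil
    then show ?thesis using w w' Cons.prems by auto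
  next
    case bs': (Cons b' bs1')
    have b: "\<alpha> = \<alpha>'" "b = b'" using Cons.prems(5) w w' bs' by simp_all
    obtain \<beta> w2 where w1: "w1 = \<beta> # w2" using Cons.prems(1) w by (cases w1) auto
    obtain \<beta>' w2' where w1': "w1' = \<beta>' # w2'" using Cons.prems(2) w' bs' by (cases w1') auto
    have ne: "tr b w1 (bs @ [j]) ~= []" "tr b w1' (bs1' @ [j']) ~= []"
      unfolding w1 w1' by (cases bs; cases bs1'; simp)+
    have h: "esrc (hd (tr b w1 (bs @ [j]))) = b" "esrc (hd (tr b w1' (bs1' @ [j']))) = b"
      unfolding w1 w1' by (cases bs; cases bs1'; simp)+
    have sub: "set (tr b w1 (bs @ [j])) \<subseteq> E" "set (tr b w1' (bs1' @ [j'])) \<subseteq> E"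
      using Cons.prems(3,4) w w' bs' b by simp_all
    have "hd (tr b w1 (bs @ [j])) = hd (tr b w1' (bs1' @ [j']))"
    proof (rule uniq)
      show "hd (tr b w1 (bs @ [j])) \<in> E" using sub(1) hd_in_set[OF ne(1)] by (rule subsetD)
      show "hd (tr b w1' (bs1' @ [j'])) \<in> E" using sub(2) hd_in_set[OF ne(2)] by (rule subsetD)
      show "esrc (hd (tr b w1 (bs @ [j]))) = esrc (hd (tr b w1' (bs1' @ [j'])))" unfolding h ..
      show "\<not> Tm (esrc (hd (tr b w1 (bs @ [j]))))" unfolding h using Cons.prems(6) by simp
    qed
    then have "w1 = w1' \<and> bs = bs1' \<and> j = j'"
      using Cons.prems sub b w w' bs' by (intro Cons.IH[of w1 w1' bs1' b]) simp_all
    then show ?thesis using w w' bs' b by simp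
  qed
qed

subsection \<open>Rotations\<close>

text \<open>The necklace of \<open>w\<close>, that is its class under rotation, and a representative of it.\<close>

definition rots :: "nat list \<Rightarrow> nat list set" where "rots w = range (\<lambda>n. rotate n w)"
definition nec :: "nat list \<Rightarrow> nat list" where "nec w = (SOME v. v \<in> rots w)"

lemma nec_rots: "nec w \<in> rots w"
  unfolding nec_def by (rule someI[of _ w]) (auto simp: rots_def intro: range_eqI[of _ _ 0])

lemma rots_rotate: "rots (rotate k w) = rots w"
proof (cases "w = []")
  case False
  show ?thesis
  proof
    show "rots (rotate k w) \<subseteq> rots w" unfolding rots_def by (auto simp: rotate_rotate)
    show "rots w \<subseteq> rots (rotate k w)"
    proof
      fix v assume "v \<in> rots w"
      then obtain n where v: "v = rotate n w" by (auto simp: rots_def)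
      let ?m = "n + (length w * k - k)"
      have "k \<le> length w * k" using False by (cases "length w") auto
      then have "?m + k = n + length w * k" by linarith
      then have "rotate ?m (rotate k w) = rotate (n + length w * k) w" by (simp only: rotate_rotate)
      also have "\<dots> = rotate n w" by (subst (1 2) rotate_conv_mod) simp
      finally show "v \<in> rots (rotate k w)" unfolding v rots_def by (metis rangeI)
    qed
  qed
qed simp

lemma nec_rotate: "nec (rotate k w) = nec w"
  unfolding nec_def rots_rotate ..

lemma layc_rotate1: "okc (w, bs) ==> layc (rotate1 w, rotate1 bs) = rotate1 (layc (w, bs))"
proof -
  assume ok: "okc (w, bs)"
  then obtain \<alpha> w1 where w: "w = \<alpha> # w1" by (cases w) (auto simp: okc_def)
  obtain b bs1 where bs: "bs = b # bs1" using ok w by (cases bs) (auto simp: okc_def)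
  have l: "length w1 = length bs1" using ok w bs by (simp add: okc_def)
  show ?thesis
    unfolding layc_def w bs by (simp add: tr_snoc[OF l])
qed

lemma okc_rotate: "okc (w, bs) ==> okc (rotate n w, rotate n bs)"
  by (simp add: okc_def)

lemma layc_rotate: "okc (w, bs) ==> mset (layc (rotate n w, rotate n bs)) = mset (layc (w, bs))"
proof (induction n)
  case (Suc n)
  have "mset (layc (rotate1 (rotate n w), rotate1 (rotate n bs))) = mset (rotate1 (layc (rotate n w, rotate n bs)))"
    by (simp only: layc_rotate1[OF okc_rotate[OF Suc.prems]])
  also have "\<dots> = mset (layc (rotate n w, rotate n bs))"
    by (cases "layc (rotate n w, rotate n bs)") simp_all
  finally show ?case using Suc by (simp add: rotate_Suc)
qed simp

lemma rotate_last: "r \<in> set bs ==> \<exists>n. last (rotate n bs) = r"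
proof -
  assume "r \<in> set bs"
  then obtain xs ys where bs: "bs = xs @ r # ys" by (meson split_list)
  have "rotate (length (xs @ [r])) ((xs @ [r]) @ ys) = ys @ (xs @ [r])" by (rule rotate_append)
  then show ?thesis using bs by (intro exI[of _ "length (xs @ [r])"]) simp
qed

section \<open>A layout determines its components\<close>

lemma lay_paths_split: "mset (lay cs (A @ p # B)) = mset (layp p) + mset (lay cs (A @ B))"
  by (simp add: lay_def)

lemma lay_cycles_split: "mset (lay (A @ c # B) ps) = mset (layc c) + mset (lay (A @ B) ps)"
  by (simp add: lay_def)

lemma std_paths_drop: "std d cs (A @ p # B) ==> std d cs (A @ B)"
  unfolding std_def okl_def priv_def by auto

lemma std_cycles_drop: "std d (A @ c # B) ps ==> std d (A @ B) ps"
  unfolding std_def okl_def priv_def by auto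

lemma lay_low_source:
  assumes std: "std d cs ps" and e: "e \<in> set (lay cs ps)" "esrc e \<le> d"
  shows "\<exists>i w j bs A B. ps = A @ ((i, w, j), bs) # B \<and> e = hd (layp ((i, w, j), bs)) \<and> esrc e = i"
proof -
  have gt: "d < v" if "v \<in> set (priv cs ps)" for v using std that unfolding std_def by blast
  have "e \<notin> set (concat (map layc cs))"
  proof
    assume "e \<in> set (concat (map layc cs))"
    then obtain c where c: "c \<in> set cs" "e \<in> set (layc c)" by auto
    have "okc c" using std c(1) unfolding std_def okl_def by blast
    then have "mset (map esrc (layc c)) = mset (snd c)" by (rule layc_sources)
    from mset_eq_setD[OF this] have "esrc e \<in> set (snd c)" using c(2) by auto
    then have "esrc e \<in> set (priv cs ps)" using c(1) unfolding priv_def by auto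
    then show False using gt e(2) by fastforce
  qed
  then obtain p where p: "p \<in> set ps" "e \<in> set (layp p)" using e(1) unfolding lay_def by auto
  obtain i w j bs where pe: "p = ((i, w, j), bs)" by (metis prod.collapse)
  have "okp d p" using std p(1) unfolding std_def okl_def by blast
  then have src: "map esrc (layp p) = i # bs" and len: "length w = Suc (length bs)"
    using layp_sources unfolding pe by (blast, simp add: okp_def)
  have "layp p ~= []" using p(2) by auto
  then obtain e0 es where l: "layp p = e0 # es" by (cases "layp p") auto
  have "e = e0"
  proof (rule ccontr)
    assume "e ~= e0"
    then have "e \<in> set es" using p(2) l by simp
    moreover have "bs = map esrc es" using src l by simp
    ultimately have "esrc e \<in> set bs" by simp
    then have "esrc e \<in> set (priv cs ps)" using p(1) unfolding priv_def pe by force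
    then show False using gt e(2) by fastforce
  qed
  moreover obtain A B where "ps = A @ p # B" using p(1) by (meson split_list)
  ultimately show ?thesis using src l pe by (intro exI[of _ i] exI[of _ w] exI[of _ j] exI[of _ bs] exI[of _ A] exI[of _ B]) simp
qed

lemma paths_determined:
  assumes "std d cs ps" "std d cs' ps'" "mset (lay cs ps) = mset (lay cs' ps')"
  shows "mset ps = mset ps' \<and> mset (lay cs []) = mset (lay cs' [])"
  using assms
proof (induction ps arbitrary: ps')
  case Nil
  have "length ps' \<le> length ([] :: (pathgen \<times> nat list) list)"
    by (rule length_bound(1)[OF Nil.prems(1)]) (use Nil.prems in \<open>simp_all add: std_def\<close>)
  then show ?case using Nil by simp
next
  case (Cons p ps)
  obtain i w j bs where p: "p = ((i, w, j), bs)" by (metis prod.collapse)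
  have okp: "okp d p" using Cons.prems(1) by (simp add: std_def okl_def)
  then have len: "length w = Suc (length bs)" and ij: "i \<le> d" "j \<le> d" by (simp_all add: p okp_def)
  have src: "map esrc (layp p) = i # bs" using layp_sources okp unfolding p by blast
  then obtain e0 es0 where l: "layp p = e0 # es0" by (cases "layp p") auto
  have e0: "esrc e0 = i" using src l by simp
  have se: "set (lay cs (p # ps)) = set (lay cs' ps')" using mset_eq_setD[OF Cons.prems(3)] .
  have "e0 \<in> set (lay cs (p # ps))" by (simp add: lay_def l)
  then have e0': "e0 \<in> set (lay cs' ps')" unfolding se .
  obtain i' w' j' bs' A B where ps': "ps' = A @ ((i', w', j'), bs') # B" "e0 = hd (layp ((i', w', j'), bs'))" "i = i'"
    using lay_low_source[OF Cons.prems(2) e0'] e0 ij by auto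
  have okp': "okp d ((i', w', j'), bs')" using Cons.prems(2) unfolding ps' std_def okl_def by simp
  have "w = w' \<and> bs = bs' \<and> j = j'"
  proof (rule tr_determined[of "set (lay cs' ps')" "\<lambda>v. v \<le> d" _ _ _ _ i])
    show "e = e'" if "e \<in> set (lay cs' ps')" "e' \<in> set (lay cs' ps')" "esrc e = esrc e'" "\<not> esrc e \<le> d" for e e'
      using std_unique_source[OF Cons.prems(2) that(1-3)] that(4) by simp
    have "set (tr i w (bs @ [j])) \<subseteq> set (lay cs (p # ps))"
      unfolding lay_def by (auto simp: p layp_def)
    then show "set (tr i w (bs @ [j])) \<subseteq> set (lay cs' ps')" unfolding se .
    show "set (tr i w' (bs' @ [j'])) \<subseteq> set (lay cs' ps')"
      unfolding ps'(1) lay_def by (auto simp: ps'(3) layp_def)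
    show "hd (tr i w (bs @ [j])) = hd (tr i w' (bs' @ [j']))"
      using l ps'(2,3) by (simp add: p layp_def)
    show "length w = Suc (length bs)" "length w' = Suc (length bs')" "j \<le> d" "j' \<le> d"
      using len ij okp' by (simp_all add: okp_def)
    have pr: "\<forall>v\<in>set (priv cs (p # ps)). d < v" "\<forall>v\<in>set (priv cs' ps'). d < v"
      using Cons.prems(1,2) by (simp_all add: std_def)
    have "set bs \<subseteq> set (priv cs (p # ps))" "set bs' \<subseteq> set (priv cs' ps')" by (auto simp: priv_def p ps'(1))
    then show "\<forall>b\<in>set bs. \<not> b \<le> d" "\<forall>b\<in>set bs'. \<not> b \<le> d" using pr by (meson not_le subsetD)+
  qed
  then have eq: "ps' = A @ p # B" using ps' p by simp
  have "mset (lay cs ps) = mset (lay cs' (A @ B))"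
    using Cons.prems(3) lay_paths_split[of cs "[]" p ps] lay_paths_split[of cs' A p B] unfolding eq by simp
  moreover have "std d cs ps" using std_paths_drop[of d cs "[]" p ps] Cons.prems(1) by simp
  moreover have "std d cs' (A @ B)" using Cons.prems(2) unfolding eq by (rule std_paths_drop)
  ultimately have "mset ps = mset (A @ B) \<and> mset (lay cs []) = mset (lay cs' [])" using Cons.IH by blast
  then show ?case unfolding eq by simp
qed

lemma cycles_determined:
  assumes "std d cs []" "std d cs' []" "mset (lay cs []) = mset (lay cs' [])"
  shows "mset (map (nec \<circ> fst) cs) = mset (map (nec \<circ> fst) cs')"
  using assms
proof (induction cs arbitrary: cs')
  case Nil
  have "cs' = []"
  proof (rule ccontr)
    assume "cs' ~= []"
    then obtain c cs1 where c: "cs' = c # cs1" by (cases cs') auto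
    then have ok: "okc c" using Nil.prems(2) by (simp add: std_def okl_def)
    then have "mset (map esrc (layc c)) = mset (snd c)" by (rule layc_sources)
    moreover have "layc c = []" using Nil.prems(3) c by (simp add: lay_def)
    ultimately show False using ok by (auto simp: okc_def)
  qed
  then show ?case by simp
next
  case (Cons c cs)
  obtain w bs where c: "c = (w, bs)" by (cases c)
  have okc: "okc c" using Cons.prems(1) by (simp add: std_def okl_def)
  then have len: "length w = length bs" and w0: "w ~= []" by (simp_all add: c okc_def)
  then have bs0: "bs ~= []" by auto
  let ?r = "last bs" and ?E = "set (lay cs' [])"
  have src: "map esrc (layc c) = ?r # butlast bs"
    unfolding c layc_def fst_conv snd_conv by (rule tr_sources[OF len w0])
  then obtain e0 es0 where l: "layc c = e0 # es0" by (cases "layc c") auto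
  have e0: "esrc e0 = ?r" using src l by simp
  have se: "set (lay (c # cs) []) = ?E" using mset_eq_setD[OF Cons.prems(3)] .
  have "e0 \<in> set (lay (c # cs) [])" by (simp add: lay_def l)
  then have e0': "e0 \<in> ?E" unfolding se .
  then obtain c' where c': "c' \<in> set cs'" "e0 \<in> set (layc c')" by (auto simp: lay_def)
  obtain w' bs' where c'e: "c' = (w', bs')" by (cases c')
  have okc': "okc c'" using Cons.prems(2) c'(1) by (simp add: std_def okl_def)
  have "mset (map esrc (layc c')) = mset bs'" using layc_sources[OF okc'] by (simp add: c'e)
  from mset_eq_setD[OF this] have "?r \<in> set bs'" using c'(2) e0 by force
  from rotate_last[OF this] obtain n where n: "last (rotate n bs') = ?r" by (elim exE)
  let ?w = "rotate n w'" and ?bs = "rotate n bs'"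
  have rot: "mset (layc (?w, ?bs)) = mset (layc c')" using layc_rotate okc' unfolding c'e by blast
  have okr: "okc (?w, ?bs)" using okc_rotate okc' unfolding c'e by blast
  then have lenr: "length ?w = length ?bs" and w0r: "?w ~= []" by (simp_all add: okc_def)
  then have bs0r: "?bs ~= []" by auto
  obtain A B where cs': "cs' = A @ c' # B" using c'(1) by (meson split_list)
  have gtd: "d < v" if "v \<in> set bs \<or> v \<in> set bs'" for v
    using that Cons.prems(1,2) unfolding std_def priv_def c cs' c'e by auto
  have subr: "set (tr ?r ?w ?bs) \<subseteq> ?E"
  proof -
    have "set (tr ?r ?w ?bs) = set (layc c')" using mset_eq_setD[OF rot] n by (simp add: layc_def)
    then show ?thesis unfolding cs' lay_def by auto
  qed
  have srcr: "map esrc (tr ?r ?w ?bs) = ?r # butlast ?bs" by (rule tr_sources[OF lenr w0r])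
  then obtain e1 es1 where l1: "tr ?r ?w ?bs = e1 # es1" by (cases "tr ?r ?w ?bs") auto
  have e1: "e1 = e0"
  proof (rule std_unique_source[OF Cons.prems(2) _ e0'])
    show "e1 \<in> set (lay cs' [])" using subr l1 by simp
    show "esrc e1 = esrc e0" using srcr l1 e0 by simp
    show "d < esrc e1" using srcr l1 gtd[of ?r] bs0 by simp
  qed
  have dist: "distinct bs" "distinct ?bs"
    using Cons.prems(1,2) unfolding std_def priv_def c cs' c'e by auto
  have split: "bs = butlast bs @ [?r]" "?bs = butlast ?bs @ [?r]"
    using append_butlast_last_id[OF bs0] append_butlast_last_id[OF bs0r] unfolding n by simp_all
  have nr: "?r \<notin> set (butlast bs)" "?r \<notin> set (butlast ?bs)"
  proof -
    have d: "distinct xs ==> xs = butlast xs @ [x] ==> x \<notin> set (butlast xs)" for x and xs :: "nat list"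
      by (metis distinct_append disjoint_iff list.set_intros(1))
    show "?r \<notin> set (butlast bs)" "?r \<notin> set (butlast ?bs)" by (rule d[OF dist(1) split(1)], rule d[OF dist(2) split(2)])
  qed
  have "w = ?w \<and> butlast bs = butlast ?bs \<and> ?r = ?r"
  proof (rule tr_determined[of ?E "\<lambda>v. v \<le> d \<or> v = ?r" _ _ _ _ ?r])
    show "e = e'" if "e \<in> ?E" "e' \<in> ?E" "esrc e = esrc e'" "\<not> (esrc e \<le> d \<or> esrc e = ?r)" for e e'
      using std_unique_source[OF Cons.prems(2) that(1-3)] that(4) by simp
    have "set (tr ?r w bs) \<subseteq> set (lay (c # cs) [])" by (auto simp: lay_def c layc_def)
    then show "set (tr ?r w (butlast bs @ [?r])) \<subseteq> ?E" unfolding se split(1)[symmetric] .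
    show "set (tr ?r ?w (butlast ?bs @ [?r])) \<subseteq> ?E" unfolding split(2)[symmetric] by (rule subr)
    have "tr ?r w bs = e0 # es0" using l by (simp add: c layc_def)
    then show "hd (tr ?r w (butlast bs @ [?r])) = hd (tr ?r ?w (butlast ?bs @ [?r]))"
      unfolding split[symmetric] l1 by (simp add: e1)
    show "length w = Suc (length (butlast bs))" "length ?w = Suc (length (butlast ?bs))"
      using len lenr bs0 bs0r by simp_all
    show "\<forall>b\<in>set (butlast bs). \<not> (b \<le> d \<or> b = ?r)" using gtd nr(1) in_set_butlastD by fastforce
    show "\<forall>b\<in>set (butlast ?bs). \<not> (b \<le> d \<or> b = ?r)"
    proof
      fix b assume b: "b \<in> set (butlast ?bs)"
      then have "b \<in> set bs'" using in_set_butlastD[OF b] by simp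
      then show "\<not> (b \<le> d \<or> b = ?r)" using gtd[of b] nr(2) b by auto
    qed
  qed simp_all
  then have eq: "w = ?w" "bs = ?bs" using split by metis+
  have lay_eq: "mset (layc c) = mset (layc c')" using rot eq by (simp add: c)
  have nec: "nec w = nec w'" using eq(1) nec_rotate by metis
  have "mset (lay cs []) = mset (lay (A @ B) [])"
    using Cons.prems(3) lay_cycles_split[of "[]" c cs "[]"] lay_cycles_split[of A c' B "[]"] lay_eq unfolding cs' by simp
  moreover have "std d cs []" using std_cycles_drop[of d "[]" c cs] Cons.prems(1) by simp
  moreover have "std d (A @ B) []" using Cons.prems(2) unfolding cs' by (rule std_cycles_drop)
  ultimately have "mset (map (nec \<circ> fst) cs) = mset (map (nec \<circ> fst) (A @ B))" using Cons.IH by blast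
  then show ?case unfolding cs' by (simp add: c c'e nec o_def)
qed

text \<open>In a standard layout an edge is determined by its source if that lies above \<open>d\<close>. Hence every trail that starts at a low vertex can be followed until it ends at a
  low vertex, and what is left decomposes into cycles in only one way.\<close>

theorem layout_determined:
  assumes std: "std d cs ps" and ok: "okl d cs' ps'" and eq: "mset (lay cs' ps') = mset (lay cs ps)"
  shows "length ps' \<le> length ps"
    "length ps' = length ps ==> mset (map fst ps') = mset (map fst ps) \<and> mset (map (nec \<circ> fst) cs') = mset (map (nec \<circ> fst) cs)"
proof -
  show "length ps' \<le> length ps" by (rule length_bound(1)[OF std ok eq])
  assume "length ps' = length ps"
  then have std': "std d cs' ps'" using length_bound(2)[OF std ok eq] by blast
  have 1: "mset ps' = mset ps \<and> mset (lay cs' []) = mset (lay cs [])" by (rule paths_determined[OF std' std eq])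
  have "std d cs []" "std d cs' []" using std std' unfolding std_def okl_def priv_def by auto
  then have "mset (map (nec \<circ> fst) cs') = mset (map (nec \<circ> fst) cs)" using cycles_determined 1 by blast
  moreover have "mset (map fst ps') = mset (map fst ps)" using 1 by (metis mset_map)
  ultimately show "mset (map fst ps') = mset (map fst ps) \<and> mset (map (nec \<circ> fst) cs') = mset (map (nec \<circ> fst) cs)" by blast
qed

section \<open>Leading terms of monomials in the generators\<close>

lemma psym_nonzeroD:
  "psym w i j es ~= 0 ==> \<exists>ts. length ts = length w \<and> last (i # ts) = j \<and> mset es = mset (tr i w ts)"
proof (induction w arbitrary: i es)
  case Nil
  then show ?case by (auto split: if_splits)
next
  case (Cons \<alpha> w)
  have "psum (\<lambda>e r. case e of (c, s, t) \<Rightarrow> if c = \<alpha> \<and> s = i then psym w t j r else 0) es ~= 0"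
    using Cons.prems by simp
  then obtain e r where er: "mset es = add_mset e (mset r)"
    "(case e of (c, s, t) \<Rightarrow> if c = \<alpha> \<and> s = i then psym w t j r else 0) ~= 0" by (rule psum_nonzeroD)
  obtain c s t where e: "e = (c, s, t)" by (cases e) auto
  have p: "c = \<alpha>" "s = i" "psym w t j r ~= 0" using er(2) by (auto simp: e split: if_splits)
  obtain ts where ts: "length ts = length w" "last (t # ts) = j" "mset r = mset (tr t w ts)" using Cons.IH[OF p(3)] by blast
  show ?case by (rule exI[of _ "t # ts"]) (use ts er e p in simp)
qed

lemma csym_nonzeroD:
  "csym w es ~= 0 ==> \<exists>bs. okc (w, bs) \<and> mset es = mset (layc (w, bs))"
proof -
  assume nz: "csym w es ~= 0"
  then obtain \<alpha> w1 where w: "w = \<alpha> # w1" by (cases w) (auto simp: csym_def)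
  have "psum (\<lambda>e r. case e of (c, s, t) \<Rightarrow> if c = \<alpha> then psym w1 t s r else 0) es ~= 0"
    using nz by (simp add: csym_def w)
  then obtain e r where er: "mset es = add_mset e (mset r)"
    "(case e of (c, s, t) \<Rightarrow> if c = \<alpha> then psym w1 t s r else 0) ~= 0" by (rule psum_nonzeroD)
  obtain c s t where e: "e = (c, s, t)" by (cases e) auto
  have p: "c = \<alpha>" "psym w1 t s r ~= 0" using er(2) by (auto simp: e split: if_splits)
  obtain ts where ts: "length ts = length w1" "last (t # ts) = s" "mset r = mset (tr t w1 ts)" using psym_nonzeroD[OF p(2)] by blast
  show ?thesis by (rule exI[of _ "t # ts"]) (use ts er e p w in \<open>simp add: okc_def layc_def\<close>)
qed

lemma psum_ge_first:
  fixes h :: "'a \<Rightarrow> 'a list \<Rightarrow> complex"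
  assumes "\<And>e r. h e r \<ge> 0"
  shows "h e r \<le> psum h (e # r)"
  using psum_nonneg[of "\<lambda>e' r'. h e' (e # r')" r] assms by simp

lemma psym_trail: "length ts = length w ==> 1 \<le> psym w i (last (i # ts)) (tr i w ts)"
proof (induction w arbitrary: i ts)
  case (Cons \<alpha> w)
  obtain t ts1 where ts: "ts = t # ts1" using Cons.prems by (cases ts) auto
  let ?j = "last (i # ts)"
  let ?h = "\<lambda>(e :: edge) r. case e of (c, s, t) \<Rightarrow> if c = \<alpha> \<and> s = i then psym w t ?j r else 0"
  have "1 \<le> psym w t (last (t # ts1)) (tr t w ts1)" using Cons by (simp add: ts)
  also have "\<dots> = ?h (\<alpha>, i, t) (tr t w ts1)" by (simp add: ts)
  also have "\<dots> \<le> psum ?h ((\<alpha>, i, t) # tr t w ts1)"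
    by (rule psum_ge_first) (auto simp: psym_nonneg split: prod.split)
  finally show ?case by (simp only: psym.simps ts tr.simps)
qed simp

lemma csym_layc: "okc (w, bs) ==> 1 \<le> csym w (layc (w, bs))"
proof -
  assume ok: "okc (w, bs)"
  then obtain \<alpha> w1 where w: "w = \<alpha> # w1" by (cases w) (auto simp: okc_def)
  obtain t ts where bs: "bs = t # ts" using ok w by (cases bs) (auto simp: okc_def)
  let ?h = "\<lambda>(e :: edge) r. case e of (c, s, t) \<Rightarrow> if c = \<alpha> then psym w1 t s r else 0"
  have "1 \<le> psym w1 t (last (t # ts)) (tr t w1 ts)" using ok by (intro psym_trail) (simp add: okc_def w bs)
  also have "\<dots> = ?h (\<alpha>, last bs, t) (tr t w1 ts)" by (simp add: bs)
  also have "\<dots> \<le> psum ?h ((\<alpha>, last bs, t) # tr t w1 ts)"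
    by (rule psum_ge_first) (auto simp: psym_nonneg split: prod.split)
  finally show ?thesis by (simp add: csym_def w layc_def bs)
qed

lemma psym_layp: "okp d ((i, w, j), bs) ==> 1 \<le> psym w i j (layp ((i, w, j), bs))"
  using psym_trail[of "bs @ [j]" w i] by (simp add: okp_def layp_def)

definition gsym :: "pathgen \<Rightarrow> coef" where "gsym q = (case q of (i, w, j) \<Rightarrow> psym w i j)"

text \<open>The leading term of a product of generators.\<close>

definition msym :: "nat list list \<Rightarrow> pathgen list \<Rightarrow> coef" where
  "msym Ms Qs = foldr conv (map csym Ms @ map gsym Qs) vac"

lemma vac_nonneg: "0 \<le> vac es" by (simp add: vac_def less_eq_complex_def)

lemma foldr_conv_nonneg: "(\<And>f r. f \<in> set fs ==> 0 \<le> f r) ==> 0 \<le> foldr conv fs vac es"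
proof (induction fs arbitrary: es)
  case Nil
  show ?case by (simp add: vac_nonneg)
next
  case (Cons f fs)
  show ?case unfolding foldr.simps o_def
    by (rule conv_nonneg) (use Cons in auto)
qed

lemma foldr_conv_layout:
  assumes "list_all2 (\<lambda>f es. (\<forall>r. 0 \<le> f r) \<and> 1 \<le> f es) fs ess"
  shows "1 \<le> foldr conv fs vac (concat ess)"
  using assms
proof (induction fs ess rule: list_all2_induct)
  case Nil
  show ?case by simp
next
  case (Cons f fs es ess)
  have nn: "0 \<le> foldr conv fs vac r" for r
    by (rule foldr_conv_nonneg) (use Cons(2) in \<open>auto simp: list_all2_conv_all_nth in_set_conv_nth\<close>)
  have "1 * 1 \<le> f es * foldr conv fs vac (concat ess)"
    by (rule mult_mono) (use Cons in \<open>auto simp: less_eq_complex_def\<close>)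
  also have "\<dots> \<le> conv f (foldr conv fs vac) (es @ concat ess)"
    by (rule conv_ge_mult) (use Cons nn in auto)
  finally show ?case by simp
qed

lemma msym_layout:
  assumes "okl d cs ps"
  shows "1 \<le> msym (map fst cs) (map fst ps) (lay cs ps)"
proof -
  have "list_all2 (\<lambda>f es. (\<forall>r. 0 \<le> f r) \<and> 1 \<le> f es) (map csym (map fst cs) @ map gsym (map fst ps)) (map layc cs @ map layp ps)"
  proof (rule list_all2_appendI)
    show "list_all2 (\<lambda>f es. (\<forall>r. 0 \<le> f r) \<and> 1 \<le> f es) (map csym (map fst cs)) (map layc cs)"
      using assms csym_layc unfolding okl_def list_all2_map1 list_all2_map2
      by (auto simp: list_all2_same csym_nonneg)
    show "list_all2 (\<lambda>f es. (\<forall>r. 0 \<le> f r) \<and> 1 \<le> f es) (map gsym (map fst ps)) (map layp ps)"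
      using assms psym_layp unfolding okl_def list_all2_map1 list_all2_map2
      by (auto simp: list_all2_same gsym_def psym_nonneg)
  qed
  from foldr_conv_layout[OF this] show ?thesis by (simp add: msym_def lay_def)
qed

lemma msym_nonzeroD:
  assumes "msym Ms Qs es ~= 0" "\<forall>(i, w, j)\<in>set Qs. i \<le> d \<and> j \<le> d \<and> w ~= []"
  shows "\<exists>cs ps. okl d cs ps \<and> map fst cs = Ms \<and> map fst ps = Qs \<and> mset es = mset (lay cs ps)"
  using assms
proof (induction Ms arbitrary: es)
  case Nil
  then show ?case
  proof (induction Qs arbitrary: es)
    case Nil
    then have "es = []" by (auto simp: msym_def vac_def split: if_splits)
    then show ?case by (intro exI[of _ "[]"]) (simp add: okl_def lay_def)
  next
    case (Cons q Qs)
    obtain i w j where q: "q = (i, w, j)" by (cases q) auto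
    have "conv (psym w i j) (msym [] Qs) es ~= 0" using Cons.prems(1) by (simp add: msym_def q gsym_def)
    then obtain r1 r2 where r: "mset es = mset r1 + mset r2" "psym w i j r1 ~= 0" "msym [] Qs r2 ~= 0" by (rule conv_nonzeroD)
    obtain ts where ts: "length ts = length w" "last (i # ts) = j" "mset r1 = mset (tr i w ts)" using psym_nonzeroD[OF r(2)] by blast
    obtain cs ps where IH: "okl d cs ps" "map fst cs = []" "map fst ps = Qs" "mset r2 = mset (lay cs ps)"
      using Cons.IH[OF r(3)] Cons.prems(2) by auto
    have w0: "w ~= []" "i \<le> d" "j \<le> d" using Cons.prems(2) by (auto simp: q)
    then have "ts ~= []" using ts(1) by auto
    then have tse: "ts = butlast ts @ [j]" using ts(2) by (metis append_butlast_last_id last_ConsR)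
    let ?p = "((i, w, j), butlast ts)"
    have "okp d ?p" using w0 ts(1) \<open>ts ~= []\<close> by (simp add: okp_def)
    moreover have "layp ?p = tr i w ts" using tse by (simp add: layp_def)
    ultimately show ?case using IH r(1) ts(3) q
      by (intro exI[of _ cs] exI[of _ "?p # ps"]) (auto simp: okl_def lay_def)
  qed
next
  case (Cons m Ms)
  have "conv (csym m) (msym Ms Qs) es ~= 0" using Cons.prems(1) by (simp add: msym_def)
  then obtain r1 r2 where r: "mset es = mset r1 + mset r2" "csym m r1 ~= 0" "msym Ms Qs r2 ~= 0" by (rule conv_nonzeroD)
  obtain bs where bs: "okc (m, bs)" "mset r1 = mset (layc (m, bs))" using csym_nonzeroD[OF r(2)] by blast
  obtain cs ps where IH: "okl d cs ps" "map fst cs = Ms" "map fst ps = Qs" "mset r2 = mset (lay cs ps)"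
    using Cons.IH[OF r(3) Cons.prems(2)] by blast
  show ?case using IH r(1) bs by (intro exI[of _ "(m, bs) # cs"] exI[of _ ps]) (auto simp: okl_def lay_def)
qed

section \<open>Invariant functions are determined by standard layouts\<close>

definition invf :: "nat \<Rightarrow> coef \<Rightarrow> bool" where
  "invf d f \<longleftrightarrow> symf f \<and> (\<forall>a b es. d < a --> d < b --> Dop a b f es = 0)"

lemma invf_good:
  assumes "good d L f"
  shows "invf d f"
proof -
  have sym: "symf f" and supp: "\<And>es. f es ~= 0 ==> \<exists>N. set es \<subseteq> Ed L N" and inv: "\<And>N. Inv d L N f"
    using assms unfolding good_def by blast+
  have "Dop a b f es = 0" if ab: "d < a" "d < b" for a b es
  proof (rule ccontr)
    assume nz: "Dop a b f es ~= 0"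
    have "Dop a b f es = psum (\<lambda>e r. 0 * f r + dm a b e (\<lambda>e'. f (e' # r))) es"
      unfolding Dop_def by (rule gop_eq_psum[OF functional_dm sym])
    with nz have "psum (\<lambda>e r. 0 * f r + dm a b e (\<lambda>e'. f (e' # r))) es ~= 0" by simp
    then obtain e r where er: "mset es = add_mset e (mset r)" "0 * f r + dm a b e (\<lambda>e'. f (e' # r)) ~= 0"
      by (rule psum_nonzeroD)
    obtain c i j where e: "e = (c, i, j)" by (cases e) auto
    have "(i = a \<and> f ((c, b, j) # r) ~= 0) \<or> (j = b \<and> f ((c, i, a) # r) ~= 0)"
      using er(2) by (auto simp: e dm_def split: if_splits)
    then obtain N where "i = a \<and> set ((c, b, j) # r) \<subseteq> Ed L N \<or> j = b \<and> set ((c, i, a) # r) \<subseteq> Ed L N"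
      using supp by blast
    then have N: "set r \<subseteq> Ed L N" "(c, i, j) \<in> Ed L (max N (max a b))"
      using ab by (auto simp: Ed_def)
    let ?N = "max N (max a b)"
    have "set es = insert (c, i, j) (set r)" using mset_eq_setD[of es "e # r"] er(1) by (simp add: e)
    then have "set es \<subseteq> Ed L ?N" using N Ed_mono[of N ?N L] by auto
    then have "Dop a b f es = 0" using inv[of ?N] ab unfolding Inv_def by auto
    then show False using nz by simp
  qed
  then show ?thesis using sym by (simp add: invf_def)
qed

abbreviation srcs :: "edge list \<Rightarrow> nat multiset" where "srcs es \<equiv> mset (map esrc es)"
abbreviation tgts :: "edge list \<Rightarrow> nat multiset" where "tgts es \<equiv> mset (map etgt es)"

lemma srcs_cong: "mset es = mset es' ==> srcs es = srcs es'" by (metis mset_map)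
lemma tgts_cong: "mset es = mset es' ==> tgts es = tgts es'" by (metis mset_map)

lemma psum_if_none: "\<forall>e\<in>set es. \<not> P e ==> psum (\<lambda>e r. if P e then h e r else 0) es = 0"
proof (rule psum_eq_0)
  fix e r assume "\<forall>e\<in>set es. \<not> P e" "mset es = add_mset e (mset r)"
  then show "(if P e then h e r else 0) = 0" by (metis set_mset_mset union_single_eq_member)
qed

text \<open>Apply the diagonal operator \<open>E\<^sub>v\<^sub>b\<close> to the list in which the target \<open>v\<close> of the first edge has been
  replaced by a fresh vertex \<open>b\<close>: the only edge with target \<open>b\<close> is the first one.\<close>

lemma split_vertex:
  assumes f: "invf d f" and vb: "d < v" "d < b" "b ~= v" "b \<notin># tgts rest"
  shows "f ((c, s, v) # rest) = psum (\<lambda>e r. if esrc e = v then f ((fst e, b, etgt e) # r) else 0) ((c, s, b) # rest)"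
proof -
  let ?es = "(c, s, b) # rest"
  let ?h = "\<lambda>e r. if esrc e = v then f ((fst e, b, etgt e) # r) else 0"
  let ?k = "\<lambda>e r. if etgt e = b then f ((fst e, esrc e, v) # r) else 0"
  have "0 = Dop v b f ?es" using f vb unfolding invf_def by simp
  also have "\<dots> = psum (\<lambda>e r. 0 * f r + dm v b e (\<lambda>e'. f (e' # r))) ?es"
    unfolding Dop_def by (rule gop_eq_psum[OF functional_dm]) (use f in \<open>simp add: invf_def\<close>)
  also have "\<dots> = psum (\<lambda>e r. ?h e r + (-1) * ?k e r) ?es" by (rule psum_cong) (auto simp: dm_def)
  also have "\<dots> = psum ?h ?es + (-1) * psum ?k ?es" by (simp only: psum_add psum_cmult)
  also have "psum ?k ?es = f ((c, s, v) # rest) + psum (\<lambda>e r. if etgt e = b then f ((fst e, esrc e, v) # (c, s, b) # r) else 0) rest"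
    by simp
  also have "psum (\<lambda>e r. if etgt e = b then f ((fst e, esrc e, v) # (c, s, b) # r) else 0) rest = 0"
    by (rule psum_if_none) (use vb(4) in force)
  finally show ?thesis by simp
qed

text \<open>A list in which a trail passes through every vertex above \<open>d\<close> at most once; such lists are the layouts up to order.\<close>

definition passed :: "nat \<Rightarrow> edge list \<Rightarrow> bool" where
  "passed d es \<longleftrightarrow> (\<forall>v>d. count (srcs es) v = count (tgts es) v \<and> count (tgts es) v \<le> 1)"

lemma size_filter_mset_le:
  "(\<And>x. x \<in># M ==> P x ==> Q x) ==> size (filter_mset P M) \<le> size (filter_mset Q M)"
  by (induction M) (auto intro: le_SucI)

text \<open>A vertex above \<open>d\<close> that is not met exactly once is split by \<open>split_vertex\<close>: one edge into it is redirected to a fresh vertex. The number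
  of edges into bad vertices decreases, because the fresh vertex is entered and left once in each resulting term.\<close>

lemma passed_determines:
  assumes f: "invf d f" and z: "\<And>es. length es = n ==> passed d es ==> f es = 0"
  shows "length es = n ==> f es = 0"
proof (induction "size (filter_mset (\<lambda>v. d < v \<and> \<not> (count (srcs es) v = 1 \<and> count (tgts es) v = 1)) (tgts es))"
    arbitrary: es rule: less_induct)
  case less
  have sym: "symf f" using f by (simp add: invf_def)
  let ?bad = "\<lambda>es v. d < v \<and> \<not> (count (srcs es) v = 1 \<and> count (tgts es) v = 1)"
  show ?case
  proof (cases "\<exists>e\<in>set es. ?bad es (etgt e)")
    case False
    then have good: "count (srcs es) v = 1" "count (tgts es) v = 1" if "d < v" "v \<in># tgts es" for v
      using that by auto
    show ?thesis
    proof (cases "passed d es")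
      case False
      then obtain v where v: "d < v" "count (srcs es) v ~= count (tgts es) v \<or> \<not> count (tgts es) v \<le> 1"
        unfolding passed_def by blast
      have "v \<notin># tgts es"
      proof
        assume "v \<in># tgts es"
        from good[OF v(1) this] v(2) show False by simp
      qed
      then have "count (tgts es) v = 0" by (simp only: not_in_iff)
      then have "count (srcs es) v ~= count (tgts es) v" using v(2) by linarith
      moreover have "(of_nat (count (srcs es) v) - of_nat (count (tgts es) v)) * f es = 0"
      proof -
        have "map (\<lambda>(c, i, j). i) es = map esrc es" "map (\<lambda>(c, i, j). j) es = map etgt es" by (simp_all add: split_beta)
        from Dop_diag[of v f es, unfolded this] show ?thesis
          using f v(1) by (simp add: invf_def count_mset del: mset_map)
      qed
      ultimately show ?thesis by simp
    qed (rule z[OF less.prems])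
  next
    case True
    then obtain c s v where v: "(c, s, v) \<in> set es" "?bad es v" by force
    then obtain R where R: "mset es = mset ((c, s, v) # R)" by (metis in_set_conv_decomp mset.simps(2) mset_append union_mset_add_mset_right)
    define b where "b = Suc (d + v + sum_mset (srcs es) + sum_mset (tgts es))"
    have "x \<le> sum_mset M" if "x \<in># M" for x and M :: "nat multiset" using multi_member_split[OF that] by auto
    from this[of b "srcs es"] this[of b "tgts es"] have bs: "b \<notin># srcs es" "b \<notin># tgts es"
      by (simp_all only: b_def) linarith+
    have bv: "d < b" "b ~= v" by (simp_all add: b_def)
    have "tgts es = add_mset v (tgts R)" using tgts_cong[OF R] by simp
    then have "b \<notin># tgts R" using bs(2) by (simp only: set_mset_add_mset_insert insert_iff) simp
    note bv = bv this
    show ?thesis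
    proof (rule ccontr)
      assume "f es ~= 0"
      then have "f ((c, s, v) # R) ~= 0" using symfD[OF sym R] by simp
      then have "psum (\<lambda>e r. if esrc e = v then f ((fst e, b, etgt e) # r) else 0) ((c, s, b) # R) ~= 0"
        using split_vertex[OF f _ bv(1-3), of c s] v(2) by simp
      then obtain e r where er: "mset ((c, s, b) # R) = add_mset e (mset r)"
          "(if esrc e = v then f ((fst e, b, etgt e) # r) else 0) ~= 0" by (rule psum_nonzeroD)
      let ?es = "(fst e, b, etgt e) # r"
      have nz: "esrc e = v" "f ?es ~= 0" using er(2) by (auto split: if_splits)
      have er': "mset ((c, s, b) # R) = mset (e # r)" using er(1) by simp
      have S: "add_mset s (srcs R) = add_mset v (srcs r)" "srcs es = add_mset s (srcs R)"
        using srcs_cong[OF er'] srcs_cong[OF R] nz(1) by simp_all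
      have T: "tgts ?es = add_mset b (tgts R)" "tgts es = add_mset v (tgts R)"
        using tgts_cong[OF er'] tgts_cong[OF R] by simp_all
      have S': "add_mset v (srcs ?es) = add_mset b (srcs es)" using S by (simp add: add_mset_commute)
      have cS: "count (srcs ?es) u = (if u = b then 1 else count (srcs es) u)" if "u ~= v" for u
        using arg_cong[OF S', of "\<lambda>M. count M u"] that bs(1) by (auto simp: not_in_iff simp del: mset_map)
      have "size (filter_mset (?bad ?es) (tgts ?es)) \<le> size (filter_mset (?bad es) (tgts R))"
      proof -
        have "count (srcs ?es) b = 1" using cS[OF bv(2)] by (simp only: if_True refl)
        moreover have "count (tgts ?es) b = 1"
          unfolding T(1) using bv(3) by (simp only: count_add_mset not_in_iff if_True refl)
        ultimately have "\<not> ?bad ?es b" by blast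
        then have "filter_mset P (tgts ?es) = filter_mset P (tgts R)" if "P = ?bad ?es" for P
          using that unfolding T(1) filter_mset_add_mset by (simp only: if_False)
        from this[OF refl] have "filter_mset (?bad ?es) (tgts ?es) = filter_mset (?bad ?es) (tgts R)" .
        moreover have "size (filter_mset (?bad ?es) (tgts R)) \<le> size (filter_mset (?bad es) (tgts R))"
        proof (rule size_filter_mset_le)
          fix u assume u: "u \<in># tgts R" "?bad ?es u"
          then have "u ~= b" using bv(3) by auto
          show "?bad es u"
          proof (cases "u = v")
            case False
            have "count (srcs ?es) u = count (srcs es) u" using cS[OF False] \<open>u ~= b\<close> by (simp only: if_False)
            moreover have "count (tgts ?es) u = count (tgts es) u"
              unfolding T using \<open>u ~= b\<close> False by (metis count_add_mset)
            ultimately show ?thesis using u(2) by (simp only: simp_thms)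
          qed (use v(2) in simp)
        qed
        ultimately show ?thesis by simp
      qed
      also have "\<dots> < size (filter_mset (?bad es) (tgts es))" using v(2) by (subst (2) T(2)) (simp only: filter_mset_add_mset if_True simp_thms size_add_mset lessI)
      finally have "f ?es = 0"
      proof (rule less.hyps)
        show "length ?es = n" using arg_cong[OF er(1), of size] arg_cong[OF R, of size] less.prems by simp
      qed
      then show False using nz(2) by simp
    qed
  qed
qed


lemma tr_append: "length w = length ts ==> tr i (w @ w') (ts @ ts') = tr i w ts @ tr (last (i # ts)) w' ts'"
  by (induction i w ts rule: tr.induct) auto

lemma lay_targets:
  assumes "okl d cs ps"
  shows "tgts (lay cs ps) = mset (map (\<lambda>p. snd (snd (fst p))) ps) + mset (priv cs ps)"
proof -
  have c: "map etgt (layc c) = snd c" if "c \<in> set cs" for c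
    using assms that unfolding okl_def okc_def layc_def by (intro tr_targets) simp
  have p: "map etgt (layp p) = snd p @ [snd (snd (fst p))]" if "p \<in> set ps" for p
    using assms that unfolding okl_def okp_def layp_def by (auto simp: split_beta intro!: tr_targets)
  have "map etgt (concat (map layc cs)) = concat (map snd cs)"
    using c by (simp add: map_concat o_def cong: map_cong)
  moreover have "map etgt (concat (map layp ps)) = concat (map (\<lambda>p. snd p @ [snd (snd (fst p))]) ps)"
    using p by (simp add: map_concat o_def cong: map_cong)
  moreover have "mset (concat (map (\<lambda>p. snd p @ [snd (snd (fst p))]) ps)) = mset (map (\<lambda>p. snd (snd (fst p))) ps) + mset (concat (map snd ps))"
    by (induction ps) simp_all
  ultimately show ?thesis unfolding lay_def priv_def map_append mset_append by simp
qed

text \<open>Join paths at common end points until all end points are at most \<open>d\<close>.\<close>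

lemma passed_join:
  assumes "okl D cs ps" "\<forall>v\<in>set (priv cs ps). d < v" "passed d (lay cs ps)"
  shows "\<exists>cs' ps'. std d cs' ps' \<and> mset (lay cs' ps') = mset (lay cs ps)"
  using assms
proof (induction "length ps" arbitrary: cs ps rule: less_induct)
  case less
  let ?i = "\<lambda>p :: pathgen \<times> nat list. fst (fst p)" and ?j = "\<lambda>p :: pathgen \<times> nat list. snd (snd (fst p))"
  have S: "srcs (lay cs ps) = mset (map ?i ps) + mset (priv cs ps)"
    using lay_sources[OF less.prems(1)] by (simp add: o_def)
  note T = lay_targets[OF less.prems(1)]
  have ends: "count (mset (map ?i ps)) v = count (mset (map ?j ps)) v" if "d < v" for v
    using less.prems(3) that unfolding passed_def S T by simp
  have ok: "\<And>c. c \<in> set cs ==> okc c" "\<And>p. p \<in> set ps ==> okp D p" using less.prems(1) by (auto simp: okl_def)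
  show ?case
  proof (cases "\<exists>p\<in>set ps. d < ?j p")
    case False
    have "?i p \<le> d" if "p \<in> set ps" for p
    proof (rule ccontr)
      assume "\<not> ?i p \<le> d"
      then have "count (mset (map ?i ps)) (?i p) = count (mset (map ?j ps)) (?i p)" using ends[of "?i p"] by linarith
      moreover have "?i p \<in># mset (map ?i ps)" using that by simp
      ultimately have "0 < count (mset (map ?j ps)) (?i p)" unfolding count_greater_zero_iff[symmetric] by linarith
      then have "?i p \<in> set (map ?j ps)" by (metis count_greater_zero_iff set_mset_mset)
      then show False using False \<open>\<not> ?i p \<le> d\<close> by auto
    qed
    then have "okp d p" if "p \<in> set ps" for p
      using ok(2)[OF that] that False by (cases p) (auto simp: okp_def not_less)
    then have "okl d cs ps" using ok(1) by (simp add: okl_def)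
    moreover have "distinct (priv cs ps)"
    proof -
      have "count (mset (priv cs ps)) v = (if v \<in> set (priv cs ps) then 1 else 0)" for v
      proof (cases "v \<in> set (priv cs ps)")
        case True
        then have "count (tgts (lay cs ps)) v \<le> 1" using less.prems(2,3) unfolding passed_def by blast
        moreover have "count (mset (priv cs ps)) v ~= 0" using True by (simp only: count_eq_zero_iff set_mset_mset) simp
        ultimately have "count (mset (priv cs ps)) v = 1" unfolding T count_union by linarith
        then show ?thesis using True by simp
      qed (simp add: count_eq_zero_iff)
      then show ?thesis by (simp add: distinct_count_atmost_1)
    qed
    ultimately show ?thesis using less.prems(2) unfolding std_def by blast
  next
    case True
    then obtain p where p: "p \<in> set ps" "d < ?j p" by blast
    obtain i w v bs where pe: "p = ((i, w, v), bs)" by (metis prod.collapse)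
    have okp: "length w = Suc (length bs)" "i \<le> D" "v \<le> D" using ok(2)[OF p(1)] by (simp_all add: pe okp_def)
    obtain A B where ps: "ps = A @ p # B" using p(1) by (meson split_list)
    show ?thesis
    proof (cases "i = v")
      case loop: True
      let ?c = "(w, bs @ [v])"
      have eq: "mset (lay (?c # cs) (A @ B)) = mset (lay cs ps)"
        unfolding ps lay_paths_split by (simp add: lay_def layc_def layp_def pe loop)
      have "\<exists>cs' ps'. std d cs' ps' \<and> mset (lay cs' ps') = mset (lay (?c # cs) (A @ B))"
      proof (rule less.hyps)
        show "length (A @ B) < length ps" by (simp add: ps)
        show "okl D (?c # cs) (A @ B)" using less.prems(1) okp unfolding okl_def ps by (auto simp: okc_def)
        show "\<forall>v\<in>set (priv (?c # cs) (A @ B)). d < v" using less.prems(2) p(2) unfolding ps priv_def by (auto simp: pe)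
        show "passed d (lay (?c # cs) (A @ B))"
          using less.prems(3) unfolding passed_def srcs_cong[OF eq] tgts_cong[OF eq] .
      qed
      then show ?thesis unfolding eq .
    next
      case False
      have "0 < count (mset (map ?j ps)) v" using p(1) by (auto simp: pe count_greater_zero_iff image_iff intro!: bexI[of _ p])
      then have "0 < count (mset (map ?i ps)) v" using ends[of v] p(2) pe by simp
      then have "v \<in> set (map ?i ps)" by (metis count_greater_zero_iff set_mset_mset)
      then obtain q where q: "q \<in> set ps" "?i q = v" by auto
      have "q ~= p" using False q(2) by (metis pe fst_conv)
      then have "q \<in> set (A @ B)" using q(1) by (auto simp: ps)
      then obtain A' B' where AB: "A @ B = A' @ q # B'" by (meson split_list)
      obtain w' j bs' where qe: "q = ((v, w', j), bs')" using q(2) by (metis prod.collapse)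
      have okq: "length w' = Suc (length bs')" "j \<le> D" using ok(2)[OF q(1)] by (simp_all add: qe okp_def)
      let ?n = "((i, w @ w', j), bs @ v # bs')"
      have sub: "set ps = {p, q} \<union> set (A' @ B')"
        using arg_cong[OF AB, of set] unfolding ps by auto
      have "tr i (w @ w') ((bs @ [v]) @ bs' @ [j]) = tr i w (bs @ [v]) @ tr v w' (bs' @ [j])"
        using tr_append[of w "bs @ [v]" i w' "bs' @ [j]"] okp(1) by simp
      then have n: "layp ?n = layp p @ layp q" by (simp add: layp_def pe qe)
      have eq: "mset (lay cs (?n # A' @ B')) = mset (lay cs ps)"
        unfolding ps lay_paths_split AB lay_paths_split[of cs "[]" ?n "A' @ B'", unfolded append_Nil] n by simp
      have "\<exists>cs' ps'. std d cs' ps' \<and> mset (lay cs' ps') = mset (lay cs (?n # A' @ B'))"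
      proof (rule less.hyps)
        show "length (?n # A' @ B') < length ps" using arg_cong[OF AB, of length] by (simp add: ps)
        show "okl D cs (?n # A' @ B')" using less.prems(1) okp okq unfolding okl_def sub by (auto simp: okp_def)
        show "\<forall>v\<in>set (priv cs (?n # A' @ B')). d < v"
          using less.prems(2) p(2) sub unfolding priv_def by (auto simp: pe qe)
        show "passed d (lay cs (?n # A' @ B'))"
          using less.prems(3) unfolding passed_def srcs_cong[OF eq] tgts_cong[OF eq] .
      qed
      then show ?thesis unfolding eq .
    qed
  qed
qed

lemma passed_layout:
  assumes "passed d es"
  shows "\<exists>cs ps. std d cs ps \<and> mset (lay cs ps) = mset es"
proof -
  let ?ps = "map (\<lambda>(c, s, t). ((s, [c], t), [])) es"
  have lay: "lay [] ?ps = es" by (simp add: lay_def layp_def o_def split_beta)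
  have "\<exists>D. \<forall>(c, s, t)\<in>set es. s \<le> D \<and> t \<le> D"
  proof (induction es)
    case (Cons e es)
    then obtain D where "\<forall>(c, s, t)\<in>set es. s \<le> D \<and> t \<le> D" by blast
    then show ?case by (intro exI[of _ "max D (max (esrc e) (etgt e))"]) (auto simp: max_def split_beta)
  qed simp
  then obtain D where "\<forall>(c, s, t)\<in>set es. s \<le> D \<and> t \<le> D" by blast
  then have "okl D [] ?ps" by (auto simp: okl_def okp_def split_beta)
  moreover have "\<forall>v\<in>set (priv [] ?ps). d < v" by (simp add: priv_def split_beta)
  ultimately show ?thesis using passed_join[of D "[]" ?ps d] assms unfolding lay by blast
qed

theorem layouts_determine:
  assumes f: "invf d f" and z: "\<And>cs ps. std d cs ps ==> length (lay cs ps) = n ==> f (lay cs ps) = 0"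
    and len: "length es = n"
  shows "f es = 0"
proof (rule passed_determines[OF f _ len])
  fix es assume es: "length es = n" "passed d es"
  obtain cs ps where l: "std d cs ps" "mset (lay cs ps) = mset es" using passed_layout[OF es(2)] by blast
  have "length (lay cs ps) = n" using es(1) l(2) by (metis size_mset)
  then show "f es = 0" using z[OF l(1)] symfD[OF _ l(2), of f] f by (simp add: invf_def)
qed

section \<open>Renaming the private vertices of a layout\<close>

type_synonym cyc = "nat list \<times> nat list"
type_synonym pth = "pathgen \<times> nat list"

abbreviation mapv :: "(nat \<Rightarrow> nat) \<Rightarrow> edge list \<Rightarrow> edge list" where
  "mapv g es \<equiv> map (\<lambda>(c, s, t). (c, g s, g t)) es"

lemma mapv_tr: "mapv g (tr i w ts) = tr (g i) w (map g ts)"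
  by (induction i w ts rule: tr.induct) auto

lemma mapv_id: "(\<And>e. e \<in> set es ==> g (esrc e) = esrc e \<and> g (etgt e) = etgt e) ==> mapv g es = es"
  by (induction es) (auto simp: split_beta)

text \<open>For a vertex that is met once the sum in \<open>split_vertex\<close> has a single term, the list with the vertex renamed.\<close>

lemma rename_vertex:
  assumes f: "invf d f" and v: "d < v" "count (srcs es) v = 1" "count (tgts es) v = 1"
    and b: "d < b" "b \<notin># srcs es" "b \<notin># tgts es"
  shows "f (mapv (id(v := b)) es) = f es"
proof -
  let ?g = "id(v := b)"
  have sym: "symf f" using f by (simp add: invf_def)
  have "v \<in># tgts es" "v \<in># srcs es" using v by (simp_all only: count_greater_zero_iff[symmetric])
  then obtain e where "e \<in> set es" "etgt e = v" by auto
  then obtain c s where e: "(c, s, v) \<in> set es" by (metis prod.collapse)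
  then obtain R where R: "mset es = mset ((c, s, v) # R)" by (metis in_set_conv_decomp mset.simps(2) mset_append union_mset_add_mset_right)
  have bv: "b ~= v" using b \<open>v \<in># tgts es\<close> by blast
  have tR: "tgts es = add_mset v (tgts R)" and sR: "srcs es = add_mset s (srcs R)"
    using tgts_cong[OF R] srcs_cong[OF R] by simp_all
  have nt: "v \<notin># tgts R" using v(3) unfolding tR by (simp add: not_in_iff del: mset_map)
  have bR: "b \<notin># tgts R" using b(3) unfolding tR by simp
  have mg: "f (mapv ?g es) = f (mapv ?g ((c, s, v) # R))"
    by (rule symfD[OF sym]) (simp only: mset_map R)
  note split = split_vertex[OF f v(1) b(1) bv bR, of c s, folded symfD[OF sym R]]
  show ?thesis
  proof (cases "s = v")
    case True
    have "v \<notin># srcs R" using v(2) True unfolding sR by (simp add: not_in_iff del: mset_map)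
    then have ns: "\<forall>e\<in>set R. \<not> esrc e = v" by force
    have "\<forall>e\<in>set R. etgt e ~= v" using nt by force
    then have "mapv ?g R = R" using ns by (intro mapv_id) simp
    moreover have "psum (\<lambda>e r. if esrc e = v then f ((fst e, b, etgt e) # (c, v, b) # r) else 0) R = 0"
      by (rule psum_if_none) (rule ns)
    ultimately show ?thesis unfolding mg using split True by simp
  next
    case False
    then have "v \<in># srcs R" using \<open>v \<in># srcs es\<close> unfolding sR by simp
    then obtain e' where "e' \<in> set R" "esrc e' = v" by auto
    then obtain c' t where e': "(c', v, t) \<in> set R" by (metis prod.collapse)
    then obtain R' where R': "mset R = mset ((c', v, t) # R')" by (metis in_set_conv_decomp mset.simps(2) mset_append union_mset_add_mset_right)
    have tR': "tgts R = add_mset t (tgts R')" and sR': "srcs R = add_mset v (srcs R')"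
      using tgts_cong[OF R'] srcs_cong[OF R'] by simp_all
    have tv: "t ~= v" "v \<notin># tgts R'" using nt unfolding tR' by auto
    have "v \<notin># srcs R'" using v(2) False unfolding sR sR' by (simp add: not_in_iff del: mset_map)
    then have ns: "\<forall>e\<in>set R'. \<not> esrc e = v" by force
    have "\<forall>e\<in>set R'. etgt e ~= v" using tv(2) by force
    then have id: "mapv ?g R' = R'" using ns by (intro mapv_id) simp
    have R2: "mset es = mset ((c, s, v) # (c', v, t) # R')" using R R' by simp
    have bR': "b \<notin># tgts ((c', v, t) # R')" using bR[unfolded tR'] by simp
    have "f es = psum (\<lambda>e r. if esrc e = v then f ((fst e, b, etgt e) # r) else 0) ((c, s, b) # (c', v, t) # R')"
      unfolding symfD[OF sym R2] by (rule split_vertex[OF f v(1) b(1) bv bR'])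
    also have "\<dots> = f ((c', b, t) # (c, s, b) # R') + psum (\<lambda>e r. if esrc e = v then f ((fst e, b, etgt e) # (c, s, b) # (c', v, t) # r) else 0) R'"
      using False by simp
    also have "psum (\<lambda>e r. if esrc e = v then f ((fst e, b, etgt e) # (c, s, b) # (c', v, t) # r) else 0) R' = 0"
      by (rule psum_if_none) (rule ns)
    also have "f ((c', b, t) # (c, s, b) # R') = f ((c, s, b) # (c', b, t) # R')"
      by (rule symfD[OF sym]) (simp add: add_mset_commute)
    also have "(c, s, b) # (c', b, t) # R' = mapv ?g ((c, s, v) # (c', v, t) # R')"
      using id False tv(1) by simp
    also have "f (mapv ?g ((c, s, v) # (c', v, t) # R')) = f (mapv ?g es)"
      by (rule symfD[OF sym]) (simp only: mset_map R2)
    finally show ?thesis by simp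
  qed
qed

abbreviation "renc g \<equiv> map (\<lambda>(w :: nat list, bs). (w, map g bs))"
abbreviation "renp g \<equiv> map (\<lambda>(q :: pathgen, bs). (q, map g bs))"

lemma lay_ren:
  assumes ok: "okl d cs ps" and g: "\<And>i. i \<le> d ==> g i = i"
  shows "lay (renc g cs) (renp g ps) = mapv g (lay cs ps)" "priv (renc g cs) (renp g ps) = map g (priv cs ps)"
    "okl d (renc g cs) (renp g ps)"
proof -
  have c: "layc (case c of (w, bs) \<Rightarrow> (w, map g bs)) = mapv g (layc c)" if "c \<in> set cs" for c
  proof -
    obtain w bs where c: "c = (w, bs)" by (cases c)
    have "bs ~= []" using ok that c unfolding okl_def okc_def by force
    then show ?thesis by (simp add: c layc_def mapv_tr last_map)
  qed
  have p: "layp (case p of (q, bs) \<Rightarrow> (q, map g bs)) = mapv g (layp p)" if "p \<in> set ps" for p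
  proof -
    obtain i w j bs where p: "p = ((i, w, j), bs)" by (metis prod.collapse)
    have "i \<le> d" "j \<le> d" using ok that p unfolding okl_def okp_def by force+
    then show ?thesis using g by (simp add: p layp_def mapv_tr)
  qed
  have "concat (map layc (renc g cs)) = mapv g (concat (map layc cs))"
    unfolding map_concat map_map o_def using c by (simp cong: map_cong)
  moreover have "concat (map layp (renp g ps)) = mapv g (concat (map layp ps))"
    unfolding map_concat map_map o_def using p by (simp cong: map_cong)
  ultimately show "lay (renc g cs) (renp g ps) = mapv g (lay cs ps)" by (simp add: lay_def)
  show "priv (renc g cs) (renp g ps) = map g (priv cs ps)"
    by (simp add: priv_def map_concat o_def split_beta)
  show "okl d (renc g cs) (renp g ps)"
    using ok unfolding okl_def okc_def okp_def by (auto simp: split_beta)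
qed

lemma map_fst_ren: "map fst (renc g cs) = map fst cs" "map fst (renp g ps) = map fst ps"
  by (simp_all add: split_beta)

text \<open>Rename the private vertices one after another. The new names are disjoint from the old ones, so no intermediate list has a clash.\<close>

lemma rename_to:
  assumes f: "invf d f"
  shows "std d cs ps ==> priv cs ps = xs @ ys ==> length us = length ys ==> distinct (xs @ us) ==>
    set us \<inter> set ys = {} ==> \<forall>u\<in>set us. d < u ==>
    \<exists>cs' ps'. std d cs' ps' \<and> map fst cs' = map fst cs \<and> map fst ps' = map fst ps \<and> priv cs' ps' = xs @ us \<and> f (lay cs' ps') = f (lay cs ps)"
proof (induction ys arbitrary: cs ps xs us)
  case Nil
  then show ?case by auto
next
  case (Cons v ys)
  obtain b us' where us: "us = b # us'" using Cons.prems(3) by (cases us) auto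
  let ?g = "id(v := b)"
  have ok: "okl d cs ps" and dist: "distinct (xs @ v # ys)" and gt: "\<forall>u\<in>set (xs @ v # ys). d < u"
    using Cons.prems(1,2) unfolding std_def by simp_all
  have v: "d < v" "v \<notin> set xs" "v \<notin> set ys" and b: "d < b" "b \<notin> set xs" "b ~= v" "b \<notin> set ys"
    using dist gt Cons.prems(4-6) by (auto simp: us)
  have fixd: "?g i = i" if "i \<le> d" for i using v(1) that by simp
  note ren = lay_ren[of d cs ps ?g, OF ok fixd]
  have mg: "map ?g (xs @ v # ys) = (xs @ [b]) @ ys" using v(2,3) by (simp add: map_idI)
  have low: "count (mset (map (fst \<circ> fst) ps)) u = 0" "count (mset (map (\<lambda>p. snd (snd (fst p))) ps)) u = 0" if "d < u" for u
    using ok that unfolding okl_def okp_def by (force simp: count_eq_zero_iff)+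
  have cnt: "count (srcs (lay cs ps)) u = count (mset (xs @ v # ys)) u" "count (tgts (lay cs ps)) u = count (mset (xs @ v # ys)) u"
    if "d < u" for u
    unfolding lay_sources[OF ok] lay_targets[OF ok] Cons.prems(2) using low[OF that] by simp_all
  have f1: "f (mapv ?g (lay cs ps)) = f (lay cs ps)"
  proof (rule rename_vertex[OF f v(1)])
    have n: "count (mset (xs @ v # ys)) v = 1" using v by (simp add: count_eq_zero_iff)
    show "count (srcs (lay cs ps)) v = 1" "count (tgts (lay cs ps)) v = 1" unfolding cnt[OF v(1)] by (rule n)+
    have n: "count (mset (xs @ v # ys)) b = 0" using b by (simp add: count_eq_zero_iff)
    show "b \<notin># srcs (lay cs ps)" "b \<notin># tgts (lay cs ps)" unfolding not_in_iff cnt[OF b(1)] by (rule n)+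
  qed (rule b(1))
  have pr: "priv (renc ?g cs) (renp ?g ps) = (xs @ [b]) @ ys" 
    by (rule trans[OF ren(2) trans[OF arg_cong[OF Cons.prems(2), of "map ?g"] mg]])
  have std1: "std d (renc ?g cs) (renp ?g ps)"
    unfolding std_def pr using ren(3) dist gt b by auto
  have "\<exists>cs' ps'. std d cs' ps' \<and> map fst cs' = map fst (renc ?g cs) \<and> map fst ps' = map fst (renp ?g ps)
      \<and> priv cs' ps' = (xs @ [b]) @ us' \<and> f (lay cs' ps') = f (lay (renc ?g cs) (renp ?g ps))"
  proof (rule Cons.IH[OF std1])
    show "priv (renc ?g cs) (renp ?g ps) = (xs @ [b]) @ ys" by (rule pr)
    show "length us' = length ys" "distinct ((xs @ [b]) @ us')" "set us' \<inter> set ys = {}" "\<forall>u\<in>set us'. d < u"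
      using Cons.prems(3-6) by (auto simp: us)
  qed
  moreover have "f (lay (renc ?g cs) (renp ?g ps)) = f (lay cs ps)" by (rule trans[OF arg_cong[OF ren(1), of f] f1])
  ultimately show ?case unfolding map_fst_ren us by simp
qed

lemma concat_map_inj:
  assumes "length xs = length ys" "\<And>k. k < length xs ==> length (xs ! k) = length (ys ! k)"
  shows "concat xs @ r = concat ys @ r' ==> xs = ys \<and> r = r'"
  using assms
proof (induction xs arbitrary: ys)
  case (Cons x xs)
  then obtain y ys' where ys: "ys = y # ys'" by (cases ys) auto
  have "length x = length y" using Cons.prems(3)[of 0] ys by simp
  then have "x = y" "concat xs @ r = concat ys' @ r'" using Cons.prems(1) ys by auto
  moreover have "length (xs ! k) = length (ys' ! k)" if "k < length xs" for k
    using Cons.prems(3)[of "Suc k"] that ys by simp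
  ultimately show ?case using Cons.IH[of ys'] Cons.prems(2) ys by simp
qed simp

lemma map_fst_snd_eqI: "map fst xs = map fst ys ==> map snd xs = map snd ys ==> xs = ys"
  by (metis zip_map_fst_snd)

lemma layout_eqI:
  assumes ok: "okl d cs ps" "okl d cs' ps'" and t: "map fst cs = map fst cs'" "map fst ps = map fst ps'"
    and pr: "priv cs ps = priv cs' ps'"
  shows "cs = cs' \<and> ps = ps'"
proof -
  have len: "length cs = length cs'" "length ps = length ps'" using t by (metis length_map)+
  have c: "length (snd c) = length (fst c)" if "c \<in> set cs \<union> set cs'" for c using ok that by (auto simp: okl_def okc_def)
  have p: "Suc (length (snd p)) = length (fst (snd (fst p)))" if "p \<in> set ps \<union> set ps'" for p
    using ok that unfolding okl_def okp_def by fastforce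
  have lc: "length (map snd cs ! k) = length (map snd cs' ! k)" if "k < length (map snd cs)" for k
    using c[of "cs ! k"] c[of "cs' ! k"] that len arg_cong[OF t(1), of "\<lambda>x. x ! k"] by simp
  have lp: "length (map snd ps ! k) = length (map snd ps' ! k)" if "k < length (map snd ps)" for k
    using p[of "ps ! k"] p[of "ps' ! k"] that len arg_cong[OF t(2), of "\<lambda>x. x ! k"] by simp
  have 1: "map snd cs = map snd cs' \<and> concat (map snd ps) = concat (map snd ps')"
    by (rule concat_map_inj[OF _ lc]) (use len pr in \<open>simp_all add: priv_def\<close>)
  have "map snd ps = map snd ps' \<and> ([] :: nat list) = []"
    by (rule concat_map_inj[OF _ lp]) (use len 1 in simp_all)
  then show ?thesis using 1 by (intro conjI map_fst_snd_eqI t) simp_all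
qed

lemma length_priv: "okl d cs ps ==> length (priv cs ps) = sum_list (map length (map fst cs)) + sum_list (map (\<lambda>(i, w, j). length w - 1) (map fst ps))"
proof -
  assume ok: "okl d cs ps"
  have 1: "map (length \<circ> snd) cs = map (length \<circ> fst) cs" using ok by (auto simp: okl_def okc_def)
  have 2: "map (length \<circ> snd) ps = map ((\<lambda>(i, w, j). length w - 1) \<circ> fst) ps"
    using ok unfolding okl_def okp_def by fastforce
  show ?thesis by (simp only: priv_def length_append length_concat map_map 1 2)
qed

text \<open>Both layouts are renamed to a third set of names that is disjoint from the names in either of them.\<close>

lemma same_words_same_value:
  assumes f: "invf d f" and std: "std d cs ps" "std d cs' ps'" and t: "map fst cs = map fst cs'" "map fst ps = map fst ps'"
  shows "f (lay cs ps) = f (lay cs' ps')"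
proof -
  let ?x = "priv cs ps" and ?y = "priv cs' ps'"
  have ok: "okl d cs ps" "okl d cs' ps'" using std by (simp_all add: std_def)
  have len: "length ?y = length ?x" unfolding length_priv[OF ok(1)] length_priv[OF ok(2)] t ..
  let ?K = "Suc (d + sum_list ?x + sum_list ?y)"
  define us where "us = [?K..<?K + length ?x]"
  have big: "u < ?K" if "u \<in> set ?x \<union> set ?y" for u using that member_le_sum_list[of u ?x] member_le_sum_list[of u ?y] by auto
  have set_us: "\<forall>u\<in>set us. ?K \<le> u" by (simp add: us_def del: upt_Suc)
  then have disj: "set us \<inter> set ?x = {}" "set us \<inter> set ?y = {}" using big by fastforce+
  have us: "length us = length ?x" "distinct ([] @ us)" "\<forall>u\<in>set us. d < u"
    using set_us by (auto simp: us_def simp del: upt_Suc)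
  obtain cs1 ps1 where 1: "std d cs1 ps1" "map fst cs1 = map fst cs" "map fst ps1 = map fst ps" "priv cs1 ps1 = us" "f (lay cs1 ps1) = f (lay cs ps)"
    using rename_to[OF f std(1) append_Nil[symmetric] us(1,2) disj(1) us(3)] by auto
  obtain cs2 ps2 where 2: "std d cs2 ps2" "map fst cs2 = map fst cs'" "map fst ps2 = map fst ps'" "priv cs2 ps2 = us" "f (lay cs2 ps2) = f (lay cs' ps')"
    using rename_to[OF f std(2) append_Nil[symmetric] us(1)[folded len] us(2) disj(2) us(3)] by auto
  have "cs1 = cs2 \<and> ps1 = ps2"
    by (rule layout_eqI[of d]) (use 1 2 t in \<open>simp_all add: std_def\<close>)
  then show ?thesis using 1(5) 2(5) by simp
qed

lemma reorder:
  assumes "mset (map g xs) = mset ys"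
  shows "\<exists>zs. mset zs = mset xs \<and> map g zs = ys"
  using assms
proof (induction ys arbitrary: xs)
  case (Cons y ys)
  then have "y \<in> set (map g xs)" by (metis list.set_intros(1) mset_eq_setD)
  then obtain x where x: "x \<in> set xs" "g x = y" by auto
  then obtain A B where AB: "xs = A @ x # B" by (meson split_list)
  have "mset (map g (A @ B)) = mset ys" using Cons.prems x(2) by (simp add: AB)
  then obtain zs where "mset zs = mset (A @ B)" "map g zs = ys" using Cons.IH by blast
  then show ?case using x(2) AB by (intro exI[of _ "x # zs"]) simp
qed simp

text \<open>Up to rotation of the cycles and reordering of the components, the value on a layout
  depends on the words only.\<close>

lemma rotate_cycles:
  assumes "\<forall>c\<in>set cs. okc c"
  shows "\<exists>cs'. map fst cs' = map (nec \<circ> fst) cs \<and> mset (concat (map snd cs')) = mset (concat (map snd cs))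
    \<and> mset (concat (map layc cs')) = mset (concat (map layc cs)) \<and> (\<forall>c\<in>set cs'. okc c)"
  using assms
proof (induction cs)
  case (Cons c cs)
  obtain w bs where c: "c = (w, bs)" by (cases c)
  then have ok: "okc (w, bs)" using Cons.prems by simp
  obtain n where n: "nec w = rotate n w" using nec_rots[of w] by (auto simp: rots_def)
  have "\<forall>c\<in>set cs. okc c" using Cons.prems by simp
  from Cons.IH[OF this] obtain cs' where "map fst cs' = map (nec \<circ> fst) cs" "mset (concat (map snd cs')) = mset (concat (map snd cs))"
    "mset (concat (map layc cs')) = mset (concat (map layc cs))" "\<forall>c\<in>set cs'. okc c" by blast
  moreover have "mset (rotate n bs) = mset bs"
    by (subst rotate_drop_take) (metis append_take_drop_id mset_append add.commute)
  ultimately show ?case using okc_rotate[OF ok, of n] layc_rotate[OF ok, of n]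
    by (intro exI[of _ "(rotate n w, rotate n bs) # cs'"]) (simp add: c n)
qed simp

theorem value_by_type:
  assumes f: "invf d f" and std: "std d cs ps" "std d cs' ps'"
    and t: "mset (map (nec \<circ> fst) cs) = mset (map (nec \<circ> fst) cs')" "mset (map fst ps) = mset (map fst ps')"
  shows "f (lay cs ps) = f (lay cs' ps')"
proof -
  have sym: "symf f" using f by (simp add: invf_def)
  have norm: "\<exists>cs1 ps1. std d cs1 ps1 \<and> map fst cs1 = map (nec \<circ> fst) cs' \<and> map fst ps1 = map fst ps' \<and> f (lay cs1 ps1) = f (lay cs0 ps0)"
    if s0: "std d cs0 ps0" and t0: "mset (map (nec \<circ> fst) cs0) = mset (map (nec \<circ> fst) cs')" "mset (map fst ps0) = mset (map fst ps')" for cs0 ps0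
  proof -
    have ok0: "\<forall>c\<in>set cs0. okc c" "\<forall>p\<in>set ps0. okp d p" using s0 by (auto simp: std_def okl_def)
    obtain cs2 where cs2: "map fst cs2 = map (nec \<circ> fst) cs0" "mset (concat (map snd cs2)) = mset (concat (map snd cs0))"
      "mset (concat (map layc cs2)) = mset (concat (map layc cs0))" "\<forall>c\<in>set cs2. okc c" using rotate_cycles[OF ok0(1)] by blast
    obtain cs1 where cs1: "mset cs1 = mset cs2" "map fst cs1 = map (nec \<circ> fst) cs'"
      using reorder[of fst cs2 "map (nec \<circ> fst) cs'"] t0(1) cs2(1) by metis
    obtain ps1 where ps1: "mset ps1 = mset ps0" "map fst ps1 = map fst ps'" using reorder[OF t0(2)] by blast
    have mc: "mset (concat (map h xs)) = mset (concat (map h ys))" if "mset xs = mset ys" for h :: "'x \<Rightarrow> 'y list" and xs ys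
    proof -
      have "mset (concat (map h zs)) = (\<Sum>z\<in>#mset zs. mset (h z))" for zs by (induction zs) simp_all
      then show ?thesis using that by simp
    qed
    have pr: "mset (priv cs1 ps1) = mset (priv cs0 ps0)"
      unfolding priv_def using mc[OF cs1(1), of snd] mc[OF ps1(1), of snd] cs2(2) by simp
    have ly: "mset (lay cs1 ps1) = mset (lay cs0 ps0)"
      unfolding lay_def using mc[OF cs1(1), of layc] mc[OF ps1(1), of layp] cs2(3) by simp
    have "std d cs1 ps1"
      using s0 mset_eq_setD[OF pr] mset_eq_imp_distinct_iff[OF pr] mset_eq_setD[OF cs1(1)] mset_eq_setD[OF ps1(1)] cs2(4) ok0(2)
      unfolding std_def okl_def by simp
    then show ?thesis using cs1(2) ps1(2) symfD[OF sym ly] by blast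
  qed
  obtain cs1 ps1 where 1: "std d cs1 ps1" "map fst cs1 = map (nec \<circ> fst) cs'" "map fst ps1 = map fst ps'" "f (lay cs1 ps1) = f (lay cs ps)"
    using norm[OF std(1) t] by blast
  obtain cs2 ps2 where 2: "std d cs2 ps2" "map fst cs2 = map (nec \<circ> fst) cs'" "map fst ps2 = map fst ps'" "f (lay cs2 ps2) = f (lay cs' ps')"
    using norm[OF std(2) refl refl] by blast
  have "f (lay cs1 ps1) = f (lay cs2 ps2)" by (rule same_words_same_value[OF f 1(1) 2(1)]) (use 1 2 in simp_all)
  then show ?thesis using 1(4) 2(4) by simp
qed

section \<open>Leading terms of products of generators\<close>

text \<open>The restriction \<open>vr\<close> is applied outside, so that leading terms of products can be computed without regard to admissibility.\<close>

definition topd :: "nat \<Rightarrow> nat \<Rightarrow> nat \<Rightarrow> (nat \<Rightarrow> uea_elem) \<Rightarrow> coef \<Rightarrow> bool" where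
  "topd d L n x g \<longleftrightarrow> x \<in> carrier (A_lim d L) \<and> deg_le n (psi d L x) \<and>
     (\<forall>r. length r = n --> psi d L x r = vr L g r) \<and> (\<forall>r. length r ~= n --> g r = 0)"

lemma adm_mset: "mset es = mset r1 + mset r2 ==> adm L es \<longleftrightarrow> adm L r1 \<and> adm L r2"
proof -
  assume "mset es = mset r1 + mset r2"
  then have "set es = set r1 \<union> set r2" by (metis set_mset_mset set_mset_union)
  moreover have "set r1 \<union> set r2 \<subseteq> Ed L (max N N')" if "set r1 \<subseteq> Ed L N" "set r2 \<subseteq> Ed L N'" for N N'
    using that Ed_mono[of N "max N N'" L] Ed_mono[of N' "max N N'" L] by auto
  ultimately show ?thesis unfolding adm_def by (metis le_sup_iff)
qed

text \<open>In the sum for degree \<open>n + m\<close> a summand with parts of other lengths contains a factor above the degree of one of the two elements.\<close>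

lemma topd_mult:
  assumes x: "topd d L n x g" and y: "topd d L m y h"
  shows "topd d L (n + m) (x \<otimes>\<^bsub>A_lim d L\<^esub> y) (conv g h)"
proof -
  let ?A = "A_lim d L"
  have xc: "x \<in> carrier ?A" "deg_le n (psi d L x)" "\<And>r. length r = n ==> psi d L x r = vr L g r" "\<And>r. length r ~= n ==> g r = 0"
    and yc: "y \<in> carrier ?A" "deg_le m (psi d L y)" "\<And>r. length r = m ==> psi d L y r = vr L h r" "\<And>r. length r ~= m ==> h r = 0"
    using x y unfolding topd_def by blast+
  note mult = A_lim_mult[OF xc(1) yc(1)]
  have val: "psi d L (x \<otimes>\<^bsub>?A\<^esub> y) es = conv (psi d L x) (psi d L y) es" if "n + m \<le> length es" for es
    by (rule mult(2)[OF xc(2) yc(2) that])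
  have "deg_le (n + m) (psi d L (x \<otimes>\<^bsub>?A\<^esub> y))"
    unfolding deg_le_def using val conv_deg[OF xc(2) yc(2)] by simp
  moreover have "psi d L (x \<otimes>\<^bsub>?A\<^esub> y) es = vr L (conv g h) es" if len: "length es = n + m" for es
  proof -
    have "psi d L (x \<otimes>\<^bsub>?A\<^esub> y) es = conv (psi d L x) (psi d L y) es" using val len by simp
    also have "\<dots> = conv (if adm L es then g else (\<lambda>_. 0)) h es"
    proof (rule conv_cong)
      fix r1 r2 assume r: "mset es = mset r1 + mset r2"
      from arg_cong[OF this, of size] have l: "length r1 + length r2 = n + m" using len by simp
      consider "length r1 = n" "length r2 = m" | "length r1 < n" "length r2 > m" | "length r1 > n" "length r2 < m"
        using l by linarith
      then show "psi d L x r1 * psi d L y r2 = (if adm L es then g else (\<lambda>_. 0)) r1 * h r2"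
      proof cases
        case 1
        then show ?thesis using xc(3) yc(3) adm_mset[OF r, of L] by (simp add: vr_def)
      next
        case 2
        then show ?thesis using deg_leD[OF yc(2)] yc(4) by simp
      next
        case 3
        then show ?thesis using deg_leD[OF xc(2)] xc(4) by simp
      qed
    qed
    also have "\<dots> = vr L (conv g h) es" by (simp add: vr_def)
    finally show ?thesis .
  qed
  moreover have "conv g h es = 0" if "length es ~= n + m" for es
  proof (rule ccontr)
    assume "conv g h es ~= 0"
    then obtain r1 r2 where r: "mset es = mset r1 + mset r2" "g r1 ~= 0" "h r2 ~= 0" by (rule conv_nonzeroD)
    have "length r1 = n" "length r2 = m" using r(2,3) xc(4) yc(4) by blast+
    then show False using arg_cong[OF r(1), of size] that by simp
  qed
  ultimately show ?thesis using mult(1) unfolding topd_def by blast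
qed

lemma topd_one: "topd d L 0 \<one>\<^bsub>A_lim d L\<^esub> vac"
  unfolding topd_def A_lim_one(2) by (auto simp: A_lim_one(1) deg_le_vac vr_def adm_def vac_def)

lemma topd_pel: "topd d L (length w) (pel d L w) (csym w)"
  unfolding topd_def pel(2) by (auto simp: pel(1) csym_length deg_le_def vr_def)

lemma topd_tel:
  assumes "i \<le> d" "j \<le> d"
  shows "topd d L (length w) (tel d L w i j) (psym w i j)"
  unfolding topd_def tel(2)[OF assms]
  using deg_leD[OF tfun_deg] by (auto simp: tel(1)[OF assms] psym_length deg_le_def vr_def tfun_top)

definition pels :: "nat \<Rightarrow> nat \<Rightarrow> nat list list \<Rightarrow> nat \<Rightarrow> uea_elem" where
  "pels d L Ms = foldr (\<lambda>w x. pel d L w \<otimes>\<^bsub>A_lim d L\<^esub> x) Ms \<one>\<^bsub>A_lim d L\<^esub>"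

definition tels :: "nat \<Rightarrow> nat \<Rightarrow> pathgen list \<Rightarrow> nat \<Rightarrow> uea_elem" where
  "tels d L Qs = foldr (\<lambda>(i, w, j) x. tel d L w i j \<otimes>\<^bsub>A_lim d L\<^esub> x) Qs \<one>\<^bsub>A_lim d L\<^esub>"

abbreviation wtc :: "nat list list \<Rightarrow> nat" where "wtc Ms \<equiv> sum_list (map length Ms)"
abbreviation wtp :: "pathgen list \<Rightarrow> nat" where "wtp Qs \<equiv> sum_list (map (\<lambda>(i, w, j). length w) Qs)"

lemma topd_pels: "topd d L (wtc Ms) (pels d L Ms) (foldr conv (map csym Ms) vac)"
proof (induction Ms)
  case (Cons w Ms)
  then show ?case using topd_mult[OF topd_pel[of d L w] Cons] by (simp add: pels_def)
qed (simp add: pels_def topd_one)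

lemma topd_tels:
  "\<forall>(i, w, j)\<in>set Qs. i \<le> d \<and> j \<le> d ==> topd d L (wtp Qs) (tels d L Qs) (foldr conv (map gsym Qs) vac)"
proof (induction Qs)
  case (Cons q Qs)
  obtain i w j where q: "q = (i, w, j)" by (metis prod.collapse)
  have ij: "i \<le> d" "j \<le> d" and IH: "topd d L (wtp Qs) (tels d L Qs) (foldr conv (map gsym Qs) vac)"
    using Cons by (auto simp: q)
  show ?case using topd_mult[OF topd_tel[OF ij, of L w] IH] 
    by (simp add: tels_def q gsym_def[of "(i, w, j)", unfolded prod.case])
qed (simp add: tels_def topd_one)

lemma topd_product:
  assumes "\<forall>(i, w, j)\<in>set Qs. i \<le> d \<and> j \<le> d"
  shows "topd d L (wtc Ms + wtp Qs) (pels d L Ms \<otimes>\<^bsub>A_lim d L\<^esub> tels d L Qs) (msym Ms Qs)"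
proof -
  have "conv (foldr conv fs vac) h = foldr conv fs h" for fs :: "coef list" and h
  proof (induction fs)
    case (Cons f fs)
    show ?case
    proof
      fix es
      have "conv (foldr conv (f # fs) vac) h es = conv f (conv (foldr conv fs vac) h) es"
        unfolding foldr.simps o_def by (rule conv_assoc)
      then show "conv (foldr conv (f # fs) vac) h es = foldr conv (f # fs) h es" unfolding Cons by simp
    qed
  qed (simp add: fun_eq_iff)
  then show ?thesis using topd_mult[OF topd_pels topd_tels[OF assms]] by (simp add: msym_def)
qed

section \<open>The index set and its layouts\<close>

type_synonym idx = "nat list multiset \<times> pathgen multiset"

text \<open>Closed trails are taken up to rotation, open trails with their end points; empty words are excluded.\<close>

definition Idx :: "nat \<Rightarrow> nat \<Rightarrow> idx set" where
  "Idx d L = {(M, Q). (\<forall>w\<in>#M. w ~= [] \<and> set w \<subseteq> {1..L} \<and> nec w = w) \<and>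
     (\<forall>(i, w, j)\<in>#Q. i \<in> {1..d} \<and> j \<in> {1..d} \<and> w ~= [] \<and> set w \<subseteq> {1..L})}"

text \<open>The order of the factors only affects lower terms; any fixed choice works.\<close>

definition lst :: "'a multiset \<Rightarrow> 'a list" where "lst M = (SOME xs. mset xs = M)"

lemma mset_lst [simp]: "mset (lst M) = M"
  unfolding lst_def using someI_ex[OF ex_mset[of M]] .

lemma set_lst [simp]: "set (lst M) = set_mset M" by (metis mset_lst set_mset_mset)

definition wt :: "idx \<Rightarrow> nat" where "wt k = wtc (lst (fst k)) + wtp (lst (snd k))"

definition prd :: "nat \<Rightarrow> nat \<Rightarrow> idx \<Rightarrow> nat \<Rightarrow> uea_elem" where
  "prd d L k = pels d L (lst (fst k)) \<otimes>\<^bsub>A_lim d L\<^esub> tels d L (lst (snd k))"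

definition type_of :: "cyc list \<Rightarrow> pth list \<Rightarrow> idx" where
  "type_of cs ps = (mset (map (nec \<circ> fst) cs), mset (map fst ps))"

lemma length_lay: "okl d cs ps ==> length (lay cs ps) = wtc (map fst cs) + wtp (map fst ps)"
proof -
  assume ok: "okl d cs ps"
  have "length (layc c) = length (fst c)" if "c \<in> set cs" for c
    using ok that unfolding okl_def okc_def layc_def by (simp add: length_tr)
  moreover have "length (layp p) = (case fst p of (i, w, j) \<Rightarrow> length w)" if "p \<in> set ps" for p
    using ok that unfolding okl_def okp_def layp_def by (auto simp: length_tr split_beta)
  ultimately show ?thesis unfolding lay_def by (simp add: length_concat o_def cong: map_cong)
qed

lemma layout_exists:
  assumes "\<forall>w\<in>set Ms. w ~= []" "\<forall>(i, w, j)\<in>set Qs. i \<le> d \<and> j \<le> d \<and> w ~= []"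
  shows "\<exists>cs ps. std d cs ps \<and> map fst cs = Ms \<and> map fst ps = Qs"
proof -
  have fresh: "\<exists>bs. length bs = n \<and> distinct bs \<and> set bs \<inter> set xs = {} \<and> (\<forall>b\<in>set bs. d < b)" for n and xs :: "nat list"
  proof (intro exI[of _ "map (\<lambda>k. Suc (d + sum_list xs + k)) [0..<n]"] conjI)
    show "set (map (\<lambda>k. Suc (d + sum_list xs + k)) [0..<n]) \<inter> set xs = {}"
      using member_le_sum_list[of _ xs] by fastforce
  qed (auto simp: distinct_map inj_on_def)
  from assms(1) show ?thesis
  proof (induction Ms)
    case Nil
    from assms(2) show ?case
    proof (induction Qs)
      case Nil
      show ?case by (intro exI[of _ "[]"]) (simp add: std_def okl_def priv_def)
    next
      case (Cons q Qs)
      obtain i w j where q: "q = (i, w, j)" by (metis prod.collapse)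
      have "\<forall>(i, w, j)\<in>set Qs. i \<le> d \<and> j \<le> d \<and> w ~= []" using Cons.prems by simp
      from Cons.IH[OF this] obtain cs ps where l: "std d cs ps" "map fst cs = []" "map fst ps = Qs" by blast
      obtain bs where bs: "length bs = length w - 1" "distinct bs" "set bs \<inter> set (priv cs ps) = {}" "\<forall>b\<in>set bs. d < b"
        using fresh[of "length w - 1" "priv cs ps"] by (elim exE conjE)
      have "cs = []" using l(2) by simp
      then have "priv cs ((q, bs) # ps) = bs @ priv cs ps" by (simp add: priv_def)
      moreover have "okl d cs ((q, bs) # ps)" using l(1) bs(1) Cons.prems by (simp add: std_def okl_def okp_def q)
      ultimately have "std d cs ((q, bs) # ps)" using l(1) bs(2-4) unfolding std_def by (simp add: ball_Un)
      then show ?case using l by (intro exI[of _ cs] exI[of _ "(q, bs) # ps"]) simp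
    qed
  next
    case (Cons w Ms)
    have "\<forall>w\<in>set Ms. w ~= []" using Cons.prems by simp
    from Cons.IH[OF this] obtain cs ps where l: "std d cs ps" "map fst cs = Ms" "map fst ps = Qs" by blast
    obtain bs where bs: "length bs = length w" "distinct bs" "set bs \<inter> set (priv cs ps) = {}" "\<forall>b\<in>set bs. d < b"
      using fresh[of "length w" "priv cs ps"] by (elim exE conjE)
    have "priv ((w, bs) # cs) ps = bs @ priv cs ps" by (simp add: priv_def)
    moreover have "okl d ((w, bs) # cs) ps" using l(1) bs(1) Cons.prems by (simp add: std_def okl_def okc_def)
    ultimately have "std d ((w, bs) # cs) ps" using l(1) bs(2-4) unfolding std_def by (simp add: ball_Un)
    then show ?case using l by (intro exI[of _ "(w, bs) # cs"] exI[of _ ps]) simp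
  qed
qed

lemma nec_props: "length (nec w) = length w" "set (nec w) = set w" "nec (nec w) = nec w" "nec w = [] \<longleftrightarrow> w = []"
proof -
  obtain n where n: "nec w = rotate n w" using nec_rots[of w] by (auto simp: rots_def)
  show "length (nec w) = length w" "set (nec w) = set w" "nec w = [] \<longleftrightarrow> w = []" unfolding n by simp_all
  show "nec (nec w) = nec w" using nec_rotate[of n w] unfolding n .
qed

lemma adm_iff: "adm L es \<longleftrightarrow> (\<forall>e\<in>set es. fst e \<in> {1..L} \<and> 1 \<le> esrc e \<and> 1 \<le> etgt e)"
proof
  assume "adm L es"
  then show "\<forall>e\<in>set es. fst e \<in> {1..L} \<and> 1 \<le> esrc e \<and> 1 \<le> etgt e" by (auto simp: adm_def Ed_def)
next
  assume *: "\<forall>e\<in>set es. fst e \<in> {1..L} \<and> 1 \<le> esrc e \<and> 1 \<le> etgt e"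
  let ?N = "sum_list (map esrc es) + sum_list (map etgt es)"
  have "esrc e \<le> ?N" "etgt e \<le> ?N" if "e \<in> set es" for e
    using that member_le_sum_list[of "esrc e" "map esrc es"] member_le_sum_list[of "etgt e" "map etgt es"]
    by (simp_all add: trans_le_add1 trans_le_add2)
  then have "set es \<subseteq> Ed L ?N" using * by (auto simp: Ed_def)
  then show "adm L es" unfolding adm_def by (rule exI)
qed

lemma adm_layout:
  assumes std: "std d cs ps"
  shows "adm L (lay cs ps) \<longleftrightarrow> type_of cs ps \<in> Idx d L"
proof -
  have ok: "\<And>c. c \<in> set cs ==> okc c" "\<And>p. p \<in> set ps ==> okp d p" and okl: "okl d cs ps"
    and gt: "\<And>v. v \<in> set (priv cs ps) ==> d < v" using std by (auto simp: std_def okl_def)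
  have cc: "map fst (layc c) = fst c" if "c \<in> set cs" for c
    using ok(1)[OF that] unfolding okc_def layc_def by (simp add: tr_colours)
  have cp: "map fst (layp p) = fst (snd (fst p))" if "p \<in> set ps" for p
    using ok(2)[OF that] unfolding okp_def layp_def by (auto simp: tr_colours split_beta)
  have "fst ` set (lay cs ps) = (\<Union>c\<in>set cs. set (map fst (layc c))) \<union> (\<Union>p\<in>set ps. set (map fst (layp p)))"
    unfolding lay_def by auto
  also have "\<dots> = (\<Union>c\<in>set cs. set (fst c)) \<union> (\<Union>p\<in>set ps. set (fst (snd (fst p))))" using cc cp by simp
  finally have col: "fst ` set (lay cs ps) = (\<Union>c\<in>set cs. set (fst c)) \<union> (\<Union>p\<in>set ps. set (fst (snd (fst p))))" .
  have src: "esrc ` set (lay cs ps) = (fst \<circ> fst) ` set ps \<union> set (priv cs ps)"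
    using arg_cong[OF lay_sources[OF okl], of set_mset] by simp
  have tgt: "etgt ` set (lay cs ps) = (\<lambda>p. snd (snd (fst p))) ` set ps \<union> set (priv cs ps)"
    using arg_cong[OF lay_targets[OF okl], of set_mset] by simp
  have "adm L (lay cs ps) \<longleftrightarrow> fst ` set (lay cs ps) \<subseteq> {1..L} \<and> (\<forall>v\<in>esrc ` set (lay cs ps). 1 \<le> v) \<and> (\<forall>v\<in>etgt ` set (lay cs ps). 1 \<le> v)"
    unfolding adm_iff by auto
  also have "\<dots> \<longleftrightarrow> (\<forall>c\<in>set cs. set (fst c) \<subseteq> {1..L}) \<and> (\<forall>p\<in>set ps. set (fst (snd (fst p))) \<subseteq> {1..L} \<and> 1 \<le> fst (fst p) \<and> 1 \<le> snd (snd (fst p)))"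
  proof -
    have pos: "(\<forall>v\<in>set (priv cs ps). 1 \<le> v) = True" using gt by fastforce
    show ?thesis unfolding col src tgt ball_Un Un_subset_iff UN_subset_iff ball_simps(9) ball_conj_distrib o_def pos simp_thms by argo
  qed
  also have "\<dots> \<longleftrightarrow> type_of cs ps \<in> Idx d L"
  proof -
    have 1: "fst c ~= []" if "c \<in> set cs" for c using ok(1)[OF that] by (simp add: okc_def)
    have 2: "fst (fst p) \<le> d" "snd (snd (fst p)) \<le> d" "fst (snd (fst p)) ~= []" if "p \<in> set ps" for p
      using ok(2)[OF that] by (auto simp: okp_def split_beta)
    have "type_of cs ps \<in> Idx d L \<longleftrightarrow>
        (\<forall>c\<in>set cs. nec (fst c) ~= [] \<and> set (nec (fst c)) \<subseteq> {1..L} \<and> nec (nec (fst c)) = nec (fst c)) \<and>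
        (\<forall>p\<in>set ps. fst (fst p) \<in> {1..d} \<and> snd (snd (fst p)) \<in> {1..d} \<and> fst (snd (fst p)) ~= [] \<and> set (fst (snd (fst p))) \<subseteq> {1..L})"
      unfolding Idx_def type_of_def mem_Collect_eq split_beta fst_conv snd_conv
      by (simp only: mset_map set_image_mset set_mset_mset ball_simps(9) o_def)
    also have "\<dots> \<longleftrightarrow> (\<forall>c\<in>set cs. set (fst c) \<subseteq> {1..L}) \<and> (\<forall>p\<in>set ps. set (fst (snd (fst p))) \<subseteq> {1..L} \<and> 1 \<le> fst (fst p) \<and> 1 \<le> snd (snd (fst p)))"
    proof (rule arg_cong2[of _ _ _ _ "(\<and>)"]; rule ball_cong[OF refl])
      fix c assume "c \<in> set cs"
      from 1[OF this] show "(nec (fst c) ~= [] \<and> set (nec (fst c)) \<subseteq> {1..L} \<and> nec (nec (fst c)) = nec (fst c)) = (set (fst c) \<subseteq> {1..L})"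
        by (simp add: nec_props)
    next
      fix p assume "p \<in> set ps"
      from 2[OF this] show "(fst (fst p) \<in> {1..d} \<and> snd (snd (fst p)) \<in> {1..d} \<and> fst (snd (fst p)) ~= [] \<and> set (fst (snd (fst p))) \<subseteq> {1..L})
          = (set (fst (snd (fst p))) \<subseteq> {1..L} \<and> 1 \<le> fst (fst p) \<and> 1 \<le> snd (snd (fst p)))"
        unfolding atLeastAtMost_iff by argo
    qed
    finally show ?thesis ..
  qed
  finally show ?thesis .
qed

lemma sum_list_mset_cong:
  fixes h :: "'a \<Rightarrow> nat"
  assumes "mset xs = mset ys"
  shows "sum_list (map h xs) = sum_list (map h ys)"
proof -
  have "sum_list (map h zs) = sum_mset (image_mset h (mset zs))" for zs by (induction zs) simp_all
  then show ?thesis using assms by simp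
qed

lemma wt_type_of: "okl d cs ps ==> wt (type_of cs ps) = length (lay cs ps)"
proof -
  assume ok: "okl d cs ps"
  have "wtc (lst (mset (map (nec \<circ> fst) cs))) = wtc (map (nec \<circ> fst) cs)" by (rule sum_list_mset_cong) simp
  also have "\<dots> = wtc (map fst cs)" by (simp add: o_def nec_props)
  finally have 1: "wtc (lst (mset (map (nec \<circ> fst) cs))) = wtc (map fst cs)" .
  have 2: "wtp (lst (mset (map fst ps))) = wtp (map fst ps)" by (rule sum_list_mset_cong) simp
  show ?thesis unfolding wt_def type_of_def fst_conv snd_conv 1 2 length_lay[OF ok] ..
qed

lemma Idx_lst:
  assumes "k \<in> Idx d L"
  shows "\<forall>w\<in>set (lst (fst k)). w ~= []" "\<forall>(i, w, j)\<in>set (lst (snd k)). i \<le> d \<and> j \<le> d \<and> w ~= []"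
    "\<forall>(i, w, j)\<in>set (lst (snd k)). i \<le> d \<and> j \<le> d"
proof -
  have "\<forall>w\<in>#fst k. w ~= [] \<and> set w \<subseteq> {1..L} \<and> nec w = w"
    "\<forall>q\<in>#snd k. fst q \<in> {1..d} \<and> snd (snd q) \<in> {1..d} \<and> fst (snd q) ~= [] \<and> set (fst (snd q)) \<subseteq> {1..L}"
    using assms by (simp_all add: Idx_def split_beta mem_Times_iff)
  then show "\<forall>w\<in>set (lst (fst k)). w ~= []" "\<forall>(i, w, j)\<in>set (lst (snd k)). i \<le> d \<and> j \<le> d \<and> w ~= []"
    "\<forall>(i, w, j)\<in>set (lst (snd k)). i \<le> d \<and> j \<le> d"
    by (simp_all add: split_beta)
qed

lemma finite_Idx: "finite {k \<in> Idx d L. wt k = n}"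
proof -
  let ?W = "{w. set w \<subseteq> {1..L} \<and> length w \<le> n}" and ?P = "{1..d} \<times> {w. set w \<subseteq> {1..L} \<and> length w \<le> n} \<times> {1..d}"
  let ?X = "{xs. set xs \<subseteq> ?W \<and> length xs \<le> n}" and ?Y = "{ys. set ys \<subseteq> ?P \<and> length ys \<le> n}"
  have W: "finite ?W" by (rule finite_lists_length_le) simp
  have "finite ?X" by (rule finite_lists_length_le[OF W])
  moreover have "finite ?Y" by (rule finite_lists_length_le) (intro finite_cartesian_product W finite_atLeastAtMost)
  ultimately have "finite ((\<lambda>(xs, ys). (mset xs, mset ys)) ` (?X \<times> ?Y))" by (intro finite_imageI finite_cartesian_product)
  moreover have "{k \<in> Idx d L. wt k = n} \<subseteq> (\<lambda>(xs, ys). (mset xs, mset ys)) ` (?X \<times> ?Y)"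
  proof
    fix k assume k: "k \<in> {k \<in> Idx d L. wt k = n}"
    let ?x = "lst (fst k)" and ?y = "lst (snd k)"
    have len: "length xs \<le> sum_list (map h xs)" if "\<forall>x\<in>set xs. 1 \<le> h x" for h :: "'z \<Rightarrow> nat" and xs
      using that by (induction xs) (auto simp: add_mono)
    have each: "h x \<le> sum_list (map h xs)" if "x \<in> set xs" for h :: "'z \<Rightarrow> nat" and xs x
      by (rule member_le_sum_list) (use that in auto)
    have kI: "k \<in> Idx d L" "wtc ?x + wtp ?y = n" using k by (simp_all add: wt_def)
    note ne = Idx_lst(1,2)[OF kI(1)]
    have "length ?x \<le> wtc ?x" by (rule len) (use ne in \<open>auto simp: Suc_le_eq\<close>)
    moreover have "set ?x \<subseteq> ?W"
    proof
      fix w assume w: "w \<in> set ?x"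
      have "length w \<le> n" using each[OF w, of length] kI(2) by simp
      then show "w \<in> ?W" using w kI(1) by (simp add: Idx_def mem_Times_iff split_beta)
    qed
    moreover have "length ?y \<le> wtp ?y" by (rule len) (use ne in \<open>auto simp: Suc_le_eq\<close>)
    moreover have "set ?y \<subseteq> ?P"
    proof
      fix q assume q: "q \<in> set ?y"
      obtain i w j where e: "q = (i, w, j)" by (metis prod.collapse)
      have "length w \<le> n" using each[OF q, of "\<lambda>(i, w, j). length w"] kI(2) by (simp add: e)
      moreover have "\<forall>q\<in>#snd k. fst q \<in> {1..d} \<and> snd (snd q) \<in> {1..d} \<and> fst (snd q) ~= [] \<and> set (fst (snd q)) \<subseteq> {1..L}"
        using kI(1) by (simp add: Idx_def mem_Times_iff split_beta)
      from bspec[OF this, of q] have "i \<in> {1..d} \<and> j \<in> {1..d} \<and> set w \<subseteq> {1..L}" using q by (simp add: e)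
      ultimately show "q \<in> ?P" by (simp add: e)
    qed
    ultimately have "(?x, ?y) \<in> ?X \<times> ?Y" using kI(2) by (intro SigmaI CollectI conjI) linarith+
    then show "k \<in> (\<lambda>(xs, ys). (mset xs, mset ys)) ` (?X \<times> ?Y)" by (intro image_eqI[of _ _ "(?x, ?y)"]) simp_all
  qed
  ultimately show ?thesis by (rule finite_subset[rotated])
qed

section \<open>Triangularity\<close>

lemma prd_topd: "k \<in> Idx d L ==> topd d L (wt k) (prd d L k) (msym (lst (fst k)) (lst (snd k)))"
  unfolding prd_def wt_def by (rule topd_product) (rule Idx_lst(3))

lemma prd_carrier: "k \<in> Idx d L ==> prd d L k \<in> carrier (A_lim d L)"
  using prd_topd unfolding topd_def by blast

abbreviation bas :: "nat \<Rightarrow> nat \<Rightarrow> idx \<Rightarrow> coef" where "bas d L k \<equiv> psi d L (prd d L k)"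

lemma bas_good: "k \<in> Idx d L ==> good d L (bas d L k)"
  by (rule A_lim_elim(1)[OF prd_carrier])

text \<open>The triangularity that gives the basis: the product can only be nonzero at a standard layout of its weight if the layout has at least as many open
  trails, and with equally many only at layouts of its own type.\<close>

lemma bas_at_layout:
  assumes k: "k \<in> Idx d L" and std: "std d cs ps" and len: "length (lay cs ps) = wt k"
    and nz: "bas d L k (lay cs ps) ~= 0"
  shows "size (snd k) \<le> length ps" "size (snd k) = length ps ==> k = type_of cs ps"
proof -
  have "bas d L k (lay cs ps) = vr L (msym (lst (fst k)) (lst (snd k))) (lay cs ps)"
    using prd_topd[OF k] len unfolding topd_def by blast
  then have "msym (lst (fst k)) (lst (snd k)) (lay cs ps) ~= 0" using nz by (auto simp: vr_def split: if_splits)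
  from msym_nonzeroD[OF this Idx_lst(2)[OF k]] obtain cs' ps' where l: "okl d cs' ps'" "map fst cs' = lst (fst k)"
    "map fst ps' = lst (snd k)" "mset (lay cs ps) = mset (lay cs' ps')" by blast
  note det = layout_determined[OF std l(1) sym[OF l(4)]]
  have sz: "length ps' = size (snd k)" using arg_cong[OF l(3), of "\<lambda>x. size (mset x)"] by simp
  show "size (snd k) \<le> length ps" using det(1) sz by simp
  assume "size (snd k) = length ps"
  then have m: "mset (map fst ps') = mset (map fst ps)" "mset (map (nec \<circ> fst) cs') = mset (map (nec \<circ> fst) cs)"
    using det(2) sz by simp_all
  have "map nec (lst (fst k)) = lst (fst k)" using k unfolding Idx_def by (auto intro!: map_idI)
  then have "map (nec \<circ> fst) cs' = lst (fst k)" unfolding map_map[symmetric] l(2) .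
  then show "k = type_of cs ps" using m unfolding type_of_def l(3) by (cases k) simp
qed

text \<open>The leading term is a sum of nonnegative terms, and the splitting of the layout into its components contributes a positive one.\<close>

lemma own_layout:
  assumes k: "k \<in> Idx d L"
  shows "\<exists>cs ps. std d cs ps \<and> type_of cs ps = k \<and> bas d L k (lay cs ps) ~= 0"
proof -
  obtain cs ps where l: "std d cs ps" "map fst cs = lst (fst k)" "map fst ps = lst (snd k)"
    using layout_exists[OF Idx_lst(1,2)[OF k]] by blast
  have ok: "okl d cs ps" using l(1) by (simp add: std_def)
  have "map (nec \<circ> fst) cs = lst (fst k)"
    unfolding map_map[symmetric] l(2) using k unfolding Idx_def by (auto intro!: map_idI)
  then have t: "type_of cs ps = k" unfolding type_of_def l(3) by simp
  have "length (lay cs ps) = wt k" using wt_type_of[OF ok] t by simp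
  then have "bas d L k (lay cs ps) = vr L (msym (lst (fst k)) (lst (snd k))) (lay cs ps)"
    using prd_topd[OF k] unfolding topd_def by blast
  also have "\<dots> = msym (map fst cs) (map fst ps) (lay cs ps)"
    using adm_layout[OF l(1)] t k l(2,3) by (simp add: vr_def)
  finally have "1 \<le> bas d L k (lay cs ps)" using msym_layout[OF ok] by simp
  then have "bas d L k (lay cs ps) ~= 0" by (auto simp: less_eq_complex_def)
  then show ?thesis using l(1) t by blast
qed

section \<open>Linear maps out of a tensor product\<close>

text \<open>The linear span as an inductive set, which suits the inductions over tensors below.\<close>

inductive_set fspan :: "('a \<Rightarrow> complex) set \<Rightarrow> ('a \<Rightarrow> complex) set" for S where
  zero: "(\<lambda>_. 0) \<in> fspan S"
| step: "s \<in> S ==> f \<in> fspan S ==> (\<lambda>r. c * s r + f r) \<in> fspan S"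


lemma fspan_scale: "f \<in> fspan S ==> (\<lambda>r. a * f r) \<in> fspan S"
proof (induction rule: fspan.induct)
  case (step s f c)
  then have "(\<lambda>r. (a * c) * s r + a * f r) \<in> fspan S" by (intro fspan.step)
  then show ?case by (simp add: algebra_simps)
qed (simp add: fspan.zero)

lemma fspan_add: "f \<in> fspan S ==> g \<in> fspan S ==> (\<lambda>r. f r + g r) \<in> fspan S"
proof (induction rule: fspan.induct)
  case (step s f c)
  then have "(\<lambda>r. c * s r + (f r + g r)) \<in> fspan S" by (intro fspan.step) auto
  then show ?case by (simp add: add.assoc)
qed simp

lemma fspan_base: "s \<in> S ==> s \<in> fspan S"
  using fspan.step[OF _ fspan.zero, of s S 1] by simp

text \<open>A vector space given as a record, identified by \<open>p\<close> with a space of functions. Equations can then be checked pointwise.\<close>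

locale function_space =
  fixes U :: "(complex, 'a, 'm) module_scheme" and p :: "'a \<Rightarrow> 'x \<Rightarrow> complex"
  assumes add: "x \<in> carrier U ==> y \<in> carrier U ==> x \<oplus>\<^bsub>U\<^esub> y \<in> carrier U"
      "x \<in> carrier U ==> y \<in> carrier U ==> p (x \<oplus>\<^bsub>U\<^esub> y) = (\<lambda>r. p x r + p y r)"
    and smult: "x \<in> carrier U ==> c \<odot>\<^bsub>U\<^esub> x \<in> carrier U" "x \<in> carrier U ==> p (c \<odot>\<^bsub>U\<^esub> x) = (\<lambda>r. c * p x r)"
    and zero: "\<zero>\<^bsub>U\<^esub> \<in> carrier U" "p \<zero>\<^bsub>U\<^esub> = (\<lambda>_. 0)"
    and inj: "x \<in> carrier U ==> y \<in> carrier U ==> p x = p y ==> x = y"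
begin

lemma span_induct:
  assumes S: "S \<subseteq> carrier U" and x: "x \<in> carrier U" "p x \<in> fspan (p ` S)"
    and P: "P \<zero>\<^bsub>U\<^esub>" "\<And>c s y. s \<in> S ==> y \<in> carrier U ==> p y \<in> fspan (p ` S) ==> P y ==> P (c \<odot>\<^bsub>U\<^esub> s \<oplus>\<^bsub>U\<^esub> y)"
  shows "P x"
proof -
  note z = zero
  have "\<forall>x\<in>carrier U. p x = f --> P x" if "f \<in> fspan (p ` S)" for f
    using that
  proof (induction rule: fspan.induct)
    case zero
    show ?case using inj[OF _ z(1)] P(1) z(2) by auto
  next
    case (step q f c)
    obtain s where s: "s \<in> S" "q = p s" using step(1) by blast
    have sc: "s \<in> carrier U" using s(1) S by blast
    show ?case
    proof (intro ballI impI)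
      fix x assume x: "x \<in> carrier U" "p x = (\<lambda>r. c * q r + f r)"
      let ?y = "x \<oplus>\<^bsub>U\<^esub> (- c) \<odot>\<^bsub>U\<^esub> s"
      have y: "?y \<in> carrier U" "p ?y = f" using x s(2) by (simp_all add: add smult sc)
      have "c \<odot>\<^bsub>U\<^esub> s \<oplus>\<^bsub>U\<^esub> ?y = x" by (rule inj) (use x y s(2) in \<open>simp_all add: add smult sc\<close>)
      moreover have "P (c \<odot>\<^bsub>U\<^esub> s \<oplus>\<^bsub>U\<^esub> ?y)" using P(2)[OF s(1) y(1)] step y by simp
      ultimately show "P x" by simp
    qed
  qed
  then show ?thesis using x by blast
qed

end

abbreviation psc :: "complex \<Rightarrow> ('s \<Rightarrow>\<^sub>0 complex) \<Rightarrow> ('s \<Rightarrow>\<^sub>0 complex)" where "psc c \<equiv> Poly_Mapping.map ((*) c)"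

lemma lookup_psc: "Poly_Mapping.lookup (psc c q) k = c * Poly_Mapping.lookup q k"
  by (simp add: Poly_Mapping.map.rep_eq when_def)

lemma psc_simps: "psc c (q + q') = psc c q + psc c q'" "psc c (psc c' q) = psc (c * c') q" "psc 0 q = 0" "psc (-1) q = - q" "psc c 0 = 0"
  "psc c (q - q') = psc c q - psc c q'" "psc c (Poly_Mapping.single k a) = Poly_Mapping.single k (c * a)"
  by (rule poly_mapping_eqI; simp add: lookup_psc lookup_add lookup_minus lookup_single when_def algebra_simps)+

lemma keys_psc: "Poly_Mapping.keys (psc c q) \<subseteq> Poly_Mapping.keys q"
  by (auto simp: in_keys_iff lookup_psc)

lemma additive_subgroup_free:
  assumes "H \<subseteq> carrier (free_space S)" "0 \<in> H" "\<And>x y. x \<in> H ==> y \<in> H ==> x + y \<in> H" "\<And>x. x \<in> H ==> - x \<in> H"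
  shows "additive_subgroup H (free_space S)"
proof (rule additive_subgroup.intro)
  let ?G = "add_monoid (free_space S)"
  have keys: "Poly_Mapping.keys (- x) = Poly_Mapping.keys x" for x :: "'a \<Rightarrow>\<^sub>0 complex" by (auto simp: in_keys_iff)
  have plus: "Poly_Mapping.keys (x + y) \<subseteq> S" if "Poly_Mapping.keys x \<subseteq> S" "Poly_Mapping.keys y \<subseteq> S" for x y :: "'a \<Rightarrow>\<^sub>0 complex"
    using that Poly_Mapping.keys_add[of x y] by blast
  have neg: "\<exists>y. Poly_Mapping.keys y \<subseteq> S \<and> y + x = 0" if "Poly_Mapping.keys x \<subseteq> S" for x :: "'a \<Rightarrow>\<^sub>0 complex"
    by (rule exI[of _ "- x"]) (simp add: keys that)
  have G: "group ?G"
    by (rule groupI) (use plus neg in \<open>auto simp: free_space_def add.assoc\<close>)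
  have "inv\<^bsub>?G\<^esub> x = - x" if "x \<in> H" for x
    by (rule group.inv_equality[OF G]) (use that assms(1) keys in \<open>auto simp: free_space_def\<close>)
  then show "subgroup H ?G" using assms by (intro group.subgroupI[OF G]) (auto simp: free_space_def)
qed

text \<open>The lift is evaluation of formal combinations. It is surjective since \<open>Z\<close> is spanned by the images of pairs of spanning vectors. For injectivity, every formal
  combination is congruent modulo the relators to one of such pairs only, and there independence forces it to vanish.\<close>

theorem tensor_lift_iso:
  fixes V :: "(complex, 'a, 'm) module_scheme" and W :: "(complex, 'b, 'n) module_scheme"
    and Z :: "(complex, 'c, 'k) module_scheme"
  assumes V: "function_space V pv" and W: "function_space W pw" and Z: "function_space Z pz" "abelian_monoid Z"
    and f: "\<And>v w. v \<in> carrier V ==> w \<in> carrier W ==> f v w \<in> carrier Z"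
    and bil: "\<And>v v' w. v \<in> carrier V ==> v' \<in> carrier V ==> w \<in> carrier W ==> f (v \<oplus>\<^bsub>V\<^esub> v') w = f v w \<oplus>\<^bsub>Z\<^esub> f v' w"
      "\<And>v w w'. v \<in> carrier V ==> w \<in> carrier W ==> w' \<in> carrier W ==> f v (w \<oplus>\<^bsub>W\<^esub> w') = f v w \<oplus>\<^bsub>Z\<^esub> f v w'"
      "\<And>c v w. v \<in> carrier V ==> w \<in> carrier W ==> f (c \<odot>\<^bsub>V\<^esub> v) w = c \<odot>\<^bsub>Z\<^esub> f v w"
      "\<And>c v w. v \<in> carrier V ==> w \<in> carrier W ==> f v (c \<odot>\<^bsub>W\<^esub> w) = c \<odot>\<^bsub>Z\<^esub> f v w"
    and S: "S1 \<subseteq> carrier V" "S2 \<subseteq> carrier W" "\<And>v. v \<in> carrier V ==> pv v \<in> fspan (pv ` S1)" "\<And>w. w \<in> carrier W ==> pw w \<in> fspan (pw ` S2)"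
    and span: "\<And>z. z \<in> carrier Z ==> pz z \<in> fspan ((\<lambda>k. pz (f (fst k) (snd k))) ` (S1 \<times> S2))"
    and indep: "\<And>K c. finite K ==> K \<subseteq> S1 \<times> S2 ==> (\<And>r. (\<Sum>k\<in>K. c k * pz (f (fst k) (snd k)) r) = 0) ==> \<forall>k\<in>K. c k = 0"
  shows "complex_linear_iso (tensor_product V W) Z (tensor_lift Z f)"
proof -
  interpret V: function_space V pv by (rule V)
  interpret W: function_space W pw by (rule W)
  interpret Z: function_space Z pz by (rule Z(1))
  interpret Zm: abelian_monoid Z by (rule Z(2))
  let ?S = "carrier V \<times> carrier W"
  let ?F = "free_space ?S"
  define T where "T = subspace_span ?F (tensor_relators V W)"
  let ?sg = "Poly_Mapping.single :: 'a \<times> 'b \<Rightarrow> complex \<Rightarrow> _"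
  have F: "carrier ?F = {q. Poly_Mapping.keys q \<subseteq> ?S}" "add ?F = (+)" "\<zero>\<^bsub>?F\<^esub> = 0" "\<And>c q. c \<odot>\<^bsub>?F\<^esub> q = psc c q"
    by (simp_all add: free_space_def)
  have keys_plus: "Poly_Mapping.keys (x + y) \<subseteq> A" if "Poly_Mapping.keys x \<subseteq> A" "Poly_Mapping.keys y \<subseteq> A"
    for x y :: "'a \<times> 'b \<Rightarrow>\<^sub>0 complex" and A
    using that Poly_Mapping.keys_add[of x y] by blast
  have keys_psc': "Poly_Mapping.keys (psc c x) \<subseteq> A" if "Poly_Mapping.keys x \<subseteq> A" for x :: "'a \<times> 'b \<Rightarrow>\<^sub>0 complex" and A c
    using that keys_psc[of c x] by blast
  \<comment> \<open>evaluation of formal combinations, in \<open>Z\<close> and as functions\<close>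
  define ev where "ev q = (\<Oplus>\<^bsub>Z\<^esub>k\<in>Poly_Mapping.keys q. Poly_Mapping.lookup q k \<odot>\<^bsub>Z\<^esub> f (fst k) (snd k))" for q
  define e where "e q = (\<lambda>r. \<Sum>k\<in>Poly_Mapping.keys q. Poly_Mapping.lookup q k * pz (f (fst k) (snd k)) r)" for q
  have fS: "f (fst k) (snd k) \<in> carrier Z" if "k \<in> ?S" for k using f that by (simp add: mem_Times_iff)
  have ev: "ev q \<in> carrier Z" "pz (ev q) = e q" if q: "q \<in> carrier ?F" for q
  proof -
    have "(\<Oplus>\<^bsub>Z\<^esub>k\<in>K. Poly_Mapping.lookup q k \<odot>\<^bsub>Z\<^esub> f (fst k) (snd k)) \<in> carrier Z \<and>
        pz (\<Oplus>\<^bsub>Z\<^esub>k\<in>K. Poly_Mapping.lookup q k \<odot>\<^bsub>Z\<^esub> f (fst k) (snd k)) = (\<lambda>r. \<Sum>k\<in>K. Poly_Mapping.lookup q k * pz (f (fst k) (snd k)) r)"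
      if "finite K" "K \<subseteq> ?S" for K
      using that
    proof (induction K)
      case empty
      show ?case by (simp add: Z.zero)
    next
      case (insert k K)
      have k: "Poly_Mapping.lookup q k \<odot>\<^bsub>Z\<^esub> f (fst k) (snd k) \<in> carrier Z" using insert.prems by (intro Z.smult fS) blast
      have K: "(\<lambda>k. Poly_Mapping.lookup q k \<odot>\<^bsub>Z\<^esub> f (fst k) (snd k)) \<in> K \<rightarrow> carrier Z"
        using insert.prems by (intro funcsetI Z.smult fS) blast
      have kS: "f (fst k) (snd k) \<in> carrier Z" using insert.prems by (intro fS) blast
      show ?case
        unfolding Zm.finsum_insert[OF insert.hyps K k]
        using insert by (simp add: Z.add Z.smult kS k)
    qed
    from this[OF finite_keys] q show "ev q \<in> carrier Z" "pz (ev q) = e q" unfolding ev_def e_def F(1) by blast+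
  qed
  have e_sup: "e q r = (\<Sum>k\<in>K. Poly_Mapping.lookup q k * pz (f (fst k) (snd k)) r)" if "finite K" "Poly_Mapping.keys q \<subseteq> K" for q r K
    unfolding e_def by (rule sum.mono_neutral_left) (use that in \<open>auto simp: in_keys_iff\<close>)
  have e_add: "e (q + q') = (\<lambda>r. e q r + e q' r)" for q q'
  proof
    fix r
    let ?K = "Poly_Mapping.keys q \<union> Poly_Mapping.keys q'"
    have K: "finite ?K" "Poly_Mapping.keys (q + q') \<subseteq> ?K" "Poly_Mapping.keys q \<subseteq> ?K" "Poly_Mapping.keys q' \<subseteq> ?K"
      using Poly_Mapping.keys_add[of q q'] by auto
    show "e (q + q') r = e q r + e q' r"
      unfolding e_sup[OF K(1,2)] e_sup[OF K(1,3)] e_sup[OF K(1,4)] by (simp add: lookup_add distrib_right sum.distrib)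
  qed
  have e_psc: "e (psc c q) = (\<lambda>r. c * e q r)" for c q
  proof
    fix r
    show "e (psc c q) r = c * e q r"
      unfolding e_sup[OF finite_keys keys_psc] by (simp add: e_def lookup_psc sum_distrib_left mult.assoc)
  qed
  have e_single: "e (?sg k c) = (\<lambda>r. c * pz (f (fst k) (snd k)) r)" for k c
    by (rule ext, subst e_sup[of "{k}"]) (auto simp: lookup_single)
  have e_diff: "e (q - q') = (\<lambda>r. e q r - e q' r)" for q q'
  proof -
    have "q - q' = q + psc (-1) q'" by (simp add: psc_simps)
    then show ?thesis by (simp only: e_add e_psc) simp
  qed
  have sgF: "?sg (v, w) c \<in> carrier ?F" if "v \<in> carrier V" "w \<in> carrier W" for v w c
    using that by (auto simp: F)
  have FI: "q + q' \<in> carrier ?F" "psc c q \<in> carrier ?F" "q - q' \<in> carrier ?F"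
    if "q \<in> carrier ?F" "q' \<in> carrier ?F" for q q' c
    using that keys_plus[of q ?S q'] keys_psc'[of q ?S c] keys_plus[of q ?S "psc (-1) q'"] keys_psc'[of q' ?S "-1"]
    by (simp_all add: F(1) psc_simps)
  have sub: "additive_subgroup H ?F" if "H \<subseteq> carrier ?F" "0 \<in> H" "\<And>x y. x \<in> H ==> y \<in> H ==> x + y \<in> H" "\<And>c x. x \<in> H ==> psc c x \<in> H" for H
    by (rule additive_subgroup_free[OF that(1-3)]) (use that(4)[of _ "-1"] in \<open>simp_all add: psc_simps\<close>)
  \<comment> \<open>the evaluation kills the relators\<close>
  let ?Ker = "{q \<in> carrier ?F. e q = (\<lambda>_. 0)}"
  have TK: "T \<subseteq> ?Ker"
    unfolding T_def subspace_span_def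
  proof (rule Inter_lower, rule CollectI, intro conjI allI ballI)
    show "additive_subgroup ?Ker ?F"
      by (rule sub) (use FI in \<open>auto simp: e_add e_psc, auto simp: F e_def\<close>)
    show "c \<odot>\<^bsub>?F\<^esub> t \<in> ?Ker" if "t \<in> ?Ker" for c t using that FI(2)[of t t c] by (simp add: F(4) e_psc)
    show "tensor_relators V W \<subseteq> ?Ker"
      unfolding tensor_relators_def
      by (auto simp: e_diff e_single bil V.add W.add V.smult W.smult Z.add Z.smult f intro!: FI sgF)
  qed
  have TI: "0 \<in> T" "\<And>x y. x \<in> T ==> y \<in> T ==> x + y \<in> T" "\<And>c x. x \<in> T ==> psc c x \<in> T" "tensor_relators V W \<subseteq> T"
  proof -
    have H: "0 \<in> H" "\<And>x y. x \<in> H ==> y \<in> H ==> x + y \<in> H" if "additive_subgroup H ?F" for H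
      using additive_subgroup.zero_closed[OF that] additive_subgroup.a_closed[OF that] by (simp_all add: F)
    show "0 \<in> T" "tensor_relators V W \<subseteq> T" unfolding T_def subspace_span_def using H(1) by blast+
    show "x + y \<in> T" if "x \<in> T" "y \<in> T" for x y using that H(2) unfolding T_def subspace_span_def by blast
    show "psc c x \<in> T" if "x \<in> T" for c x using that unfolding T_def subspace_span_def F(4) by blast
  qed
  have Tdiff: "x - y \<in> T" if "x \<in> T" "y \<in> T" for x y
    using TI(2)[OF that(1) TI(3)[OF that(2), of "-1"]] by (simp add: psc_simps)
  \<comment> \<open>modulo the relators, only pairs of spanning vectors are needed\<close>
  define R where "R = {q. \<exists>b. Poly_Mapping.keys b \<subseteq> S1 \<times> S2 \<and> q - b \<in> T}"
  have RT: "q \<in> R" if "q \<in> T" for q using that unfolding R_def by (intro CollectI exI[of _ 0]) simp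
  have Radd: "q + q' \<in> R" if qR: "q \<in> R" "q' \<in> R" for q q'
  proof -
    obtain b b' where b: "Poly_Mapping.keys b \<subseteq> S1 \<times> S2" "q - b \<in> T" "Poly_Mapping.keys b' \<subseteq> S1 \<times> S2" "q' - b' \<in> T"
      using qR unfolding R_def by blast
    have "q + q' - (b + b') \<in> T" using TI(2)[OF b(2,4)] by (simp add: algebra_simps)
    then show ?thesis using keys_plus[OF b(1,3)] unfolding R_def by blast
  qed
  have Rpsc: "psc c q \<in> R" if qR: "q \<in> R" for c q
  proof -
    obtain b where b: "Poly_Mapping.keys b \<subseteq> S1 \<times> S2" "q - b \<in> T" using qR unfolding R_def by blast
    have "psc c q - psc c b \<in> T" using TI(3)[OF b(2), of c] by (simp add: psc_simps)
    then show ?thesis using keys_psc'[OF b(1)] unfolding R_def by blast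
  qed
  have Rmod: "q \<in> R" if "q - q' \<in> T" "q' \<in> R" for q q' using Radd[OF RT[OF that(1)] that(2)] by simp
  have rel: "?sg (v \<oplus>\<^bsub>V\<^esub> v', w) 1 - ?sg (v, w) 1 - ?sg (v', w) 1 \<in> T" "?sg (c \<odot>\<^bsub>V\<^esub> v, w) 1 - ?sg (v, w) c \<in> T"
    if "v \<in> carrier V" "v' \<in> carrier V" "w \<in> carrier W" for v v' w c
    using that by (intro subsetD[OF TI(4)]; unfold tensor_relators_def; blast)+
  have rel': "?sg (v, w \<oplus>\<^bsub>W\<^esub> w') 1 - ?sg (v, w) 1 - ?sg (v, w') 1 \<in> T" "?sg (v, c \<odot>\<^bsub>W\<^esub> w) 1 - ?sg (v, w) c \<in> T"
    if "v \<in> carrier V" "w \<in> carrier W" "w' \<in> carrier W" for v w w' c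
    using that by (intro subsetD[OF TI(4)]; unfold tensor_relators_def; blast)+
  have sc1: "?sg k c = psc c (?sg k 1)" for k c by (simp add: psc_simps)
  have R2: "?sg (s, w) 1 \<in> R" if s: "s \<in> S1" and w: "w \<in> carrier W" for s w
  proof (rule W.span_induct[OF S(2) w S(4)[OF w]])
    have sV: "s \<in> carrier V" using s S(1) by blast
    have "0 \<odot>\<^bsub>W\<^esub> \<zero>\<^bsub>W\<^esub> = \<zero>\<^bsub>W\<^esub>" by (rule W.inj) (simp_all add: W.smult W.zero)
    then show "?sg (s, \<zero>\<^bsub>W\<^esub>) 1 \<in> R" using rel'(2)[OF sV W.zero(1) W.zero(1), of 0] by (simp add: RT)
    fix c t y assume t: "t \<in> S2" and y: "y \<in> carrier W" "?sg (s, y) 1 \<in> R"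
    have tW: "t \<in> carrier W" using t S(2) by blast
    have "?sg (s, t) 1 \<in> R" unfolding R_def using s t TI(1) by (intro CollectI exI[of _ "?sg (s, t) 1"]) simp
    then have "?sg (s, c \<odot>\<^bsub>W\<^esub> t) 1 \<in> R" using Rmod[OF rel'(2)[OF sV tW tW, of c]] Rpsc[of _ c] sc1[of _ c] by metis
    then show "?sg (s, c \<odot>\<^bsub>W\<^esub> t \<oplus>\<^bsub>W\<^esub> y) 1 \<in> R"
      using Rmod[OF _ Radd[OF _ y(2)]] rel'(1)[OF sV W.smult(1)[OF tW, of c] y(1)] by (simp add: diff_diff_add)
  qed
  have R1: "?sg (v, w) 1 \<in> R" if v: "v \<in> carrier V" and w: "w \<in> carrier W" for v w
  proof (rule V.span_induct[OF S(1) v S(3)[OF v]])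
    have "0 \<odot>\<^bsub>V\<^esub> \<zero>\<^bsub>V\<^esub> = \<zero>\<^bsub>V\<^esub>" by (rule V.inj) (simp_all add: V.smult V.zero)
    then show "?sg (\<zero>\<^bsub>V\<^esub>, w) 1 \<in> R" using rel(2)[OF V.zero(1) V.zero(1) w, of 0] by (simp add: RT)
    fix c s y assume s: "s \<in> S1" and y: "y \<in> carrier V" "?sg (y, w) 1 \<in> R"
    have sV: "s \<in> carrier V" using s S(1) by blast
    have "?sg (c \<odot>\<^bsub>V\<^esub> s, w) 1 \<in> R" using R2[OF s w] Rmod[OF rel(2)[OF sV sV w, of c]] Rpsc[of _ c] sc1[of _ c] by metis
    then show "?sg (c \<odot>\<^bsub>V\<^esub> s \<oplus>\<^bsub>V\<^esub> y, w) 1 \<in> R"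
      using Rmod[OF _ Radd[OF _ y(2)]] rel(1)[OF V.smult(1)[OF sV, of c] y(1) w] by (simp add: diff_diff_add)
  qed
  have Rall: "q \<in> R" if "finite K" "K \<subseteq> ?S" "Poly_Mapping.keys q \<subseteq> K" for q K
    using that
  proof (induction K arbitrary: q)
    case empty
    then have "q = 0" by (simp add: keys_eq_empty)
    then show ?case using RT[OF TI(1)] by simp
  next
    case (insert k K)
    let ?c = "Poly_Mapping.lookup q k"
    have r: "q - ?sg k ?c \<in> R"
    proof (rule insert.IH)
      show "Poly_Mapping.keys (q - ?sg k ?c) \<subseteq> K"
      proof
        fix x assume "x \<in> Poly_Mapping.keys (q - ?sg k ?c)"
        then have "Poly_Mapping.lookup q x ~= Poly_Mapping.lookup (?sg k ?c) x" by (simp add: in_keys_iff lookup_minus)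
        then have "x ~= k" "x \<in> Poly_Mapping.keys q" by (auto simp: lookup_single when_def in_keys_iff split: if_splits)
        then show "x \<in> K" using insert.prems(2) by blast
      qed
    qed (use insert.prems in blast)
    have "?sg k 1 \<in> R" using R1[of "fst k" "snd k"] insert.prems(1) by (auto simp: mem_Times_iff)
    then have "?sg k ?c \<in> R" by (subst sc1) (rule Rpsc)
    from Radd[OF r this] show ?case by simp
  qed
  have ker: "a \<in> T" if a: "a \<in> carrier ?F" "e a = (\<lambda>_. 0)" for a
  proof -
    obtain b where b: "Poly_Mapping.keys b \<subseteq> S1 \<times> S2" "a - b \<in> T" using Rall[OF finite_keys, of a a] a(1) unfolding R_def F(1) by blast
    have "e (a - b) = (\<lambda>_. 0)" using TK b(2) by blast
    then have "e b = (\<lambda>_. 0)" unfolding e_diff a(2) by (simp add: fun_eq_iff)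
    then have "\<forall>k\<in>Poly_Mapping.keys b. Poly_Mapping.lookup b k = 0"
      by (intro indep[OF finite_keys b(1)]) (simp add: e_def fun_eq_iff)
    then have "b = 0" by (auto simp: in_keys_iff intro: poly_mapping_eqI)
    then show ?thesis using b(2) by simp
  qed
  \<comment> \<open>cosets\<close>
  let ?C = "\<lambda>a. T +>\<^bsub>?F\<^esub> a"
  have C: "?C a = {h + a | h. h \<in> T}" for a unfolding a_r_coset_def' F by blast
  have C_eq: "?C a = ?C b \<longleftrightarrow> a - b \<in> T" for a b
  proof
    assume "?C a = ?C b"
    moreover have "a \<in> ?C a" using TI(1) unfolding C by (intro CollectI exI[of _ 0]) simp
    ultimately obtain h where "h \<in> T" "a = h + b" unfolding C by blast
    then show "a - b \<in> T" by simp
  next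
    have 1: "?C a \<subseteq> ?C b" if "a - b \<in> T" for a b
    proof
      fix x assume "x \<in> ?C a"
      then obtain h where "h \<in> T" "x = h + a" unfolding C by blast
      then show "x \<in> ?C b" using TI(2)[of h "a - b"] that unfolding C by (intro CollectI exI[of _ "h + (a - b)"]) simp
    qed
    assume "a - b \<in> T"
    then show "?C a = ?C b" using 1[of a b] 1[of b a] Tdiff[OF TI(1), of "a - b"] by (auto simp: algebra_simps)
  qed
  let ?Q = "tensor_product V W"
  have Q: "carrier ?Q = ?C ` carrier ?F" "\<And>A B. A \<oplus>\<^bsub>?Q\<^esub> B = A <+>\<^bsub>?F\<^esub> B" "\<And>c A. c \<odot>\<^bsub>?Q\<^esub> A = (\<Union>a\<in>A. ?C (psc c a))"
    by (auto simp: tensor_product_def quot_module_def FactRing_def A_RCOSETS_def' ring.defs module.defs T_def[symmetric] F(4))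
  have Qadd: "?C a \<oplus>\<^bsub>?Q\<^esub> ?C b = ?C (a + b)" for a b
  proof -
    have "?C a \<oplus>\<^bsub>?Q\<^esub> ?C b = {(h + a) + (h' + b) | h h'. h \<in> T \<and> h' \<in> T}" unfolding Q(2) set_add_def' F(2) C by blast
    also have "\<dots> = ?C (a + b)" unfolding C
    proof (intro equalityI subsetI)
      fix x assume "x \<in> {(h + a) + (h' + b) | h h'. h \<in> T \<and> h' \<in> T}"
      then obtain h h' where "h \<in> T" "h' \<in> T" "x = (h + a) + (h' + b)" by blast
      then show "x \<in> {h + (a + b) | h. h \<in> T}" using TI(2)[of h h'] by (intro CollectI exI[of _ "h + h'"]) (simp add: algebra_simps)
    next
      fix x assume "x \<in> {h + (a + b) | h. h \<in> T}"
      then obtain h where "h \<in> T" "x = h + (a + b)" by blast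
      then show "x \<in> {(h + a) + (h' + b) | h h'. h \<in> T \<and> h' \<in> T}" using TI(1)
        by (intro CollectI exI[of _ h] exI[of _ 0]) (simp add: algebra_simps)
    qed
    finally show ?thesis .
  qed
  have Qsc: "c \<odot>\<^bsub>?Q\<^esub> ?C a = ?C (psc c a)" for c a
  proof -
    have "?C (psc c x) = ?C (psc c a)" if x: "x \<in> ?C a" for x
    proof -
      obtain h where "h \<in> T" "x = h + a" using x unfolding C by blast
      then have "psc c x - psc c a \<in> T" using TI(3)[of h c] by (simp add: psc_simps)
      then show ?thesis by (simp only: C_eq)
    qed
    moreover have "a \<in> ?C a" using TI(1) unfolding C by (intro CollectI exI[of _ 0]) simp
    ultimately show ?thesis unfolding Q(3) by blast
  qed
  let ?l = "tensor_lift Z f"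
  have lift: "?l (?C a) = ev a" if a: "a \<in> carrier ?F" for a
  proof -
    have "ev (h + a) = ev a" if "h \<in> T" for h
    proof (rule Z.inj)
      have h: "h \<in> carrier ?F" "e h = (\<lambda>_. 0)" using TK that by blast+
      show "ev (h + a) \<in> carrier Z" "ev a \<in> carrier Z" using ev FI h(1) a by blast+
      show "pz (ev (h + a)) = pz (ev a)" using ev(2)[OF FI(1)[OF h(1) a]] ev(2)[OF a] h(2) by (simp add: e_add)
    qed
    then have "ev ` ?C a = {ev a}" unfolding C using TI(1) by (auto intro!: image_eqI[of _ _ "0 + a"])
    moreover have "?l (?C a) = the_elem (ev ` ?C a)" unfolding tensor_lift_def ev_def[abs_def] ..
    ultimately show ?thesis by simp
  qed
  have ev_eq: "ev a = z" if "a \<in> carrier ?F" "z \<in> carrier Z" "e a = pz z" for a z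
    by (rule Z.inj) (use that ev in simp_all)
  have surj: "\<exists>a\<in>carrier ?F. e a = g" if "g \<in> fspan ((\<lambda>k. pz (f (fst k) (snd k))) ` (S1 \<times> S2))" for g
    using that
  proof (induction rule: fspan.induct)
    case zero
    show ?case by (rule bexI[of _ 0]) (simp_all add: e_def F)
  next
    case (step s g c)
    then obtain k a where k: "k \<in> S1 \<times> S2" "s = pz (f (fst k) (snd k))" and a: "a \<in> carrier ?F" "e a = g" by blast
    have kF: "?sg k c \<in> carrier ?F" using k(1) S(1,2) by (auto simp: F)
    show ?case by (rule bexI[OF _ FI(1)[OF kF a(1)]]) (simp add: e_add e_single k(2) a(2))
  qed
  show ?thesis
    unfolding complex_linear_iso_def
  proof (intro conjI ballI allI bij_betw_imageI inj_onI)
    fix A B assume "A \<in> carrier ?Q" "B \<in> carrier ?Q" and eq: "?l A = ?l B"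
    then obtain a b where ab: "a \<in> carrier ?F" "A = ?C a" "b \<in> carrier ?F" "B = ?C b" unfolding Q(1) by blast
    have "ev a = ev b" using eq lift ab by simp
    then have "e a = e b" using ev(2) ab by metis
    then have "e (a - b) = (\<lambda>_. 0)" by (simp add: e_diff)
    from ker[OF FI(3)[OF ab(1,3)] this] show "A = B" unfolding ab(2,4) C_eq .
  next
    show "?l ` carrier ?Q = carrier Z"
    proof (intro equalityI subsetI)
      fix z assume "z \<in> ?l ` carrier ?Q"
      then show "z \<in> carrier Z" unfolding Q(1) using lift ev by auto
    next
      fix z assume z: "z \<in> carrier Z"
      obtain a where a: "a \<in> carrier ?F" "e a = pz z" using surj[OF span[OF z]] by blast
      have "z = ?l (?C a)" using lift[OF a(1)] ev_eq[OF a(1) z a(2)] by simp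
      then show "z \<in> ?l ` carrier ?Q" using a(1) unfolding Q(1) by blast
    qed
  next
    fix A B assume "A \<in> carrier ?Q" "B \<in> carrier ?Q"
    then obtain a b where ab: "a \<in> carrier ?F" "A = ?C a" "b \<in> carrier ?F" "B = ?C b" unfolding Q(1) by blast
    have "ev (a + b) = ev a \<oplus>\<^bsub>Z\<^esub> ev b"
      by (rule ev_eq[OF FI(1)[OF ab(1,3)]]) (use ev ab in \<open>simp_all add: Z.add e_add\<close>)
    then show "?l (A \<oplus>\<^bsub>?Q\<^esub> B) = ?l A \<oplus>\<^bsub>Z\<^esub> ?l B" unfolding ab(2,4) Qadd using lift FI ab by simp
  next
    fix c A assume "A \<in> carrier ?Q"
    then obtain a where a: "a \<in> carrier ?F" "A = ?C a" unfolding Q(1) by blast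
    have "ev (psc c a) = c \<odot>\<^bsub>Z\<^esub> ev a"
      by (rule ev_eq[OF FI(2)[OF a(1) a(1)]]) (use ev a in \<open>simp_all add: Z.smult e_psc\<close>)
    then show "?l (c \<odot>\<^bsub>?Q\<^esub> A) = c \<odot>\<^bsub>Z\<^esub> ?l A" unfolding a(2) Qsc using lift FI a by simp
  qed
qed

section \<open>A basis\<close>

lemma fspan_sum:
  assumes "finite K" "b ` K \<subseteq> S" "f \<in> fspan S"
  shows "(\<lambda>r. f r + (\<Sum>k\<in>K. c k * b k r)) \<in> fspan S"
  using assms
proof (induction K)
  case (insert x K)
  then have "(\<lambda>r. c x * b x r + (f r + (\<Sum>k\<in>K. c k * b k r))) \<in> fspan S" by (intro fspan.step) auto
  then show ?case using insert by (simp add: algebra_simps)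
qed simp

lemma good_sum:
  assumes "finite K" "\<And>k. k \<in> K ==> good d L (b k)" "good d L f"
  shows "good d L (\<lambda>r. f r + (\<Sum>k\<in>K. c k * b k r))"
  using assms
proof (induction K)
  case (insert x K)
  then have "good d L (\<lambda>r. c x * b x r + (f r + (\<Sum>k\<in>K. c k * b k r)))"
    by (intro good_linear(1)[OF good_linear(2)]) auto
  then show ?case using insert by (simp add: algebra_simps)
qed simp

lemma length_paths: "okl d cs ps ==> length ps \<le> length (lay cs ps)"
proof -
  assume ok: "okl d cs ps"
  have "length ps \<le> wtp (map fst ps)" if "\<forall>p\<in>set ps. okp d p"
    using that by (induction ps) (auto simp: okp_def split_beta)
  then show ?thesis using ok length_lay[OF ok] unfolding okl_def by simp
qed

lemma good_layout: "good d L f ==> std d cs ps ==> type_of cs ps \<notin> Idx d L ==> f (lay cs ps) = 0"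
  using adm_layout[of d cs ps L] unfolding good_def adm_def by blast

lemma deg_le_sum:
  assumes "deg_le n f" "\<And>k. k \<in> K ==> deg_le n (b k)"
  shows "deg_le n (\<lambda>r. f r + (\<Sum>k\<in>K. c k * b k r))"
  using assms unfolding deg_le_def by (simp add: sum.neutral)

text \<open>Induction on the degree and, inside, on the number \<open>r\<close> of open trails below which the function is known to vanish. By triangularity and since values depend on types only,
  the values at layouts with \<open>r\<close> open trails can be removed by subtracting basis elements without disturbing smaller \<open>r\<close>. As the number of open trails is at most the degree,
  finally all values at layouts vanish and the degree drops.\<close>

lemma spanning_deg:
  "good d L f ==> deg_le n f ==> f \<in> fspan (bas d L ` Idx d L)"
proof (induction n arbitrary: f rule: less_induct)
  case (less n)
  let ?S = "fspan (bas d L ` Idx d L)"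
  have "f \<in> ?S" if "good d L f" "deg_le n f"
      "\<And>cs ps. std d cs ps ==> length (lay cs ps) = n ==> length ps < r ==> f (lay cs ps) = 0" "n < r + m" for r m f
    using that
  proof (induction m arbitrary: r f)
    case 0
    have z: "f es = 0" if len: "length es = n" for es
    proof (rule layouts_determine[OF invf_good[OF 0(1)] _ len])
      fix cs ps assume l: "std d cs ps" "length (lay cs ps) = n"
      then have "length ps \<le> n" using length_paths[of d cs ps] by (simp add: std_def)
      then show "f (lay cs ps) = 0" using 0(3)[OF l] 0(4) by simp
    qed
    show ?case
    proof (cases n)
      case 0
      have "f = (\<lambda>_. 0)" using z deg_leD[OF \<open>deg_le n f\<close>] unfolding 0 by (metis gr0I ext)
      then show ?thesis by (simp add: fspan.zero)
    next
      case (Suc n')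
      have "deg_le n' f" unfolding deg_le_def
      proof (intro allI impI)
        fix es :: "edge list" assume "n' < length es"
        then have "length es = n \<or> n < length es" using Suc by linarith
        then show "f es = 0" using z deg_leD[OF \<open>deg_le n f\<close>] by blast
      qed
      then show ?thesis using less.IH[of n' f] Suc 0(1) by simp
    qed
  next
    case (Suc m)
    let ?K = "{k \<in> Idx d L. wt k = n \<and> size (snd k) = r}"
    have finK: "finite ?K" by (rule finite_subset[OF _ finite_Idx[of d L n]]) blast
    have "\<forall>k\<in>Idx d L. \<exists>l. \<exists>cs ps. l = lay cs ps \<and> std d cs ps \<and> type_of cs ps = k \<and> bas d L k l ~= 0"
      using own_layout by blast
    from bchoice[OF this] obtain lk where
      lk: "\<forall>k\<in>Idx d L. \<exists>cs ps. lk k = lay cs ps \<and> std d cs ps \<and> type_of cs ps = k \<and> bas d L k (lk k) ~= 0" by blast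
    define c where "c k = - f (lk k) / bas d L k (lk k)" for k
    define f' where "f' = (\<lambda>es. f es + (\<Sum>k\<in>?K. c k * bas d L k es))"
    have deg: "deg_le n (bas d L k)" if "k \<in> ?K" for k using prd_topd[of k d L] that unfolding topd_def by auto
    have g': "good d L f'" unfolding f'_def by (rule good_sum[OF finK]) (simp_all add: bas_good Suc.prems(1))
    have "f' \<in> ?S"
    proof (rule Suc.IH[OF g'])
      show "deg_le n f'" unfolding f'_def by (rule deg_le_sum[OF Suc.prems(2) deg])
      show "n < Suc r + m" using Suc.prems(4) by simp
      fix cs ps assume l: "std d cs ps" "length (lay cs ps) = n" "length ps < Suc r"
      let ?t = "type_of cs ps" and ?l = "lay cs ps"
      have ok: "okl d cs ps" using l(1) by (simp add: std_def)
      have wtt: "wt ?t = n" using wt_type_of[OF ok] l(2) by simp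
      have off: "bas d L k ?l = 0" if "k \<in> ?K" "\<not> (length ps = r \<and> k = ?t)" for k
      proof (rule ccontr)
        assume nz: "bas d L k ?l ~= 0"
        note b = bas_at_layout[OF _ l(1) _ nz]
        have k: "k \<in> Idx d L" "length ?l = wt k" using that l(2) by auto
        have "r \<le> length ps" using b(1)[OF k] that by simp
        then have "length ps = r" using l(3) by simp
        moreover then have "k = ?t" using b(2)[OF k] that by simp
        ultimately show False using that by blast
      qed
      show "f' ?l = 0"
      proof (cases "length ps = r")
        case False
        then have "(\<Sum>k\<in>?K. c k * bas d L k ?l) = 0" using off by (intro sum.neutral) simp
        then show ?thesis using False l Suc.prems(3) by (simp add: f'_def)
      next
        case True
        show ?thesis
        proof (cases "?t \<in> Idx d L")
          case False
          then show ?thesis by (rule good_layout[OF g' l(1)])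
        next
          case t: True
          have tK: "?t \<in> ?K" using t wtt True by (simp add: type_of_def)
          obtain cs' ps' where l': "lk ?t = lay cs' ps'" "std d cs' ps'" "type_of cs' ps' = ?t" "bas d L ?t (lk ?t) ~= 0"
            using lk t by blast
          have same: "h (lay cs ps) = h (lk ?t)" if "good d L h" for h
            unfolding l'(1) by (rule value_by_type[OF invf_good[OF that] l(1) l'(2)]) (use l'(3) in \<open>simp_all add: type_of_def\<close>)
          have "(\<Sum>k\<in>?K. c k * bas d L k ?l) = c ?t * bas d L ?t ?l + (\<Sum>k\<in>?K - {?t}. c k * bas d L k ?l)"
            by (rule sum.remove[OF finK tK])
          also have "(\<Sum>k\<in>?K - {?t}. c k * bas d L k ?l) = 0" using off by (intro sum.neutral) simp
          also have "c ?t * bas d L ?t ?l = - f (lk ?t)"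
            unfolding same[OF bas_good[OF t]] c_def using l'(4) by simp
          finally show ?thesis unfolding f'_def using same[OF Suc.prems(1)] by simp
        qed
      qed
    qed
    from fspan_sum[OF finK _ this, of "bas d L" "\<lambda>k. - c k"]
    have "(\<lambda>r. f' r + (\<Sum>k\<in>?K. - c k * bas d L k r)) \<in> ?S" by (simp only: image_mono subset_iff) blast
    moreover have "(\<lambda>r. f' r + (\<Sum>k\<in>?K. - c k * bas d L k r)) = f"
      unfolding f'_def by (simp add: fun_eq_iff sum_negf)
    ultimately show ?case by simp
  qed
  from this[of f 0 "Suc n"] show ?case using less.prems by simp
qed

theorem bas_spanning: "good d L f ==> f \<in> fspan (bas d L ` Idx d L)"
  using spanning_deg[of d L f] unfolding good_def by blast

text \<open>Among the indices with nonzero coefficient take one of maximal weight and then with the fewest open trails. At its layout all other summands vanish.\<close>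

theorem bas_independent:
  assumes K: "finite K" "K \<subseteq> Idx d L" and z: "\<And>es. (\<Sum>k\<in>K. c k * bas d L k es) = 0"
  shows "\<forall>k\<in>K. c k = 0"
proof (rule ccontr)
  assume "\<not> (\<forall>k\<in>K. c k = 0)"
  let ?K = "{k \<in> K. c k ~= 0}"
  have ne: "?K ~= {}" "finite ?K" using \<open>\<not> (\<forall>k\<in>K. c k = 0)\<close> K(1) by auto
  define n where "n = Max (wt ` ?K)"
  let ?K1 = "{k \<in> ?K. wt k = n}"
  have "n \<in> wt ` ?K" unfolding n_def by (rule Max_in) (use ne in auto)
  then have ne1: "?K1 ~= {}" by blast
  have fin1: "finite ?K1" using K(1) by simp
  have "Min ((size \<circ> snd) ` ?K1) \<in> (size \<circ> snd) ` ?K1" by (rule Min_in) (use ne1 fin1 in auto)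
  then obtain k where k: "k \<in> ?K1" "Min ((size \<circ> snd) ` ?K1) = size (snd k)" by (metis (no_types, lifting) image_iff o_apply)
  have kI: "k \<in> Idx d L" "k \<in> K" "c k ~= 0" "wt k = n" using k(1) K(2) by auto
  obtain cs ps where l: "std d cs ps" "type_of cs ps = k" "bas d L k (lay cs ps) ~= 0" using own_layout[OF kI(1)] by blast
  have ok: "okl d cs ps" using l(1) by (simp add: std_def)
  have len: "length (lay cs ps) = n" using wt_type_of[OF ok] l(2) kI(4) by simp
  have lps: "length ps = size (snd k)" using arg_cong[OF l(2), of "\<lambda>k. size (snd k)"] by (simp add: type_of_def)
  have off: "c k' * bas d L k' (lay cs ps) = 0" if "k' \<in> K - {k}" for k'
  proof (rule ccontr)
    assume "c k' * bas d L k' (lay cs ps) ~= 0"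
    then have nz: "c k' ~= 0" "bas d L k' (lay cs ps) ~= 0" by auto
    have k'I: "k' \<in> Idx d L" and k'K: "k' \<in> ?K" using that nz(1) K(2) by auto
    have le: "wt k' \<le> n" unfolding n_def by (rule Max_ge) (use k'K ne(2) in auto)
    have "deg_le (wt k') (bas d L k')" using prd_topd[OF k'I] unfolding topd_def by blast
    then have "\<not> wt k' < n" using nz(2) len unfolding deg_le_def by metis
    then have w: "length (lay cs ps) = wt k'" using le len by simp
    have "size (snd k') \<le> length ps" by (rule bas_at_layout(1)[OF k'I l(1) w nz(2)])
    moreover have "size (snd k) \<le> size (snd k')"
      unfolding k(2)[symmetric] by (rule Min_le) (use fin1 k'K w len in auto)
    ultimately have "k' = type_of cs ps" using bas_at_layout(2)[OF k'I l(1) w nz(2)] lps by simp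
    then show False using that l(2) by simp
  qed
  have "(\<Sum>k'\<in>K. c k' * bas d L k' (lay cs ps)) = c k * bas d L k (lay cs ps) + (\<Sum>k'\<in>K - {k}. c k' * bas d L k' (lay cs ps))"
    by (rule sum.remove[OF K(1) kI(2)])
  also have "(\<Sum>k'\<in>K - {k}. c k' * bas d L k' (lay cs ps)) = 0" using off by (intro sum.neutral) blast
  finally show False using z[of "lay cs ps"] kI(3) l(3) by simp
qed

section \<open>The subalgebra generated by the path generators\<close>

text \<open>Colours outside the range give zero, so that the words produced by commutators need not be tracked.\<close>

definition EnL :: "nat \<Rightarrow> nat \<Rightarrow> nat \<Rightarrow> nat \<Rightarrow> nat \<Rightarrow> lin" where
  "EnL L N \<alpha> i j = (if \<alpha> \<in> {1..L} then En N \<alpha> i j else 0)"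

lemma mat_unit_mult:
  assumes "j \<in> {1..N}"
  shows "(\<Sum>m=1..N. mat_unit i j \<alpha> \<gamma> p m * mat_unit k l \<beta> \<gamma> m q) = (if \<alpha> = \<beta> \<and> \<gamma> = \<alpha> \<and> p = i \<and> q = l \<and> j = k then 1 else 0)"
proof -
  have "(\<Sum>m=1..N. mat_unit i j \<alpha> \<gamma> p m * mat_unit k l \<beta> \<gamma> m q)
      = (\<Sum>m=1..N. if m = j then (if \<alpha> = \<beta> \<and> \<gamma> = \<alpha> \<and> p = i \<and> q = l \<and> j = k then 1 else 0) else 0)"
    by (rule sum.cong[OF refl]) (auto simp: mat_unit_def)
  then show ?thesis using assms by (simp add: sum.delta)
qed

lemma gl_relations_EnL: "gl_relations (EnL L)"
proof
  show "EnL L N \<alpha> i j = 0" if "i \<notin> {1..N} \<or> j \<notin> {1..N}" for N \<alpha> i j :: nat using that by (auto simp: EnL_def En_def)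
  fix N \<alpha> i j \<beta> k l :: nat
  let ?c = "if \<alpha> = \<beta> \<and> j = k then 1 else 0 :: complex" and ?c' = "if \<alpha> = \<beta> \<and> l = i then -1 else 0 :: complex"
  show "EnL L N \<alpha> i j * EnL L N \<beta> k l - EnL L N \<beta> k l * EnL L N \<alpha> i j =
      (if \<alpha> = \<beta> then (if j = k \<and> j \<in> {1..N} then EnL L N \<alpha> i l else 0) - (if l = i \<and> l \<in> {1..N} then EnL L N \<alpha> k j else 0) else 0)"
  proof (cases "i \<in> {1..N} \<and> j \<in> {1..N} \<and> k \<in> {1..N} \<and> l \<in> {1..N} \<and> \<alpha> \<in> {1..L} \<and> \<beta> \<in> {1..L}")
    case True
    have "lie_bracket (gl_sum L N) (mat_unit i j \<alpha>) (mat_unit k l \<beta>) \<gamma> p q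
        = lie_add (gl_sum L N) (lie_scale (gl_sum L N) ?c (mat_unit i l \<alpha>)) (lie_scale (gl_sum L N) ?c' (mat_unit k j \<alpha>)) \<gamma> p q" for \<gamma> p q
    proof -
      have 1: "lie_bracket (gl_sum L N) x y \<gamma> p q = (\<Sum>m=1..N. x \<gamma> p m * y \<gamma> m q) - (\<Sum>m=1..N. y \<gamma> p m * x \<gamma> m q)"
        "lie_add (gl_sum L N) x y \<gamma> p q = x \<gamma> p q + y \<gamma> p q" "lie_scale (gl_sum L N) c x \<gamma> p q = c * x \<gamma> p q" for x y c
        by (simp_all add: gl_sum_def)
      have jl: "j \<in> {1..N}" "l \<in> {1..N}" using True by blast+
      show ?thesis
        unfolding 1 mat_unit_mult[OF jl(1)] mat_unit_mult[OF jl(2)]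
        by (cases "\<alpha> = \<beta>"; cases "j = k"; cases "l = i") (simp_all add: mat_unit_def)
    qed
    then have br: "lie_bracket (gl_sum L N) (mat_unit i j \<alpha>) (mat_unit k l \<beta>)
        = lie_add (gl_sum L N) (lie_scale (gl_sum L N) ?c (mat_unit i l \<alpha>)) (lie_scale (gl_sum L N) ?c' (mat_unit k j \<alpha>))"
      by (intro ext)
    have "EnL L N \<alpha> i j * EnL L N \<beta> k l - EnL L N \<beta> k l * EnL L N \<alpha> i j
        = Lop N (lie_bracket (gl_sum L N) (mat_unit i j \<alpha>) (mat_unit k l \<beta>))"
      using True Lop_commutator[of N "mat_unit i j \<alpha>" "mat_unit k l \<beta>" L] by (simp add: EnL_def En_def)
    also have "\<dots> = scal ?c * Lop N (mat_unit i l \<alpha>) + scal ?c' * Lop N (mat_unit k j \<alpha>)"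
      unfolding br Lop_linear ..
    finally show ?thesis using True by (simp add: EnL_def En_def scal_simps)
  next
    case False
    have z: "EnL L N \<gamma> p q = 0" if "\<gamma> \<notin> {1..L} \<or> p \<notin> {1..N} \<or> q \<notin> {1..N}" for \<gamma> p q
      using that unfolding EnL_def En_def by presburger
    have "EnL L N \<alpha> i j = 0 \<or> EnL L N \<beta> k l = 0" using False z by blast
    then have "EnL L N \<alpha> i j * EnL L N \<beta> k l - EnL L N \<beta> k l * EnL L N \<alpha> i j = 0" by (elim disjE) simp_all
    moreover have "(if j = k \<and> j \<in> {1..N} then EnL L N \<alpha> i l else 0) = 0" if "\<alpha> = \<beta>"
    proof (cases "j = k \<and> j \<in> {1..N}")
      case True
      then have "k \<in> {1..N}" by simp
      then have "EnL L N \<alpha> i l = 0" using False z[of \<alpha> i l] that True by blast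
      then show ?thesis by simp
    qed (simp only: if_False)
    moreover have "(if l = i \<and> l \<in> {1..N} then EnL L N \<alpha> k j else 0) = 0" if "\<alpha> = \<beta>"
    proof (cases "l = i \<and> l \<in> {1..N}")
      case True
      then have "i \<in> {1..N}" by simp
      then have "EnL L N \<alpha> k j = 0" using False z[of \<alpha> k j] that True by blast
      then show ?thesis by simp
    qed (simp only: if_False)
    ultimately show ?thesis by (cases "\<alpha> = \<beta>") (simp_all del: atLeastAtMost_iff)
  qed
qed

lemma T_Top: "gl_relations.T (EnL L) N w i j = (if set w \<subseteq> {1..L} then Top N w i j else 0)"
proof -
  interpret gl_relations "EnL L" by (rule gl_relations_EnL)
  show ?thesis
  proof (induction w arbitrary: i)
    case (Cons \<alpha> w)
    show ?case unfolding T.simps Cons by (cases "\<alpha> \<in> {1..L}"; cases "set w \<subseteq> {1..L}") (simp_all add: EnL_def del: atLeastAtMost_iff)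
  qed simp
qed

definition tgen :: "nat \<Rightarrow> nat \<Rightarrow> pathgen \<Rightarrow> nat \<Rightarrow> lin" where
  "tgen d L q = (\<lambda>N. gl_relations.T (EnL L) (N + max d 1) (fst (snd q)) (fst q) (snd (snd q)))"

lemma function_space_A_lim: "function_space (A_lim d L) (psi d L)"
  by unfold_locales (simp_all add: A_lim_add A_lim_smult A_lim_zero, rule psi_inj)

lemma lst_empty [simp]: "lst {#} = []"
  by (metis mset_lst mset_zero_iff)

definition gensY :: "nat \<Rightarrow> nat \<Rightarrow> (nat \<Rightarrow> uea_elem) set" where
  "gensY d L = (\<lambda>Q. tels d L (lst Q)) ` {Q. ({#}, Q) \<in> Idx d L}"

text \<open>The subalgebra that complements the one for \<open>d = 0\<close>: the span of ordered products of path generators.\<close>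

definition Ysub :: "nat \<Rightarrow> nat \<Rightarrow> (nat \<Rightarrow> uea_elem) set" where
  "Ysub d L = {x \<in> carrier (A_lim d L). psi d L x \<in> fspan (psi d L ` gensY d L)}"

lemma Idx_path: "({#}, Q) \<in> Idx d L \<longleftrightarrow> (\<forall>q\<in>#Q. fst q \<in> {1..d} \<and> snd (snd q) \<in> {1..d} \<and> fst (snd q) ~= [] \<and> set (fst (snd q)) \<subseteq> {1..L})"
  by (simp add: Idx_def split_beta)

lemma emb_tels:
  assumes "\<forall>q\<in>set Qs. fst q \<in> {1..d} \<and> snd (snd q) \<in> {1..d} \<and> set (fst (snd q)) \<subseteq> {1..L}"
  shows "tels d L Qs \<in> carrier (A_lim d L)" "emb d L (tels d L Qs) = prod_list (map (tgen d L) Qs)"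
proof -
  have "tels d L Qs \<in> carrier (A_lim d L) \<and> emb d L (tels d L Qs) = prod_list (map (tgen d L) Qs)"
    using assms
  proof (induction Qs)
    case Nil
    show ?case using A_lim_one(1)[of d L] emb_simps(4)[OF A_lim_one(1), of d L] by (simp add: tels_def)
  next
    case (Cons q Qs)
    obtain i w j where q: "q = (i, w, j)" by (metis prod.collapse)
    have v: "i \<in> {1..d}" "j \<in> {1..d}" "set w \<subseteq> {1..L}" using Cons.prems by (simp_all add: q)
    have IH: "tels d L Qs \<in> carrier (A_lim d L)" "emb d L (tels d L Qs) = prod_list (map (tgen d L) Qs)" using Cons by simp_all
    have t: "tel d L w i j \<in> carrier (A_lim d L)" using v by (intro tel(1)) simp_all
    have eq: "tels d L (q # Qs) = tel d L w i j \<otimes>\<^bsub>A_lim d L\<^esub> tels d L Qs" by (simp add: tels_def q)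
    have "emb d L (tel d L w i j) = tgen d L q" unfolding emb_tel[OF v(3,1,2)] using v(3) by (simp add: tgen_def T_Top q)
    then show ?case unfolding eq using A_lim_mult(1)[OF t IH(1)] emb_simps(1)[OF t IH(1)] IH(2) by simp
  qed
  then show "tels d L Qs \<in> carrier (A_lim d L)" "emb d L (tels d L Qs) = prod_list (map (tgen d L) Qs)" by blast+
qed

lemma gensY_carrier: "gensY d L \<subseteq> carrier (A_lim d L)"
proof
  fix x assume "x \<in> gensY d L"
  then obtain Q where Q: "x = tels d L (lst Q)" "({#}, Q) \<in> Idx d L" unfolding gensY_def by blast
  show "x \<in> carrier (A_lim d L)" unfolding Q(1) by (rule emb_tels(1)) (use Q(2) in \<open>simp add: Idx_path\<close>)
qed

lemma Ysub_linear:
  assumes "x \<in> Ysub d L" "y \<in> Ysub d L"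
  shows "x \<oplus>\<^bsub>A_lim d L\<^esub> y \<in> Ysub d L" "c \<odot>\<^bsub>A_lim d L\<^esub> x \<in> Ysub d L"
proof -
  have "x \<in> carrier (A_lim d L)" "y \<in> carrier (A_lim d L)" and s: "psi d L x \<in> fspan (psi d L ` gensY d L)" "psi d L y \<in> fspan (psi d L ` gensY d L)"
    using assms by (simp_all add: Ysub_def)
  note l = A_lim_add[OF this(1,2)] A_lim_smult[OF this(1), of c]
  show "x \<oplus>\<^bsub>A_lim d L\<^esub> y \<in> Ysub d L" "c \<odot>\<^bsub>A_lim d L\<^esub> x \<in> Ysub d L"
    unfolding Ysub_def mem_Collect_eq l(2,4) using l(1,3) fspan_add[OF s] fspan_scale[OF s(1)] by blast+
qed

lemma Ysub_zero: "\<zero>\<^bsub>A_lim d L\<^esub> \<in> Ysub d L"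
  unfolding Ysub_def by (simp add: A_lim_zero fspan.zero)

lemma emb_Ysub:
  shows "0 \<in> emb d L ` Ysub d L" "u \<in> emb d L ` Ysub d L ==> v \<in> emb d L ` Ysub d L ==> u + v \<in> emb d L ` Ysub d L"
    "u \<in> emb d L ` Ysub d L ==> (\<lambda>_. scal c) * u \<in> emb d L ` Ysub d L"
    "u \<in> emb d L ` Ysub d L ==> - u \<in> emb d L ` Ysub d L"
    "u - v \<in> emb d L ` Ysub d L ==> v - u \<in> emb d L ` Ysub d L"
    "u - v \<in> emb d L ` Ysub d L ==> v - w \<in> emb d L ` Ysub d L ==> u - w \<in> emb d L ` Ysub d L"
    "u - v \<in> emb d L ` Ysub d L ==> v \<in> emb d L ` Ysub d L ==> u \<in> emb d L ` Ysub d L"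
proof -
  let ?V = "emb d L ` Ysub d L"
  have car: "x \<in> carrier (A_lim d L)" if "x \<in> Ysub d L" for x using that by (simp add: Ysub_def)
  show "0 \<in> ?V" using Ysub_zero emb_simps(5)[OF A_lim_zero(1), of d L] by (metis image_eqI)
  have add: "u + v \<in> ?V" if uv: "u \<in> ?V" "v \<in> ?V" for u v
  proof -
    obtain x y where "x \<in> Ysub d L" "y \<in> Ysub d L" "u = emb d L x" "v = emb d L y" using uv by blast
    then show ?thesis using emb_simps(2)[OF car car] Ysub_linear(1) by (metis image_eqI)
  qed
  have sc: "(\<lambda>_. scal c) * u \<in> ?V" if u: "u \<in> ?V" for u c
  proof -
    obtain x where "x \<in> Ysub d L" "u = emb d L x" using u by blast
    then show ?thesis using emb_simps(3)[OF car] Ysub_linear(2) by (metis image_eqI)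
  qed
  have neg: "- u \<in> ?V" if "u \<in> ?V" for u
  proof -
    have "(\<lambda>_. scal (- 1)) * u = - u" by (simp add: fun_eq_iff scal_simps(5)[of 1])
    then show ?thesis using sc[OF that, of "-1"] by simp
  qed
  show "u \<in> ?V ==> v \<in> ?V ==> u + v \<in> ?V" "u \<in> ?V ==> (\<lambda>_. scal c) * u \<in> ?V" "u \<in> ?V ==> - u \<in> ?V"
    using add sc neg by blast+
  show "v - u \<in> ?V" if "u - v \<in> ?V" using neg[OF that] unfolding minus_diff_eq .
  show "u - w \<in> ?V" if "u - v \<in> ?V" "v - w \<in> ?V"
  proof -
    have "(u - v) + (v - w) = u - w" by (rule ext) simp
    then show ?thesis using add[OF that] by (simp only:)
  qed
  show "u \<in> ?V" if "u - v \<in> ?V" "v \<in> ?V" using add[OF that] unfolding diff_add_cancel .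
qed

text \<open>Induction on the total length. Swapping neighbouring factors changes a product by products of smaller total length, so modulo the span the order does not matter and a
  product may be sorted. Factors with the empty word are scalars and can be dropped; hence the number of factors is part of the measure.\<close>

lemma tgen_products:
  "\<forall>q\<in>set Qs. fst q \<in> {1..d} \<and> snd (snd q) \<in> {1..d} ==> prod_list (map (tgen d L) Qs) \<in> emb d L ` Ysub d L"
proof (induction "wtp Qs + length Qs" arbitrary: Qs rule: less_induct)
  case less
  interpret gl_relations "EnL L" by (rule gl_relations_EnL)
  let ?V = "emb d L ` Ysub d L" and ?p = "\<lambda>Qs. prod_list (map (tgen d L) Qs)"
  let ?ok = "\<lambda>q :: pathgen. fst q \<in> {1..d} \<and> snd (snd q) \<in> {1..d}"
  let ?m = "\<lambda>Qs. wtp Qs + length Qs"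
  have swap: "?p (A @ q # q' # B) - ?p (A @ q' # q # B) \<in> ?V"
    if n: "?m (A @ q # q' # B) = ?m Qs" and ok: "\<forall>q\<in>set (A @ q # q' # B). ?ok q" for A q q' B
  proof -
    obtain i w j k w' l where q: "q = (i, w, j)" "q' = (k, w', l)" by (metis prod.collapse)
    have cl: "?p A * (\<lambda>N. Q (N + max d 1) i j k l) * ?p B \<in> ?V" if "Q \<in> QS (length w + length w')" for Q
      using that
    proof (induction rule: QS.induct)
      case zero
      have "?p A * (\<lambda>N. 0) * ?p B = 0" by (simp add: fun_eq_iff)
      then show ?case using emb_Ysub(1) by metis
    next
      case (add P Q)
      have "?p A * (\<lambda>N. P (N + max d 1) i j k l + Q (N + max d 1) i j k l) * ?p B
          = ?p A * (\<lambda>N. P (N + max d 1) i j k l) * ?p B + ?p A * (\<lambda>N. Q (N + max d 1) i j k l) * ?p B"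
        by (simp add: fun_eq_iff algebra_simps)
      then show ?case using emb_Ysub(2)[OF add.IH] by metis
    next
      case (neg Q)
      have "?p A * (\<lambda>N. - Q (N + max d 1) i j k l) * ?p B = - (?p A * (\<lambda>N. Q (N + max d 1) i j k l) * ?p B)"
        by (simp add: fun_eq_iff)
      then show ?case using emb_Ysub(4)[OF neg.IH] by metis
    next
      case (cross x y)
      have a: "?p (A @ (i, x, l) # (k, y, j) # B) \<in> ?V"
        by (rule less.hyps) (use n ok cross in \<open>auto simp: q\<close>)
      have b: "?p (A @ (i, x, l) # (k, y, j) # B) = ?p A * (\<lambda>N. T (N + max d 1) x i l * T (N + max d 1) y k j) * ?p B"
        by (simp add: fun_eq_iff tgen_def mult.assoc)
      show ?case using a unfolding b .
    next
      case (straight x y)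
      have a: "?p (A @ (i, x, j) # (k, y, l) # B) \<in> ?V"
        by (rule less.hyps) (use n ok straight in \<open>auto simp: q\<close>)
      have b: "?p (A @ (i, x, j) # (k, y, l) # B) = ?p A * (\<lambda>N. T (N + max d 1) x i j * T (N + max d 1) y k l) * ?p B"
        by (simp add: fun_eq_iff tgen_def mult.assoc)
      show ?case using a unfolding b .
    qed
    have "?p (A @ q # q' # B) - ?p (A @ q' # q # B) = ?p A * (\<lambda>N. Cm w w' (N + max d 1) i j k l) * ?p B"
      by (simp add: fun_eq_iff tgen_def q algebra_simps)
    then show ?thesis using cl[OF T_commutator[of w w']] by simp
  qed
  have bubble: "?p (C @ A @ x # B) - ?p (C @ x # A @ B) \<in> ?V"
    if "?m (C @ A @ x # B) = ?m Qs" "\<forall>q\<in>set (C @ A @ x # B). ?ok q" for C A x B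
    using that
  proof (induction A arbitrary: C)
    case Nil
    show ?case unfolding append_Nil diff_self by (rule emb_Ysub(1))
  next
    case (Cons a A)
    have 1: "?p ((C @ [a]) @ A @ x # B) - ?p ((C @ [a]) @ x # A @ B) \<in> ?V" by (rule Cons.IH) (use Cons.prems in simp_all)
    have 2: "?p (C @ a # x # (A @ B)) - ?p (C @ x # a # (A @ B)) \<in> ?V" by (rule swap) (use Cons.prems in simp_all)
    have 1: "?p (C @ (a # A) @ x # B) - ?p (C @ a # x # (A @ B)) \<in> ?V" using 1 by (simp only: append_assoc append_Cons append_Nil)
    show ?case using emb_Ysub(6)[OF 1 2] by (simp only: append_Cons)
  qed
  have perm: "?p (C @ Q1) - ?p (C @ Q2) \<in> ?V"
    if "mset Q1 = mset Q2" "?m (C @ Q1) = ?m Qs" "\<forall>q\<in>set (C @ Q1). ?ok q" for C Q1 Q2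
    using that
  proof (induction Q1 arbitrary: C Q2)
    case Nil
    then have "Q2 = []" by simp
    then show ?case by (simp only: diff_self emb_Ysub(1))
  next
    case (Cons x Q1)
    have "x \<in> set Q2" using mset_eq_setD[OF Cons.prems(1)] by auto
    then obtain A B where Q2: "Q2 = A @ x # B" by (meson split_list)
    have m: "mset Q1 = mset (A @ B)" using Cons.prems(1) by (simp add: Q2)
    have mm: "?m (C @ A @ x # B) = ?m (C @ x # Q1)" "set (A @ B) = set Q1"
      using sum_list_mset_cong[OF m, of "\<lambda>(i, w, j). length w"] mset_eq_setD[OF m] arg_cong[OF m, of size] by simp_all
    have 1: "?p ((C @ [x]) @ Q1) - ?p ((C @ [x]) @ (A @ B)) \<in> ?V" by (rule Cons.IH[OF m]) (use Cons.prems in simp_all)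
    have 2: "?p (C @ A @ x # B) - ?p (C @ x # A @ B) \<in> ?V"
      by (rule bubble) (use Cons.prems(2,3) mm in auto)
    have 1: "?p (C @ x # Q1) - ?p (C @ x # A @ B) \<in> ?V" using 1 by (simp only: append_assoc append_Cons append_Nil)
    show ?case unfolding Q2 by (rule emb_Ysub(6)[OF 1 emb_Ysub(5)[OF 2]])
  qed
  show ?case
  proof (cases "\<exists>q\<in>set Qs. fst (snd q) = []")
    case True
    then obtain i j where "(i, [], j) \<in> set Qs" by (metis prod.collapse)
    then obtain A B where Qs: "Qs = A @ (i, [], j) # B" by (meson split_list)
    have ij: "i \<in> {1..d}" using less.prems Qs by simp
    have "?p (A @ B) \<in> ?V" by (rule less.hyps) (use less.prems Qs in auto)
    moreover have "tgen d L (i, [], j) = (if i = j then 1 else 0)"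
      using ij by (auto simp: tgen_def fun_eq_iff)
    moreover have "?p Qs = ?p A * tgen d L (i, [], j) * ?p B" by (simp add: Qs mult.assoc)
    ultimately show ?thesis using emb_Ysub(1)[of d L] by (cases "i = j") (simp_all only: simp_thms map_append prod_list.append if_True if_False mult_1_right mult_zero_right mult_zero_left)
  next
    case ne: False
    show ?thesis
    proof (cases "\<forall>q\<in>set Qs. set (fst (snd q)) \<subseteq> {1..L}")
      case False
      then obtain q where q: "q \<in> set Qs" "\<not> set (fst (snd q)) \<subseteq> {1..L}" by blast
      then obtain A B where Qs: "Qs = A @ q # B" by (meson split_list)
      have "tgen d L q = 0" using q(2) by (simp add: tgen_def fun_eq_iff T_Top)
      then have "?p Qs = 0" by (simp add: Qs)
      then show ?thesis using emb_Ysub(1) by metis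
    next
      case True
      let ?l = "lst (mset Qs)"
      have val: "\<forall>q\<in>set ?l. fst q \<in> {1..d} \<and> snd (snd q) \<in> {1..d} \<and> set (fst (snd q)) \<subseteq> {1..L}"
        using less.prems True by simp
      have "({#}, mset Qs) \<in> Idx d L" unfolding Idx_path using less.prems True ne by simp
      then have "tels d L ?l \<in> gensY d L" unfolding gensY_def by blast
      then have "tels d L ?l \<in> Ysub d L" unfolding Ysub_def using emb_tels(1)[OF val] by (simp add: fspan_base)
      then have "?p ?l \<in> ?V" unfolding emb_tels(2)[OF val, symmetric] by blast
      moreover have "?p ([] @ Qs) - ?p ([] @ ?l) \<in> ?V" by (rule perm) (use less.prems in simp_all)
      ultimately show ?thesis unfolding append_Nil by (rule emb_Ysub(7)[rotated])
    qed
  qed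
qed

lemma scal_fun_commute: "u * ((\<lambda>_. scal c) * v) = (\<lambda>_. scal c) * (u * v)" for u v :: "nat \<Rightarrow> lin"
  by (simp add: fun_eq_iff mult.assoc[symmetric] scal_mult_left)

text \<open>Multiplication is computed on operators, where products of ordered products are products of generators in some order.\<close>

lemma Ysub_mult:
  assumes x: "x \<in> Ysub d L" and y: "y \<in> Ysub d L"
  shows "x \<otimes>\<^bsub>A_lim d L\<^esub> y \<in> Ysub d L"
proof -
  let ?V = "emb d L ` Ysub d L"
  interpret function_space "A_lim d L" "psi d L" by (rule function_space_A_lim)
  have xy: "x \<in> carrier (A_lim d L)" "psi d L x \<in> fspan (psi d L ` gensY d L)" "y \<in> carrier (A_lim d L)" "psi d L y \<in> fspan (psi d L ` gensY d L)"
    using x y by (simp_all add: Ysub_def)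
  have car: "s \<in> carrier (A_lim d L)" if "s \<in> gensY d L" for s using gensY_carrier that by blast
  have gg: "emb d L s * emb d L t \<in> ?V" if st: "s \<in> gensY d L" "t \<in> gensY d L" for s t
  proof -
    obtain Q Q' where Q: "s = tels d L (lst Q)" "({#}, Q) \<in> Idx d L" "t = tels d L (lst Q')" "({#}, Q') \<in> Idx d L"
      using st unfolding gensY_def by blast
    have "prod_list (map (tgen d L) (lst Q @ lst Q')) \<in> ?V"
      by (rule tgen_products) (use Q(2,4) in \<open>auto simp: Idx_path\<close>)
    moreover have "emb d L s = prod_list (map (tgen d L) (lst Q))" unfolding Q(1) by (rule emb_tels(2)) (use Q(2) in \<open>simp add: Idx_path\<close>)
    moreover have "emb d L t = prod_list (map (tgen d L) (lst Q'))" unfolding Q(3) by (rule emb_tels(2)) (use Q(4) in \<open>simp add: Idx_path\<close>)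
    ultimately show ?thesis by simp
  qed
  have gy: "emb d L s * emb d L y \<in> ?V" if s: "s \<in> gensY d L" for s
  proof (rule span_induct[OF gensY_carrier xy(3,4)])
    show "emb d L s * emb d L \<zero>\<^bsub>A_lim d L\<^esub> \<in> ?V" using emb_Ysub(1) by (simp add: emb_simps(5)[OF A_lim_zero(1)])
    fix c t z assume t: "t \<in> gensY d L" and z: "z \<in> carrier (A_lim d L)" "emb d L s * emb d L z \<in> ?V"
    have "emb d L s * emb d L (c \<odot>\<^bsub>A_lim d L\<^esub> t \<oplus>\<^bsub>A_lim d L\<^esub> z) = (\<lambda>_. scal c) * (emb d L s * emb d L t) + emb d L s * emb d L z"
      unfolding emb_simps(2)[OF smult(1)[OF car[OF t]] z(1)] emb_simps(3)[OF car[OF t]] distrib_left scal_fun_commute ..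
    then show "emb d L s * emb d L (c \<odot>\<^bsub>A_lim d L\<^esub> t \<oplus>\<^bsub>A_lim d L\<^esub> z) \<in> ?V"
      using emb_Ysub(2)[OF emb_Ysub(3)[OF gg[OF s t]] z(2)] by simp
  qed
  have "emb d L x * emb d L y \<in> ?V"
  proof (rule span_induct[OF gensY_carrier xy(1,2)])
    show "emb d L \<zero>\<^bsub>A_lim d L\<^esub> * emb d L y \<in> ?V" using emb_Ysub(1) by (simp add: emb_simps(5)[OF A_lim_zero(1)])
    fix c t z assume t: "t \<in> gensY d L" and z: "z \<in> carrier (A_lim d L)" "emb d L z * emb d L y \<in> ?V"
    have "emb d L (c \<odot>\<^bsub>A_lim d L\<^esub> t \<oplus>\<^bsub>A_lim d L\<^esub> z) * emb d L y = (\<lambda>_. scal c) * (emb d L t * emb d L y) + emb d L z * emb d L y"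
      unfolding emb_simps(2)[OF smult(1)[OF car[OF t]] z(1)] emb_simps(3)[OF car[OF t]] distrib_right mult.assoc ..
    then show "emb d L (c \<odot>\<^bsub>A_lim d L\<^esub> t \<oplus>\<^bsub>A_lim d L\<^esub> z) * emb d L y \<in> ?V"
      using emb_Ysub(2)[OF emb_Ysub(3)[OF gy[OF t]] z(2)] by simp
  qed
  then obtain z where z: "z \<in> Ysub d L" "emb d L x * emb d L y = emb d L z" by blast
  have "x \<otimes>\<^bsub>A_lim d L\<^esub> y = z"
    by (rule emb_inj[OF A_lim_mult(1)[OF xy(1,3)]]) (use z emb_simps(1)[OF xy(1,3)] in \<open>simp_all add: Ysub_def\<close>)
  then show ?thesis using z(1) by simp
qed

lemma Ysub_subalgebra: "complex_subalgebra (Ysub d L) (A_lim d L)"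
  unfolding complex_subalgebra_def
proof (intro conjI allI ballI)
  interpret A: ring "A_lim d L" by (rule ring_A_lim)
  interpret function_space "A_lim d L" "psi d L" by (rule function_space_A_lim)
  show "subring (Ysub d L) (A_lim d L)"
  proof (rule A.subringI)
    show "Ysub d L \<subseteq> carrier (A_lim d L)" by (auto simp: Ysub_def)
    have "\<one>\<^bsub>A_lim d L\<^esub> \<in> gensY d L" unfolding gensY_def
      by (rule image_eqI[of _ _ "{#}"]) (simp_all add: tels_def Idx_path)
    then show "\<one>\<^bsub>A_lim d L\<^esub> \<in> Ysub d L" unfolding Ysub_def by (simp add: fspan_base A_lim_one(1))
    show "\<ominus>\<^bsub>A_lim d L\<^esub> h \<in> Ysub d L" if h: "h \<in> Ysub d L" for h
    proof -
      have hc: "h \<in> carrier (A_lim d L)" using h by (simp add: Ysub_def)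
      have "\<ominus>\<^bsub>A_lim d L\<^esub> h = (-1) \<odot>\<^bsub>A_lim d L\<^esub> h"
      proof (rule A.minus_equality[OF _ hc smult(1)[OF hc]])
        show "(-1) \<odot>\<^bsub>A_lim d L\<^esub> h \<oplus>\<^bsub>A_lim d L\<^esub> h = \<zero>\<^bsub>A_lim d L\<^esub>" by (rule inj) (simp_all add: add smult zero hc)
      qed
      then show ?thesis using Ysub_linear(2)[OF h h] by simp
    qed
    show "h1 \<otimes>\<^bsub>A_lim d L\<^esub> h2 \<in> Ysub d L" "h1 \<oplus>\<^bsub>A_lim d L\<^esub> h2 \<in> Ysub d L" if "h1 \<in> Ysub d L" "h2 \<in> Ysub d L" for h1 h2
      using Ysub_mult Ysub_linear(1) that by blast+
  qed
  show "c \<odot>\<^bsub>A_lim d L\<^esub> y \<in> Ysub d L" if "y \<in> Ysub d L" for c y using Ysub_linear(2)[OF that that] .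
qed

section \<open>The tensor decomposition\<close>

lemma A0_embed_hom:
  "A0_embed d (x \<otimes>\<^bsub>A_lim 0 L\<^esub> y) = A0_embed d x \<otimes>\<^bsub>A_lim d L\<^esub> A0_embed d y"
  "A0_embed d (x \<oplus>\<^bsub>A_lim 0 L\<^esub> y) = A0_embed d x \<oplus>\<^bsub>A_lim d L\<^esub> A0_embed d y"
  "A0_embed d (c \<odot>\<^bsub>A_lim 0 L\<^esub> x) = c \<odot>\<^bsub>A_lim d L\<^esub> A0_embed d x"
  "A0_embed d \<one>\<^bsub>A_lim 0 L\<^esub> = \<one>\<^bsub>A_lim d L\<^esub>"
  by (auto simp: A0_embed_def A_lim_sel fun_eq_iff restrict_def)

lemma A0_embed_pels: "A0_embed d (pels 0 L Ms) = pels d L Ms"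
  by (induction Ms) (simp_all add: pels_def A0_embed_hom A0_embed_pel)

lemma Idx_split: "(M, Q) \<in> Idx d L \<longleftrightarrow> (M, {#}) \<in> Idx 0 L \<and> ({#}, Q) \<in> Idx d L"
  by (auto simp: Idx_def)

lemma Idx_0: "(M, Q) \<in> Idx 0 L ==> Q = {#}"
  by (cases Q) (auto simp: Idx_def split_beta)

theorem theorem1p2:
  fixes d L :: nat
  assumes "d \<ge> 1" and "L \<ge> 2"
  shows "\<exists>Y. complex_subalgebra Y (A_lim d L) \<and>
    complex_linear_iso
      (tensor_product (A_lim 0 L) (A_lim d L\<lparr>carrier := Y\<rparr>))
      (A_lim d L)
      (tensor_lift (A_lim d L) (\<lambda>a y. A0_embed d a \<otimes>\<^bsub>A_lim d L\<^esub> y))"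
proof (intro exI[of _ "Ysub d L"] conjI)
  show "complex_subalgebra (Ysub d L) (A_lim d L)" by (rule Ysub_subalgebra)
  let ?Z = "A_lim d L" and ?f = "\<lambda>a y. A0_embed d a \<otimes>\<^bsub>A_lim d L\<^esub> y"
  let ?W = "?Z\<lparr>carrier := Ysub d L\<rparr>"
  let ?S1 = "(\<lambda>M. pels 0 L (lst M)) ` {M. (M, {#}) \<in> Idx 0 L}"
  interpret A: ring ?Z by (rule ring_A_lim)
  interpret A0: ring "A_lim 0 L" by (rule ring_A_lim)
  interpret Z: function_space ?Z "psi d L" by (rule function_space_A_lim)
  have Yc: "y \<in> carrier ?Z" if "y \<in> Ysub d L" for y using that by (simp add: Ysub_def)
  have Ac: "A0_embed d a \<in> carrier ?Z" if "a \<in> carrier (A_lim 0 L)" for a by (rule A0_embed_psi(1)[OF that])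
  have W: "function_space ?W (psi d L)"
    by unfold_locales (simp_all add: Ysub_linear Ysub_zero Z.add Z.smult Z.zero Yc, rule Z.inj, simp_all add: Yc)
  have sc: "(c \<odot>\<^bsub>?Z\<^esub> x) \<otimes>\<^bsub>?Z\<^esub> y = c \<odot>\<^bsub>?Z\<^esub> (x \<otimes>\<^bsub>?Z\<^esub> y)" "x \<otimes>\<^bsub>?Z\<^esub> (c \<odot>\<^bsub>?Z\<^esub> y) = c \<odot>\<^bsub>?Z\<^esub> (x \<otimes>\<^bsub>?Z\<^esub> y)"
    if "x \<in> carrier ?Z" "y \<in> carrier ?Z" for c x y
  proof -
    have xy: "x \<otimes>\<^bsub>?Z\<^esub> y \<in> carrier ?Z" by (rule A_lim_mult(1)[OF that])
    note emb = emb_simps(1)[OF Z.smult(1)[OF that(1)] that(2)] emb_simps(1)[OF that(1) Z.smult(1)[OF that(2)]] emb_simps(1)[OF that]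
      emb_simps(3)[OF that(1)] emb_simps(3)[OF that(2)] emb_simps(3)[OF xy]
    show "(c \<odot>\<^bsub>?Z\<^esub> x) \<otimes>\<^bsub>?Z\<^esub> y = c \<odot>\<^bsub>?Z\<^esub> (x \<otimes>\<^bsub>?Z\<^esub> y)"
      by (rule emb_inj[OF A_lim_mult(1)[OF Z.smult(1)[OF that(1)] that(2)] Z.smult(1)[OF xy]]) (simp only: emb mult.assoc)
    show "x \<otimes>\<^bsub>?Z\<^esub> (c \<odot>\<^bsub>?Z\<^esub> y) = c \<odot>\<^bsub>?Z\<^esub> (x \<otimes>\<^bsub>?Z\<^esub> y)"
      by (rule emb_inj[OF A_lim_mult(1)[OF that(1) Z.smult(1)[OF that(2)]] Z.smult(1)[OF xy]]) (simp only: emb scal_fun_commute)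
  qed
  have pel_car: "pels e L Ms \<in> carrier (A_lim e L)" for e Ms using topd_pels unfolding topd_def by blast
  have prod: "?f (pels 0 L (lst M)) (tels d L (lst Q)) = prd d L (M, Q)" for M Q
    by (simp add: prd_def A0_embed_pels)
  have prod0: "pels 0 L (lst M) = prd 0 L (M, {#})" for M
    using pel_car[of 0 "lst M"] by (simp add: prd_def tels_def)
  have img: "(\<lambda>k. psi d L (?f (fst k) (snd k))) ` (?S1 \<times> gensY d L) = bas d L ` Idx d L"
  proof (intro equalityI subsetI)
    fix g assume "g \<in> (\<lambda>k. psi d L (?f (fst k) (snd k))) ` (?S1 \<times> gensY d L)"
    then obtain M Q where "(M, {#}) \<in> Idx 0 L" "({#}, Q) \<in> Idx d L" "g = psi d L (?f (pels 0 L (lst M)) (tels d L (lst Q)))"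
      unfolding gensY_def by auto
    then show "g \<in> bas d L ` Idx d L" unfolding prod using Idx_split by blast
  next
    fix g assume "g \<in> bas d L ` Idx d L"
    then obtain M Q where k: "(M, Q) \<in> Idx d L" "g = bas d L (M, Q)" by auto
    then have "(pels 0 L (lst M), tels d L (lst Q)) \<in> ?S1 \<times> gensY d L" unfolding gensY_def using Idx_split by blast
    then show "g \<in> (\<lambda>k. psi d L (?f (fst k) (snd k))) ` (?S1 \<times> gensY d L)"
      by (rule rev_image_eqI) (simp add: k(2) prod)
  qed
  have img0: "psi 0 L ` ?S1 = bas 0 L ` Idx 0 L"
  proof -
    have I0: "Idx 0 L = (\<lambda>M. (M, {#})) ` {M. (M, {#}) \<in> Idx 0 L}" using Idx_0 by auto
    have "bas 0 L ` Idx 0 L = (\<lambda>M. bas 0 L (M, {#})) ` {M. (M, {#}) \<in> Idx 0 L}"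
      by (rule trans[OF arg_cong[OF I0, of "image (bas 0 L)"] image_image])
    then show ?thesis unfolding image_image prod0 by (rule sym)
  qed
  show "complex_linear_iso (tensor_product (A_lim 0 L) ?W) ?Z (tensor_lift ?Z ?f)"
  proof (rule tensor_lift_iso[where ?S1.0 = ?S1 and ?S2.0 = "gensY d L", OF function_space_A_lim W function_space_A_lim])
    show "abelian_monoid ?Z" by unfold_locales
    show "?S1 \<subseteq> carrier (A_lim 0 L)" using pel_car by blast
    show "gensY d L \<subseteq> carrier ?W" using gensY_carrier by (auto simp: Ysub_def fspan_base)
    show "psi 0 L v \<in> fspan (psi 0 L ` ?S1)" if "v \<in> carrier (A_lim 0 L)" for v
      unfolding img0 by (rule bas_spanning[OF A_lim_elim(1)[OF that]])
    show "psi d L w \<in> fspan (psi d L ` gensY d L)" if "w \<in> carrier ?W" for w using that by (simp add: Ysub_def)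
    show "psi d L z \<in> fspan ((\<lambda>k. psi d L (?f (fst k) (snd k))) ` (?S1 \<times> gensY d L))" if "z \<in> carrier ?Z" for z
      unfolding img by (rule bas_spanning[OF A_lim_elim(1)[OF that]])
    show "\<forall>k\<in>K. c k = 0" if K: "finite K" "K \<subseteq> ?S1 \<times> gensY d L" and z: "\<And>r. (\<Sum>k\<in>K. c k * psi d L (?f (fst k) (snd k)) r) = 0" for K c
    proof -
      have "\<forall>k\<in>K. \<exists>h. h \<in> Idx d L \<and> k = (pels 0 L (lst (fst h)), tels d L (lst (snd h)))"
      proof
        fix k assume "k \<in> K"
        then obtain M Q where MQ: "(M, {#}) \<in> Idx 0 L" "({#}, Q) \<in> Idx d L" "k = (pels 0 L (lst M), tels d L (lst Q))"
          using K(2) unfolding gensY_def by blast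
        have "(M, Q) \<in> Idx d L" by (rule Idx_split[THEN iffD2, OF conjI[OF MQ(1,2)]])
        then show "\<exists>h. h \<in> Idx d L \<and> k = (pels 0 L (lst (fst h)), tels d L (lst (snd h)))"
          using MQ(3) by (intro exI[of _ "(M, Q)"] conjI) simp_all
      qed
      from bchoice[OF this] obtain h where h: "\<forall>k\<in>K. h k \<in> Idx d L \<and> k = (pels 0 L (lst (fst (h k))), tels d L (lst (snd (h k))))" by blast
      have inj: "inj_on h K"
      proof (rule inj_onI)
        fix k k' assume kk: "k \<in> K" "k' \<in> K" "h k = h k'"
        have "k = (pels 0 L (lst (fst (h k))), tels d L (lst (snd (h k))))" using h kk(1) by blast
        moreover have "k' = (pels 0 L (lst (fst (h k))), tels d L (lst (snd (h k))))" unfolding kk(3) using h kk(2) by blast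
        ultimately show "k = k'" by (rule trans[OF _ sym])
      qed
      have val: "psi d L (?f (fst k) (snd k)) = bas d L (h k)" if "k \<in> K" for k
      proof -
        have k: "k = (pels 0 L (lst (fst (h k))), tels d L (lst (snd (h k))))" using h that by blast
        show ?thesis by (subst (1 2) k) (simp add: prod)
      qed
      have "\<forall>k'\<in>h ` K. c (inv_into K h k') = 0"
      proof (rule bas_independent)
        show "finite (h ` K)" "h ` K \<subseteq> Idx d L" using K(1) h by auto
        fix r
        have "(\<Sum>k'\<in>h ` K. c (inv_into K h k') * bas d L k' r) = (\<Sum>k\<in>K. c k * bas d L (h k) r)"
          by (subst sum.reindex[OF inj]) (simp add: inv_into_f_f[OF inj])
        also have "\<dots> = (\<Sum>k\<in>K. c k * psi d L (?f (fst k) (snd k)) r)" by (rule sum.cong[OF refl]) (simp add: val)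
        finally show "(\<Sum>k'\<in>h ` K. c (inv_into K h k') * bas d L k' r) = 0" using z by simp
      qed
      then show ?thesis using inv_into_f_f[OF inj] by simp
    qed
  qed (simp_all add: Yc Ac A0_embed_hom A.l_distr A.r_distr sc)
qed

end
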